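(* Let $d\ge2$, $k\in\mathbb N_0$ and $R>0$. If $k<\frac d2+2$, then for an equivariant 1-form $A$ on $\mathbb B^d_R$ with radial profile $u$, i.e., for $$A^{ij}_k(x)=(\delta^j_kx^i-\delta^i_kx^j)u(|x|),\quad x\in\mathbb B^d_R,\quad i,j,k\in\{1,\dots,d\},$$ we have that $A\in H^k(\mathbb B^d_R)$ if and only if $u(|\cdot|)\in H^k(\mathbb B^{d+2}_R)$. What is more, $$\|A\|_{H^k(\mathbb B^d_R)}\simeq\|u(|\cdot|)\|_{H^k(\mathbb B^{d+2}_R)}$$ for all equivariant 1-forms $A\in H^k(\mathbb B^d_R)$, where the implicit constants can be chosen uniformly for all $R$ in a bounded set positively distanced from zero. (The Sobolev order $k$ and the component index $k$ in $A^{ij}_k$ are unrelated.)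
   Context: $\mathbb B^n_R$ is the ball in $\mathbb R^n$ centered at the origin with radius $R$. $\|f\|^2_{H^k(\Omega)}=\sum_{|\gamma|\le k}\|\partial^\gamma f\|^2_{L^2(\Omega)}$. For a 1-form $A=(A_1,\dots,A_d)$ with values in real skew-symmetric $d\times d$ matrices, $\|A\|^2_{H^k}=\sum_{i,j,l}\|A^{ij}_l\|^2_{H^k}$, and $A\in H^k$ means all components are in $H^k$. The radial profile is a function $u:[0,R)\to\mathbb R$. $a\simeq b$ means $a\le Cb$ and $b\le Ca$ for an implicit constant $C>0$ (independent of $A$). *)

theory Defs
  imports "HOL-Analysis.Analysis"
begin

section \<open>Test functions\<close>

definition partial_deriv :: "'n \<Rightarrow> (real ^ 'n \<Rightarrow> real) \<Rightarrow> real ^ 'n \<Rightarrow> real" where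
  "partial_deriv i f x = deriv (\<lambda>t. f (x + t *\<^sub>R axis i 1)) 0"

text \<open>
  All iterated partial derivatives, taken in any order, exist and are Frechet differentiable
  (in particular continuous); this is \<open>C\<^sup>\<infinity>\<close>.
\<close>

definition smooth :: "(real ^ 'n \<Rightarrow> real) \<Rightarrow> bool" where
  "smooth f \<longleftrightarrow> (\<forall>is. foldr partial_deriv is f differentiable_on UNIV)"

definition test_functions :: "(real ^ 'n) set \<Rightarrow> (real ^ 'n \<Rightarrow> real) set" where
  "test_functions \<Omega> =
     {\<phi>. smooth \<phi> \<and> compact (closure {x. \<phi> x \<noteq> 0}) \<and> closure {x. \<phi> x \<noteq> 0} \<subseteq> \<Omega>}"

text \<open>
  A multi-index is a function \<open>\<gamma> :: 'n \<Rightarrow> nat\<close>, with \<open>|\<gamma>| = sum \<gamma> UNIV\<close>. The index type carries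
  no order, so \<open>\<partial>\<^sup>\<gamma>\<close> applies the powers of the \<open>\<partial>\<^sub>i\<close> along an arbitrary fixed enumeration of the
  coordinates. It is only applied to smooth functions, where the enumeration is immaterial.
\<close>

definition coords :: "'n::finite list" where
  "coords = (SOME xs. distinct xs \<and> set xs = UNIV)"

lemma coords: "distinct (coords :: 'n::finite list)" "set (coords :: 'n list) = UNIV"
proof -
  have "\<exists>xs :: 'n list. distinct xs \<and> set xs = UNIV"
    using finite_distinct_list[of "UNIV :: 'n set"] by auto
  from someI_ex[OF this]
  show "distinct (coords :: 'n list)" "set (coords :: 'n list) = UNIV"
    by (auto simp: coords_def)
qed

definition multi_deriv :: "('n::finite \<Rightarrow> nat) \<Rightarrow> (real ^ 'n \<Rightarrow> real) \<Rightarrow> real ^ 'n \<Rightarrow> real" where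
  "multi_deriv \<gamma> f = foldr (\<lambda>i. partial_deriv i ^^ \<gamma> i) coords f"

lemma finite_multi_indices: "finite {\<gamma> :: 'n::finite \<Rightarrow> nat. sum \<gamma> UNIV \<le> k}"
proof (rule finite_subset)
  have "\<gamma> i \<le> sum \<gamma> UNIV" for \<gamma> :: "'n \<Rightarrow> nat" and i
    by (rule member_le_sum) simp_all
  then show "{\<gamma> :: 'n \<Rightarrow> nat. sum \<gamma> UNIV \<le> k} \<subseteq> UNIV \<rightarrow>\<^sub>E {..k}"
    unfolding PiE_UNIV_domain using order_trans by blast
  show "finite (UNIV \<rightarrow>\<^sub>E {..k} :: ('n \<Rightarrow> nat) set)"
    by (rule finite_PiE) auto
qed

section \<open>Sobolev spaces\<close>

text \<open>
  Elements of function spaces are represented by functions rather than by classes modulo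
  null sets; values outside \<open>\<Omega>\<close> play no role.
\<close>

definition L2 :: "(real ^ 'n) set \<Rightarrow> (real ^ 'n \<Rightarrow> real) set" where
  "L2 \<Omega> = {f \<in> borel_measurable (lebesgue_on \<Omega>). integrable (lebesgue_on \<Omega>) (\<lambda>x. (f x)\<^sup>2)}"

definition L2_norm :: "(real ^ 'n) set \<Rightarrow> (real ^ 'n \<Rightarrow> real) \<Rightarrow> real" where
  "L2_norm \<Omega> f = sqrt (integral\<^sup>L (lebesgue_on \<Omega>) (\<lambda>x. (f x)\<^sup>2))"

definition locally_integrable :: "(real ^ 'n) set \<Rightarrow> (real ^ 'n \<Rightarrow> real) \<Rightarrow> bool" where
  "locally_integrable \<Omega> f \<longleftrightarrow> (\<forall>K. compact K \<and> K \<subseteq> \<Omega> \<longrightarrow> f absolutely_integrable_on K)"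

definition has_weak_deriv ::
    "(real ^ 'n) set \<Rightarrow> ('n::finite \<Rightarrow> nat) \<Rightarrow> (real ^ 'n \<Rightarrow> real) \<Rightarrow> (real ^ 'n \<Rightarrow> real) \<Rightarrow> bool" where
  "has_weak_deriv \<Omega> \<gamma> f g \<longleftrightarrow>
     locally_integrable \<Omega> f \<and> locally_integrable \<Omega> g \<and>
     (\<forall>\<phi> \<in> test_functions \<Omega>.
        integral\<^sup>L (lebesgue_on \<Omega>) (\<lambda>x. f x * multi_deriv \<gamma> \<phi> x) =
        (-1) ^ (sum \<gamma> UNIV) * integral\<^sup>L (lebesgue_on \<Omega>) (\<lambda>x. g x * \<phi> x))"

text \<open>For open \<open>\<Omega>\<close> the weak derivative, if it exists, is unique up to a null set.\<close>

definition weak_deriv ::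
    "(real ^ 'n) set \<Rightarrow> ('n::finite \<Rightarrow> nat) \<Rightarrow> (real ^ 'n \<Rightarrow> real) \<Rightarrow> real ^ 'n \<Rightarrow> real" where
  "weak_deriv \<Omega> \<gamma> f = (SOME g. has_weak_deriv \<Omega> \<gamma> f g)"

definition sobolev :: "nat \<Rightarrow> (real ^ 'n::finite) set \<Rightarrow> (real ^ 'n \<Rightarrow> real) set" where
  "sobolev k \<Omega> =
     {f \<in> L2 \<Omega>. \<forall>\<gamma>. sum \<gamma> UNIV \<le> k \<longrightarrow> (\<exists>g \<in> L2 \<Omega>. has_weak_deriv \<Omega> \<gamma> f g)}"

definition sobolev_norm :: "nat \<Rightarrow> (real ^ 'n::finite) set \<Rightarrow> (real ^ 'n \<Rightarrow> real) \<Rightarrow> real" where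
  "sobolev_norm k \<Omega> f = sqrt (\<Sum>\<gamma> | sum \<gamma> UNIV \<le> k. (L2_norm \<Omega> (weak_deriv \<Omega> \<gamma> f))\<^sup>2)"

section \<open>Matrix-valued 1-forms\<close>

text \<open>For a 1-form \<open>A\<close>, the entry \<open>A l x $ i $ j\<close> is \<open>A\<^sup>i\<^sup>j\<^sub>l(x)\<close>.\<close>

type_synonym 'd one_form = "'d \<Rightarrow> real ^ 'd \<Rightarrow> real ^ 'd ^ 'd"

definition sobolev_form :: "nat \<Rightarrow> (real ^ 'd::finite) set \<Rightarrow> 'd one_form set" where
  "sobolev_form k \<Omega> = {A. \<forall>i j l. (\<lambda>x. A l x $ i $ j) \<in> sobolev k \<Omega>}"

definition sobolev_form_norm :: "nat \<Rightarrow> (real ^ 'd::finite) set \<Rightarrow> 'd one_form \<Rightarrow> real" where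
  "sobolev_form_norm k \<Omega> A =
     sqrt (\<Sum>i\<in>UNIV. \<Sum>j\<in>UNIV. \<Sum>l\<in>UNIV. (sobolev_norm k \<Omega> (\<lambda>x. A l x $ i $ j))\<^sup>2)"

text \<open>
  The profile is a function on \<open>[0,R)\<close>; its values elsewhere are irrelevant. The displayed
  formula forces each \<open>A l x\<close> with \<open>x\<close> in the ball to be skew-symmetric.
\<close>

definition equivariant_form :: "real \<Rightarrow> (real \<Rightarrow> real) \<Rightarrow> 'd::finite one_form \<Rightarrow> bool" where
  "equivariant_form R u A \<longleftrightarrow>
     (\<forall>x \<in> ball 0 R. \<forall>i j l.
        A l x $ i $ j = (of_bool (j = l) * x $ i - of_bool (i = l) * x $ j) * u (norm x))"

end

theory Submission
  imports Defs
begin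

text \<open>
  Write \<open>u(|x|) = 2 v(|x|\<^sup>2)\<close>. The entries of \<open>A\<close> are, up to sign, \<open>0\<close> and the functions
  \<open>2 x\<^sub>l v(|x|\<^sup>2)\<close>, which are the first derivatives of \<open>V(|x|\<^sup>2)\<close> when \<open>V' = v\<close>. So in both dimensions one
  has to estimate the derivatives of order \<open>M\<close> of a radial function; in terms of \<open>s = |x|\<^sup>2\<close> these are
  \<open>\<Sum>\<^sub>j p\<^sub>j(x) W\<^sub>j(s)\<close> with \<open>M/2 \<le> j \<le> M\<close>, where \<open>W\<^sub>j\<close> is the \<open>j\<close>-th derivative of the profile and \<open>p\<^sub>j\<close> is
  homogeneous of degree \<open>2j - M\<close>. Their \<open>L\<^sup>2\<close> norms in dimension \<open>n\<close> together are comparable to the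
  norms of the \<open>W\<^sub>j\<close> on \<open>(0, R\<^sup>2)\<close> with weight \<open>s\<^bsup>2j - M + n/2 - 1\<^esup>\<close>: for the lower bound,
  \<open>(y \<cdot> \<nabla>)\<^sup>M\<close> with \<open>y = t x/|x| + (1 - t\<^sup>2)\<^bsup>1/2\<^esup> e\<close>, \<open>e\<close> a unit vector orthogonal to \<open>x\<close>, yields a polynomial in \<open>t\<close>
  whose coefficients are multiples of \<open>|x|\<^bsup>2j - M\<^esup> W\<^sub>j\<close>. Passing from \<open>M\<close>, \<open>j\<close>, \<open>d\<close> to \<open>M - 1\<close>, \<open>j - 1\<close>,
  \<open>d + 2\<close> does not change the weight; the index \<open>2j = M\<close>, which occurs only in dimension \<open>d\<close>, is
  covered by Hardy's inequality. Weak derivatives of \<open>f(|x|\<^sup>2)\<close> are derivatives of an absolutely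
  continuous profile away from the origin, and a point is removable for \<open>L\<^sup>2\<close> gradients if \<open>n \<ge> 2\<close>.
\<close>

subsection \<open>Smooth functions\<close>

text \<open>The data are bare functions: neither measurability nor differentiability of the profile
  is assumed, and weak derivatives are tested only against functions of \<open>x\<close>. Hence much
  of the work is to move from the ball to the interval \<open>(0, R\<^sup>2)\<close>: a Borel
  version of the profile, sphere averages obtained as Radon-Nikodym densities, and an inductive
  construction of the functions \<open>W j\<close> from the given weak derivatives. The variable
  |x|^2 is preferred to |x| because it is a polynomial: the coefficients in the chain rule are then
  homogeneous polynomials, and only the profile itself can be singular at the origin. The factor 2
  makes the entries of the form exactly \<open>coef [l] 1\<close> times the profile, so one family
  of statements with a parameter \<open>q\<close>, 0 for functions and 1 for forms, serves both
  dimensions; the primitive \<open>V\<close> is never constructed, its coefficient being zero in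
  every jet that occurs. All constants are independent of the radius except the one in Hardy's
  inequality, where \<open>1 / T = 1 / R\<^sup>2\<close> appears; this is where a positive lower
  bound on the radii enters.\<close>

lemma partial_deriv_eqI:
  assumes "(f has_derivative D) (at x)"
  shows "partial_deriv i f x = D (axis i 1)"
proof -
  have "((\<lambda>t. f (x + t *\<^sub>R axis i 1)) has_derivative (\<lambda>t. D (t *\<^sub>R axis i 1))) (at 0)"
    by (rule has_derivative_compose[of "\<lambda>t. x + t *\<^sub>R axis i 1" _ 0 UNIV f D])
      (auto intro!: derivative_eq_intros assms)
  moreover have "D (t *\<^sub>R axis i 1) = t * D (axis i 1)" for t
    using linear_cmul[OF has_derivative_linear[OF assms]] by simp
  ultimately have "((\<lambda>t. f (x + t *\<^sub>R axis i 1)) has_real_derivative D (axis i 1)) (at 0)"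
    by (simp add: has_field_derivative_def mult_commute_abs)
  then show ?thesis
    unfolding partial_deriv_def by (rule DERIV_imp_deriv)
qed

lemma differentiable_on_UNIV_E:
  assumes "f differentiable_on UNIV"
  obtains D where "(f has_derivative D) (at x)"
  using assms by (auto simp: differentiable_on_def differentiable_def)

lemma has_partial_deriv:
  assumes "f differentiable_on UNIV"
  shows "((\<lambda>t. f (x + t *\<^sub>R axis i 1)) has_real_derivative partial_deriv i f (x + t *\<^sub>R axis i 1)) (at t)"
proof -
  obtain D where D: "(f has_derivative D) (at (x + t *\<^sub>R axis i 1))"
    using assms by (auto simp: differentiable_on_def differentiable_def)
  have "((\<lambda>t. f (x + t *\<^sub>R axis i 1)) has_derivative (\<lambda>t. D (t *\<^sub>R axis i 1))) (at t)"
    by (rule has_derivative_compose[of "\<lambda>t. x + t *\<^sub>R axis i 1" _ t UNIV f D])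
      (auto intro!: derivative_eq_intros D)
  moreover have "D (t *\<^sub>R axis i 1) = t * D (axis i 1)" for t
    using linear_cmul[OF has_derivative_linear[OF D]] by simp
  ultimately show ?thesis
    by (simp add: has_field_derivative_def mult_commute_abs partial_deriv_eqI[OF D])
qed

lemma partial_deriv_const [simp]: "partial_deriv i (\<lambda>x. c) = (\<lambda>x. 0)"
  by (rule ext) (rule partial_deriv_eqI, rule has_derivative_const)

lemma partial_deriv_nth:
  fixes i l :: "'n::finite"
  shows "partial_deriv i (\<lambda>x. x $ l) = (\<lambda>x. of_bool (i = l))"
proof
  fix x :: "real ^ 'n"
  have "((\<lambda>x. x $ l) has_derivative (\<lambda>x. x $ l)) (at x)"
    by (rule bounded_linear_imp_has_derivative[OF bounded_linear_vec_nth])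
  from partial_deriv_eqI[OF this, of i] show "partial_deriv i (\<lambda>x. x $ l) x = of_bool (i = l)"
    by (simp add: axis_def)
qed

lemma partial_deriv_add:
  assumes "f differentiable_on UNIV" "g differentiable_on UNIV"
  shows "partial_deriv i (\<lambda>x. f x + g x) = (\<lambda>x. partial_deriv i f x + partial_deriv i g x)"
proof
  fix x
  obtain D where D: "(f has_derivative D) (at x)"
    by (rule differentiable_on_UNIV_E[OF assms(1)])
  obtain E where E: "(g has_derivative E) (at x)"
    by (rule differentiable_on_UNIV_E[OF assms(2)])
  show "partial_deriv i (\<lambda>x. f x + g x) x = partial_deriv i f x + partial_deriv i g x"
    using partial_deriv_eqI[OF has_derivative_add[OF D E]] partial_deriv_eqI[OF D] partial_deriv_eqI[OF E]
    by simp
qed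

lemma partial_deriv_mult:
  assumes "f differentiable_on UNIV" "g differentiable_on UNIV"
  shows "partial_deriv i (\<lambda>x. f x * g x) = (\<lambda>x. f x * partial_deriv i g x + partial_deriv i f x * g x)"
proof
  fix x
  obtain D where D: "(f has_derivative D) (at x)"
    by (rule differentiable_on_UNIV_E[OF assms(1)])
  obtain E where E: "(g has_derivative E) (at x)"
    by (rule differentiable_on_UNIV_E[OF assms(2)])
  show "partial_deriv i (\<lambda>x. f x * g x) x = f x * partial_deriv i g x + partial_deriv i f x * g x"
    using partial_deriv_eqI[OF has_derivative_mult[OF D E]] partial_deriv_eqI[OF D]
      partial_deriv_eqI[OF E] by simp
qed

lemma partial_deriv_compose:
  assumes "f differentiable_on UNIV" "\<And>s. (h has_real_derivative h' s) (at s)"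
  shows "partial_deriv i (\<lambda>x. h (f x)) = (\<lambda>x. h' (f x) * partial_deriv i f x)"
proof
  fix x
  obtain D where D: "(f has_derivative D) (at x)"
    using assms by (auto simp: differentiable_on_def differentiable_def)
  show "partial_deriv i (\<lambda>x. h (f x)) x = h' (f x) * partial_deriv i f x"
    using partial_deriv_eqI[OF has_derivative_compose[OF D assms(2)[unfolded has_field_derivative_def]]]
      partial_deriv_eqI[OF D] by simp
qed

text \<open>A level \<open>n\<close> replaces the quantifier over all words of partial derivatives
  in \<open>smooth\<close>, so that closure under sums, products and compositions becomes an
  induction: the product and chain rules only produce expressions in functions of level
  \<open>n\<close>.\<close>

primrec diff_upto :: "nat \<Rightarrow> (real ^ 'n \<Rightarrow> real) \<Rightarrow> bool" where
  "diff_upto 0 f \<longleftrightarrow> f differentiable_on UNIV"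
| "diff_upto (Suc n) f \<longleftrightarrow> f differentiable_on UNIV \<and> (\<forall>i. diff_upto n (partial_deriv i f))"

lemma diff_upto_foldr: "diff_upto n f \<longleftrightarrow> (\<forall>is. length is \<le> n \<longrightarrow> foldr partial_deriv is f differentiable_on UNIV)"
proof (induction n arbitrary: f)
  case (Suc n)
  show ?case
  proof
    assume L: "diff_upto (Suc n) f"
    show "\<forall>is. length is \<le> Suc n \<longrightarrow> foldr partial_deriv is f differentiable_on UNIV"
    proof (intro allI impI)
      fix js :: "'a list" assume "length js \<le> Suc n"
      \<comment> \<open>\<open>foldr\<close> applies the last letter first, whereas the recursion of
        \<open>diff_upto\<close> peels off the first derivative taken; hence the word is split at
        its end.\<close>
      then show "foldr partial_deriv js f differentiable_on UNIV"
        using L Suc.IH by (cases js rule: rev_cases) auto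
    qed
  next
    assume R: "\<forall>is. length is \<le> Suc n \<longrightarrow> foldr partial_deriv is f differentiable_on UNIV"
    have "f differentiable_on UNIV" using R[rule_format, of "[]"] by simp
    moreover have "diff_upto n (partial_deriv i f)" for i
      unfolding Suc.IH
    proof (intro allI impI)
      fix js :: "'a list" assume "length js \<le> n"
      then show "foldr partial_deriv js (partial_deriv i f) differentiable_on UNIV"
        using R[rule_format, of "js @ [i]"] by simp
    qed
    ultimately show "diff_upto (Suc n) f" by simp
  qed
qed simp

lemma smooth_iff: "smooth f \<longleftrightarrow> (\<forall>n. diff_upto n f)"
  unfolding smooth_def diff_upto_foldr by blast

lemma diff_upto_differentiable: "diff_upto n f \<Longrightarrow> f differentiable_on UNIV"
  by (cases n) auto

lemma diff_upto_Suc: "diff_upto (Suc n) f \<Longrightarrow> diff_upto n f"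
  unfolding diff_upto_foldr by simp

lemma smooth_differentiable: "smooth f \<Longrightarrow> f differentiable_on UNIV"
  unfolding smooth_iff using diff_upto_differentiable by blast

lemma smooth_partial_deriv: "smooth f \<Longrightarrow> smooth (partial_deriv i f)"
  unfolding smooth_iff using diff_upto.simps(2) by blast

lemma smooth_const: "smooth (\<lambda>x. c)"
proof -
  have "diff_upto n (\<lambda>x. c)" for n by (induction n arbitrary: c) auto
  then show ?thesis unfolding smooth_iff by blast
qed

lemma smooth_nth:
  fixes l :: "'n::finite"
  shows "smooth (\<lambda>x. x $ l)"
proof -
  have d: "(\<lambda>x. x $ l) differentiable_on (UNIV :: (real ^ 'n) set)"
    by (intro linear_imp_differentiable_on bounded_linear.linear bounded_linear_vec_nth)
  have "diff_upto n (\<lambda>x. x $ l)" for n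
    using d smooth_const by (cases n) (auto simp: partial_deriv_nth smooth_iff)
  then show ?thesis by (simp add: smooth_iff)
qed

lemma diff_upto_add: "diff_upto n f \<Longrightarrow> diff_upto n g \<Longrightarrow> diff_upto n (\<lambda>x. f x + g x)"
  by (induction n arbitrary: f g) (auto simp: partial_deriv_add intro: differentiable_on_add)

lemma diff_upto_mult: "diff_upto n f \<Longrightarrow> diff_upto n g \<Longrightarrow> diff_upto n (\<lambda>x. f x * g x)"
proof (induction n arbitrary: f g)
  case 0 then show ?case by (auto intro: differentiable_on_mult)
next
  case (Suc n)
  then have d: "diff_upto n f" "diff_upto n g" "f differentiable_on UNIV" "g differentiable_on UNIV"
    using diff_upto_Suc by auto
  have "diff_upto n (\<lambda>x. f x * partial_deriv i g x + partial_deriv i f x * g x)" for i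
    using Suc d by (intro diff_upto_add Suc.IH) auto
  then show ?case
    using d by (simp add: partial_deriv_mult differentiable_on_mult)
qed

lemma smooth_add: "smooth f \<Longrightarrow> smooth g \<Longrightarrow> smooth (\<lambda>x. f x + g x)"
  by (simp add: smooth_iff diff_upto_add)

lemma smooth_mult: "smooth f \<Longrightarrow> smooth g \<Longrightarrow> smooth (\<lambda>x. f x * g x)"
  by (simp add: smooth_iff diff_upto_mult)

lemma smooth_sum: "(\<And>i. i \<in> A \<Longrightarrow> smooth (f i)) \<Longrightarrow> smooth (\<lambda>x. \<Sum>i\<in>A. f i x)"
  by (induction A rule: infinite_finite_induct) (auto intro: smooth_const smooth_add)

lemma smooth_prod: "(\<And>i. i \<in> A \<Longrightarrow> smooth (f i)) \<Longrightarrow> smooth (\<lambda>x. \<Prod>i\<in>A. f i x)"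
  by (induction A rule: infinite_finite_induct) (auto intro: smooth_const smooth_mult)

lemma partial_deriv_sum:
  "(\<And>i. i \<in> A \<Longrightarrow> f i differentiable_on UNIV) \<Longrightarrow>
    partial_deriv l (\<lambda>x. \<Sum>i\<in>A. f i x) = (\<lambda>x. \<Sum>i\<in>A. partial_deriv l (f i) x)"
proof (induction A rule: infinite_finite_induct)
  case (insert a A)
  then have "(\<lambda>x. \<Sum>i\<in>A. f i x) differentiable_on UNIV"
    by (auto intro!: differentiable_sum simp: differentiable_on_def)
  then show ?case using insert by (simp add: partial_deriv_add)
qed auto

lemma smooth_continuous: "smooth f \<Longrightarrow> continuous_on UNIV f"
  using smooth_differentiable differentiable_imp_continuous_on by blast

lemma smooth_borel: "smooth f \<Longrightarrow> f \<in> borel_measurable borel"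
  by (simp add: borel_measurable_continuous_onI smooth_continuous)

text \<open>Schwarz's theorem: the second difference over a square of side \<open>h\<close> is
  symmetric in the two directions and, by two mean value theorems, equals \<open>h * h\<close> times
  either mixed derivative at some point of the square. Continuity of both, as \<open>h\<close> tends
  to 0, gives equality.\<close>

lemma partial_deriv_commute:
  fixes f :: "real ^ 'n::finite \<Rightarrow> real"
  assumes "smooth f"
  shows "partial_deriv i (partial_deriv l f) = partial_deriv l (partial_deriv i f)"
proof
  fix x :: "real ^ 'n"
  define e where "e i = (axis i 1 :: real ^ 'n)" for i
  have mean: "\<exists>s t. 0 < s \<and> s < h \<and> 0 < t \<and> t < h \<and>
      f (x + h *\<^sub>R e i + h *\<^sub>R e l) - f (x + h *\<^sub>R e i) - f (x + h *\<^sub>R e l) + f x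
        = h * h * partial_deriv l (partial_deriv i f) (x + s *\<^sub>R e i + t *\<^sub>R e l)"
    if h: "h > 0" for h i l
  proof -
    \<comment> \<open>One mean value theorem in direction \<open>i\<close> for the increment in
      direction \<open>l\<close>, then one in direction \<open>l\<close> for the partial derivative
      in direction \<open>i\<close>.\<close>
    define G where "G s = f ((x + h *\<^sub>R e l) + s *\<^sub>R e i) - f (x + s *\<^sub>R e i)" for s
    have "(G has_real_derivative partial_deriv i f ((x + h *\<^sub>R e l) + s *\<^sub>R e i)
        - partial_deriv i f (x + s *\<^sub>R e i)) (at s)" for s
      unfolding G_def e_def
      by (intro DERIV_diff has_partial_deriv smooth_differentiable assms)
    from MVT2[OF h this] obtain s where s: "0 < s" "s < h"
      "G h - G 0 = h * (partial_deriv i f ((x + h *\<^sub>R e l) + s *\<^sub>R e i) - partial_deriv i f (x + s *\<^sub>R e i))"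
      by auto
    have "((\<lambda>t. partial_deriv i f ((x + s *\<^sub>R e i) + t *\<^sub>R e l)) has_real_derivative
       partial_deriv l (partial_deriv i f) ((x + s *\<^sub>R e i) + t *\<^sub>R e l)) (at t)" for t
      unfolding e_def by (intro has_partial_deriv smooth_differentiable smooth_partial_deriv assms)
    from MVT2[OF h this] obtain t where t: "0 < t" "t < h"
      "partial_deriv i f ((x + s *\<^sub>R e i) + h *\<^sub>R e l) - partial_deriv i f ((x + s *\<^sub>R e i) + 0 *\<^sub>R e l)
       = h * partial_deriv l (partial_deriv i f) ((x + s *\<^sub>R e i) + t *\<^sub>R e l)"
      by auto
    show ?thesis
      using s t by (intro exI[of _ s] exI[of _ t]) (simp add: G_def algebra_simps)
  qed
  have lim: "((\<lambda>n. g (x + s n *\<^sub>R e i + t n *\<^sub>R e l)) \<longlonglongrightarrow> g x)"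
    if "smooth g" "\<And>n. 0 < s n \<and> s n < inverse (real (Suc n))" "\<And>n. 0 < t n \<and> t n < inverse (real (Suc n))"
    for g s t i l
  proof -
    have s: "s \<longlonglongrightarrow> 0" and t: "t \<longlonglongrightarrow> 0"
      using that(2,3) by (auto intro!: tendsto_sandwich[OF _ _ tendsto_const LIMSEQ_inverse_real_of_nat]
        simp: less_imp_le eventually_sequentially)
    have "(\<lambda>n. x + s n *\<^sub>R e i + t n *\<^sub>R e l) \<longlonglongrightarrow> x + 0 *\<^sub>R e i + 0 *\<^sub>R e l"
      by (intro tendsto_intros s t)
    moreover have "isCont g (x + 0 *\<^sub>R e i + 0 *\<^sub>R e l)"
      using smooth_continuous[OF that(1)] by (simp add: continuous_on_eq_continuous_at)
    ultimately show ?thesis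
      using isCont_tendsto_compose by fastforce
  qed
  define h where "h n = inverse (real (Suc n))" for n
  have h: "h n > 0" for n by (simp add: h_def)
  define Q where "Q i l n s t \<longleftrightarrow> 0 < s \<and> s < h n \<and> 0 < t \<and> t < h n \<and>
      f (x + h n *\<^sub>R e i + h n *\<^sub>R e l) - f (x + h n *\<^sub>R e i) - f (x + h n *\<^sub>R e l) + f x
        = h n * h n * partial_deriv l (partial_deriv i f) (x + s *\<^sub>R e i + t *\<^sub>R e l)" for i l n s t
  have Q: "\<exists>s t. Q i l n s t" for i l n
    unfolding Q_def by (rule mean[OF h])
  obtain s t where st: "\<And>n. Q i l n (s n) (t n)" using Q by metis
  obtain s' t' where st': "\<And>n. Q l i n (s' n) (t' n)" using Q by metis
  have eq: "partial_deriv l (partial_deriv i f) (x + s n *\<^sub>R e i + t n *\<^sub>R e l)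
    = partial_deriv i (partial_deriv l f) (x + s' n *\<^sub>R e l + t' n *\<^sub>R e i)" for n
  proof -
    have c: "x + h n *\<^sub>R e l + h n *\<^sub>R e i = x + h n *\<^sub>R e i + h n *\<^sub>R e l" by simp
    have "h n * h n * partial_deriv l (partial_deriv i f) (x + s n *\<^sub>R e i + t n *\<^sub>R e l)
      = h n * h n * partial_deriv i (partial_deriv l f) (x + s' n *\<^sub>R e l + t' n *\<^sub>R e i)"
      using st[of n] st'[of n] unfolding Q_def c by linarith
    then show ?thesis using h[of n] by simp
  qed
  have L1: "(\<lambda>n. partial_deriv l (partial_deriv i f) (x + s n *\<^sub>R e i + t n *\<^sub>R e l))
      \<longlonglongrightarrow> partial_deriv l (partial_deriv i f) x"
    by (rule lim) (use assms st h_def Q_def in \<open>auto intro: smooth_partial_deriv\<close>)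
  have L2: "(\<lambda>n. partial_deriv i (partial_deriv l f) (x + s' n *\<^sub>R e l + t' n *\<^sub>R e i))
      \<longlonglongrightarrow> partial_deriv i (partial_deriv l f) x"
    by (rule lim) (use assms st' h_def Q_def in \<open>auto intro: smooth_partial_deriv\<close>)
  show "partial_deriv i (partial_deriv l f) x = partial_deriv l (partial_deriv i f) x"
    using LIMSEQ_unique[OF L2 L1[unfolded eq]] .
qed

section \<open>Iterated derivatives as words in the coordinates\<close>

lemma smooth_foldr: "smooth f \<Longrightarrow> smooth (foldr partial_deriv is f)"
  by (induction "is") (auto intro: smooth_partial_deriv)

lemma foldr_partial_deriv_commute:
  "smooth f \<Longrightarrow> foldr partial_deriv is (partial_deriv i f) = partial_deriv i (foldr partial_deriv is f)"
  by (induction "is") (auto simp: partial_deriv_commute[OF smooth_foldr])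

lemma foldr_partial_deriv_remove1:
  "smooth f \<Longrightarrow> i \<in> set is \<Longrightarrow> foldr partial_deriv is f = partial_deriv i (foldr partial_deriv (remove1 i is) f)"
proof (induction "is")
  case (Cons a as)
  then show ?case
    by (cases "a = i") (auto simp: partial_deriv_commute[OF smooth_foldr])
qed auto

text \<open>By commutation any letter can be pulled to the front. This frees all later arguments
  from the arbitrary enumeration \<open>coords\<close> in \<open>multi_deriv\<close>.\<close>

lemma foldr_partial_deriv_mset:
  assumes "smooth f" "mset is = mset js"
  shows "foldr partial_deriv is f = foldr partial_deriv js f"
  using assms(2)
proof (induction "is" arbitrary: js)
  case (Cons a as)
  then have "a \<in> set js" using mset_eq_setD by fastforce
  moreover have "mset as = mset (remove1 a js)"
    using Cons.prems by (metis add_mset_remove_trivial mset.simps(2) mset_remove1)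
  ultimately show ?case
    using Cons.IH[of "remove1 a js"] foldr_partial_deriv_remove1[OF assms(1)] by (metis comp_apply foldr.simps(2))
qed auto

text \<open>Multi-indices are traded for words, because along a word derivatives can be added one at
  a time; \<open>count\<close> of the multiset leads back.\<close>

definition multi_list :: "('n::finite \<Rightarrow> nat) \<Rightarrow> 'n list" where
  "multi_list \<gamma> = concat (map (\<lambda>i. replicate (\<gamma> i) i) coords)"

lemma multi_deriv_list:
  fixes \<gamma> :: "'n::finite \<Rightarrow> nat"
  shows "multi_deriv \<gamma> f = foldr partial_deriv (multi_list \<gamma>) f"
proof -
  have r: "foldr partial_deriv (replicate m i) g = (partial_deriv i ^^ m) g" for m and i :: 'n and g
    by (induction m) auto
  have "foldr (\<lambda>i. partial_deriv i ^^ \<gamma> i) xs f = foldr partial_deriv (concat (map (\<lambda>i. replicate (\<gamma> i) i) xs)) f" for xs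
    by (induction xs) (auto simp: r)
  then show ?thesis by (simp add: multi_deriv_def multi_list_def)
qed

lemma count_multi_list: "count (mset (multi_list \<gamma>)) i = \<gamma> i"
proof -
  have "distinct xs \<Longrightarrow> count (mset (concat (map (\<lambda>i. replicate (\<gamma> i) i) xs))) i = (if i \<in> set xs then \<gamma> i else 0)" for xs
    by (induction xs) auto
  from this[OF coords(1)] show ?thesis by (simp add: multi_list_def coords(2))
qed

lemma length_multi_list: "length (multi_list \<gamma>) = sum \<gamma> UNIV"
proof -
  have "size (mset (multi_list \<gamma>)) = sum (count (mset (multi_list \<gamma>))) UNIV"
    by (simp add: size_multiset_overloaded_eq) (rule sum.mono_neutral_left, auto simp: count_eq_zero_iff)
  then show ?thesis by (simp add: count_multi_list)
qed

lemma multi_list_count: "mset (multi_list (count (mset is))) = mset is"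
  by (rule multiset_eqI) (simp add: count_multi_list)

lemma sum_count_mset: "sum (count (mset is)) UNIV = length (is :: 'n::finite list)"
  using length_multi_list[of "count (mset is)"] multi_list_count[of "is"] by (metis size_mset)

subsection \<open>Smooth functions of one variable\<close>

text \<open>The derivative is an existentially quantified function rather than
  \<open>deriv g\<close>, so smoothness is shown by exhibiting a formula for the derivative.\<close>

primrec diff1_upto :: "nat \<Rightarrow> (real \<Rightarrow> real) \<Rightarrow> bool" where
  "diff1_upto 0 g \<longleftrightarrow> (\<forall>x. g differentiable (at x))"
| "diff1_upto (Suc n) g \<longleftrightarrow> (\<exists>g'. (\<forall>x. (g has_real_derivative g' x) (at x)) \<and> diff1_upto n g')"

definition smooth1 :: "(real \<Rightarrow> real) \<Rightarrow> bool" where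
  "smooth1 g \<longleftrightarrow> (\<forall>n. diff1_upto n g)"

lemma diff1_upto_differentiable: "diff1_upto n g \<Longrightarrow> g differentiable (at x)"
  by (cases n) (auto simp: real_differentiable_def)

lemma diff1_upto_Suc: "diff1_upto (Suc n) g \<Longrightarrow> diff1_upto n g"
proof (induction n arbitrary: g)
  case 0 then show ?case by (auto simp: real_differentiable_def)
next
  case (Suc n) then show ?case by (metis diff1_upto.simps(2))
qed

lemma smooth1_deriv: "smooth1 g \<Longrightarrow> (g has_real_derivative deriv g x) (at x)"
  using diff1_upto_differentiable[of 0 g x] unfolding smooth1_def
  by (metis DERIV_imp_deriv real_differentiable_def)

lemma smooth1_deriv_smooth: "smooth1 g \<Longrightarrow> smooth1 (deriv g)"
  unfolding smooth1_def
proof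
  fix n assume "\<forall>n. diff1_upto n g"
  then obtain g' where g': "\<forall>x. (g has_real_derivative g' x) (at x)" "diff1_upto n g'"
    by (meson diff1_upto.simps(2))
  then have "deriv g = g'" using DERIV_imp_deriv by blast
  then show "diff1_upto n (deriv g)" using g' by simp
qed

lemma smooth1_antideriv: "smooth1 g' \<Longrightarrow> (\<And>x. (g has_real_derivative g' x) (at x)) \<Longrightarrow> smooth1 g"
  unfolding smooth1_def by (metis diff1_upto.simps(2) diff1_upto_Suc)

lemma smooth1_continuous: "smooth1 g \<Longrightarrow> continuous_on A g"
  by (meson DERIV_continuous_on has_field_derivative_at_within smooth1_deriv)

lemma diff1_upto_add: "diff1_upto n f \<Longrightarrow> diff1_upto n g \<Longrightarrow> diff1_upto n (\<lambda>x. f x + g x)"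
proof (induction n arbitrary: f g)
  case (Suc n)
  then obtain f' g' where "\<forall>x. (f has_real_derivative f' x) (at x)" "diff1_upto n f'"
    "\<forall>x. (g has_real_derivative g' x) (at x)" "diff1_upto n g'" by auto
  with Suc.IH show ?case by (auto intro!: exI[of _ "\<lambda>x. f' x + g' x"] DERIV_add)
qed auto

lemma diff1_upto_mult: "diff1_upto n f \<Longrightarrow> diff1_upto n g \<Longrightarrow> diff1_upto n (\<lambda>x. f x * g x)"
proof (induction n arbitrary: f g)
  case (Suc n)
  then obtain f' g' where d: "\<forall>x. (f has_real_derivative f' x) (at x)" "diff1_upto n f'"
    "\<forall>x. (g has_real_derivative g' x) (at x)" "diff1_upto n g'" by auto
  moreover have "diff1_upto n f" "diff1_upto n g" using Suc.prems diff1_upto_Suc by auto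
  ultimately have "diff1_upto n (\<lambda>x. f' x * g x + g' x * f x)"
    using Suc.IH diff1_upto_add by auto
  with d show ?case by (auto intro!: exI[of _ "\<lambda>x. f' x * g x + g' x * f x"] DERIV_mult)
qed auto

lemma diff1_upto_const: "diff1_upto n (\<lambda>x. c)"
  by (induction n arbitrary: c) (auto intro!: exI[of _ "\<lambda>x. 0"])

lemma smooth1_add: "smooth1 f \<Longrightarrow> smooth1 g \<Longrightarrow> smooth1 (\<lambda>x. f x + g x)"
  by (simp add: smooth1_def diff1_upto_add)

lemma smooth1_mult: "smooth1 f \<Longrightarrow> smooth1 g \<Longrightarrow> smooth1 (\<lambda>x. f x * g x)"
  by (simp add: smooth1_def diff1_upto_mult)

lemma smooth1_const: "smooth1 (\<lambda>x. c)"
  by (simp add: smooth1_def diff1_upto_const)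

lemma smooth1_affine: "smooth1 (\<lambda>x. a * x + b)"
  by (rule smooth1_antideriv[OF smooth1_const[of a]]) (auto intro!: derivative_eq_intros)

lemma diff1_upto_compose: "diff1_upto n f \<Longrightarrow> diff1_upto n g \<Longrightarrow> diff1_upto n (\<lambda>x. f (g x))"
proof (induction n arbitrary: f g)
  case 0
  then show ?case
    by (auto intro!: differentiable_chain_at[of g _ f, unfolded o_def])
next
  case (Suc n)
  then obtain f' g' where d: "\<forall>x. (f has_real_derivative f' x) (at x)" "diff1_upto n f'"
    "\<forall>x. (g has_real_derivative g' x) (at x)" "diff1_upto n g'" by auto
  moreover have "diff1_upto n g" using Suc.prems diff1_upto_Suc by auto
  ultimately have "diff1_upto n (\<lambda>x. f' (g x) * g' x)"
    using Suc.IH diff1_upto_mult by auto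
  moreover have "((\<lambda>x. f (g x)) has_real_derivative f' (g x) * g' x) (at x)" for x
    using d by (intro DERIV_chain2) auto
  ultimately show ?case unfolding diff1_upto.simps by (intro exI[of _ "\<lambda>x. f' (g x) * g' x"]) blast
qed

lemma smooth1_compose: "smooth1 f \<Longrightarrow> smooth1 g \<Longrightarrow> smooth1 (\<lambda>x. f (g x))"
  by (simp add: smooth1_def diff1_upto_compose)

lemma diff_upto_compose: "diff1_upto n h \<Longrightarrow> diff_upto n f \<Longrightarrow> diff_upto n (\<lambda>x. h (f x))"
proof (induction n arbitrary: h f)
  case 0
  then have "h differentiable_on (f ` UNIV)"
    by (auto simp: differentiable_on_def intro: differentiable_at_withinI)
  with 0 show ?case using differentiable_on_compose by auto
next
  case (Suc n)
  then obtain h' where h': "\<And>x. (h has_real_derivative h' x) (at x)" "diff1_upto n h'" by auto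
  have f: "diff_upto n f" "f differentiable_on UNIV" using Suc.prems diff_upto_Suc by auto
  have "h differentiable_on (f ` UNIV)"
    using h'(1) differentiable_on_def real_differentiable_def differentiable_at_withinI by metis
  then have "(\<lambda>x. h (f x)) differentiable_on UNIV"
    using f differentiable_on_compose by auto
  moreover have "diff_upto n (partial_deriv i (\<lambda>x. h (f x)))" for i
    unfolding partial_deriv_compose[OF f(2) h'(1)]
    using Suc.IH[OF h'(2) f(1)] Suc.prems(2) by (intro diff_upto_mult) auto
  ultimately show ?case by simp
qed

lemma smooth_compose: "smooth1 h \<Longrightarrow> smooth f \<Longrightarrow> smooth (\<lambda>x. h (f x))"
  by (simp add: smooth_iff smooth1_def diff_upto_compose)

text \<open>The flat function \<open>e\<^sup>-\<^sup>1\<^sup>/\<^sup>t\<close> needs polynomial prefactors in \<open>1/t\<close> to be closed under differentiation.\<close>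

definition flat :: "real poly \<Rightarrow> real \<Rightarrow> real" where
  "flat p t = (if t \<le> 0 then 0 else poly p (1 / t) * exp (- (1 / t)))"

lemma poly_exp_tendsto_0: "((\<lambda>x. poly p x * exp (- x)) \<longlongrightarrow> (0::real)) at_top"
proof -
  have "((\<lambda>x. \<Sum>i\<le>degree p. coeff p i * (x ^ i / exp x)) \<longlongrightarrow> (\<Sum>i\<le>degree p. coeff p i * 0)) at_top"
    by (intro tendsto_intros tendsto_power_div_exp_0)
  then show ?thesis
    by (simp only: poly_altdef sum_distrib_right exp_minus divide_inverse mult.assoc mult_zero_right sum.neutral_const)
qed

text \<open>With \<open>x = 1 / t\<close>, differentiating \<open>p(x) exp(-x)\<close> in
  \<open>t\<close> gives \<open>x^2 (p(x) - p'(x)) exp(-x)\<close>, hence the polynomial on the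
  right. The class is closed under differentiation, and smoothness follows by induction in
  \<open>smooth1_flat\<close>.\<close>

lemma flat_has_derivative:
  "(flat p has_real_derivative flat (monom 1 2 * (p - pderiv p)) t) (at t)"
proof -
  consider "t < 0" | "t > 0" | "t = 0" by linarith
  then show ?thesis
  proof cases
    case 1
    have "((\<lambda>_. 0) has_real_derivative 0) (at t)" by simp
    then have "(flat p has_real_derivative 0) (at t)"
      by (rule has_field_derivative_transform_within_open[of _ _ _ "{..<0}"]) (use 1 in \<open>auto simp: flat_def\<close>)
    then show ?thesis using 1 by (simp add: flat_def)
  next
    case 2
    have "((\<lambda>t. poly p (1 / t) * exp (- (1 / t))) has_real_derivative
        flat (monom 1 2 * (p - pderiv p)) t) (at t)"
      using 2 by (auto intro!: derivative_eq_intros DERIV_chain2[OF poly_DERIV]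
        simp: flat_def poly_monom field_simps power2_eq_square)
    then show ?thesis
      by (rule has_field_derivative_transform_within_open[of _ _ _ "{0<..}"]) (use 2 in \<open>auto simp: flat_def\<close>)
  next
    case 3
    \<comment> \<open>At 0 the difference quotient from the right is again a polynomial in
      \<open>1 / h\<close> times \<open>exp (- (1 / h))\<close>, with \<open>X * p\<close> in place
      of \<open>p\<close>.\<close>
    have "((\<lambda>h. poly (monom 1 1 * p) (inverse h) * exp (- inverse h)) \<longlongrightarrow> 0) (at_right 0)"
      by (rule filterlim_compose[OF poly_exp_tendsto_0 filterlim_inverse_at_top_right])
    then have "((\<lambda>h. flat p h / h) \<longlongrightarrow> 0) (at_right 0)"
      by (rule Lim_transform_eventually)
        (auto simp: flat_def poly_monom field_simps eventually_at_right_less intro!: eventually_at_rightI[of 0 1])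
    moreover have "((\<lambda>h. flat p h / h) \<longlongrightarrow> 0) (at_left 0)"
      by (rule Lim_transform_eventually[OF tendsto_const])
        (auto simp: flat_def intro!: eventually_at_leftI[of "-1" 0])
    ultimately have "((\<lambda>h. flat p h / h) \<longlongrightarrow> 0) (at 0)"
      using filterlim_split_at by blast
    moreover have "flat q 0 = 0" for q by (simp add: flat_def)
    ultimately show ?thesis using 3 by (simp add: DERIV_def)
  qed
qed

lemma smooth1_flat: "smooth1 (flat p)"
proof -
  have "diff1_upto n (flat p)" for n
  proof (induction n arbitrary: p)
    case 0 then show ?case using flat_has_derivative real_differentiable_def by auto
  next
    case (Suc n) then show ?case using flat_has_derivative by auto
  qed
  then show ?thesis by (simp add: smooth1_def)
qed

text \<open>The support stays in \<open>[a, b]\<close> while \<open>Suc m\<close> steepens both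
  edges, so the bumps tend to the indicator of the open interval and can stand in for it in
  dominated convergence.\<close>

definition bump :: "real \<Rightarrow> real \<Rightarrow> nat \<Rightarrow> real \<Rightarrow> real" where
  "bump a b m t = flat 1 (real (Suc m) * (t - a)) * flat 1 (real (Suc m) * (b - t))"

lemma flat_1_bounds: "0 \<le> flat 1 t" "flat 1 t \<le> 1"
  by (auto simp: flat_def)

lemma bump_bounds: "0 \<le> bump a b m t" "bump a b m t \<le> 1"
  unfolding bump_def by (intro mult_nonneg_nonneg mult_le_one flat_1_bounds)+

lemma bump_eq_0: "t \<notin> {a<..<b} \<Longrightarrow> bump a b m t = 0"
  by (auto simp: bump_def flat_def mult_le_0_iff zero_le_mult_iff not_less)

lemma bump_pos: "t \<in> {a<..<b} \<Longrightarrow> bump a b m t > 0"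
  by (auto simp: bump_def flat_def mult_le_0_iff not_le intro!: mult_pos_pos)

lemma smooth1_bump: "smooth1 (bump a b m)"
proof -
  have "bump a b m = (\<lambda>t. flat 1 (real (Suc m) * t + (- real (Suc m) * a)) * flat 1 ((- real (Suc m)) * t + real (Suc m) * b))"
    by (simp add: bump_def fun_eq_iff algebra_simps)
  moreover have "smooth1 (\<lambda>t. flat 1 (real (Suc m) * t + (- real (Suc m) * a)) * flat 1 ((- real (Suc m)) * t + real (Suc m) * b))"
    by (intro smooth1_mult smooth1_compose[OF smooth1_flat] smooth1_affine)
  ultimately show ?thesis by simp
qed

lemma bump_tendsto: "(\<lambda>m. bump a b m t) \<longlonglongrightarrow> indicator {a<..<b} t"
proof -
  have f: "(\<lambda>m. flat 1 (real (Suc m) * s)) \<longlonglongrightarrow> 1" if "s > 0" for s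
  proof -
    have "(\<lambda>m. exp (- (inverse (real (Suc m)) * (1 / s)))) \<longlonglongrightarrow> exp (- (0 * (1 / s)))"
      by (intro tendsto_intros LIMSEQ_inverse_real_of_nat)
    then show ?thesis using that
      by (simp add: flat_def mult_le_0_iff not_le field_simps del: of_nat_Suc)
  qed
  show ?thesis
  proof (cases "t \<in> {a<..<b}")
    case True
    then have "(\<lambda>m. flat 1 (real (Suc m) * (t - a)) * flat 1 (real (Suc m) * (b - t))) \<longlonglongrightarrow> 1 * 1"
      by (intro tendsto_mult f) auto
    then show ?thesis using True by (simp add: bump_def)
  next
    case False then show ?thesis by (simp add: bump_eq_0 del: greaterThanLessThan_iff)
  qed
qed

subsection \<open>Test functions\<close>

lemma test_functionsI:
  assumes "smooth \<phi>" "compact K" "K \<subseteq> \<Omega>" "\<And>x. x \<notin> K \<Longrightarrow> \<phi> x = 0"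
  shows "\<phi> \<in> test_functions \<Omega>"
proof -
  have "closure {x. \<phi> x \<noteq> 0} \<subseteq> K"
    using assms by (intro closure_minimal compact_imp_closed) auto
  then show ?thesis
    using assms unfolding test_functions_def
    by (auto simp: compact_eq_bounded_closed intro: bounded_subset)
qed

lemma test_functionsE:
  assumes "\<phi> \<in> test_functions \<Omega>"
  obtains K where "smooth \<phi>" "compact K" "K \<subseteq> \<Omega>" "\<And>x. x \<notin> K \<Longrightarrow> \<phi> x = 0"
proof (rule that)
  show "\<phi> x = 0" if "x \<notin> closure {x. \<phi> x \<noteq> 0}" for x
    using that closure_subset[of "{x. \<phi> x \<noteq> 0}"] by auto
qed (use assms in \<open>auto simp: test_functions_def\<close>)

lemma test_smooth: "\<phi> \<in> test_functions \<Omega> \<Longrightarrow> smooth \<phi>"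
  by (simp add: test_functions_def)

lemma partial_deriv_outside:
  assumes "closed K" "\<And>x. x \<notin> K \<Longrightarrow> f x = 0" "x \<notin> K"
  shows "partial_deriv i f x = 0"
proof (rule partial_deriv_eqI)
  show "(f has_derivative (\<lambda>_. 0)) (at x)"
    by (rule has_derivative_transform_within_open[of "\<lambda>_. 0" _ _ _ "- K"]) (use assms in auto)
qed

lemma test_partial_deriv: "\<phi> \<in> test_functions \<Omega> \<Longrightarrow> partial_deriv i \<phi> \<in> test_functions \<Omega>"
  by (elim test_functionsE, rule test_functionsI)
    (auto intro: smooth_partial_deriv partial_deriv_outside compact_imp_closed)

lemma test_foldr: "\<phi> \<in> test_functions \<Omega> \<Longrightarrow> foldr partial_deriv is \<phi> \<in> test_functions \<Omega>"
  by (induction "is") (auto intro: test_partial_deriv)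

lemma test_mult: "smooth p \<Longrightarrow> \<phi> \<in> test_functions \<Omega> \<Longrightarrow> (\<lambda>x. p x * \<phi> x) \<in> test_functions \<Omega>"
  by (elim test_functionsE, rule test_functionsI) (auto intro: smooth_mult)

lemma test_mono: "\<phi> \<in> test_functions \<Omega> \<Longrightarrow> \<Omega> \<subseteq> \<Omega>' \<Longrightarrow> \<phi> \<in> test_functions \<Omega>'"
  by (auto simp: test_functions_def)

lemma test_bounded:
  assumes "\<phi> \<in> test_functions \<Omega>"
  obtains B where "\<And>x. \<bar>\<phi> x\<bar> \<le> B" "B \<ge> 0"
proof -
  obtain K where K: "smooth \<phi>" "compact K" "\<And>x. x \<notin> K \<Longrightarrow> \<phi> x = 0"
    using test_functionsE[OF assms] by metis
  have "compact (\<phi> ` K)"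
    using K smooth_continuous by (meson compact_continuous_image continuous_on_subset subset_UNIV)
  then obtain B where "\<And>x. x \<in> K \<Longrightarrow> \<bar>\<phi> x\<bar> \<le> B"
    by (force dest!: compact_imp_bounded simp: bounded_iff)
  then have "\<bar>\<phi> x\<bar> \<le> max B 0" for x
    using K(3)[of x] by (cases "x \<in> K") fastforce+
  then show ?thesis using that[of "max B 0"] by simp
qed

lemma test_borel [measurable]: "\<phi> \<in> test_functions \<Omega> \<Longrightarrow> \<phi> \<in> borel_measurable borel"
  using test_smooth smooth_borel by blast

lemma integrable_mult_bounded:
  fixes f g :: "'a::euclidean_space \<Rightarrow> real"
  assumes "set_integrable lebesgue K f" "g \<in> borel_measurable borel" "\<And>x. \<bar>g x\<bar> \<le> B" "\<And>x. x \<notin> K \<Longrightarrow> g x = 0"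
  shows "integrable lebesgue (\<lambda>x. f x * g x)"
proof -
  have eq: "(\<lambda>x. f x * g x) = (\<lambda>x. indicator K x *\<^sub>R f x * g x)"
    using assms(4) by (force simp: indicator_def)
  have m: "g \<in> borel_measurable lebesgue" using assms(2) by (simp add: measurable_completion)
  show ?thesis unfolding eq
  proof (rule Bochner_Integration.integrable_bound)
    show "integrable lebesgue (\<lambda>x. B * (indicator K x *\<^sub>R f x))"
      using assms(1) unfolding set_integrable_def by (rule integrable_mult_right)
    show "(\<lambda>x. indicat_real K x *\<^sub>R f x * g x) \<in> borel_measurable lebesgue"
      using assms(1) m unfolding set_integrable_def by auto
    show "AE x in lebesgue. norm (indicat_real K x *\<^sub>R f x * g x) \<le> norm (B * (indicat_real K x *\<^sub>R f x))"
      using assms(3) by (intro AE_I2) (auto simp: abs_mult mult.commute[of B] intro!: mult_left_mono order_trans[OF assms(3) abs_ge_self])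
  qed
qed

lemma integrable_test_mult:
  assumes "locally_integrable \<Omega> f" "\<phi> \<in> test_functions \<Omega>"
  shows "integrable lebesgue (\<lambda>x. f x * \<phi> x)"
proof -
  obtain K where K: "smooth \<phi>" "compact K" "K \<subseteq> \<Omega>" "\<And>x. x \<notin> K \<Longrightarrow> \<phi> x = 0"
    using test_functionsE[OF assms(2)] by metis
  obtain B where "\<And>x. \<bar>\<phi> x\<bar> \<le> B" using test_bounded[OF assms(2)] by metis
  then show ?thesis
    using assms(1) K unfolding locally_integrable_def
    by (intro integrable_mult_bounded[of K _ _ B] smooth_borel) auto
qed

lemma integral_lebesgue_on_test:
  assumes "\<phi> \<in> test_functions \<Omega>" "\<Omega> \<in> sets lebesgue"
  shows "integral\<^sup>L (lebesgue_on \<Omega>) (\<lambda>x. f x * \<phi> x) = integral\<^sup>L lebesgue (\<lambda>x. f x * \<phi> x)"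
proof -
  obtain K where K: "K \<subseteq> \<Omega>" "\<And>x. x \<notin> K \<Longrightarrow> \<phi> x = 0"
    using test_functionsE[OF assms(1)] by metis
  then have "(\<lambda>x. indicator \<Omega> x *\<^sub>R (f x * \<phi> x)) = (\<lambda>x. f x * \<phi> x)"
    by (auto simp: indicator_def fun_eq_iff)
  then show ?thesis using assms(2) by (subst integral_restrict_space) auto
qed

subsection \<open>The fundamental lemma of the calculus of variations\<close>

text \<open>A Dynkin class argument: boxes form an intersection-stable generator of the Borel sets,
  and the sets over which \<open>h\<close> integrates to 0 are closed under complements and disjoint
  unions.\<close>

lemma AE_zero_of_box_integrals:
  fixes h :: "'a::euclidean_space \<Rightarrow> real"
  assumes h: "integrable lborel h" and z: "\<And>a b. (LINT x:box a b|lborel. h x) = 0"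
  shows "AE x in lborel. h x = 0"
proof (rule sigma_finite_measure.density_zero[OF sigma_finite_lborel h])
  let ?G = "range (\<lambda>(a, b). box a b :: 'a set)"
  have si: "set_integrable lborel A h" if "A \<in> sets borel" for A
    unfolding set_integrable_def using that by (intro integrable_mult_indicator h) auto
  let ?B = "\<lambda>n::nat. box (- (real n *\<^sub>R One)) (real n *\<^sub>R One) :: 'a set"
  \<comment> \<open>The whole space is not a box, but an increasing union of boxes; its integral is
    needed for complements.\<close>
  have "(\<lambda>n. LINT x:?B n|lborel. h x) \<longlonglongrightarrow> (LINT x:(\<Union>n. ?B n)|lborel. h x)"
  proof (rule set_integral_cont_up)
    show "incseq ?B"
      by (auto simp: incseq_def mem_box algebra_simps intro: order_le_less_trans order_less_le_trans)
        (meson of_nat_le_iff order_less_le_trans order_le_less_trans le_imp_neg_le)+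
    show "set_integrable lborel (\<Union>n. ?B n) h" by (rule si) auto
  qed auto
  then have U: "(LINT x:UNIV|lborel. h x) = 0"
    by (simp add: z UN_box_eq_UNIV LIMSEQ_const_iff)
  fix A :: "'a set" assume "A \<in> sets lborel"
  then have A: "A \<in> sigma_sets UNIV ?G" by (simp add: borel_eq_box)
  have "Int_stable ?G" by (auto simp: Int_stable_def box_Int_box)
  moreover have "?G \<subseteq> Pow UNIV" by simp
  ultimately show "(LINT x:A|lborel. h x) = 0"
    using A
  proof (induction rule: sigma_sets_induct_disjoint)
    case (basic A) then show ?case using z by auto
  next
    case empty then show ?case by (simp add: set_lebesgue_integral_def)
  next
    case (compl A)
    then have A: "A \<in> sets borel" by (simp add: borel_eq_box)
    have "(LINT x:A \<union> (UNIV - A)|lborel. h x) = (LINT x:A|lborel. h x) + (LINT x:UNIV - A|lborel. h x)"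
      using A by (intro set_integral_Un si) auto
    then show ?case using compl U by simp
  next
    case (union A)
    then have A: "A n \<in> sets borel" for n by (auto simp: borel_eq_box)
    have "(LINT x:(\<Union>i. A i)|lborel. h x) = (\<Sum>i. (LINT x:(A i)|lborel. h x))"
      using A union by (intro lebesgue_integral_countable_add si) (auto simp: disjoint_family_on_def)
    then show ?case using union by simp
  qed
qed

text \<open>Localised to one closed box at a time, where the restriction of \<open>h\<close> has a
  Borel version to which \<open>AE_zero_of_box_integrals\<close> applies; \<Omega> is a countable
  union of such boxes.\<close>

lemma AE_zero_on_open:
  fixes h :: "'a::euclidean_space \<Rightarrow> real"
  assumes "open \<Omega>"
    and int: "\<And>a b. cbox a b \<subseteq> \<Omega> \<Longrightarrow> set_integrable lebesgue (cbox a b) h"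
    and z: "\<And>a b. cbox a b \<subseteq> \<Omega> \<Longrightarrow> (LINT x:box a b|lebesgue. h x) = 0"
  shows "AE x in lebesgue. x \<in> \<Omega> \<longrightarrow> h x = 0"
proof -
  have box: "AE x in lebesgue. x \<in> cbox a b \<longrightarrow> h x = 0" if ab: "cbox a b \<subseteq> \<Omega>" for a b
  proof -
    define h1 where "h1 x = indicator (box a b) x *\<^sub>R h x" for x
    have "set_integrable lebesgue (box a b) h"
      by (rule set_integrable_subset[OF int[OF ab]]) (auto simp: box_subset_cbox)
    then have h1: "integrable lebesgue h1" by (simp add: set_integrable_def h1_def[abs_def])
    then obtain h2 where h2: "h2 \<in> borel_measurable lborel" "AE x in lborel. h1 x = h2 x"
      using completion_ex_borel_measurable_real by blast
    then have AE: "AE x in lebesgue. h1 x = h2 x" by (simp add: AE_completion_iff)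
    have m2: "h2 \<in> borel_measurable lebesgue" using h2(1) by (simp add: measurable_completion)
    have "integrable lebesgue h2"
      using h1 AE m2 integrable_cong_AE borel_measurable_integrable by blast
    then have i2: "integrable lborel h2" using h2(1) by (simp add: integrable_completion)
    have "(LINT x:box p q|lborel. h2 x) = 0" for p q
    proof -
      obtain c d where cd: "box p q \<inter> box a b = box c d"
        using box_Int_box by blast
      have "(LINT x:box p q|lborel. h2 x) = (LINT x:box p q|lebesgue. h2 x)"
        unfolding set_lebesgue_integral_def using h2(1) by (subst integral_completion) auto
      also have "\<dots> = (LINT x:box p q|lebesgue. h1 x)"
        unfolding set_lebesgue_integral_def using AE m2 h1
        by (intro integral_cong_AE borel_measurable_scaleR borel_measurable_indicator)
          (auto simp: borel_measurable_integrable)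
      also have "\<dots> = (LINT x:box c d|lebesgue. h x)"
        unfolding set_lebesgue_integral_def h1_def cd[symmetric] by (auto intro!: Bochner_Integration.integral_cong simp: indicator_def)
      also have "\<dots> = 0"
      \<comment> \<open>Only the open box is known to lie in \<open>cbox a b\<close>, while the
        hypothesis asks for the closed one. Taking closures settles this for a nonempty box; for an
        empty one the closed box may stick out, but the integral is trivially 0.\<close>
      proof (cases "box c d = {}")
        case False
        have "box c d \<subseteq> cbox a b"
          using cd box_subset_cbox by blast
        then have "closure (box c d) \<subseteq> cbox a b"
          by (rule closure_minimal) auto
        then have "cbox c d \<subseteq> cbox a b"
          using False by (simp add: closure_box)
        then show ?thesis using z ab by blast
      qed (simp add: set_lebesgue_integral_def)
      finally show ?thesis .
    qed
    from AE_zero_of_box_integrals[OF i2 this] AE have "AE x in lebesgue. h1 x = 0"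
      by (auto simp: AE_completion_iff elim: AE_mp)
    moreover have "AE x in lebesgue. x \<notin> cbox a b - box a b"
      using negligible_frontier_interval[of a b] by (intro AE_not_in) (simp add: negligible_iff_null_sets)
    ultimately show ?thesis by eventually_elim (auto simp: h1_def indicator_def split: if_splits)
  qed
  obtain D where D: "countable D" "\<And>X. X \<in> D \<Longrightarrow> \<exists>a b. X = cbox a b" "\<Union>D = \<Omega>"
    using open_countable_Union_open_cbox[OF assms(1)] by metis
  have "AE x in lebesgue. \<forall>X\<in>D. x \<in> X \<longrightarrow> h x = 0"
    using D box by (subst AE_ball_countable) (metis Union_upper)+
  then show ?thesis using D(3) by (auto elim!: AE_mp)
qed

lemma bump_prod_eq_0:
  assumes "x \<notin> box c d"
  shows "(\<Prod>i\<in>UNIV. bump (c $ i) (d $ i) m (x $ i)) = 0"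
proof -
  obtain i where "x $ i \<notin> {c $ i<..<d $ i}"
    using assms by (auto simp: mem_box_cart)
  then show ?thesis by (intro prod_zero) (auto intro!: bexI[of _ i] bump_eq_0)
qed

lemma box_test_function:
  assumes "cbox c d \<subseteq> \<Omega>"
  shows "(\<lambda>x. \<Prod>i\<in>UNIV. bump (c $ i) (d $ i) m (x $ i)) \<in> test_functions \<Omega>"
proof (rule test_functionsI[where K = "cbox c d"])
  show "smooth (\<lambda>x. \<Prod>i\<in>UNIV. bump (c $ i) (d $ i) m (x $ i))"
    by (intro smooth_prod smooth_compose[OF smooth1_bump] smooth_nth)
  fix x assume "x \<notin> cbox c d"
  then show "(\<Prod>i\<in>UNIV. bump (c $ i) (d $ i) m (x $ i)) = 0"
    using box_subset_cbox by (intro bump_prod_eq_0) blast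
qed (use assms in auto)

text \<open>Products of one-variable bumps are test functions that converge boundedly to the
  indicator of a box, which reduces the claim to vanishing box integrals.\<close>

lemma fundamental_lemma:
  assumes "open \<Omega>" "locally_integrable \<Omega> h"
    and z: "\<And>\<phi>. \<phi> \<in> test_functions \<Omega> \<Longrightarrow> integral\<^sup>L lebesgue (\<lambda>x. h x * \<phi> x) = 0"
  shows "AE x in lebesgue. x \<in> \<Omega> \<longrightarrow> h x = 0"
proof (rule AE_zero_on_open[OF assms(1)])
  show int: "set_integrable lebesgue (cbox a b) h" if "cbox a b \<subseteq> \<Omega>" for a b
    using assms(2) that unfolding locally_integrable_def by auto
  fix c d assume cd: "cbox c d \<subseteq> \<Omega>"
  define \<phi> where "\<phi> m x = (\<Prod>i\<in>UNIV. bump (c $ i) (d $ i) m (x $ i))" for m x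
  have b: "0 \<le> \<phi> m x" "\<phi> m x \<le> 1" for m x
    unfolding \<phi>_def using bump_bounds by (auto intro!: prod_nonneg prod_le_1)
  have "(\<lambda>m. integral\<^sup>L lebesgue (\<lambda>x. h x * \<phi> m x)) \<longlonglongrightarrow> integral\<^sup>L lebesgue (\<lambda>x. indicator (box c d) x *\<^sub>R h x)"
  proof (rule integral_dominated_convergence)
    show "integrable lebesgue (\<lambda>x. norm (indicator (cbox c d) x *\<^sub>R h x))"
      using int[OF cd] unfolding set_integrable_def by (rule integrable_norm)
    show "AE x in lebesgue. (\<lambda>m. h x * \<phi> m x) \<longlonglongrightarrow> indicator (box c d) x *\<^sub>R h x"
    proof (rule AE_I2)
      fix x
      have "(\<lambda>m. \<phi> m x) \<longlonglongrightarrow> (\<Prod>i\<in>UNIV. indicator {c $ i<..<d $ i} (x $ i))"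
        unfolding \<phi>_def by (intro tendsto_prod bump_tendsto)
      also have "(\<Prod>i\<in>UNIV. indicator {c $ i<..<d $ i} (x $ i)) = (indicator (box c d) x :: real)"
        by (auto simp: indicator_def mem_box_cart intro!: prod_zero)
      finally show "(\<lambda>m. h x * \<phi> m x) \<longlonglongrightarrow> indicator (box c d) x *\<^sub>R h x"
        by (auto simp: mult.commute intro!: tendsto_intros)
    qed
    have z': "\<phi> m x = 0" if "x \<notin> cbox c d" for m x
      using that box_subset_cbox unfolding \<phi>_def by (intro bump_prod_eq_0) blast
    show "AE x in lebesgue. norm (h x * \<phi> m x) \<le> norm (indicator (cbox c d) x *\<^sub>R h x)" for m
      using b z' by (intro AE_I2) (auto simp: indicator_def abs_mult intro!: mult_left_le)
    show "(\<lambda>x. h x * \<phi> m x) \<in> borel_measurable lebesgue" for m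
      using integrable_test_mult[OF assms(2) box_test_function[OF cd, of m]] by (auto simp: \<phi>_def)
    have "set_integrable lebesgue (box c d) h"
      by (rule set_integrable_subset[OF int[OF cd]]) (auto simp: box_subset_cbox)
    then show "(\<lambda>x. indicator (box c d) x *\<^sub>R h x) \<in> borel_measurable lebesgue"
      by (auto simp: set_integrable_def)
  qed
  moreover have "integral\<^sup>L lebesgue (\<lambda>x. h x * \<phi> m x) = 0" for m
    unfolding \<phi>_def by (rule z[OF box_test_function[OF cd]])
  ultimately show "(LINT x:box c d|lebesgue. h x) = 0"
    unfolding set_lebesgue_integral_def by (simp add: LIMSEQ_const_iff)
qed

subsection \<open>Radial functions\<close>

text \<open>In the variable \<open>s = |x|\<^sup>2\<close> Lebesgue measure becomes \<open>c\<^sub>n s\<^bsup>n/2 - 1\<^esup> ds\<close>.\<close>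

definition radial_const :: "'n::finite itself \<Rightarrow> real" where
  "radial_const _ = real CARD('n) / 2 * unit_ball_vol (real CARD('n))"

definition radial_density :: "'n::finite itself \<Rightarrow> real \<Rightarrow> real" where
  "radial_density t s = indicator {0<..} s * (radial_const t * s powr (real CARD('n) / 2 - 1))"

lemma radial_const_pos: "radial_const t > 0"
  by (auto simp: radial_const_def intro!: mult_pos_pos)

lemma radial_density_nonneg: "radial_density t s \<ge> 0"
  using radial_const_pos[of t] by (auto simp: radial_density_def indicator_def)

lemma radial_density_pos: "s > 0 \<Longrightarrow> radial_density t s > 0"
  using radial_const_pos[of t] by (auto simp: radial_density_def)

lemma radial_density_borel [measurable]: "radial_density t \<in> borel_measurable borel"
  unfolding radial_density_def by measurable

lemma inner_self_borel [measurable]: "(\<lambda>x::'a::euclidean_space. x \<bullet> x) \<in> borel_measurable borel"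
  by (intro borel_measurable_continuous_onI continuous_intros)

text \<open>Both measures are determined by the half-lines \<open>{..s}\<close>. For positive
  \<open>s\<close> these have measure \<open>unit_ball_vol n * s powr (n / 2)\<close>: on the left
  as the volume of the ball of radius \<open>sqrt s\<close>, on the right as the integral of the
  derivative of that volume in \<open>s\<close>, which explains the constant in
  \<open>radial_const\<close>.\<close>

lemma distr_inner_self:
  "distr (lborel :: (real ^ 'n::finite) measure) borel (\<lambda>x. x \<bullet> x) = density lborel (\<lambda>s. ennreal (radial_density TYPE('n) s))"
    (is "?D = ?E")
proof (rule measure_eqI_generator_eq)
  let ?G = "range (\<lambda>a. {..a::real})"
  define n where "n = real CARD('n)"
  have n: "n > 0" by (simp add: n_def)
  have eD: "emeasure ?D {..s} = ennreal (if s \<le> 0 then 0 else unit_ball_vol n * s powr (n / 2))" for s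
  proof -
    have "emeasure ?D {..s} = emeasure lborel {x :: real ^ 'n. x \<bullet> x \<le> s}"
      by (subst emeasure_distr) (auto simp: vimage_def)
    also have "\<dots> = ennreal (if s \<le> 0 then 0 else unit_ball_vol n * s powr (n / 2))"
    proof (cases "s \<le> 0")
      case True
      then have "{x :: real ^ 'n. x \<bullet> x \<le> s} \<subseteq> {0}"
        using inner_gt_zero_iff by (metis (mono_tags, lifting) insertI1 leD mem_Collect_eq order_trans subsetI)
      then have "emeasure lborel {x :: real ^ 'n. x \<bullet> x \<le> s} \<le> emeasure lborel {0 :: real ^ 'n}"
        by (intro emeasure_mono) auto
      then show ?thesis using True by simp
    next
      case False
      then have "{x :: real ^ 'n. x \<bullet> x \<le> s} = cball 0 (sqrt s)"
        by (auto simp: norm_eq_sqrt_inner)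
      moreover have "sqrt s ^ CARD('n) = s powr (n / 2)"
        using False by (simp add: n_def powr_half_sqrt[symmetric] powr_power)
      ultimately show ?thesis using False by (simp add: emeasure_cball n_def)
    qed
    finally show ?thesis .
  qed
  have eE: "emeasure ?E {..s} = ennreal (if s \<le> 0 then 0 else unit_ball_vol n * s powr (n / 2))" for s
  proof -
    have "emeasure ?E {..s} = (\<integral>\<^sup>+t. ennreal (radial_density TYPE('n) t) * indicator {..s} t \<partial>lborel)"
      by (subst emeasure_density) auto
    also have "\<dots> = ennreal (if s \<le> 0 then 0 else unit_ball_vol n * s powr (n / 2))"
    proof (cases "s \<le> 0")
      case True
      then have "(\<lambda>t. ennreal (radial_density TYPE('n) t) * indicator {..s} t) = (\<lambda>t. 0)"
        by (auto simp: fun_eq_iff radial_density_def indicator_def)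
      then show ?thesis using True by simp
    next
      case False
      have eq: "ennreal (radial_density TYPE('n) t) * indicator {..s} t
        = ennreal (radial_const TYPE('n) * t powr (n / 2 - 1)) * indicator {0..s} t" for t
        by (auto simp: radial_density_def indicator_def n_def)
      have "((\<lambda>t. t powr (n / 2 - 1)) has_integral (s powr (n / 2 - 1 + 1) / (n / 2 - 1 + 1))) {0..s}"
        using n False by (intro has_integral_powr_from_0) auto
      then have "((\<lambda>t. radial_const TYPE('n) * t powr (n / 2 - 1)) has_integral
          (radial_const TYPE('n) * (s powr (n / 2 - 1 + 1) / (n / 2 - 1 + 1)))) {0..s}"
        by (rule has_integral_mult_right)
      moreover have "radial_const TYPE('n) * (s powr (n / 2 - 1 + 1) / (n / 2 - 1 + 1)) = unit_ball_vol n * s powr (n / 2)"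
        using n by (simp add: radial_const_def n_def)
      ultimately show ?thesis
        using False radial_const_pos[of "TYPE('n)"] unfolding eq
        by (subst nn_integral_has_integral_lebesgue') auto
    qed
    finally show ?thesis .
  qed
  show "Int_stable ?G" by (auto simp: Int_stable_def)
  show "?G \<subseteq> Pow UNIV" "sets ?D = sigma_sets UNIV ?G" "sets ?E = sigma_sets UNIV ?G"
    by (auto simp: borel_eq_atMost)
  show "range (\<lambda>i. {..real i}) \<subseteq> ?G" by auto
  show "(\<Union>i. {..real i}) = UNIV" using real_arch_simple by auto
  show "emeasure ?D {..real i} \<noteq> \<infinity>" for i by (simp add: eD)
  show "emeasure ?D X = emeasure ?E X" if "X \<in> ?G" for X using that eD eE by auto
qed

lemma nn_integral_radial:
  assumes [measurable]: "g \<in> borel_measurable borel"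
  shows "(\<integral>\<^sup>+x. g (x \<bullet> x) \<partial>(lborel :: (real ^ 'n::finite) measure)) = (\<integral>\<^sup>+s. ennreal (radial_density TYPE('n) s) * g s \<partial>lborel)"
proof -
  have "(\<integral>\<^sup>+x. g (x \<bullet> x) \<partial>(lborel :: (real ^ 'n) measure)) = integral\<^sup>N (distr (lborel :: (real ^ 'n) measure) borel (\<lambda>x. x \<bullet> x)) g"
    by (subst nn_integral_distr) auto
  then show ?thesis
    unfolding distr_inner_self by (subst (asm) nn_integral_density) auto
qed

lemma integrable_radial:
  fixes g :: "real \<Rightarrow> real"
  assumes [measurable]: "g \<in> borel_measurable borel"
  shows "integrable (lborel :: (real ^ 'n::finite) measure) (\<lambda>x. g (x \<bullet> x)) \<longleftrightarrow> integrable lborel (\<lambda>s. radial_density TYPE('n) s * g s)"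
proof -
  have "integrable (lborel :: (real ^ 'n) measure) (\<lambda>x. g (x \<bullet> x)) \<longleftrightarrow> integrable (distr (lborel :: (real ^ 'n) measure) borel (\<lambda>x. x \<bullet> x)) g"
    by (subst integrable_distr_eq) auto
  then show ?thesis
    unfolding distr_inner_self by (subst (asm) integrable_density) (auto simp: radial_density_nonneg)
qed

lemma integral_radial:
  fixes g :: "real \<Rightarrow> real"
  assumes [measurable]: "g \<in> borel_measurable borel"
  shows "integral\<^sup>L (lborel :: (real ^ 'n::finite) measure) (\<lambda>x. g (x \<bullet> x)) = integral\<^sup>L lborel (\<lambda>s. radial_density TYPE('n) s * g s)"
proof -
  have "integral\<^sup>L (lborel :: (real ^ 'n) measure) (\<lambda>x. g (x \<bullet> x)) = integral\<^sup>L (distr (lborel :: (real ^ 'n) measure) borel (\<lambda>x. x \<bullet> x)) g"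
    by (subst integral_distr) auto
  then show ?thesis
    unfolding distr_inner_self by (subst (asm) integral_density) (auto simp: radial_density_nonneg)
qed

text \<open>The image measure has a density, so preimages of null sets under |x|^2 are null.\<close>

lemma AE_radial:
  assumes "AE s in lborel. 0 < s \<longrightarrow> P s"
  shows "AE x in (lborel :: (real ^ 'n::finite) measure). x \<noteq> 0 \<longrightarrow> P (x \<bullet> x)"
proof -
  obtain N where N: "N \<in> null_sets lborel" "{s \<in> space lborel. \<not> (0 < s \<longrightarrow> P s)} \<subseteq> N"
    using assms by (auto simp: eventually_ae_filter)
  have [measurable]: "N \<in> sets borel" using N(1) by auto
  have "(\<integral>\<^sup>+x. indicator N (x \<bullet> x) \<partial>(lborel :: (real ^ 'n) measure)) = (\<integral>\<^sup>+s. ennreal (radial_density TYPE('n) s) * indicator N s \<partial>lborel)"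
    by (rule nn_integral_radial) auto
  also have "\<dots> = 0"
  proof (subst nn_integral_0_iff_AE)
    show "AE s in lborel. ennreal (radial_density TYPE('n) s) * indicator N s = 0"
      using AE_not_in[OF N(1)] by eventually_elim auto
  qed auto
  finally have "AE x in (lborel :: (real ^ 'n) measure). (indicator N (x \<bullet> x) :: ennreal) = 0"
    by (subst (asm) nn_integral_0_iff_AE) auto
  then show ?thesis
  proof eventually_elim
    case (elim x)
    then have "x \<bullet> x \<notin> N" by (simp add: indicator_eq_0_iff)
    then have "x \<bullet> x \<notin> {s \<in> space lborel. \<not> (0 < s \<longrightarrow> P s)}" using N(2) by blast
    then show ?case by auto
  qed
qed

text \<open>The density is strictly positive on the positive axis, which gives the converse of
  \<open>AE_radial\<close> for Borel sets.\<close>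

lemma null_set_radial:
  assumes [measurable]: "G \<in> sets borel" and "AE x in (lborel :: (real ^ 'n::finite) measure). x \<bullet> x \<notin> G"
    and G: "G \<subseteq> {0<..}"
  shows "G \<in> null_sets lborel"
proof -
  have "(\<integral>\<^sup>+s. ennreal (radial_density TYPE('n) s) * indicator G s \<partial>lborel) = (\<integral>\<^sup>+x. indicator G (x \<bullet> x) \<partial>(lborel :: (real ^ 'n) measure))"
    by (rule nn_integral_radial[symmetric]) auto
  also have "\<dots> = 0"
    using assms(2) by (subst nn_integral_0_iff_AE) auto
  finally have "AE s in lborel. ennreal (radial_density TYPE('n) s) * indicator G s = 0"
    by (subst (asm) nn_integral_0_iff_AE) auto
  then have "AE s in lborel. s \<notin> G"
  proof eventually_elim
    case (elim s)
    then show ?case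
      using G radial_density_pos[of s "TYPE('n)"] by (auto simp: indicator_def split: if_splits)
  qed
  then show ?thesis using AE_iff_null_sets[of G lborel] assms(1) by simp
qed

text \<open>A continuous image of a Borel set need not be Borel. But an F-sigma set in Euclidean
  space is a countable union of compact sets, and images of compact sets are compact.\<close>

lemma fsigma_image_inner_self:
  assumes "fsigma (C :: (real ^ 'n::finite) set)"
  shows "(\<lambda>x. x \<bullet> x) ` C \<in> sets borel"
proof -
  obtain F :: "nat \<Rightarrow> (real ^ 'n) set" where F: "\<And>n. closed (F n)" "C = (\<Union>n. F n)"
    using assms by (auto elim: fsigma.cases)
  have "F n = (\<Union>m::nat. F n \<inter> cball 0 (real m))" for n
    using real_arch_simple by (fastforce simp: mem_cball)
  then have "C = (\<Union>n. \<Union>m::nat. F n \<inter> cball 0 (real m))" using F(2) by simp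
  then have im: "(\<lambda>x. x \<bullet> x) ` C = (\<Union>n. \<Union>m::nat. (\<lambda>x. x \<bullet> x) ` (F n \<inter> cball 0 (real m)))" by auto
  have cpt: "compact ((\<lambda>x. x \<bullet> x) ` (F n \<inter> cball 0 (real m)))" for n m
    using F(1) by (intro compact_continuous_image continuous_intros) (auto intro: closed_Int_compact)
  have "(\<Union>n. \<Union>m::nat. (\<lambda>x. x \<bullet> x) ` (F n \<inter> cball 0 (real m))) \<in> sets borel"
    by (intro sets.countable_UN image_subsetI borel_closed compact_imp_closed cpt)
  with im show ?thesis by simp
qed

text \<open>
  Inner approximation by closed sets passes to images under \<open>x \<mapsto> |x|\<^sup>2\<close>, applied to the set
  and to its complement.
\<close>

lemma radial_set_measurable:
  assumes E: "{x \<in> ball 0 R - {0} :: (real ^ 'n::finite) set. x \<bullet> x \<in> E} \<in> sets lebesgue" and R: "R > 0"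
  shows "E \<inter> {0<..<R\<^sup>2} \<in> sets lebesgue"
proof -
  let ?N = "\<lambda>x :: real ^ 'n. x \<bullet> x"
  let ?\<Omega> = "ball 0 R - {0} :: (real ^ 'n) set"
  have \<Omega>: "x \<in> ?\<Omega> \<longleftrightarrow> ?N x \<in> {0<..<R\<^sup>2}" for x
    using R by (auto simp: norm_eq_sqrt_inner real_less_lsqrt real_sqrt_less_iff[symmetric, of _ "R\<^sup>2"] simp del: real_sqrt_less_iff)
  have "open ?\<Omega>" by auto
  then have "?\<Omega> \<in> sets lebesgue" using borel_open by (metis sets_completionI_sets sets_lborel)
  then have "?\<Omega> - {x \<in> ?\<Omega>. ?N x \<in> E} \<in> sets lebesgue" using E by (rule sets.Diff)
  moreover have "?\<Omega> - {x \<in> ?\<Omega>. ?N x \<in> E} = {x \<in> ?\<Omega>. ?N x \<notin> E}" by auto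
  ultimately have E': "{x \<in> ?\<Omega>. ?N x \<notin> E} \<in> sets lebesgue" by simp
  obtain C1 T1 where 1: "fsigma C1" "T1 \<in> null_sets lebesgue" "C1 \<union> T1 = {x \<in> ?\<Omega>. ?N x \<in> E}"
    by (rule lebesgue_set_almost_fsigma[OF E])
  obtain C2 T2 where 2: "fsigma C2" "T2 \<in> null_sets lebesgue" "C2 \<union> T2 = {x \<in> ?\<Omega>. ?N x \<notin> E}"
    by (rule lebesgue_set_almost_fsigma[OF E'])
  \<comment> \<open>\<open>G\<close> collects the values missed by both inner approximations. A
    point of the punctured ball over \<open>G\<close> lies in neither \<open>C1\<close> nor
    \<open>C2\<close>, hence in one of the null sets \<open>T1\<close>, \<open>T2\<close>; so
    \<open>G\<close> is null without any control of the images of \<open>T1\<close> and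
    \<open>T2\<close>.\<close>
  define G where "G = {0<..<R\<^sup>2} - (?N ` C1 \<union> ?N ` C2)"
  have B: "?N ` C1 \<in> sets borel" "?N ` C2 \<in> sets borel"
    using 1 2 fsigma_image_inner_self by auto
  have "AE x in lebesgue. x \<notin> T1 \<union> T2"
    by (intro AE_not_in null_sets.Un 1 2)
  moreover have "x \<in> T1 \<union> T2" if "?N x \<in> G" for x
  proof -
    have "x \<in> ?\<Omega>" "x \<notin> C1" "x \<notin> C2" using that \<Omega> by (auto simp: G_def)
    then show ?thesis using 1(3) 2(3) by blast
  qed
  ultimately have "AE x in lebesgue. ?N x \<notin> G" by (auto elim: AE_mp)
  then have "G \<in> null_sets lborel"
    using B by (intro null_set_radial[where 'n = 'n]) (auto simp: G_def AE_completion_iff)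
  then have "G \<inter> E \<in> null_sets lebesgue"
    by (intro null_sets_completion_subset[OF _ null_sets_completionI]) auto
  then have G: "G \<inter> E \<in> sets lebesgue" by (rule null_setsD2)
  have "E \<inter> {0<..<R\<^sup>2} = ?N ` C1 \<union> (G \<inter> E)"
  proof (intro equalityI subsetI)
    fix s assume "s \<in> E \<inter> {0<..<R\<^sup>2}"
    moreover have "s \<notin> ?N ` C2" if "s \<in> E" using 2(3) that by blast
    ultimately show "s \<in> ?N ` C1 \<union> (G \<inter> E)" by (auto simp: G_def)
  next
    fix s assume "s \<in> ?N ` C1 \<union> (G \<inter> E)"
    moreover have "s \<in> E \<inter> {0<..<R\<^sup>2}" if "s \<in> ?N ` C1" using that 1(3) \<Omega> by blast
    ultimately show "s \<in> E \<inter> {0<..<R\<^sup>2}" by (auto simp: G_def)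
  qed
  then show ?thesis using B G by auto
qed

text \<open>The profile is an arbitrary function, so its measurability has to be extracted from that
  of the function on the ball. Afterwards it may be replaced by a Borel function, which composes
  safely with |x|^2.\<close>

lemma radial_borel_version:
  fixes U :: "real \<Rightarrow> real"
  assumes "(\<lambda>x :: real ^ 'n::finite. U (x \<bullet> x)) \<in> borel_measurable (lebesgue_on (ball 0 R))" and R: "R > 0"
  obtains U0 where "U0 \<in> borel_measurable borel" "AE s in lborel. 0 < s \<and> s < R\<^sup>2 \<longrightarrow> U s = U0 s"
proof -
  define U1 where "U1 s = (if s \<in> {0<..<R\<^sup>2} then U s else 0)" for s
  have "U1 \<in> borel_measurable lebesgue"
  proof (rule borel_measurableI_le)
    fix c
    have "{x \<in> space (lebesgue_on (ball 0 R)). U (x \<bullet> x) \<le> c} \<in> sets (lebesgue_on (ball 0 R :: (real ^ 'n) set))"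
      using assms(1) by (rule borel_measurable_le) auto
    then have "{x \<in> ball 0 R :: (real ^ 'n) set. U (x \<bullet> x) \<le> c} \<in> sets lebesgue"
      by (auto simp: space_restrict_space sets_restrict_space_iff)
    then have "{x \<in> ball 0 R :: (real ^ 'n) set. U (x \<bullet> x) \<le> c} - {0} \<in> sets lebesgue"
      by (rule sets.Diff) auto
    moreover have eq: "{x \<in> ball 0 R :: (real ^ 'n) set. U (x \<bullet> x) \<le> c} - {0} = {x \<in> ball 0 R - {0}. x \<bullet> x \<in> {s. U s \<le> c}}"
      by auto
    ultimately have "{x \<in> ball 0 R - {0} :: (real ^ 'n) set. x \<bullet> x \<in> {s. U s \<le> c}} \<in> sets lebesgue"
      by (simp only: eq)
    from radial_set_measurable[OF this R]
    have "{s. U s \<le> c} \<inter> {0<..<R\<^sup>2} \<in> sets lebesgue" .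
    moreover have "{s. U1 s \<le> c} = {s. U s \<le> c} \<inter> {0<..<R\<^sup>2} \<union> (if 0 \<le> c then - {0<..<R\<^sup>2} else {})"
      by (auto simp: U1_def)
    moreover have "closed (- {0<..<R\<^sup>2})" by (intro closed_Compl) auto
    then have "- {0<..<R\<^sup>2} \<in> sets lebesgue" using borel_closed by (metis sets_completionI_sets sets_lborel)
    ultimately show "{s \<in> space lebesgue. U1 s \<le> c} \<in> sets lebesgue" by auto
  qed
  then obtain U0 where "U0 \<in> borel_measurable lborel" "AE s in lborel. U1 s = U0 s"
    using completion_ex_borel_measurable_real by blast
  then show ?thesis
    by (intro that[of U0]) (auto simp: U1_def elim: AE_mp)
qed

lemma smooth_inner_self: "smooth (\<lambda>x :: real ^ 'n::finite. x \<bullet> x)"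
  unfolding inner_vec_def inner_real_def by (intro smooth_sum smooth_mult smooth_nth)

lemma partial_deriv_inner_self: "partial_deriv i (\<lambda>x :: real ^ 'n::finite. x \<bullet> x) = (\<lambda>x. 2 * x $ i)"
proof -
  have "((\<lambda>x. x \<bullet> x) has_derivative (\<lambda>h. x \<bullet> h + h \<bullet> x)) (at x)" for x :: "real ^ 'n"
    by (intro derivative_eq_intros) auto
  from partial_deriv_eqI[OF this] show ?thesis
    by (simp add: fun_eq_iff inner_axis inner_axis')
qed

lemma punctured_ball_iff: "R > 0 \<Longrightarrow> x \<in> ball 0 R - {0} \<longleftrightarrow> 0 < x \<bullet> x \<and> x \<bullet> x < R\<^sup>2"
  for x :: "'a::euclidean_space"
  by (auto simp: norm_eq_sqrt_inner real_less_lsqrt real_sqrt_less_iff[symmetric, of _ "R\<^sup>2"] simp del: real_sqrt_less_iff)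

lemma compact_in_annulus:
  assumes "compact K" "K \<subseteq> ball 0 R - {0 :: 'a::euclidean_space}" and R: "R > 0"
  obtains a b where "0 < a" "a < b" "b < R\<^sup>2" "\<And>x. x \<in> K \<Longrightarrow> x \<bullet> x \<in> {a..b}"
proof (cases "K = {}")
  case True
  then show ?thesis using that[of "R\<^sup>2 / 3" "R\<^sup>2 / 2"] R by auto
next
  case False
  have "continuous_on K (\<lambda>x. x \<bullet> x)" by (intro continuous_intros)
  from continuous_attains_inf[OF assms(1) False this] continuous_attains_sup[OF assms(1) False this]
  obtain x y where xy: "x \<in> K" "y \<in> K" "\<And>z. z \<in> K \<Longrightarrow> x \<bullet> x \<le> z \<bullet> z" "\<And>z. z \<in> K \<Longrightarrow> z \<bullet> z \<le> y \<bullet> y"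
    by blast
  have x: "0 < x \<bullet> x" and y: "y \<bullet> y < R\<^sup>2"
    using assms xy punctured_ball_iff[OF R] by blast+
  have "x \<bullet> x \<le> y \<bullet> y" using xy by auto
  \<comment> \<open>Half the minimum of |x|^2 makes \<open>a < b\<close> strict even if
    \<open>K\<close> lies on a single sphere.\<close>
  show ?thesis
  proof (rule that[of "x \<bullet> x / 2" "y \<bullet> y"])
    show "0 < x \<bullet> x / 2" "x \<bullet> x / 2 < y \<bullet> y" "y \<bullet> y < R\<^sup>2"
      using x y \<open>x \<bullet> x \<le> y \<bullet> y\<close> by linarith+
    show "z \<bullet> z \<in> {x \<bullet> x / 2..y \<bullet> y}" if "z \<in> K" for z
      using xy(3,4)[OF that] x unfolding atLeastAtMost_iff by linarith
  qed
qed

lemma test_in_annulus: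
  assumes "\<phi> \<in> test_functions (ball 0 R - {0 :: real ^ 'n::finite})" "R > 0"
  obtains a b where "0 < a" "a < b" "b < R\<^sup>2" "\<And>x. x \<bullet> x \<notin> {a..b} \<Longrightarrow> \<phi> x = 0"
proof -
  obtain K where K: "compact K" "K \<subseteq> ball 0 R - {0}" "\<And>x. x \<notin> K \<Longrightarrow> \<phi> x = 0"
    using test_functionsE[OF assms(1)] by metis
  show ?thesis
    by (rule compact_in_annulus[OF K(1,2) assms(2)]) (use K(3) that in blast)
qed

lemma annulus_compact: "compact {x :: real ^ 'n::finite. x \<bullet> x \<in> {a..b}}"
proof -
  have "closed ((\<lambda>x :: real ^ 'n. x \<bullet> x) -` {a..b})"
    by (intro continuous_closed_vimage continuous_intros)
  moreover have "bounded {x :: real ^ 'n. x \<bullet> x \<in> {a..b}}"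
    by (rule boundedI[of _ "sqrt b"]) (auto simp: norm_eq_sqrt_inner)
  ultimately show ?thesis by (simp add: compact_eq_bounded_closed vimage_def)
qed

definition test1 :: "real \<Rightarrow> (real \<Rightarrow> real) \<Rightarrow> bool" where
  "test1 T \<eta> \<longleftrightarrow> smooth1 \<eta> \<and> (\<exists>a b. 0 < a \<and> a < b \<and> b < T \<and> (\<forall>s. s \<notin> {a..b} \<longrightarrow> \<eta> s = 0))"

lemma test1E:
  assumes "test1 T \<eta>"
  obtains a b where "smooth1 \<eta>" "0 < a" "a < b" "b < T" "\<And>s. s \<notin> {a..b} \<Longrightarrow> \<eta> s = 0"
  using assms by (auto simp: test1_def)

lemma radial_test_function:
  assumes "test1 (R\<^sup>2) \<eta>" "smooth p" "R > 0"
  shows "(\<lambda>x. p x * \<eta> (x \<bullet> x)) \<in> test_functions (ball 0 R - {0 :: real ^ 'n::finite})"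
proof -
  obtain a b where ab: "smooth1 \<eta>" "0 < a" "a < b" "b < R\<^sup>2" "\<And>s. s \<notin> {a..b} \<Longrightarrow> \<eta> s = 0"
    by (rule test1E[OF assms(1)]) (rule that)
  show ?thesis
  proof (rule test_functionsI[OF _ annulus_compact[of a b]])
    show "smooth (\<lambda>x. p x * \<eta> (x \<bullet> x))"
      by (intro smooth_mult assms smooth_compose[OF ab(1)] smooth_inner_self)
    show "{x :: real ^ 'n. x \<bullet> x \<in> {a..b}} \<subseteq> ball 0 R - {0}"
    proof
      fix x :: "real ^ 'n" assume "x \<in> {x. x \<bullet> x \<in> {a..b}}"
      then have "0 < x \<bullet> x \<and> x \<bullet> x < R\<^sup>2"
        unfolding mem_Collect_eq atLeastAtMost_iff using ab by linarith
      then show "x \<in> ball 0 R - {0}" using punctured_ball_iff[OF assms(3)] by blast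
    qed
  qed (use ab in auto)
qed

text \<open>Borel measurability is built in because the composition of a merely Lebesgue measurable
  \<open>U\<close> with |x|^2 is not covered by the substitution formulas. Integrability is asked
  only away from both 0 and \<open>T\<close>.\<close>

definition loc1 :: "real \<Rightarrow> (real \<Rightarrow> real) \<Rightarrow> bool" where
  "loc1 T U \<longleftrightarrow> U \<in> borel_measurable borel \<and> (\<forall>a b. 0 < a \<longrightarrow> b < T \<longrightarrow> set_integrable lborel {a..b} U)"

lemma loc1D: "loc1 T U \<Longrightarrow> 0 < a \<Longrightarrow> b < T \<Longrightarrow> set_integrable lborel {a..b} U"
  and loc1_borel [measurable_dest]: "loc1 T U \<Longrightarrow> U \<in> borel_measurable borel"
  by (auto simp: loc1_def)

lemma integrable_mult_bounded1:
  fixes f g :: "real \<Rightarrow> real"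
  assumes "set_integrable lborel K f" "g \<in> borel_measurable borel" "\<And>x. x \<in> K \<Longrightarrow> \<bar>g x\<bar> \<le> B" "\<And>x. x \<notin> K \<Longrightarrow> g x = 0"
  shows "integrable lborel (\<lambda>x. f x * g x)"
proof -
  have eq: "(\<lambda>x. f x * g x) = (\<lambda>x. indicator K x *\<^sub>R f x * g x)"
    using assms(4) by (force simp: indicator_def)
  show ?thesis unfolding eq
  proof (rule Bochner_Integration.integrable_bound)
    show "integrable lborel (\<lambda>x. B * (indicator K x *\<^sub>R f x))"
      using assms(1) unfolding set_integrable_def by (rule integrable_mult_right)
    show "(\<lambda>x. indicat_real K x *\<^sub>R f x * g x) \<in> borel_measurable lborel"
      using assms(1,2) unfolding set_integrable_def by auto
    show "AE x in lborel. norm (indicat_real K x *\<^sub>R f x * g x) \<le> norm (B * (indicat_real K x *\<^sub>R f x))"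
    proof (rule AE_I2)
      fix x show "norm (indicat_real K x *\<^sub>R f x * g x) \<le> norm (B * (indicat_real K x *\<^sub>R f x))"
        using order_trans[OF assms(3) abs_ge_self, of x]
        by (cases "x \<in> K") (auto simp: abs_mult mult.commute[of B] intro!: mult_left_mono)
    qed
  qed
qed

lemma continuous_bounded_Icc:
  assumes "continuous_on {a..b} (g :: real \<Rightarrow> real)"
  obtains B where "\<And>x. x \<in> {a..b} \<Longrightarrow> \<bar>g x\<bar> \<le> B"
proof -
  have "bounded (g ` {a..b})" by (intro compact_imp_bounded compact_continuous_image assms compact_Icc)
  then show ?thesis using that by (force simp: bounded_iff)
qed

lemma loc1_test1_integrable:
  assumes "loc1 T U" "test1 T \<eta>"
  shows "integrable lborel (\<lambda>s. U s * \<eta> s)"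
proof -
  obtain a b where ab: "smooth1 \<eta>" "0 < a" "a < b" "b < T" "\<And>s. s \<notin> {a..b} \<Longrightarrow> \<eta> s = 0"
    by (rule test1E[OF assms(2)]) (rule that)
  obtain B where "\<And>x. x \<in> {a..b} \<Longrightarrow> \<bar>\<eta> x\<bar> \<le> B"
    using continuous_bounded_Icc smooth1_continuous[OF ab(1)] by metis
  then show ?thesis
    using assms(1) ab smooth1_continuous[OF ab(1), of UNIV]
    by (intro integrable_mult_bounded1[of "{a..b}" _ _ B]) (auto intro: loc1D borel_measurable_continuous_onI)
qed

lemma test1_bump: "0 < a \<Longrightarrow> a < b \<Longrightarrow> b < T \<Longrightarrow> test1 T (bump a b m)"
  unfolding test1_def using smooth1_bump bump_eq_0 by (metis greaterThanLessThan_subseteq_atLeastAtMost_iff order_refl subsetD)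

lemma fundamental_lemma1:
  assumes h: "loc1 T h" and z: "\<And>\<eta>. test1 T \<eta> \<Longrightarrow> integral\<^sup>L lborel (\<lambda>s. h s * \<eta> s) = 0"
  shows "AE s in lborel. 0 < s \<and> s < T \<longrightarrow> h s = 0"
proof -
  have [measurable]: "h \<in> borel_measurable borel" using h by (rule loc1_borel)
  have si: "set_integrable lborel {a..b} h" if "cbox a b \<subseteq> {0<..<T}" for a b
    using that loc1D[OF h, of a b] by (cases "a \<le> b") (auto simp: subset_eq set_integrable_def)
  have "AE s in lebesgue. s \<in> {0<..<T} \<longrightarrow> h s = 0"
  proof (rule AE_zero_on_open)
    show "set_integrable lebesgue (cbox a b) h" if "cbox a b \<subseteq> {0<..<T}" for a b
      using si[OF that] by (simp add: set_integrable_def integrable_completion)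
    fix a b assume ab: "cbox a b \<subseteq> {0<..<T}"
    show "(LINT x:box a b|lebesgue. h x) = 0"
    proof (cases "a < b")
      case True
      then have ab': "0 < a" "b < T" using ab by (auto simp: subset_eq)
      have "(\<lambda>m. integral\<^sup>L lborel (\<lambda>x. h x * bump a b m x)) \<longlonglongrightarrow> integral\<^sup>L lborel (\<lambda>x. indicator (box a b) x *\<^sub>R h x)"
      proof (rule integral_dominated_convergence)
        show "integrable lborel (\<lambda>x. norm (indicator {a..b} x *\<^sub>R h x))"
          using si[OF ab] unfolding set_integrable_def by (rule integrable_norm)
        show "AE x in lborel. (\<lambda>m. h x * bump a b m x) \<longlonglongrightarrow> indicator (box a b) x *\<^sub>R h x"
          unfolding box_real by (intro AE_I2) (auto simp: mult.commute[of "h _"] intro!: tendsto_mult_right bump_tendsto)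
        show "AE x in lborel. norm (h x * bump a b m x) \<le> norm (indicator {a..b} x *\<^sub>R h x)" for m
          using bump_bounds[of a b m] bump_eq_0[of _ a b m] by (intro AE_I2) (auto simp: indicator_def abs_mult intro!: mult_left_le)
        show "(\<lambda>x. h x * bump a b m x) \<in> borel_measurable lborel" for m
          using loc1_test1_integrable[OF h test1_bump[OF ab'(1) True ab'(2)]] by blast
      qed auto
      moreover have "integral\<^sup>L lborel (\<lambda>x. h x * bump a b m x) = 0" for m
        by (rule z[OF test1_bump[OF ab'(1) True ab'(2)]])
      ultimately show ?thesis
        unfolding set_lebesgue_integral_def by (simp add: LIMSEQ_const_iff integral_completion)
    qed (auto simp: set_lebesgue_integral_def)
  qed auto
  then show ?thesis by (simp add: AE_completion_iff)
qed

subsection \<open>Averaging over spheres\<close>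

text \<open>The image under |x|^2 of the measure with density \<open>k\<close> is absolutely
  continuous by \<open>AE_radial\<close>; \<kappa> is its Radon-Nikodym density. Up to a factor
  depending on \<open>s\<close> it replaces the integral of \<open>k\<close> over the sphere |x|^2 =
  s, without surface measure.\<close>

lemma radial_average_nonneg:
  fixes k :: "real ^ 'n::finite \<Rightarrow> real"
  assumes k [measurable]: "k \<in> borel_measurable lebesgue" and k0: "\<And>x. k x \<ge> 0"
    and fin: "\<And>a b. 0 < a \<Longrightarrow> b < T \<Longrightarrow> (\<integral>\<^sup>+x. ennreal (k x) * indicator {a..b} (x \<bullet> x) \<partial>lebesgue) < \<infinity>"
  obtains \<kappa> where "loc1 T \<kappa>" "\<And>s. \<kappa> s \<ge> 0"
    "\<And>\<theta> a b. 0 < a \<Longrightarrow> b < T \<Longrightarrow> \<theta> \<in> borel_measurable borel \<Longrightarrow> (\<And>s. s \<notin> {a..b} \<Longrightarrow> \<theta> s = 0) \<Longrightarrow>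
      (\<integral>\<^sup>+x. ennreal (\<theta> (x \<bullet> x) * k x) \<partial>lebesgue) = (\<integral>\<^sup>+s. ennreal (\<theta> s * \<kappa> s) \<partial>lborel)"
proof -
  have N [measurable]: "(\<lambda>x :: real ^ 'n. x \<bullet> x) \<in> borel_measurable lebesgue"
    by (simp add: measurable_completion)
  define \<nu> where "\<nu> = distr (density lebesgue (\<lambda>x. ennreal (k x))) borel (\<lambda>x. x \<bullet> x)"
  have nn: "(\<integral>\<^sup>+s. g s \<partial>\<nu>) = (\<integral>\<^sup>+x. ennreal (k x) * g (x \<bullet> x) \<partial>lebesgue)"
    if [measurable]: "g \<in> borel_measurable borel" for g
    unfolding \<nu>_def by (simp add: nn_integral_distr nn_integral_density)
  have "absolutely_continuous lborel \<nu>"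
    unfolding absolutely_continuous_def
  proof
    fix A :: "real set" assume A: "A \<in> null_sets lborel"
    then have [measurable]: "A \<in> sets borel" by auto
    have "AE s in lborel. 0 < s \<longrightarrow> s \<notin> A" using AE_not_in[OF A] by eventually_elim auto
    from AE_radial[OF this] have "AE x in (lebesgue :: (real ^ 'n) measure). x \<noteq> 0 \<longrightarrow> x \<bullet> x \<notin> A"
      by (simp add: AE_completion_iff)
    moreover have "AE x in (lebesgue :: (real ^ 'n) measure). x \<noteq> 0"
      using AE_lborel_singleton[of "0 :: real ^ 'n"] by (simp add: AE_completion_iff)
    ultimately have "AE x in (lebesgue :: (real ^ 'n) measure). ennreal (k x) * indicator A (x \<bullet> x) = 0"
      by eventually_elim auto
    then have "(\<integral>\<^sup>+s. indicator A s \<partial>\<nu>) = 0"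
      by (subst nn) (auto simp: nn_integral_0_iff_AE)
    then have "emeasure \<nu> A = 0" by (subst (asm) nn_integral_indicator) (auto simp: \<nu>_def)
    then show "A \<in> null_sets \<nu>" by (auto simp: null_sets_def \<nu>_def)
  qed
  then obtain f where f [measurable]: "f \<in> borel_measurable lborel" and \<nu>: "density lborel f = \<nu>"
    using sigma_finite_measure.Radon_Nikodym[OF sigma_finite_lborel] by (metis \<nu>_def sets_distr sets_lborel)
  have f' [measurable]: "f \<in> borel_measurable borel" using f by simp
  \<comment> \<open>Only on compact subintervals of \<open>(0, T)\<close> is the density known to be
    finite almost everywhere; elsewhere \<open>enn2real\<close> sends an infinite value to
    0.\<close>
  define \<kappa> where "\<kappa> s = enn2real (f s)" for s
  have [measurable]: "\<kappa> \<in> borel_measurable borel" unfolding \<kappa>_def by measurable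
  have finf: "(\<integral>\<^sup>+s. f s * indicator {a..b} s \<partial>lborel) < \<infinity>" if "0 < a" "b < T" for a b
  proof -
    have "(\<integral>\<^sup>+s. f s * indicator {a..b} s \<partial>lborel) = (\<integral>\<^sup>+s. indicator {a..b} s \<partial>\<nu>)"
      unfolding \<nu>[symmetric] by (subst nn_integral_density) auto
    also have "\<dots> < \<infinity>" using fin[OF that] by (subst nn) auto
    finally show ?thesis .
  qed
  have AEf: "AE s in lborel. s \<in> {a..b} \<longrightarrow> f s = ennreal (\<kappa> s)" if "0 < a" "b < T" for a b
  proof -
    have "AE s in lborel. f s * indicator {a..b} s \<noteq> \<infinity>"
      using finf[OF that] by (intro nn_integral_PInf_AE) auto
    then show ?thesis by eventually_elim (auto simp: \<kappa>_def less_top)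
  qed
  show ?thesis
  proof (rule that)
    show "\<kappa> s \<ge> 0" for s by (simp add: \<kappa>_def)
    show "loc1 T \<kappa>" unfolding loc1_def
    proof (intro conjI allI impI)
      fix a b :: real assume ab: "0 < a" "b < T"
      show "set_integrable lborel {a..b} \<kappa>" unfolding set_integrable_def
      proof (rule integrableI_bounded)
        have "(\<integral>\<^sup>+s. ennreal (norm (indicat_real {a..b} s *\<^sub>R \<kappa> s)) \<partial>lborel) = (\<integral>\<^sup>+s. f s * indicator {a..b} s \<partial>lborel)"
          using AEf[OF ab] by (intro nn_integral_cong_AE, eventually_elim) (auto simp: indicator_def \<kappa>_def)
        then show "(\<integral>\<^sup>+s. ennreal (norm (indicat_real {a..b} s *\<^sub>R \<kappa> s)) \<partial>lborel) < \<infinity>"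
          using finf[OF ab] by simp
      qed auto
    qed auto
    fix \<theta> :: "real \<Rightarrow> real" and a b :: real
    assume ab: "0 < a" "b < T" and [measurable]: "\<theta> \<in> borel_measurable borel"
      and s: "\<And>s. s \<notin> {a..b} \<Longrightarrow> \<theta> s = 0"
    have "(\<integral>\<^sup>+x. ennreal (\<theta> (x \<bullet> x) * k x) \<partial>lebesgue) = (\<integral>\<^sup>+s. ennreal (\<theta> s) \<partial>\<nu>)"
      using k0 by (subst nn) (auto simp: ennreal_mult' mult.commute[of "\<theta> _"])
    also have "\<dots> = (\<integral>\<^sup>+s. f s * ennreal (\<theta> s) \<partial>lborel)"
      unfolding \<nu>[symmetric] by (subst nn_integral_density) auto
    also have "\<dots> = (\<integral>\<^sup>+s. ennreal (\<theta> s * \<kappa> s) \<partial>lborel)"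
    proof (rule nn_integral_cong_AE, use AEf[OF ab] in eventually_elim)
      case (elim t)
      then show ?case using s[of t]
        by (cases "t \<in> {a..b}") (auto simp: ennreal_mult'' \<kappa>_def mult.commute)
    qed
    finally show "(\<integral>\<^sup>+x. ennreal (\<theta> (x \<bullet> x) * k x) \<partial>lebesgue) = (\<integral>\<^sup>+s. ennreal (\<theta> s * \<kappa> s) \<partial>lborel)" .
  qed
qed

text \<open>\<kappa> is the difference of the averages of the positive and negative parts of
  \<open>k\<close>.\<close>

lemma radial_average:
  fixes k :: "real ^ 'n::finite \<Rightarrow> real"
  assumes k: "\<And>a b. 0 < a \<Longrightarrow> b < T \<Longrightarrow> set_integrable lebesgue {x. x \<bullet> x \<in> {a..b}} k"
  obtains \<kappa> where "loc1 T \<kappa>"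
    "\<And>\<theta> a b. 0 < a \<Longrightarrow> b < T \<Longrightarrow> \<theta> \<in> borel_measurable borel \<Longrightarrow> (\<And>s. s \<notin> {a..b} \<Longrightarrow> \<theta> s = 0) \<Longrightarrow>
      integrable lebesgue (\<lambda>x. \<theta> (x \<bullet> x) * k x) \<Longrightarrow>
      integrable lborel (\<lambda>s. \<theta> s * \<kappa> s) \<and>
      integral\<^sup>L lebesgue (\<lambda>x. \<theta> (x \<bullet> x) * k x) = integral\<^sup>L lborel (\<lambda>s. \<theta> s * \<kappa> s)"
proof -
  \<comment> \<open>\<open>k\<close> is controlled only on annuli inside 0 < |x|^2 < T; the
    truncation is a pointwise limit of restrictions to such annuli and hence measurable on the whole
    space.\<close>
  define k1 where "k1 x = indicator {0<..<T} (x \<bullet> x) * k x" for x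
  have k1: "k1 \<in> borel_measurable lebesgue"
  proof (rule borel_measurable_LIMSEQ_real)
    fix m
    let ?A = "{x :: real ^ 'n. x \<bullet> x \<in> {inverse (real (Suc m)) .. T - inverse (real (Suc m))}}"
    have "set_integrable lebesgue ?A k" by (rule k) auto
    then show "(\<lambda>x. indicator ?A x *\<^sub>R k x) \<in> borel_measurable lebesgue"
      by (auto simp: set_integrable_def)
  next
    fix x :: "real ^ 'n"
    let ?s = "x \<bullet> x"
    have "(\<lambda>m. indicator {x. x \<bullet> x \<in> {inverse (real (Suc m)) .. T - inverse (real (Suc m))}} x *\<^sub>R k x) \<longlonglongrightarrow> indicator {0<..<T} ?s * k x"
    proof (rule tendsto_eventually)
      show "\<forall>\<^sub>F m in sequentially. indicator {x. x \<bullet> x \<in> {inverse (real (Suc m)) .. T - inverse (real (Suc m))}} x *\<^sub>R k x = indicator {0<..<T} ?s * k x"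
      proof (cases "?s \<in> {0<..<T}")
        case True
        have "\<forall>\<^sub>F m in sequentially. inverse (real (Suc m)) < min ?s (T - ?s)"
          using True by (intro order_tendstoD(2)[OF LIMSEQ_inverse_real_of_nat]) auto
        then show ?thesis by eventually_elim (use True in \<open>auto simp: indicator_def\<close>)
      next
        case False
        have "?s \<notin> {inverse (real (Suc m)) .. T - inverse (real (Suc m))}" for m
        proof
          have "inverse (real (Suc m)) > 0" by simp
          moreover assume "?s \<in> {inverse (real (Suc m)) .. T - inverse (real (Suc m))}"
          ultimately show False using False unfolding atLeastAtMost_iff greaterThanLessThan_iff by linarith
        qed
        with False show ?thesis by (auto simp: indicator_def)
      qed
    qed
    then show "(\<lambda>m. indicator {x. x \<bullet> x \<in> {inverse (real (Suc m)) .. T - inverse (real (Suc m))}} x *\<^sub>R k x) \<longlonglongrightarrow> k1 x"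
      by (simp add: k1_def)
  qed
  have fin: "(\<integral>\<^sup>+x. ennreal (max 0 (c * k1 x)) * indicator {a..b} (x \<bullet> x) \<partial>lebesgue) < \<infinity>"
    if "0 < a" "b < T" "\<bar>c\<bar> = 1" for a b c :: real
  proof -
    have "(\<integral>\<^sup>+x. ennreal (max 0 (c * k1 x)) * indicator {a..b} (x \<bullet> x) \<partial>lebesgue)
      \<le> (\<integral>\<^sup>+x. ennreal (norm (indicator {x. x \<bullet> x \<in> {a..b}} x *\<^sub>R k x)) \<partial>lebesgue)"
    proof (rule nn_integral_mono)
      fix x
      have "max 0 (c * k1 x) \<le> \<bar>k x\<bar>" using that(3) by (auto simp: k1_def indicator_def abs_if split: if_splits)
      then show "ennreal (max 0 (c * k1 x)) * indicator {a..b} (x \<bullet> x) \<le> ennreal (norm (indicator {x. x \<bullet> x \<in> {a..b}} x *\<^sub>R k x))"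
        by (auto simp: indicator_def intro: ennreal_leI)
    qed
    also have "\<dots> < \<infinity>" using k[OF that(1,2)] by (auto simp: set_integrable_def integrable_iff_bounded)
    finally show ?thesis .
  qed
  have m: "(\<lambda>x. max 0 (c * k1 x)) \<in> borel_measurable lebesgue" for c
    using k1 by measurable
  obtain \<kappa>p where p: "loc1 T \<kappa>p" "\<And>s. \<kappa>p s \<ge> 0"
    "\<And>\<theta> a b. 0 < a \<Longrightarrow> b < T \<Longrightarrow> \<theta> \<in> borel_measurable borel \<Longrightarrow> (\<And>s. s \<notin> {a..b} \<Longrightarrow> \<theta> s = 0) \<Longrightarrow>
      (\<integral>\<^sup>+x. ennreal (\<theta> (x \<bullet> x) * max 0 (1 * k1 x)) \<partial>lebesgue) = (\<integral>\<^sup>+s. ennreal (\<theta> s * \<kappa>p s) \<partial>lborel)"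
    by (rule radial_average_nonneg[OF m[of 1] _ fin[of _ _ 1]]) auto
  obtain \<kappa>n where n: "loc1 T \<kappa>n" "\<And>s. \<kappa>n s \<ge> 0"
    "\<And>\<theta> a b. 0 < a \<Longrightarrow> b < T \<Longrightarrow> \<theta> \<in> borel_measurable borel \<Longrightarrow> (\<And>s. s \<notin> {a..b} \<Longrightarrow> \<theta> s = 0) \<Longrightarrow>
      (\<integral>\<^sup>+x. ennreal (\<theta> (x \<bullet> x) * max 0 (- 1 * k1 x)) \<partial>lebesgue) = (\<integral>\<^sup>+s. ennreal (\<theta> s * \<kappa>n s) \<partial>lborel)"
    by (rule radial_average_nonneg[OF m[of "- 1"] _ fin[of _ _ "- 1"]]) auto
  show ?thesis
  proof (rule that)
    show "loc1 T (\<lambda>s. \<kappa>p s - \<kappa>n s)"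
      using p(1) n(1) by (auto simp: loc1_def intro: set_integral_diff)
    fix \<theta> :: "real \<Rightarrow> real" and a b :: real
    assume ab: "0 < a" "b < T" and \<theta>[measurable]: "\<theta> \<in> borel_measurable borel"
      and s: "\<And>s. s \<notin> {a..b} \<Longrightarrow> \<theta> s = 0" and int: "integrable lebesgue (\<lambda>x. \<theta> (x \<bullet> x) * k x)"
    have \<theta>': "(\<lambda>s. - \<theta> s) \<in> borel_measurable borel" "\<And>s. s \<notin> {a..b} \<Longrightarrow> - \<theta> s = 0"
      using s by auto
    have half: "integrable lborel (\<lambda>s. \<theta> s * \<kappa> s) \<and> integrable lebesgue (\<lambda>x. \<theta> (x \<bullet> x) * max 0 (c * k1 x)) \<and>
        integral\<^sup>L lebesgue (\<lambda>x. \<theta> (x \<bullet> x) * max 0 (c * k1 x)) = integral\<^sup>L lborel (\<lambda>s. \<theta> s * \<kappa> s)"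
      if c: "\<bar>c\<bar> = 1" and \<kappa>: "loc1 T \<kappa>"
        and eq: "\<And>\<theta> a b. 0 < a \<Longrightarrow> b < T \<Longrightarrow> \<theta> \<in> borel_measurable borel \<Longrightarrow> (\<And>s. s \<notin> {a..b} \<Longrightarrow> \<theta> s = 0) \<Longrightarrow>
      (\<integral>\<^sup>+x. ennreal (\<theta> (x \<bullet> x) * max 0 (c * k1 x)) \<partial>lebesgue) = (\<integral>\<^sup>+s. ennreal (\<theta> s * \<kappa> s) \<partial>lborel)" for c \<kappa>
    proof -
      have N [measurable]: "(\<lambda>x :: real ^ 'n. x \<bullet> x) \<in> borel_measurable lebesgue"
        by (simp add: measurable_completion)
      have I: "integrable lebesgue (\<lambda>x. \<theta> (x \<bullet> x) * max 0 (c * k1 x))"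
      proof (rule Bochner_Integration.integrable_bound[OF int])
        show "(\<lambda>x. \<theta> (x \<bullet> x) * max 0 (c * k1 x)) \<in> borel_measurable lebesgue"
          using k1 by measurable
        have "\<bar>max 0 (c * k1 x)\<bar> \<le> \<bar>k x\<bar>" for x using c by (auto simp: k1_def indicator_def abs_if split: if_splits)
        then show "AE x in lebesgue. norm (\<theta> (x \<bullet> x) * max 0 (c * k1 x)) \<le> norm (\<theta> (x \<bullet> x) * k x)"
          by (intro AE_I2) (simp add: abs_mult mult_left_mono)
      qed
      have [measurable]: "\<kappa> \<in> borel_measurable borel" using \<kappa> by (rule loc1_borel)
      \<comment> \<open>\<open>eq\<close> computes nonnegative integrals and so sees only the
        positive part of the integrand; applied to -\<theta> it gives the negative part.\<close>
      have I': "integrable lborel (\<lambda>s. \<theta> s * \<kappa> s)"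
        using I eq[OF ab \<theta> s] eq[OF ab \<theta>'] unfolding real_integrable_def by simp
      show ?thesis
        using I I' eq[OF ab \<theta> s] eq[OF ab \<theta>'] by (simp add: real_lebesgue_integral_def)
    qed
    have "\<bar>- 1 :: real\<bar> = 1" by simp
    note P = half[OF abs_one p(1) p(3)] and M = half[OF this n(1) n(3)]
    have split: "\<theta> (x \<bullet> x) * k x = \<theta> (x \<bullet> x) * max 0 (1 * k1 x) - \<theta> (x \<bullet> x) * max 0 (- 1 * k1 x)" for x
    proof (cases "x \<bullet> x \<in> {a..b}")
      case True
      then have "x \<bullet> x \<in> {0<..<T}" using ab unfolding atLeastAtMost_iff greaterThanLessThan_iff by linarith
      then have "k1 x = k x" by (simp add: k1_def)
      then show ?thesis by (auto simp: max_def algebra_simps)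
    qed (simp add: s)
    have diff: "\<theta> s * (\<kappa>p s - \<kappa>n s) = \<theta> s * \<kappa>p s - \<theta> s * \<kappa>n s" for s
      by (rule right_diff_distrib)
    show "integrable lborel (\<lambda>s. \<theta> s * (\<kappa>p s - \<kappa>n s)) \<and>
      integral\<^sup>L lebesgue (\<lambda>x. \<theta> (x \<bullet> x) * k x) = integral\<^sup>L lborel (\<lambda>s. \<theta> s * (\<kappa>p s - \<kappa>n s))"
      unfolding split diff
      using P[THEN conjunct1] M[THEN conjunct1] P[THEN conjunct2, THEN conjunct1] M[THEN conjunct2, THEN conjunct1]
        P[THEN conjunct2, THEN conjunct2] M[THEN conjunct2, THEN conjunct2]
      by (simp only: Bochner_Integration.integrable_diff Bochner_Integration.integral_diff simp_thms)
  qed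
qed

subsection \<open>Weak derivatives of radial functions\<close>

lemma test_integrable: "\<phi> \<in> test_functions \<Omega> \<Longrightarrow> integrable lborel \<phi>"
proof -
  assume \<phi>: "\<phi> \<in> test_functions \<Omega>"
  have "(\<lambda>x. 1 :: real) absolutely_integrable_on K" if "compact K" for K :: "(real ^ 'a) set"
    using lmeasurable_compact[OF that] by (simp add: absolutely_integrable_on_const)
  then have "locally_integrable \<Omega> (\<lambda>x. 1 :: real)" by (simp add: locally_integrable_def)
  from integrable_test_mult[OF this \<phi>] have "integrable lebesgue \<phi>" by simp
  then show ?thesis using test_borel[OF \<phi>] by (subst (asm) integrable_completion) auto
qed

lemma integral_translate:
  fixes f :: "'a::euclidean_space \<Rightarrow> real"
  assumes "f \<in> borel_measurable borel"
  shows "integral\<^sup>L lborel (\<lambda>x. f (x + c)) = integral\<^sup>L lborel f"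
proof -
  have "integral\<^sup>L lborel f = integral\<^sup>L (distr lborel borel ((+) c)) f"
    by (simp add: lborel_distr_plus)
  also have "\<dots> = integral\<^sup>L lborel (\<lambda>x. f (c + x))"
    using assms by (subst integral_distr) auto
  finally show ?thesis by (simp add: add.commute)
qed

text \<open>By translation invariance every difference quotient of \<phi> has integral 0; these
  quotients converge to the partial derivative under a common bound.\<close>

lemma integral_partial_deriv_zero:
  assumes \<phi>: "\<phi> \<in> test_functions \<Omega>"
  shows "integral\<^sup>L lborel (partial_deriv i \<phi>) = 0"
proof -
  define e where "e = (axis i 1 :: real ^ 'a)"
  define h where "h m = inverse (real (Suc m))" for m
  have h: "h m > 0" "h m \<le> 1" for m by (auto simp: h_def field_simps)
  have h0: "h \<longlonglongrightarrow> 0" unfolding h_def by (rule LIMSEQ_inverse_real_of_nat)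
  obtain K where K: "smooth \<phi>" "compact K" "K \<subseteq> \<Omega>" "\<And>x. x \<notin> K \<Longrightarrow> \<phi> x = 0"
    using test_functionsE[OF \<phi>] by metis
  obtain r where r: "\<And>x. x \<in> K \<Longrightarrow> norm x \<le> r"
    using compact_imp_bounded[OF K(2)] by (auto simp: bounded_iff)
  obtain B where B: "\<And>x. \<bar>partial_deriv i \<phi> x\<bar> \<le> B" "B \<ge> 0"
    using test_bounded[OF test_partial_deriv[OF \<phi>]] by metis
  have [measurable]: "\<phi> \<in> borel_measurable borel" "partial_deriv i \<phi> \<in> borel_measurable borel"
    using test_borel[OF \<phi>] test_borel[OF test_partial_deriv[OF \<phi>]] by auto
  define q where "q m x = (\<phi> (x + h m *\<^sub>R e) - \<phi> x) / h m" for m x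
  have q0: "integral\<^sup>L lborel (q m) = 0" for m
  proof -
    have "integrable lborel (\<lambda>x. \<phi> (x + h m *\<^sub>R e))"
    proof -
      have "integrable (distr lborel borel ((+) (h m *\<^sub>R e))) \<phi>"
        using test_integrable[OF \<phi>] by (simp add: lborel_distr_plus)
      then show ?thesis by (subst (asm) integrable_distr_eq) (auto simp: add.commute)
    qed
    then show ?thesis
      unfolding q_def using test_integrable[OF \<phi>] integral_translate[of \<phi> "h m *\<^sub>R e"] by simp
  qed
  have "(\<lambda>m. integral\<^sup>L lborel (q m)) \<longlonglongrightarrow> integral\<^sup>L lborel (partial_deriv i \<phi>)"
  proof (rule integral_dominated_convergence)
    \<comment> \<open>The quotients are bounded by \<open>B\<close> through the mean value theorem,
      and since \<open>h m \<le> 1\<close> they vanish outside the ball of radius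
      \<open>r + 1\<close>, with \<open>r\<close> a bound for the support.\<close>
    show "integrable lborel (\<lambda>x :: real ^ 'a. indicator (cball 0 (r + 1)) x * B)"
      using lmeasurable_cball[of "0 :: real ^ 'a" "r + 1"] by (intro integrable_mult_left) (auto simp: fmeasurable_def)
    show "AE x in lborel. (\<lambda>m. q m x) \<longlonglongrightarrow> partial_deriv i \<phi> x"
    proof (rule AE_I2)
      fix x
      have "((\<lambda>t. \<phi> (x + t *\<^sub>R e)) has_real_derivative partial_deriv i \<phi> x) (at 0)"
        using has_partial_deriv[OF smooth_differentiable[OF K(1)], of x i 0] by (simp add: e_def)
      then have "((\<lambda>t. (\<phi> (x + t *\<^sub>R e) - \<phi> x) / t) \<longlongrightarrow> partial_deriv i \<phi> x) (at 0)"
        by (simp add: DERIV_def)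
      moreover have "filterlim h (at 0) sequentially"
        using h0 h by (auto simp: filterlim_at intro!: always_eventually less_imp_neq[THEN not_sym])
      ultimately show "(\<lambda>m. q m x) \<longlonglongrightarrow> partial_deriv i \<phi> x"
        unfolding q_def by (rule filterlim_compose)
    qed
    show "AE x in lborel. norm (q m x) \<le> indicator (cball 0 (r + 1)) x * B" for m
    proof (rule AE_I2)
      fix x
      obtain t where t: "\<phi> (x + h m *\<^sub>R e) - \<phi> (x + 0 *\<^sub>R e) = (h m - 0) * partial_deriv i \<phi> (x + t *\<^sub>R e)"
        using MVT2[OF h(1)[of m], of "\<lambda>t. \<phi> (x + t *\<^sub>R e)" "\<lambda>t. partial_deriv i \<phi> (x + t *\<^sub>R e)"]
          has_partial_deriv[OF smooth_differentiable[OF K(1)], of x i] unfolding e_def by blast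
      then have "q m x = partial_deriv i \<phi> (x + t *\<^sub>R e)"
        using h(1)[of m] by (simp add: q_def)
      then have qB: "\<bar>q m x\<bar> \<le> B" using B by simp
      show "norm (q m x) \<le> indicator (cball 0 (r + 1)) x * B"
      proof (cases "norm x \<le> r + 1")
        case False
        have "norm x \<le> norm (x + h m *\<^sub>R e) + norm (h m *\<^sub>R e)" by (metis add_diff_cancel norm_triangle_ineq4)
        moreover have "norm (h m *\<^sub>R e) \<le> 1" using h[of m] by (simp add: e_def)
        ultimately have "x \<notin> K" "x + h m *\<^sub>R e \<notin> K" using r[of x] r[of "x + h m *\<^sub>R e"] False by auto
        then show ?thesis using K(4) False by (simp add: q_def)
      qed (use qB in simp)
    qed
    show "q m \<in> borel_measurable lborel" for m unfolding q_def by measurable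
  qed auto
  then show ?thesis by (simp add: q0 LIMSEQ_const_iff)
qed

text \<open>For a partial derivative of a test function the divergence theorem would express this
  tail as a sphere integral; \<open>weak_deriv_radial\<close> obtains that relation by testing, with
  the averages of \<open>radial_average\<close> in the role of sphere integrals.\<close>

definition sphere_tail :: "(real ^ 'n::finite \<Rightarrow> real) \<Rightarrow> real \<Rightarrow> real" where
  "sphere_tail \<phi> s = integral\<^sup>L lborel (\<lambda>x. \<phi> x * of_bool (s \<le> x \<bullet> x))"

lemma sphere_tail_borel:
  assumes [measurable]: "\<phi> \<in> borel_measurable borel"
  shows "sphere_tail \<phi> \<in> borel_measurable borel"
proof -
  have "(\<lambda>(s, x). \<phi> x * (if s \<le> x \<bullet> x then 1 else 0)) \<in> borel_measurable (borel \<Otimes>\<^sub>M lborel)"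
    by measurable
  from lborel.borel_measurable_lebesgue_integral[OF this] show ?thesis
    unfolding sphere_tail_def[abs_def] by (simp add: of_bool_def)
qed

lemma sphere_tail_bound:
  assumes "\<phi> \<in> test_functions \<Omega>"
  shows "\<bar>sphere_tail \<phi> s\<bar> \<le> integral\<^sup>L lborel (\<lambda>x. \<bar>\<phi> x\<bar>)"
proof -
  have "\<bar>sphere_tail \<phi> s\<bar> \<le> integral\<^sup>L lborel (\<lambda>x. \<bar>\<phi> x * of_bool (s \<le> x \<bullet> x)\<bar>)"
    unfolding sphere_tail_def by (rule integral_abs_bound)
  also have "\<dots> \<le> integral\<^sup>L lborel (\<lambda>x. \<bar>\<phi> x\<bar>)"
    using test_integrable[OF assms] by (intro integral_mono_AE' integrable_abs) auto
  finally show ?thesis .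
qed

text \<open>Fubini with the kernel \<open>s \<le> \<rho> x\<close>. For \<open>\<rho> x\<close> in
  \<open>[a, b]\<close> the inner integral on the left is a primitive of \<open>W\<close> evaluated
  at \<open>\<rho> x\<close>, so the formula trades a primitive for \<open>W\<close> itself, at the
  cost of replacing \<phi> by its tails.\<close>

lemma integral_tail:
  fixes \<phi> \<rho> :: "'a::euclidean_space \<Rightarrow> real"
  assumes \<phi>: "integrable lborel \<phi>" and [measurable]: "\<rho> \<in> borel_measurable borel" "W \<in> borel_measurable borel"
    and W: "set_integrable lborel {a..b} W"
  shows "integral\<^sup>L lborel (\<lambda>x. \<phi> x * (LINT s:{a..b}|lborel. W s * of_bool (s \<le> \<rho> x)))
    = (LINT s:{a..b}|lborel. W s * (\<integral>x. \<phi> x * of_bool (s \<le> \<rho> x) \<partial>lborel))"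
proof -
  have [measurable]: "\<phi> \<in> borel_measurable borel" using borel_measurable_integrable[OF \<phi>] by simp
  have P: "pair_sigma_finite (lborel :: 'a measure) (lborel :: real measure)" ..
  define f where "f x s = \<phi> x * (indicator {a..b} s * W s * (if s \<le> \<rho> x then 1 else 0))" for x s
  have fm: "case_prod f \<in> borel_measurable (lborel \<Otimes>\<^sub>M lborel)"
    unfolding f_def by measurable
  have W': "integrable lborel (\<lambda>s. indicator {a..b} s * W s)"
    using W by (simp add: set_integrable_def)
  have f2: "integrable lborel (\<lambda>s. f x s)" for x
    unfolding f_def
    by (intro integrable_mult_right Bochner_Integration.integrable_bound[OF W']) (auto intro!: AE_I2)
  have "integrable (lborel \<Otimes>\<^sub>M lborel) (case_prod f)"
  proof (rule pair_sigma_finite.Fubini_integrable[OF P fm])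
    show "integrable lborel (\<lambda>x. \<integral>s. norm (case_prod f (x, s)) \<partial>lborel)"
    proof (rule Bochner_Integration.integrable_bound)
      show "integrable lborel (\<lambda>x. \<phi> x * (\<integral>s. \<bar>indicator {a..b} s * W s\<bar> \<partial>lborel))"
        by (intro integrable_mult_left \<phi>)
      show "(\<lambda>x. \<integral>s. norm (case_prod f (x, s)) \<partial>lborel) \<in> borel_measurable lborel"
        using fm by measurable
      show "AE x in lborel. norm (\<integral>s. norm (case_prod f (x, s)) \<partial>lborel) \<le> norm (\<phi> x * (\<integral>s. \<bar>indicator {a..b} s * W s\<bar> \<partial>lborel))"
      proof (rule AE_I2)
        fix x
        have "(\<integral>s. norm (f x s) \<partial>lborel) \<le> (\<integral>s. \<bar>\<phi> x\<bar> * \<bar>indicator {a..b} s * W s\<bar> \<partial>lborel)"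
          by (intro integral_mono integrable_norm f2 integrable_mult_right integrable_abs W')
            (auto simp: f_def abs_mult)
        then show "norm (\<integral>s. norm (case_prod f (x, s)) \<partial>lborel) \<le> norm (\<phi> x * (\<integral>s. \<bar>indicator {a..b} s * W s\<bar> \<partial>lborel))"
          by (simp add: abs_mult)
      qed
    qed
  qed (use f2 in auto)
  from pair_sigma_finite.Fubini_integral[OF P this]
  have "(\<integral>x. (\<integral>s. f x s \<partial>lborel) \<partial>lborel) = (\<integral>s. (\<integral>x. f x s \<partial>lborel) \<partial>lborel)" by simp
  moreover have "(\<integral>s. f x s \<partial>lborel) = \<phi> x * (LINT s:{a..b}|lborel. W s * of_bool (s \<le> \<rho> x))" for x
    unfolding f_def set_lebesgue_integral_def by (subst integral_mult_right_zero) (simp add: of_bool_def mult.assoc)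
  moreover have "(\<integral>x. f x s \<partial>lborel) = indicator {a..b} s *\<^sub>R (W s * (\<integral>x. \<phi> x * of_bool (s \<le> \<rho> x) \<partial>lborel))" for s
  proof -
    have "f x s = (indicator {a..b} s * W s) * (\<phi> x * of_bool (s \<le> \<rho> x))" for x
      by (simp add: f_def)
    then show ?thesis by simp
  qed
  ultimately show ?thesis by (simp add: set_lebesgue_integral_def)
qed

lemma integral_sphere_tail:
  assumes "\<phi> \<in> test_functions \<Omega>" "W \<in> borel_measurable borel" "set_integrable lborel {a..b} W"
  shows "integral\<^sup>L lborel (\<lambda>x. \<phi> x * (LINT s:{a..b}|lborel. W s * of_bool (s \<le> x \<bullet> x)))
    = (LINT s:{a..b}|lborel. W s * sphere_tail \<phi> s)"
  unfolding sphere_tail_def by (intro integral_tail test_integrable[OF assms(1)] assms inner_self_borel)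

text \<open>\<open>V\<close> is the derivative of \<open>U\<close> on \<open>(0, T)\<close> in the sense that a representative of \<open>U\<close> is a primitive of \<open>V\<close>.\<close>

definition ac_deriv :: "real \<Rightarrow> (real \<Rightarrow> real) \<Rightarrow> (real \<Rightarrow> real) \<Rightarrow> bool" where
  "ac_deriv T U V \<longleftrightarrow> loc1 T U \<and> loc1 T V \<and>
    (\<exists>U'. (AE s in lborel. 0 < s \<and> s < T \<longrightarrow> U s = U' s) \<and>
      (\<forall>a b. 0 < a \<longrightarrow> a \<le> b \<longrightarrow> b < T \<longrightarrow> U' b - U' a = (LINT s:{a..b}|lborel. V s)))"

lemma AE_radial_open:
  assumes "AE s in lborel. 0 < s \<and> s < T \<longrightarrow> P s"
  shows "AE x in (lebesgue :: (real ^ 'n::finite) measure). 0 < x \<bullet> x \<and> x \<bullet> x < T \<longrightarrow> P (x \<bullet> x)"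
proof -
  have "AE s in lborel. 0 < s \<longrightarrow> (s < T \<longrightarrow> P s)" using assms by eventually_elim auto
  from AE_radial[OF this] show ?thesis unfolding AE_completion_iff by eventually_elim auto
qed

text \<open>Writing \<open>U\<close> as a constant plus a primitive of \<open>V\<close>, Fubini
  gives the integral of \<open>V\<close> against the tail \<Phi> of the partial derivative.
  Everything rests on \<Phi> = -\<kappa> almost everywhere, where \<kappa> averages
  \<open>2 x_i \<phi>\<close> over spheres; that identity involves neither \<open>U\<close> nor
  \<open>V\<close> and is proved with smooth profiles, for which the chain rule is
  classical.\<close>

lemma weak_deriv_radial:
  fixes \<phi> :: "real ^ 'n::finite \<Rightarrow> real"
  assumes UV: "ac_deriv (R\<^sup>2) U V" and R: "R > 0" and \<phi>: "\<phi> \<in> test_functions (ball 0 R - {0})"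
  shows "integral\<^sup>L lebesgue (\<lambda>x. U (x \<bullet> x) * partial_deriv i \<phi> x) = - integral\<^sup>L lebesgue (\<lambda>x. 2 * x $ i * V (x \<bullet> x) * \<phi> x)"
proof -
  define k where "k x = 2 * x $ i * \<phi> x" for x
  have ktest: "k \<in> test_functions (ball 0 R - {0})"
    unfolding k_def by (intro test_mult[OF _ \<phi>] smooth_mult smooth_const smooth_nth)
  have d\<phi>: "partial_deriv i \<phi> \<in> test_functions (ball 0 R - {0})" by (rule test_partial_deriv[OF \<phi>])
  have \<phi>_m [measurable]: "\<phi> \<in> borel_measurable borel" "partial_deriv i \<phi> \<in> borel_measurable borel" "k \<in> borel_measurable borel"
    using test_borel[OF \<phi>] test_borel[OF d\<phi>] test_borel[OF ktest] .
  obtain a2 b2 where ab2: "0 < a2" "a2 < b2" "b2 < R\<^sup>2" "\<And>x. x \<bullet> x \<notin> {a2..b2} \<Longrightarrow> \<phi> x = 0"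
    using test_in_annulus[OF \<phi> R] by metis
  have d\<phi>0: "partial_deriv i \<phi> x = 0" if "x \<bullet> x \<notin> {a2..b2}" for x
    by (rule partial_deriv_outside[of "{x. x \<bullet> x \<in> {a2..b2}}"])
      (use that ab2(4) compact_imp_closed[OF annulus_compact[of a2 b2]] in auto)
  have "set_integrable lebesgue {x. x \<bullet> x \<in> {a..b}} k" for a b
    unfolding set_integrable_def using test_integrable[OF ktest] annulus_compact[of a b]
    by (intro integrable_mult_indicator) (auto simp: integrable_completion intro: lmeasurable_compact fmeasurableD)
  then obtain \<kappa> where \<kappa>: "loc1 (R\<^sup>2) \<kappa>"
    "\<And>\<theta> a b. 0 < a \<Longrightarrow> b < R\<^sup>2 \<Longrightarrow> \<theta> \<in> borel_measurable borel \<Longrightarrow> (\<And>s. s \<notin> {a..b} \<Longrightarrow> \<theta> s = 0) \<Longrightarrow>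
      integrable lebesgue (\<lambda>x. \<theta> (x \<bullet> x) * k x) \<Longrightarrow>
      integrable lborel (\<lambda>s. \<theta> s * \<kappa> s) \<and>
      integral\<^sup>L lebesgue (\<lambda>x. \<theta> (x \<bullet> x) * k x) = integral\<^sup>L lborel (\<lambda>s. \<theta> s * \<kappa> s)"
    using radial_average[of "R\<^sup>2" k] by blast
  define \<Phi> where "\<Phi> = sphere_tail (partial_deriv i \<phi>)"
  have [measurable]: "\<Phi> \<in> borel_measurable borel" "\<kappa> \<in> borel_measurable borel"
    unfolding \<Phi>_def using sphere_tail_borel[OF \<phi>_m(2)] loc1_borel[OF \<kappa>(1)] by auto
  have \<Phi>loc: "loc1 (R\<^sup>2) \<Phi>"
    unfolding loc1_def
  proof (intro conjI allI impI)
    fix a b :: real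
    have "integrable lborel (\<lambda>s. indicat_real {a..b} s * \<Phi> s)"
    proof (rule Bochner_Integration.integrable_bound)
      show "integrable lborel (\<lambda>s. indicat_real {a..b} s * integral\<^sup>L lborel (\<lambda>x. \<bar>partial_deriv i \<phi> x\<bar>))"
        by (intro integrable_mult_left integrable_real_indicator) (auto simp: emeasure_lborel_Icc_eq)
      show "AE s in lborel. norm (indicat_real {a..b} s * \<Phi> s) \<le> norm (indicat_real {a..b} s * integral\<^sup>L lborel (\<lambda>x. \<bar>partial_deriv i \<phi> x\<bar>))"
        using order_trans[OF sphere_tail_bound[OF d\<phi>] abs_ge_self] unfolding \<Phi>_def
        by (intro AE_I2) (auto simp: indicator_def)
    qed auto
    then show "set_integrable lborel {a..b} \<Phi>" by (simp add: set_integrable_def)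
  qed auto
  \<comment> \<open>The case of smooth profiles: for a one-variable test function \<eta> with
    primitive \<open>H\<close>, the derivative of \<open>H(|x|^2) \<phi>(x)\<close> integrates to 0,
    which is the claim tested against \<eta>.\<close>
  have "AE s in lborel. 0 < s \<and> s < R\<^sup>2 \<longrightarrow> \<kappa> s + \<Phi> s = 0"
  proof (rule fundamental_lemma1)
    show "loc1 (R\<^sup>2) (\<lambda>s. \<kappa> s + \<Phi> s)"
      using \<kappa>(1) \<Phi>loc by (auto simp: loc1_def intro: set_integral_add)
    fix \<eta> assume \<eta>: "test1 (R\<^sup>2) \<eta>"
    obtain a1 b1 where ab1: "smooth1 \<eta>" "0 < a1" "a1 < b1" "b1 < R\<^sup>2" "\<And>s. s \<notin> {a1..b1} \<Longrightarrow> \<eta> s = 0"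
      by (rule test1E[OF \<eta>]) (rule that)
    define a b where "a = min a1 a2" and "b = max b1 b2"
    have sub: "{a1..b1} \<subseteq> {a..b}" "{a2..b2} \<subseteq> {a..b}" and ab0: "0 < a" "a < b" "b < R\<^sup>2"
      using ab1 ab2(1-3) by (auto simp: a_def b_def)
    have "\<eta> s = 0" if "s \<notin> {a..b}" for s using that sub(1) ab1(5) by blast
    moreover have "\<phi> x = 0" "partial_deriv i \<phi> x = 0" if "x \<bullet> x \<notin> {a..b}" for x
      using that sub(2) ab2(4) d\<phi>0 by blast+
    ultimately have ab: "0 < a" "a < b" "b < R\<^sup>2" "\<And>s. s \<notin> {a..b} \<Longrightarrow> \<eta> s = 0"
      "\<And>x. x \<bullet> x \<notin> {a..b} \<Longrightarrow> partial_deriv i \<phi> x = 0"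
      using ab0 by blast+
    have [measurable]: "\<eta> \<in> borel_measurable borel"
      using smooth1_continuous[OF ab1(1)] by (rule borel_measurable_continuous_onI)
    have "\<exists>F. \<forall>x::real. (-\<infinity>::ereal) < x \<longrightarrow> x < (\<infinity>::ereal) \<longrightarrow> (F has_vector_derivative \<eta> x) (at x)"
      using smooth1_continuous[OF ab1(1), of UNIV]
      by (intro einterval_antiderivative) (auto simp: continuous_on_eq_continuous_at)
    then obtain F where F: "\<And>x. (F has_real_derivative \<eta> x) (at x)"
      by (auto simp: has_real_derivative_iff_has_vector_derivative)
    define H where "H s = F s - F a" for s
    have H: "(H has_real_derivative \<eta> x) (at x)" for x
      unfolding H_def by (auto intro!: derivative_eq_intros F)
    have Hs: "smooth1 H" by (rule smooth1_antideriv[OF ab1(1) H])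
    have Hint: "H s = (LINT t:{a..b}|lborel. \<eta> t * of_bool (t \<le> s))" if "s \<in> {a..b}" for s
    proof -
      have "(LINT t:{a..b}|lborel. \<eta> t * of_bool (t \<le> s)) = (\<integral>t. \<eta> t * indicator {a..s} t \<partial>lborel)"
        unfolding set_lebesgue_integral_def using that by (intro Bochner_Integration.integral_cong) (auto simp: indicator_def)
      also have "\<dots> = F s - F a"
        using that smooth1_continuous[OF ab1(1), of UNIV] F
        by (intro integral_FTC_Icc_real) (auto simp: continuous_on_eq_continuous_at)
      finally show ?thesis by (simp add: H_def)
    qed
    \<comment> \<open>\<open>H\<close> is constant but possibly nonzero beyond the support of
      \<eta>; it is the factor \<phi> that supplies compact support.\<close>
    have "(\<lambda>x. H (x \<bullet> x) * \<phi> x) \<in> test_functions (ball 0 R - {0})"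
      by (intro test_mult[OF _ \<phi>] smooth_compose[OF Hs] smooth_inner_self)
    from integral_partial_deriv_zero[OF this, of i]
    have "integral\<^sup>L lborel (\<lambda>x. H (x \<bullet> x) * partial_deriv i \<phi> x + \<eta> (x \<bullet> x) * (2 * x $ i) * \<phi> x) = 0"
      using partial_deriv_compose[OF smooth_differentiable[OF smooth_inner_self] H, of i]
      by (subst (asm) partial_deriv_mult)
        (auto intro!: smooth_differentiable smooth_compose[OF Hs] smooth_inner_self test_smooth[OF \<phi>] simp: partial_deriv_inner_self)
    moreover have "(\<lambda>x. H (x \<bullet> x) * partial_deriv i \<phi> x) \<in> test_functions (ball 0 R - {0})"
      by (intro test_mult[OF _ d\<phi>] smooth_compose[OF Hs] smooth_inner_self)
    moreover have \<eta>k: "(\<lambda>x. \<eta> (x \<bullet> x) * k x) \<in> test_functions (ball 0 R - {0})"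
      by (intro test_mult[OF _ ktest] smooth_compose[OF ab1(1)] smooth_inner_self)
    ultimately have 1: "integral\<^sup>L lborel (\<lambda>x. H (x \<bullet> x) * partial_deriv i \<phi> x) + integral\<^sup>L lborel (\<lambda>x. \<eta> (x \<bullet> x) * k x) = 0"
      by (subst Bochner_Integration.integral_add[symmetric]) (auto simp: k_def mult.assoc dest: test_integrable)
    have "integrable lebesgue (\<lambda>x. \<eta> (x \<bullet> x) * k x)"
      using test_integrable[OF \<eta>k] by (subst integrable_completion) auto
    from \<kappa>(2)[OF ab(1,3) _ ab(4) this]
    have \<kappa>\<eta>: "integrable lborel (\<lambda>s. \<eta> s * \<kappa> s)"
      "integral\<^sup>L lborel (\<lambda>x. \<eta> (x \<bullet> x) * k x) = integral\<^sup>L lborel (\<lambda>s. \<eta> s * \<kappa> s)"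
      by (auto simp: integral_completion)
    have "integral\<^sup>L lborel (\<lambda>x. H (x \<bullet> x) * partial_deriv i \<phi> x)
      = integral\<^sup>L lborel (\<lambda>x. partial_deriv i \<phi> x * (LINT t:{a..b}|lborel. \<eta> t * of_bool (t \<le> x \<bullet> x)))"
    proof (rule Bochner_Integration.integral_cong[OF refl])
      fix x show "H (x \<bullet> x) * partial_deriv i \<phi> x = partial_deriv i \<phi> x * (LINT t:{a..b}|lborel. \<eta> t * of_bool (t \<le> x \<bullet> x))"
        using Hint[of "x \<bullet> x"] ab(5)[of x] by (cases "x \<bullet> x \<in> {a..b}") simp_all
    qed
    also have "\<dots> = (LINT s:{a..b}|lborel. \<eta> s * \<Phi> s)"
      unfolding \<Phi>_def using loc1_test1_integrable[OF _ \<eta>, of "\<lambda>_. 1"]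
      by (intro integral_sphere_tail[OF d\<phi>]) (auto intro!: borel_integrable_atLeastAtMost' smooth1_continuous[OF ab1(1)])
    also have "\<dots> = integral\<^sup>L lborel (\<lambda>s. \<eta> s * \<Phi> s)"
      unfolding set_lebesgue_integral_def using ab(4) by (intro Bochner_Integration.integral_cong) (auto simp: indicator_def)
    finally have 2: "integral\<^sup>L lborel (\<lambda>x. H (x \<bullet> x) * partial_deriv i \<phi> x) = integral\<^sup>L lborel (\<lambda>s. \<eta> s * \<Phi> s)" .
    have "integral\<^sup>L lborel (\<lambda>s. \<eta> s * \<Phi> s + \<eta> s * \<kappa> s) = 0"
      using 1 2 \<kappa>\<eta> loc1_test1_integrable[OF \<Phi>loc \<eta>] by (subst Bochner_Integration.integral_add) (auto simp: mult.commute)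
    then show "integral\<^sup>L lborel (\<lambda>s. (\<kappa> s + \<Phi> s) * \<eta> s) = 0"
      by (simp add: algebra_simps)
  qed
  then have \<kappa>\<Phi>: "AE s in lborel. 0 < s \<and> s < R\<^sup>2 \<longrightarrow> \<Phi> s = - \<kappa> s" by eventually_elim auto
  define a b where "a = a2" and "b = b2"
  note ab = ab2[folded a_def b_def] and d\<phi>0 = d\<phi>0[folded a_def b_def]
  obtain U' where U': "AE s in lborel. 0 < s \<and> s < R\<^sup>2 \<longrightarrow> U s = U' s"
    "\<And>a b. 0 < a \<Longrightarrow> a \<le> b \<Longrightarrow> b < R\<^sup>2 \<Longrightarrow> U' b - U' a = (LINT s:{a..b}|lborel. V s)"
    and loc: "loc1 (R\<^sup>2) U" "loc1 (R\<^sup>2) V"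
    using UV unfolding ac_deriv_def by metis
  have [measurable]: "U \<in> borel_measurable borel" "V \<in> borel_measurable borel"
    using loc loc1_borel by auto
  have Vab: "set_integrable lborel {a..b} V" by (rule loc1D[OF loc(2) ab(1,3)])
  define L where "L x = (LINT t:{a..b}|lborel. V t * of_bool (t \<le> x \<bullet> x))" for x :: "real ^ 'n"
  have L: "U' (x \<bullet> x) = U' a + L x" if "x \<bullet> x \<in> {a..b}" for x
  proof -
    have "L x = (LINT t:{a..x \<bullet> x}|lborel. V t)"
      unfolding L_def set_lebesgue_integral_def using that by (intro Bochner_Integration.integral_cong) (auto simp: indicator_def)
    then show ?thesis using U'(2)[of a "x \<bullet> x"] that ab by auto
  qed
  have "AE x in lborel. U (x \<bullet> x) * partial_deriv i \<phi> x = (U' a + L x) * partial_deriv i \<phi> x"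
    using AE_radial_open[OF U'(1), where 'n = 'n] unfolding AE_completion_iff
  proof eventually_elim
    case (elim x)
    then show ?case using L[of x] d\<phi>0[of x] ab by (cases "x \<bullet> x \<in> {a..b}") auto
  qed
  moreover have Lm [measurable]: "L \<in> borel_measurable borel"
  proof -
    have "(\<lambda>(x :: real ^ 'n, t). indicator {a..b} t * (V t * (if t \<le> x \<bullet> x then 1 else 0))) \<in> borel_measurable (borel \<Otimes>\<^sub>M lborel)"
      by measurable
    from lborel.borel_measurable_lebesgue_integral[OF this] show ?thesis
      unfolding L_def[abs_def] set_lebesgue_integral_def by (simp add: of_bool_def)
  qed
  ultimately have "integral\<^sup>L lborel (\<lambda>x. U (x \<bullet> x) * partial_deriv i \<phi> x) = integral\<^sup>L lborel (\<lambda>x. (U' a + L x) * partial_deriv i \<phi> x)"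
    by (intro integral_cong_AE) auto
  also have "\<dots> = integral\<^sup>L lborel (\<lambda>x. U' a * partial_deriv i \<phi> x + partial_deriv i \<phi> x * L x)"
    by (simp add: algebra_simps)
  also have "\<dots> = integral\<^sup>L lborel (\<lambda>x. U' a * partial_deriv i \<phi> x) + integral\<^sup>L lborel (\<lambda>x. partial_deriv i \<phi> x * L x)"
  proof (rule Bochner_Integration.integral_add)
    show "integrable lborel (\<lambda>x. partial_deriv i \<phi> x * L x)"
    proof (rule Bochner_Integration.integrable_bound)
      show "integrable lborel (\<lambda>x. partial_deriv i \<phi> x * (LINT t:{a..b}|lborel. \<bar>V t\<bar>))"
        by (intro integrable_mult_left test_integrable[OF d\<phi>])
      have "\<bar>L x\<bar> \<le> (LINT t:{a..b}|lborel. \<bar>V t\<bar>)" for x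
      proof -
        have "\<bar>L x\<bar> \<le> integral\<^sup>L lborel (\<lambda>t. \<bar>indicator {a..b} t *\<^sub>R (V t * of_bool (t \<le> x \<bullet> x))\<bar>)"
          unfolding L_def set_lebesgue_integral_def by (rule integral_abs_bound)
        also have "\<dots> \<le> integral\<^sup>L lborel (\<lambda>t. indicator {a..b} t *\<^sub>R \<bar>V t\<bar>)"
          using set_integrable_abs[OF Vab] unfolding set_integrable_def
          by (intro integral_mono_AE') (auto simp: indicator_def)
        finally show ?thesis by (simp add: set_lebesgue_integral_def)
      qed
      from order_trans[OF this abs_ge_self] show "AE x in lborel. norm (partial_deriv i \<phi> x * L x) \<le> norm (partial_deriv i \<phi> x * (LINT t:{a..b}|lborel. \<bar>V t\<bar>))"
        by (intro AE_I2) (simp add: abs_mult mult_left_mono)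
    qed auto
  qed (use test_integrable[OF d\<phi>] in auto)
  \<comment> \<open>The additive constant drops out, so the choice of the base point
    \<open>a\<close> is harmless.\<close>
  also have "integral\<^sup>L lborel (\<lambda>x. U' a * partial_deriv i \<phi> x) = 0"
    using integral_partial_deriv_zero[OF \<phi>] by simp
  also have "integral\<^sup>L lborel (\<lambda>x. partial_deriv i \<phi> x * L x) = (LINT s:{a..b}|lborel. V s * \<Phi> s)"
    unfolding L_def \<Phi>_def by (rule integral_sphere_tail[OF d\<phi> _ Vab]) auto
  also have "\<dots> = integral\<^sup>L lborel (\<lambda>s. - ((indicator {a..b} s * V s) * \<kappa> s))"
    unfolding set_lebesgue_integral_def
  proof (rule integral_cong_AE)
    show "AE s in lborel. indicator {a..b} s *\<^sub>R (V s * \<Phi> s) = - ((indicator {a..b} s * V s) * \<kappa> s)"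
      using \<kappa>\<Phi> by eventually_elim (use ab in \<open>auto simp: indicator_def\<close>)
  qed auto
  also have "\<dots> = - integral\<^sup>L lebesgue (\<lambda>x. (indicator {a..b} (x \<bullet> x) * V (x \<bullet> x)) * k x)"
  proof -
    have [measurable]: "(\<lambda>x :: real ^ 'n. indicator {a..b} (x \<bullet> x) * V (x \<bullet> x)) \<in> borel_measurable borel" by measurable
    have "integrable lborel (\<lambda>s. radial_density TYPE('n) s * (indicator {a..b} s * V s))"
    proof -
      have "continuous_on {a..b} (\<lambda>s. radial_const TYPE('n) * s powr (real CARD('n) / 2 - 1))"
        using ab by (intro continuous_intros) auto
      then obtain B where B: "\<And>s. s \<in> {a..b} \<Longrightarrow> \<bar>radial_const TYPE('n) * s powr (real CARD('n) / 2 - 1)\<bar> \<le> B"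
        using continuous_bounded_Icc by metis
      have "integrable lborel (\<lambda>s. V s * (indicator {a..b} s * radial_density TYPE('n) s))"
        by (rule integrable_mult_bounded1[OF Vab, of _ B]) (use B ab in \<open>auto simp: radial_density_def indicator_def\<close>)
      then show ?thesis by (simp add: mult_ac)
    qed
    then have "integrable lborel (\<lambda>x :: real ^ 'n. indicator {a..b} (x \<bullet> x) * V (x \<bullet> x))"
      by (subst integrable_radial[of "\<lambda>s. indicator {a..b} s * V s"]) auto
    moreover obtain B where B: "\<And>x. \<bar>k x\<bar> \<le> B" using test_bounded[OF ktest] by metis
    ultimately have "integrable lebesgue (\<lambda>x. (indicator {a..b} (x \<bullet> x) * V (x \<bullet> x)) * k x)"
      by (intro integrable_mult_bounded[of UNIV _ _ B]) (auto simp: set_integrable_def integrable_completion)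
    from \<kappa>(2)[of a b "\<lambda>s. indicator {a..b} s * V s", OF ab(1,3) _ _ this]
    show ?thesis by (auto simp: indicator_def)
  qed
  also have "(\<lambda>x. (indicator {a..b} (x \<bullet> x) * V (x \<bullet> x)) * k x) = (\<lambda>x. 2 * x $ i * V (x \<bullet> x) * \<phi> x)"
    using ab(4) by (auto simp: fun_eq_iff k_def indicator_def)
  finally show ?thesis by (simp add: integral_completion)
qed

subsection \<open>From weak gradients to primitives\<close>

lemma test1_deriv:
  assumes "test1 T \<eta>"
  shows "test1 T (deriv \<eta>)"
proof -
  obtain a b where ab: "smooth1 \<eta>" "0 < a" "a < b" "b < T" "\<And>s. s \<notin> {a..b} \<Longrightarrow> \<eta> s = 0"
    by (rule test1E[OF assms]) (rule that)
  have "deriv \<eta> s = 0" if "s \<notin> {a..b}" for s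
  proof (rule DERIV_imp_deriv, rule has_field_derivative_transform_within_open[of "\<lambda>_. 0" _ _ "- {a..b}"])
    show "open (- {a..b})" by (intro open_Compl closed_atLeastAtMost)
  qed (use that ab(5) in auto)
  then show ?thesis using ab smooth1_deriv_smooth[OF ab(1)] unfolding test1_def by blast
qed

text \<open>Powers of \<open>s\<close> may be singular at 0, but \<eta> vanishes near 0. The
  derivative is a combination of functions \<open>s powr \<beta> * \<eta> s\<close> with new \<beta>
  and \<eta>, so smoothness follows by induction over this whole class.\<close>

lemma test1_powr:
  assumes "test1 T \<eta>"
  shows "((\<lambda>s. s powr \<beta> * \<eta> s) has_real_derivative (s powr \<beta> * deriv \<eta> s + \<beta> * (s powr (\<beta> - 1) * \<eta> s))) (at s)"
    and "test1 T (\<lambda>s. s powr \<beta> * \<eta> s)"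
proof -
  have D: "((\<lambda>s. s powr \<beta> * \<eta> s) has_real_derivative (s powr \<beta> * deriv \<eta> s + \<beta> * (s powr (\<beta> - 1) * \<eta> s))) (at s)"
    if \<eta>: "test1 T \<eta>" for \<eta> s \<beta>
  proof -
    obtain a b where ab: "smooth1 \<eta>" "0 < a" "\<And>s. s \<notin> {a..b} \<Longrightarrow> \<eta> s = 0"
      by (rule test1E[OF \<eta>]) (rule that)
    show ?thesis
    proof (cases "s > 0")
      case True
      then show ?thesis
        by (auto intro!: derivative_eq_intros smooth1_deriv[OF ab(1)] simp: field_simps powr_diff)
    next
      case False
      have "((\<lambda>s. s powr \<beta> * \<eta> s) has_real_derivative 0) (at s)"
        by (rule has_field_derivative_transform_within_open[of "\<lambda>_. 0" _ _ "{..<a}"]) (use False ab in auto)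
      moreover have "deriv \<eta> s = 0"
        by (rule DERIV_imp_deriv, rule has_field_derivative_transform_within_open[of "\<lambda>_. 0" _ _ "{..<a}"])
          (use False ab in auto)
      ultimately show ?thesis using False ab by simp
    qed
  qed
  show "((\<lambda>s. s powr \<beta> * \<eta> s) has_real_derivative (s powr \<beta> * deriv \<eta> s + \<beta> * (s powr (\<beta> - 1) * \<eta> s))) (at s)"
    by (rule D[OF assms])
  have "diff1_upto n (\<lambda>s. s powr \<beta> * \<eta> s)" if "test1 T \<eta>" for n \<beta> \<eta>
    using that
  proof (induction n arbitrary: \<beta> \<eta>)
    case 0 then show ?case using D[OF 0] by (auto simp: real_differentiable_def)
  next
    case (Suc n)
    have "diff1_upto n (\<lambda>s. s powr \<beta> * deriv \<eta> s + \<beta> * (s powr (\<beta> - 1) * \<eta> s))"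
      by (intro diff1_upto_add diff1_upto_mult diff1_upto_const Suc.IH Suc.prems test1_deriv)
    then show ?case
      using D[OF Suc.prems, of \<beta>] unfolding diff1_upto.simps
      by (intro exI[of _ "\<lambda>s. s powr \<beta> * deriv \<eta> s + \<beta> * (s powr (\<beta> - 1) * \<eta> s)"] conjI allI)
  qed
  then have "smooth1 (\<lambda>s. s powr \<beta> * \<eta> s)" using assms by (simp add: smooth1_def)
  moreover obtain a b where "0 < a" "a < b" "b < T" "\<And>s. s \<notin> {a..b} \<Longrightarrow> \<eta> s = 0"
    by (rule test1E[OF assms]) (rule that)
  ultimately show "test1 T (\<lambda>s. s powr \<beta> * \<eta> s)"
    unfolding test1_def by (metis mult_zero_right)
qed

section \<open>Weak derivatives on an interval\<close>

lemma loc1_mult: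
  assumes U: "loc1 T U" and g: "continuous_on {0<..} g" "g \<in> borel_measurable borel"
  shows "loc1 T (\<lambda>s. g s * U s)"
  unfolding loc1_def
proof (intro conjI allI impI)
  show "(\<lambda>s. g s * U s) \<in> borel_measurable borel" using g loc1_borel[OF U] by measurable
  fix a b :: real assume ab: "0 < a" "b < T"
  have "continuous_on {a..b} g" using ab by (intro continuous_on_subset[OF g(1)]) auto
  then obtain B where B: "\<And>s. s \<in> {a..b} \<Longrightarrow> \<bar>g s\<bar> \<le> B" using continuous_bounded_Icc by metis
  have "integrable lborel (\<lambda>s. U s * (indicator {a..b} s * g s))"
    by (rule integrable_mult_bounded1[OF loc1D[OF U ab], of _ B]) (use B g in auto)
  then show "set_integrable lborel {a..b} (\<lambda>s. g s * U s)" by (simp add: set_integrable_def mult_ac)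
qed

lemma loc1_powr: "loc1 T U \<Longrightarrow> loc1 T (\<lambda>s. s powr \<beta> * U s)"
  by (rule loc1_mult) (auto intro!: continuous_intros)

lemma loc1_cmult: "loc1 T U \<Longrightarrow> loc1 T (\<lambda>s. c * U s)"
  by (rule loc1_mult) auto

lemma loc1_add: "loc1 T U \<Longrightarrow> loc1 T V \<Longrightarrow> loc1 T (\<lambda>s. U s + V s)"
  by (auto simp: loc1_def intro: set_integral_add)

lemma loc1_const: "loc1 T (\<lambda>_. c)"
  by (auto simp: loc1_def intro!: borel_integrable_atLeastAtMost')

definition weak1 :: "real \<Rightarrow> (real \<Rightarrow> real) \<Rightarrow> (real \<Rightarrow> real) \<Rightarrow> bool" where
  "weak1 T U V \<longleftrightarrow> loc1 T U \<and> loc1 T V \<and>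
    (\<forall>\<eta>. test1 T \<eta> \<longrightarrow> integral\<^sup>L lborel (\<lambda>s. U s * deriv \<eta> s) = - integral\<^sup>L lborel (\<lambda>s. V s * \<eta> s))"

text \<open>Product rule, by testing the hypothesis with \<open>s powr \<beta> * \<eta> s\<close>;
  it allows powers of \<open>s\<close> to be moved on and off the profile derivatives.\<close>

lemma weak1_powr_mult:
  assumes "weak1 T U V"
  shows "weak1 T (\<lambda>s. s powr \<beta> * U s) (\<lambda>s. s powr \<beta> * V s + \<beta> * (s powr (\<beta> - 1) * U s))"
  unfolding weak1_def
proof (intro conjI allI impI)
  have U: "loc1 T U" and V: "loc1 T V" using assms by (auto simp: weak1_def)
  show "loc1 T (\<lambda>s. s powr \<beta> * U s)" "loc1 T (\<lambda>s. s powr \<beta> * V s + \<beta> * (s powr (\<beta> - 1) * U s))"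
    by (intro loc1_powr loc1_add loc1_cmult U V)+
  fix \<eta> assume \<eta>: "test1 T \<eta>"
  have d: "deriv (\<lambda>s. s powr \<beta> * \<eta> s) = (\<lambda>s. s powr \<beta> * deriv \<eta> s + \<beta> * (s powr (\<beta> - 1) * \<eta> s))"
    using test1_powr(1)[OF \<eta>] DERIV_imp_deriv by blast
  note i = loc1_test1_integrable
  have "integral\<^sup>L lborel (\<lambda>s. U s * (s powr \<beta> * deriv \<eta> s) + \<beta> * (U s * (s powr (\<beta> - 1) * \<eta> s))) = - integral\<^sup>L lborel (\<lambda>s. V s * (s powr \<beta> * \<eta> s))"
  proof -
    have "integral\<^sup>L lborel (\<lambda>s. U s * deriv (\<lambda>s. s powr \<beta> * \<eta> s) s) = - integral\<^sup>L lborel (\<lambda>s. V s * (s powr \<beta> * \<eta> s))"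
      using assms test1_powr(2)[OF \<eta>, of \<beta>] unfolding weak1_def by blast
    then show ?thesis unfolding d by (simp only: distrib_left mult.left_commute)
  qed
  then have "integral\<^sup>L lborel (\<lambda>s. U s * (s powr \<beta> * deriv \<eta> s)) + \<beta> * integral\<^sup>L lborel (\<lambda>s. U s * (s powr (\<beta> - 1) * \<eta> s)) = - integral\<^sup>L lborel (\<lambda>s. V s * (s powr \<beta> * \<eta> s))"
    using i[OF U test1_powr(2)[OF test1_deriv[OF \<eta>]]] i[OF U test1_powr(2)[OF \<eta>]] by simp
  moreover have "integral\<^sup>L lborel (\<lambda>s. (s powr \<beta> * V s + \<beta> * (s powr (\<beta> - 1) * U s)) * \<eta> s)
     = integral\<^sup>L lborel (\<lambda>s. V s * (s powr \<beta> * \<eta> s)) + \<beta> * integral\<^sup>L lborel (\<lambda>s. U s * (s powr (\<beta> - 1) * \<eta> s))"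
    using i[OF V test1_powr(2)[OF \<eta>, of \<beta>]] i[OF U test1_powr(2)[OF \<eta>]]
    by (subst integral_mult_right_zero[symmetric], subst Bochner_Integration.integral_add[symmetric])
      (auto simp: algebra_simps)
  moreover have "integral\<^sup>L lborel (\<lambda>s. s powr \<beta> * U s * deriv \<eta> s) = integral\<^sup>L lborel (\<lambda>s. U s * (s powr \<beta> * deriv \<eta> s))"
    by (simp add: mult_ac)
  ultimately show "integral\<^sup>L lborel (\<lambda>s. s powr \<beta> * U s * deriv \<eta> s)
    = - integral\<^sup>L lborel (\<lambda>s. (s powr \<beta> * V s + \<beta> * (s powr (\<beta> - 1) * U s)) * \<eta> s)" by linarith
qed

lemma continuous_antiderivative:
  fixes g :: "real \<Rightarrow> real"
  assumes "continuous_on UNIV g"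
  obtains F where "\<And>x. (F has_real_derivative g x) (at x)" "F a = 0"
    "\<And>x y. x \<le> y \<Longrightarrow> (\<integral>t. g t * indicator {x..y} t \<partial>lborel) = F y - F x"
proof -
  have "\<exists>F. \<forall>x::real. (-\<infinity>::ereal) < x \<longrightarrow> x < (\<infinity>::ereal) \<longrightarrow> (F has_vector_derivative g x) (at x)"
    using assms by (intro einterval_antiderivative) (auto simp: continuous_on_eq_continuous_at)
  then obtain F where F: "\<And>x. (F has_real_derivative g x) (at x)"
    by (auto simp: has_real_derivative_iff_has_vector_derivative)
  show ?thesis
  proof (rule that[of "\<lambda>x. F x - F a"])
    show "((\<lambda>x. F x - F a) has_real_derivative g x) (at x)" for x
      by (auto intro!: derivative_eq_intros F)
    show "(\<integral>t. g t * indicator {x..y} t \<partial>lborel) = F y - F a - (F x - F a)" if "x \<le> y" for x y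
      using integral_FTC_Icc_real[OF that, of F g] F assms by (auto simp: continuous_on_eq_continuous_at)
  qed simp
qed

text \<open>Subtracting from a test function the multiple of a fixed bump \<theta> with the same
  integral leaves a function of integral 0, whose primitive is again a test function. Thus
  \<open>h\<close> minus a suitable constant annihilates all test functions.\<close>

lemma du_Bois_Reymond:
  assumes h: "loc1 T h" and T: "T > 0"
    and z: "\<And>\<eta>. test1 T \<eta> \<Longrightarrow> integral\<^sup>L lborel (\<lambda>s. h s * deriv \<eta> s) = 0"
  shows "\<exists>c. AE s in lborel. 0 < s \<and> s < T \<longrightarrow> h s = c"
proof -
  define \<theta> where "\<theta> = bump (T / 3) (T / 2) 0"
  have \<theta>: "test1 T \<theta>" unfolding \<theta>_def using T by (intro test1_bump) auto
  have one: "loc1 T (\<lambda>_. 1)" by (rule loc1_const)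
  note i1 = loc1_test1_integrable[OF one, simplified]
  define m where "m = integral\<^sup>L lborel \<theta>"
  have m: "m \<noteq> 0"
  proof
    assume "m = 0"
    then have "AE s in lborel. \<theta> s = 0"
      unfolding m_def using i1[OF \<theta>] bump_bounds by (subst (asm) integral_nonneg_eq_0_iff_AE) (auto simp: \<theta>_def)
    then have "AE s in lborel. s \<notin> {T / 3<..<T / 2}"
      unfolding \<theta>_def by eventually_elim (use bump_pos[of _ "T / 3" "T / 2" 0] in force)
    then have "emeasure lborel {T / 3<..<T / 2} = 0"
      using AE_iff_null_sets[of "{T / 3<..<T / 2}" lborel] by auto
    then show False using T by simp
  qed
  define c where "c = integral\<^sup>L lborel (\<lambda>s. h s * \<theta> s) / m"
  have "AE s in lborel. 0 < s \<and> s < T \<longrightarrow> h s + (- c) = 0"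
  proof (rule fundamental_lemma1)
    show "loc1 T (\<lambda>s. h s + (- c))"
      using h loc1_cmult[OF one, of "- c"] by (intro loc1_add) auto
    fix \<eta> assume \<eta>: "test1 T \<eta>"
    define \<mu> where "\<mu> = integral\<^sup>L lborel \<eta> / m"
    define g where "g s = \<eta> s + (- \<mu>) * \<theta> s" for s
    obtain a1 b1 where 1: "smooth1 \<eta>" "0 < a1" "a1 < b1" "b1 < T" "\<And>s. s \<notin> {a1..b1} \<Longrightarrow> \<eta> s = 0"
      by (rule test1E[OF \<eta>]) (rule that)
    obtain a2 b2 where 2: "smooth1 \<theta>" "0 < a2" "a2 < b2" "b2 < T" "\<And>s. s \<notin> {a2..b2} \<Longrightarrow> \<theta> s = 0"
      by (rule test1E[OF \<theta>]) (rule that)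
    \<comment> \<open>Halving makes \<open>g\<close> vanish at \<open>a\<close> itself and not only
      to its left.\<close>
    define a b where "a = min a1 a2 / 2" and "b = max b1 b2"
    have ab: "0 < a" "a < b" "b < T" using 1(2-4) 2(2-4) by (auto simp: a_def b_def)
    have gs: "smooth1 g" unfolding g_def by (intro smooth1_add smooth1_mult smooth1_const 1 2)
    have g0: "g s = 0" if "s \<le> a \<or> b < s" for s
    proof -
      have "s \<notin> {a1..b1}" "s \<notin> {a2..b2}" using that ab 1(2-4) 2(2-4) by (auto simp: a_def b_def)
      then show ?thesis using 1(5) 2(5) by (simp add: g_def)
    qed
    have "integral\<^sup>L lborel g = integral\<^sup>L lborel \<eta> + (- \<mu>) * m"
      unfolding g_def m_def using i1[OF \<eta>] i1[OF \<theta>] by simp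
    then have gi: "integral\<^sup>L lborel g = 0" using m by (simp add: \<mu>_def)
    obtain F where F: "\<And>x. (F has_real_derivative g x) (at x)" "F a = 0"
      "\<And>x y. x \<le> y \<Longrightarrow> (\<integral>t. g t * indicator {x..y} t \<partial>lborel) = F y - F x"
      using continuous_antiderivative[OF smooth1_continuous[OF gs]] by metis
    have "F s = 0" if "s \<notin> {a..b}" for s
    proof (cases "s < a")
      case True
      have "(\<lambda>t. g t * indicator {s..a} t) = (\<lambda>_. 0)" using g0 by (auto simp: indicator_def fun_eq_iff)
      then show ?thesis using F(3)[of s a] F(2) True by simp
    next
      case False
      then have "s > b" using that by auto
      have "g t * indicator {a..s} t = g t" for t using g0[of t] \<open>s > b\<close> by (cases "t \<in> {a..s}") auto
      then have "(\<lambda>t. g t * indicator {a..s} t) = g" by blast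
      then show ?thesis using F(3)[of a s] F(2) False gi by simp
    qed
    then have F1: "test1 T F"
      using smooth1_antideriv[OF gs F(1)] ab unfolding test1_def by blast
    have "deriv F = g" using F(1) DERIV_imp_deriv by blast
    then have "0 = integral\<^sup>L lborel (\<lambda>s. h s * \<eta> s + (- \<mu>) * (h s * \<theta> s))"
      using z[OF F1] by (simp add: g_def algebra_simps)
    also have "\<dots> = integral\<^sup>L lborel (\<lambda>s. h s * \<eta> s) - \<mu> * (c * m)"
      using loc1_test1_integrable[OF h \<eta>] loc1_test1_integrable[OF h \<theta>] m by (simp add: c_def)
    also have "\<mu> * (c * m) = c * integral\<^sup>L lborel \<eta>" using m by (simp add: \<mu>_def)
    also have "integral\<^sup>L lborel (\<lambda>s. h s * \<eta> s) - c * integral\<^sup>L lborel \<eta> = integral\<^sup>L lborel (\<lambda>s. h s * \<eta> s - c * \<eta> s)"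
      using loc1_test1_integrable[OF h \<eta>] i1[OF \<eta>] by simp
    finally show "integral\<^sup>L lborel (\<lambda>s. (h s + (- c)) * \<eta> s) = 0" by (simp add: algebra_simps)
  qed
  then show ?thesis by (intro exI[of _ c]) auto
qed

text \<open>\<open>U\<close> minus a primitive of \<open>V\<close> has weak derivative 0, hence is
  constant by \<open>du_Bois_Reymond\<close>; the required representative of \<open>U\<close> is
  that primitive plus the constant.\<close>

lemma weak1_imp_ac_deriv:
  assumes "weak1 T U V" and T: "T > 0"
  shows "ac_deriv T U V"
proof -
  have U: "loc1 T U" and V: "loc1 T V"
    and w: "\<And>\<eta>. test1 T \<eta> \<Longrightarrow> integral\<^sup>L lborel (\<lambda>s. U s * deriv \<eta> s) = - integral\<^sup>L lborel (\<lambda>s. V s * \<eta> s)"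
    using assms by (auto simp: weak1_def)
  have [measurable]: "U \<in> borel_measurable borel" "V \<in> borel_measurable borel" using U V loc1_borel by auto
  define s0 where "s0 = T / 2"
  have s0: "0 < s0" "s0 < T" using T by (auto simp: s0_def)
  \<comment> \<open>The oriented integral from the midpoint: one of the two intervals is always
    empty or a single point. The base point is interior because \<open>V\<close> may fail to be
    integrable up to either end.\<close>
  define K where "K s = (LINT t:{s0..s}|lborel. V t) - (LINT t:{s..s0}|lborel. V t)" for s
  have HK: "(LINT t:{a..b}|lborel. V t) = integral {a..b} V" if "0 < a" "b < T" for a b
    using set_borel_integral_eq_integral(2)[OF loc1D[OF V that]] .
  have io: "V integrable_on {a..b}" if "0 < a" "b < T" for a b
    using set_borel_integral_eq_integral(1)[OF loc1D[OF V that]] .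
  have z: "integral {a..b} V = 0" if "b \<le> a" for a b
    using that by (cases "a = b") auto
  have comb: "integral {a..c} V = integral {a..b} V + integral {b..c} V" if "0 < a" "a \<le> b" "b \<le> c" "c < T" for a b c
    using Henstock_Kurzweil_Integration.integral_combine[OF that(2,3) io[OF that(1,4)]] by simp
  have K: "K b - K a = (LINT s:{a..b}|lborel. V s)" if "0 < a" "a \<le> b" "b < T" for a b
  proof -
    consider "b \<le> s0" | "a \<le> s0" "s0 \<le> b" | "s0 \<le> a" by linarith
    then show ?thesis
    proof cases
      case 1 then show ?thesis
        using that s0 comb[of a b s0] z[of b s0] z[of a s0] by (simp add: K_def HK)
    next
      case 2 then show ?thesis
        using that s0 comb[of a s0 b] z[of a s0] z[of s0 b] by (simp add: K_def HK)
    next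
      case 3 then show ?thesis
        using that s0 comb[of s0 a b] z[of s0 b] z[of s0 a] by (simp add: K_def HK)
    qed
  qed
  have [measurable]: "K \<in> borel_measurable borel"
  proof -
    have "(\<lambda>(s, t). (if s0 \<le> t \<and> t \<le> s then 1 else 0) * V t) \<in> borel_measurable (borel \<Otimes>\<^sub>M lborel)"
      "(\<lambda>(s, t). (if s \<le> t \<and> t \<le> s0 then 1 else 0) * V t) \<in> borel_measurable (borel \<Otimes>\<^sub>M lborel)"
      by measurable
    then show ?thesis
      unfolding K_def[abs_def] set_lebesgue_integral_def
      using lborel.borel_measurable_lebesgue_integral by (auto simp: indicator_def of_bool_def)
  qed
  define L where "L a b s = (LINT t:{a..b}|lborel. V t * of_bool (t \<le> s))" for a b s
  have KL: "K s = K a + L a b s" if "0 < a" "b < T" "s \<in> {a..b}" for a b s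
  proof -
    have "L a b s = (LINT t:{a..s}|lborel. V t)"
      unfolding L_def set_lebesgue_integral_def using that by (intro Bochner_Integration.integral_cong) (auto simp: indicator_def)
    then show ?thesis using K[of a s] that by auto
  qed
  have Lb: "\<bar>L a b s\<bar> \<le> (LINT t:{a..b}|lborel. \<bar>V t\<bar>)" if "0 < a" "b < T" for a b s
  proof -
    have "\<bar>L a b s\<bar> \<le> integral\<^sup>L lborel (\<lambda>t. \<bar>indicator {a..b} t *\<^sub>R (V t * of_bool (t \<le> s))\<bar>)"
      unfolding L_def set_lebesgue_integral_def by (rule integral_abs_bound)
    also have "\<dots> \<le> integral\<^sup>L lborel (\<lambda>t. indicator {a..b} t *\<^sub>R \<bar>V t\<bar>)"
      using set_integrable_abs[OF loc1D[OF V that]] unfolding set_integrable_def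
      by (intro integral_mono_AE') (auto simp: indicator_def)
    finally show ?thesis by (simp add: set_lebesgue_integral_def)
  qed
  have Kloc: "loc1 T K"
    unfolding loc1_def
  proof (intro conjI allI impI)
    fix a b :: real assume ab: "0 < a" "b < T"
    define B where "B = \<bar>K a\<bar> + (LINT t:{a..b}|lborel. \<bar>V t\<bar>)"
    have "integrable lborel (\<lambda>s. 1 * (indicator {a..b} s * K s))"
    proof (rule integrable_mult_bounded1[of "{a..b}" _ _ B])
      show "\<bar>indicator {a..b} s * K s\<bar> \<le> B" if "s \<in> {a..b}" for s
        using KL[OF ab that] Lb[OF ab, of s] that by (simp add: B_def)
    qed (auto intro!: borel_integrable_atLeastAtMost')
    then show "set_integrable lborel {a..b} K" by (simp add: set_integrable_def)
  qed auto
  have Kw: "integrable lborel (\<lambda>s. K s * deriv \<eta> s) \<and> integral\<^sup>L lborel (\<lambda>s. K s * deriv \<eta> s) = - integral\<^sup>L lborel (\<lambda>s. V s * \<eta> s)" if \<eta>: "test1 T \<eta>" for \<eta>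
  proof
    show "integrable lborel (\<lambda>s. K s * deriv \<eta> s)"
      by (rule loc1_test1_integrable[OF Kloc test1_deriv[OF \<eta>]])
    obtain a b where ab: "smooth1 \<eta>" "0 < a" "a < b" "b < T" "\<And>s. s \<notin> {a..b} \<Longrightarrow> \<eta> s = 0"
      by (rule test1E[OF \<eta>]) (rule that)
    have d0: "deriv \<eta> s = 0" if "s \<notin> {a..b}" for s
    proof (rule DERIV_imp_deriv, rule has_field_derivative_transform_within_open[of "\<lambda>_. 0" _ _ "- {a..b}"])
      show "open (- {a..b})" by (intro open_Compl closed_atLeastAtMost)
    qed (use that ab(5) in auto)
    have one: "loc1 T (\<lambda>_. 1)" by (rule loc1_const)
    have di: "integrable lborel (deriv \<eta>)"
      using loc1_test1_integrable[OF one test1_deriv[OF \<eta>]] by simp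
    have tail: "(\<integral>s. deriv \<eta> s * of_bool (t \<le> s) \<partial>lborel) = - \<eta> t" if "t \<le> b" for t
    proof -
      have "(\<integral>s. deriv \<eta> s * of_bool (t \<le> s) \<partial>lborel) = (\<integral>s. deriv \<eta> s * indicator {t..b + 1} s \<partial>lborel)"
        using d0 by (intro Bochner_Integration.integral_cong) (auto simp: indicator_def)
      also have "\<dots> = \<eta> (b + 1) - \<eta> t"
        using that smooth1_deriv[OF ab(1)] smooth1_continuous[OF smooth1_deriv_smooth[OF ab(1)], of UNIV]
        by (intro integral_FTC_Icc_real) (auto simp: continuous_on_eq_continuous_at)
      also have "\<eta> (b + 1) = 0" by (rule ab(5)) simp
      finally show ?thesis by simp
    qed
    have d1: "integral\<^sup>L lborel (deriv \<eta>) = 0"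
    proof -
      have "integral\<^sup>L lborel (deriv \<eta>) = (\<integral>s. deriv \<eta> s * of_bool (a - 1 \<le> s) \<partial>lborel)"
        using d0 by (intro Bochner_Integration.integral_cong) auto
      also have "\<dots> = - \<eta> (a - 1)" using ab by (intro tail) auto
      also have "\<eta> (a - 1) = 0" by (rule ab(5)) simp
      finally show ?thesis by simp
    qed
    have KL': "K s * deriv \<eta> s = K a * deriv \<eta> s + deriv \<eta> s * L a b s" for s
      using KL[OF ab(2,4), of s] d0[of s] by (cases "s \<in> {a..b}") (auto simp: algebra_simps)
    have "integrable lborel (\<lambda>s. deriv \<eta> s * L a b s)"
    proof -
      have "integrable lborel (\<lambda>s. K s * deriv \<eta> s - K a * deriv \<eta> s)"
        using \<open>integrable lborel (\<lambda>s. K s * deriv \<eta> s)\<close> di by simp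
      then show ?thesis by (simp add: KL')
    qed
    then have "integral\<^sup>L lborel (\<lambda>s. K s * deriv \<eta> s) = integral\<^sup>L lborel (\<lambda>s. deriv \<eta> s * L a b s)"
      unfolding KL' using di d1 by simp
    \<comment> \<open>The same exchange as for spheres, in one variable: the tail of
      \<open>deriv \<eta>\<close> beyond \<open>t\<close> is \<open>- \<eta> t\<close>.\<close>
    also have "\<dots> = (LINT t:{a..b}|lborel. V t * (\<integral>s. deriv \<eta> s * of_bool (t \<le> s) \<partial>lborel))"
      unfolding L_def by (rule integral_tail[OF di, of "\<lambda>s. s" V]) (use loc1D[OF V ab(2,4)] in auto)
    also have "\<dots> = integral\<^sup>L lborel (\<lambda>s. - (V s * \<eta> s))"
      unfolding set_lebesgue_integral_def using tail ab(5)
      by (intro Bochner_Integration.integral_cong) (auto simp: indicator_def)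
    finally show "integral\<^sup>L lborel (\<lambda>s. K s * deriv \<eta> s) = - integral\<^sup>L lborel (\<lambda>s. V s * \<eta> s)" by simp
  qed
  have "\<exists>c. AE s in lborel. 0 < s \<and> s < T \<longrightarrow> U s + (- 1) * K s = c"
  proof (rule du_Bois_Reymond[OF _ T])
    show "loc1 T (\<lambda>s. U s + (- 1) * K s)" by (intro loc1_add loc1_cmult U Kloc)
    fix \<eta> assume \<eta>: "test1 T \<eta>"
    show "integral\<^sup>L lborel (\<lambda>s. (U s + (- 1) * K s) * deriv \<eta> s) = 0"
      using Kw[OF \<eta>] w[OF \<eta>] loc1_test1_integrable[OF U test1_deriv[OF \<eta>]]
      by (simp add: left_diff_distrib)
  qed
  then obtain c where c: "AE s in lborel. 0 < s \<and> s < T \<longrightarrow> U s + (- 1) * K s = c" by blast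
  have "AE s in lborel. 0 < s \<and> s < T \<longrightarrow> U s = K s + c" using c by eventually_elim auto
  moreover have "K b + c - (K a + c) = (LINT s:{a..b}|lborel. V s)" if "0 < a" "a \<le> b" "b < T" for a b
    using K[OF that] by simp
  ultimately show ?thesis unfolding ac_deriv_def using U V by (intro conjI exI[of _ "\<lambda>s. K s + c"]) auto
qed

lemma locally_integrable_radial:
  fixes p :: "real ^ 'n::finite \<Rightarrow> real"
  assumes U: "loc1 (R\<^sup>2) U" and R: "R > 0" and p: "continuous_on UNIV p"
  shows "locally_integrable (ball 0 R - {0}) (\<lambda>x. p x * U (x \<bullet> x))"
  unfolding locally_integrable_def
proof (intro allI impI)
  fix K :: "(real ^ 'n) set" assume K: "compact K \<and> K \<subseteq> ball 0 R - {0}"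
  have [measurable]: "U \<in> borel_measurable borel" using loc1_borel[OF U] .
  obtain a b where ab: "0 < a" "a < b" "b < R\<^sup>2" "\<And>x. x \<in> K \<Longrightarrow> x \<bullet> x \<in> {a..b}"
    using compact_in_annulus[of K R] K R by metis
  have "continuous_on {a..b} (\<lambda>s. radial_const TYPE('n) * s powr (real CARD('n) / 2 - 1))"
    using ab by (intro continuous_intros) auto
  then obtain B where B: "\<And>s. s \<in> {a..b} \<Longrightarrow> \<bar>radial_const TYPE('n) * s powr (real CARD('n) / 2 - 1)\<bar> \<le> B"
    using continuous_bounded_Icc by metis
  have "integrable lborel (\<lambda>s. U s * (indicator {a..b} s * radial_density TYPE('n) s))"
    by (rule integrable_mult_bounded1[OF loc1D[OF U ab(1,3)], of _ B]) (use B ab in \<open>auto simp: radial_density_def indicator_def\<close>)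
  then have "integrable lborel (\<lambda>s. radial_density TYPE('n) s * (indicator {a..b} s * U s))" by (simp add: mult_ac)
  then have "integrable lborel (\<lambda>x :: real ^ 'n. indicator {a..b} (x \<bullet> x) * U (x \<bullet> x))"
    by (subst integrable_radial[of "\<lambda>s. indicator {a..b} s * U s"]) auto
  then have i: "integrable lebesgue (\<lambda>x :: real ^ 'n. indicator {a..b} (x \<bullet> x) * U (x \<bullet> x))"
    by (subst integrable_completion) auto
  have "bounded (p ` K)"
    using K p by (intro compact_imp_bounded compact_continuous_image) (auto intro: continuous_on_subset)
  then obtain C where C: "\<And>x. x \<in> K \<Longrightarrow> \<bar>p x\<bar> \<le> C" by (force simp: bounded_iff)
  have pm: "p \<in> borel_measurable lborel" using p by (simp add: borel_measurable_continuous_onI)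
  have Ks: "K \<in> sets borel" using K by (auto intro: borel_closed compact_imp_closed)
  show "(\<lambda>x. p x * U (x \<bullet> x)) absolutely_integrable_on K"
    unfolding set_integrable_def
  proof (rule Bochner_Integration.integrable_bound)
    show "integrable lebesgue (\<lambda>x :: real ^ 'n. C * (indicator {a..b} (x \<bullet> x) * U (x \<bullet> x)))" using i by (intro integrable_mult_right)
    have "(\<lambda>x. indicat_real K x *\<^sub>R (p x * U (x \<bullet> x))) \<in> borel_measurable lborel" using pm Ks by simp
    then show "(\<lambda>x. indicat_real K x *\<^sub>R (p x * U (x \<bullet> x))) \<in> borel_measurable lebesgue" by (rule measurable_completion)
    show "AE x in lebesgue. norm (indicat_real K x *\<^sub>R (p x * U (x \<bullet> x))) \<le> norm (C * (indicator {a..b} (x \<bullet> x) * U (x \<bullet> x)))"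
    proof (rule AE_I2)
      fix x show "norm (indicat_real K x *\<^sub>R (p x * U (x \<bullet> x))) \<le> norm (C * (indicator {a..b} (x \<bullet> x) * U (x \<bullet> x)))"
        using ab(4)[of x] order_trans[OF C[of x] abs_ge_self] by (cases "x \<in> K") (auto simp: abs_mult mult_right_mono)
    qed
  qed
qed

text \<open>
  Testing against the fields \<open>x\<^sub>i |x|\<^bsup>-n\<^esup> \<eta>(|x|\<^sup>2)\<close>, whose divergence is \<open>2 |x|\<^bsup>2-n\<^esup> \<eta>'(|x|\<^sup>2)\<close>,
  turns the weak gradient into a weak derivative in \<open>s = |x|\<^sup>2\<close>.
\<close>

lemma weak_gradient_radial:
  fixes g :: "'n::finite \<Rightarrow> real ^ 'n \<Rightarrow> real"
  assumes R: "R > 0" and H: "loc1 (R\<^sup>2) H"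
    and g: "\<And>i. locally_integrable (ball 0 R - {0}) (g i)"
    and w: "\<And>i \<phi>. \<phi> \<in> test_functions (ball 0 R - {0}) \<Longrightarrow>
      integral\<^sup>L lebesgue (\<lambda>x. H (x \<bullet> x) * partial_deriv i \<phi> x) = - integral\<^sup>L lebesgue (\<lambda>x. g i x * \<phi> x)"
  obtains \<kappa> where "weak1 (R\<^sup>2) H \<kappa>"
proof -
  define n where "n = real CARD('n)"
  define c where "c = radial_const TYPE('n)"
  have c: "c > 0" by (simp add: c_def radial_const_pos)
  have [measurable]: "H \<in> borel_measurable borel" by (rule loc1_borel[OF H])
  define k where "k x = (\<Sum>i\<in>UNIV. x $ i * g i x)" for x
  have "set_integrable lebesgue {x. x \<bullet> x \<in> {a..b}} k" if "0 < a" "b < R\<^sup>2" for a b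
  proof -
    let ?A = "{x :: real ^ 'n. x \<bullet> x \<in> {a..b}}"
    have sub: "?A \<subseteq> ball 0 R - {0}"
    proof
      fix x assume "x \<in> ?A"
      then have "0 < x \<bullet> x \<and> x \<bullet> x < R\<^sup>2" using that unfolding mem_Collect_eq atLeastAtMost_iff by linarith
      then show "x \<in> ball 0 R - {0}" using punctured_ball_iff[OF R] by blast
    qed
    have gi: "set_integrable lebesgue ?A (g i)" for i
      using g[of i] sub annulus_compact unfolding locally_integrable_def by blast
    have "integrable lebesgue (\<lambda>x. (indicator ?A x *\<^sub>R g i x) * (indicator ?A x * x $ i))" for i
    proof (rule integrable_mult_bounded[of ?A _ _ "\<bar>sqrt b\<bar>"])
      show "set_integrable lebesgue ?A (\<lambda>x. indicator ?A x *\<^sub>R g i x)"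
      proof -
        have "(\<lambda>x. indicat_real ?A x *\<^sub>R (indicat_real ?A x *\<^sub>R g i x)) = (\<lambda>x. indicator ?A x *\<^sub>R g i x)"
          by (auto simp: indicator_def)
        then show ?thesis using gi[of i] unfolding set_integrable_def by presburger
      qed
      have "?A \<in> sets borel" using annulus_compact[of a b] by (intro borel_closed compact_imp_closed)
      moreover have "(\<lambda>x :: real ^ 'n. x $ i) \<in> borel_measurable borel" by (rule smooth_borel[OF smooth_nth])
      ultimately show "(\<lambda>x. indicator ?A x * x $ i) \<in> borel_measurable borel" by simp
      show "\<bar>indicator ?A x * x $ i\<bar> \<le> \<bar>sqrt b\<bar>" for x
      proof (cases "x \<in> ?A")
        case True
        then have "norm x \<le> sqrt b" by (simp add: norm_eq_sqrt_inner)
        then show ?thesis using True component_le_norm_cart[of x i] by simp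
      qed simp
    qed auto
    then have "integrable lebesgue (\<lambda>x. \<Sum>i\<in>UNIV. (indicator ?A x *\<^sub>R g i x) * (indicator ?A x * x $ i))"
      by (intro Bochner_Integration.integrable_sum)
    moreover have "(\<Sum>i\<in>UNIV. (indicator ?A x *\<^sub>R g i x) * (indicator ?A x * x $ i)) = indicator ?A x *\<^sub>R k x" for x
      by (cases "x \<in> ?A") (simp_all add: k_def mult.commute)
    ultimately show ?thesis by (simp add: set_integrable_def)
  qed
  then obtain \<kappa> where \<kappa>: "loc1 (R\<^sup>2) \<kappa>"
    "\<And>\<theta> a b. 0 < a \<Longrightarrow> b < R\<^sup>2 \<Longrightarrow> \<theta> \<in> borel_measurable borel \<Longrightarrow> (\<And>s. s \<notin> {a..b} \<Longrightarrow> \<theta> s = 0) \<Longrightarrow>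
      integrable lebesgue (\<lambda>x. \<theta> (x \<bullet> x) * k x) \<Longrightarrow>
      integrable lborel (\<lambda>s. \<theta> s * \<kappa> s) \<and>
      integral\<^sup>L lebesgue (\<lambda>x. \<theta> (x \<bullet> x) * k x) = integral\<^sup>L lborel (\<lambda>s. \<theta> s * \<kappa> s)"
    using radial_average[of "R\<^sup>2" k] by blast
  \<comment> \<open>Origin of the formula: \<kappa> averages \<open>x \<bullet> g(x)\<close>, which
    for a smooth profile is \<open>2 |x|^2 H'\<close>. The density contributes
    \<open>c s^(n/2 - 1)\<close>, so \<kappa> would be \<open>2 c s^(n/2) H'\<close>; solving for
    \<open>H'\<close> gives the right-hand side.\<close>
  have "weak1 (R\<^sup>2) H (\<lambda>s. 1 / (2 * c) * (s powr (- n / 2) * \<kappa> s))"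
    unfolding weak1_def
  proof (intro conjI allI impI H loc1_cmult loc1_powr \<kappa>(1))
    fix \<eta> assume \<eta>: "test1 (R\<^sup>2) \<eta>"
    define \<theta> where "\<theta> s = s powr (- n / 2) * \<eta> s" for s
    have \<theta>: "test1 (R\<^sup>2) \<theta>" unfolding \<theta>_def by (rule test1_powr(2)[OF \<eta>])
    obtain a b where ab: "smooth1 \<theta>" "0 < a" "a < b" "b < R\<^sup>2" "\<And>s. s \<notin> {a..b} \<Longrightarrow> \<theta> s = 0"
      by (rule test1E[OF \<theta>]) (rule that)
    have [measurable]: "\<theta> \<in> borel_measurable borel"
      using smooth1_continuous[OF ab(1)] by (rule borel_measurable_continuous_onI)
    have d\<theta>: "deriv \<theta> s = s powr (- n / 2) * deriv \<eta> s + (- n / 2) * (s powr (- n / 2 - 1) * \<eta> s)" for s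
      unfolding \<theta>_def by (rule DERIV_imp_deriv[OF test1_powr(1)[OF \<eta>]])
    define \<phi> where "\<phi> i x = x $ i * \<theta> (x \<bullet> x)" for i and x :: "real ^ 'n"
    have \<phi>: "\<phi> i \<in> test_functions (ball 0 R - {0})" for i
      unfolding \<phi>_def by (rule radial_test_function[OF \<theta> smooth_nth R])
    have d\<phi>: "partial_deriv i (\<phi> i) x = x $ i * (deriv \<theta> (x \<bullet> x) * (2 * x $ i)) + \<theta> (x \<bullet> x)" for i x
      unfolding \<phi>_def using partial_deriv_compose[OF smooth_differentiable[OF smooth_inner_self] smooth1_deriv[OF ab(1)], of i]
      by (subst partial_deriv_mult)
        (auto intro!: smooth_differentiable smooth_nth smooth_compose[OF ab(1)] smooth_inner_self
          simp: partial_deriv_nth partial_deriv_inner_self)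
    have Hloc: "locally_integrable (ball 0 R - {0 :: real ^ 'n}) (\<lambda>x. H (x \<bullet> x))"
      using locally_integrable_radial[OF H R, of "\<lambda>_ :: real ^ 'n. 1"] by simp
    have iL: "integrable lebesgue (\<lambda>x. H (x \<bullet> x) * partial_deriv i (\<phi> i) x)" for i
      by (rule integrable_test_mult[OF Hloc test_partial_deriv[OF \<phi>]])
    have iR: "integrable lebesgue (\<lambda>x. g i x * \<phi> i x)" for i
      by (rule integrable_test_mult[OF g \<phi>])
    have kx: "(\<Sum>i\<in>UNIV. g i x * \<phi> i x) = \<theta> (x \<bullet> x) * k x" for x
      by (simp add: k_def \<phi>_def sum_distrib_left mult_ac)
    have div: "(\<Sum>i\<in>UNIV. partial_deriv i (\<phi> i) x) = n * \<theta> (x \<bullet> x) + 2 * (x \<bullet> x) * deriv \<theta> (x \<bullet> x)" for x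
      unfolding d\<phi> by (simp add: sum.distrib n_def inner_vec_def sum_distrib_left sum_distrib_right mult_ac)
    have d0: "deriv \<eta> s = 0" "\<eta> s = 0" if "s \<le> 0" for s
    proof -
      obtain a b where "0 < a" "\<And>s. s \<notin> {a..b} \<Longrightarrow> deriv \<eta> s = 0"
        by (rule test1E[OF test1_deriv[OF \<eta>]]) (rule that)
      then show "deriv \<eta> s = 0" using that by force
      obtain a b where "0 < a" "\<And>s. s \<notin> {a..b} \<Longrightarrow> \<eta> s = 0"
        by (rule test1E[OF \<eta>]) (rule that)
      then show "\<eta> s = 0" using that by force
    qed
    \<comment> \<open>The factor \<open>s powr (- n / 2)\<close> in \<theta> makes the terms with
      \<eta> itself cancel in the divergence, and the remaining power of \<open>s\<close> cancel
      against the density.\<close>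
    have dens: "radial_density TYPE('n) s * (H s * (n * \<theta> s + 2 * s * deriv \<theta> s)) = 2 * c * (H s * deriv \<eta> s)" for s
    proof (cases "s > 0")
      case True
      have "s * s powr (- n / 2 - 1) = s powr (- n / 2)" and pw: "s * s powr (- n / 2) * s powr (n / 2 - 1) = 1"
        using True by (simp_all add: powr_mult_base flip: powr_add)
      then have "n * \<theta> s + 2 * s * deriv \<theta> s = 2 * (s * s powr (- n / 2)) * deriv \<eta> s"
        unfolding d\<theta> \<theta>_def by (simp add: algebra_simps)
      then have "radial_density TYPE('n) s * (H s * (n * \<theta> s + 2 * s * deriv \<theta> s))
        = 2 * c * (s * s powr (- n / 2) * s powr (n / 2 - 1)) * (H s * deriv \<eta> s)"
        using True by (simp add: radial_density_def c_def n_def mult_ac)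
      then show ?thesis unfolding pw by simp
    qed (simp add: radial_density_def d0)
    have m': "deriv \<theta> \<in> borel_measurable borel"
      using smooth1_continuous[OF smooth1_deriv_smooth[OF ab(1)]] by (rule borel_measurable_continuous_onI)
    have "(\<Sum>i\<in>UNIV. integral\<^sup>L lebesgue (\<lambda>x. H (x \<bullet> x) * partial_deriv i (\<phi> i) x))
      = integral\<^sup>L lebesgue (\<lambda>x :: real ^ 'n. H (x \<bullet> x) * (n * \<theta> (x \<bullet> x) + 2 * (x \<bullet> x) * deriv \<theta> (x \<bullet> x)))"
      using iL by (subst Bochner_Integration.integral_sum[symmetric]) (auto simp: sum_distrib_left[symmetric] div)
    also have "\<dots> = integral\<^sup>L lborel (\<lambda>s. radial_density TYPE('n) s * (H s * (n * \<theta> s + 2 * s * deriv \<theta> s)))"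
      using m' by (subst integral_completion, simp, subst integral_radial[symmetric]) auto
    also have "\<dots> = 2 * c * integral\<^sup>L lborel (\<lambda>s. H s * deriv \<eta> s)"
      unfolding dens by simp
    finally have L: "(\<Sum>i\<in>UNIV. integral\<^sup>L lebesgue (\<lambda>x. H (x \<bullet> x) * partial_deriv i (\<phi> i) x)) = 2 * c * integral\<^sup>L lborel (\<lambda>s. H s * deriv \<eta> s)" .
    have "(\<Sum>i\<in>UNIV. integral\<^sup>L lebesgue (\<lambda>x. g i x * \<phi> i x)) = integral\<^sup>L lebesgue (\<lambda>x. \<theta> (x \<bullet> x) * k x)"
      using iR by (subst Bochner_Integration.integral_sum[symmetric]) (auto simp: kx)
    also have "\<dots> = integral\<^sup>L lborel (\<lambda>s. \<theta> s * \<kappa> s)"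
    proof -
      have "integrable lebesgue (\<lambda>x. \<Sum>i\<in>UNIV. g i x * \<phi> i x)" using iR by (intro Bochner_Integration.integrable_sum)
      then have "integrable lebesgue (\<lambda>x. \<theta> (x \<bullet> x) * k x)" by (simp add: kx)
      from \<kappa>(2)[OF ab(2,4) _ ab(5) this] show ?thesis by simp
    qed
    finally have "2 * c * integral\<^sup>L lborel (\<lambda>s. H s * deriv \<eta> s) = - integral\<^sup>L lborel (\<lambda>s. \<theta> s * \<kappa> s)"
      unfolding L[symmetric] using w[OF \<phi>] by (simp add: sum_negf)
    then have "integral\<^sup>L lborel (\<lambda>s. H s * deriv \<eta> s) = - (1 / (2 * c) * integral\<^sup>L lborel (\<lambda>s. \<theta> s * \<kappa> s))"
      using c by (simp add: field_simps)
    also have "1 / (2 * c) * integral\<^sup>L lborel (\<lambda>s. \<theta> s * \<kappa> s) = integral\<^sup>L lborel (\<lambda>s. 1 / (2 * c) * (\<theta> s * \<kappa> s))"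
      by (rule integral_mult_right_zero[symmetric])
    also have "(\<lambda>s. 1 / (2 * c) * (\<theta> s * \<kappa> s)) = (\<lambda>s. 1 / (2 * c) * (s powr (- n / 2) * \<kappa> s) * \<eta> s)"
      by (simp add: \<theta>_def fun_eq_iff)
    finally show "integral\<^sup>L lborel (\<lambda>s. H s * deriv \<eta> s) = - integral\<^sup>L lborel (\<lambda>s. 1 / (2 * c) * (s powr (- n / 2) * \<kappa> s) * \<eta> s)" .
  qed
  then show ?thesis by (rule that)
qed

subsection \<open>Removing the origin\<close>

lemma smooth_step_exists:
  obtains E C where "smooth1 E" "\<And>s. s \<le> 1 \<Longrightarrow> E s = 0" "\<And>s. s \<ge> 2 \<Longrightarrow> E s = 1" "\<And>s. \<bar>E s\<bar> \<le> C"
    "\<And>s. \<bar>deriv E s\<bar> \<le> C" "\<And>s. s \<notin> {1..2} \<Longrightarrow> deriv E s = 0" "C > 0"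
proof -
  define \<theta> where "\<theta> = bump 1 2 0"
  have \<theta>: "smooth1 \<theta>" unfolding \<theta>_def by (rule smooth1_bump)
  obtain F where F: "\<And>x. (F has_real_derivative \<theta> x) (at x)" "F 1 = 0"
    "\<And>x y. x \<le> y \<Longrightarrow> (\<integral>t. \<theta> t * indicator {x..y} t \<partial>lborel) = F y - F x"
    using continuous_antiderivative[OF smooth1_continuous[OF \<theta>]] by metis
  \<comment> \<open>The bump is positive inside the interval, so its total integral
    \<open>F 2\<close> is positive and the primitive can be normalised.\<close>
  obtain z where z: "1 < z" "z < 2" "F 2 - F 1 = (2 - 1) * \<theta> z"
    using MVT2[of 1 2 F \<theta>] F(1) by auto
  have m: "F 2 > 0" using z F(2) bump_pos[of z 1 2 0] by (auto simp: \<theta>_def)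
  have F1: "F s = 0" if "s \<le> 1" for s
  proof -
    have "(\<lambda>t. \<theta> t * indicator {s..1} t) = (\<lambda>_. 0)"
      using bump_eq_0[of _ 1 2 0] by (auto simp: \<theta>_def fun_eq_iff indicator_def)
    then show ?thesis using F(3)[OF that] F(2) by simp
  qed
  have F2: "F s = F 2" if "s \<ge> 2" for s
  proof -
    have "(\<lambda>t. \<theta> t * indicator {2..s} t) = (\<lambda>_. 0)"
      using bump_eq_0[of _ 1 2 0] by (auto simp: \<theta>_def fun_eq_iff indicator_def)
    then show ?thesis using F(3)[OF that] by simp
  qed
  have "continuous_on {1..2} F" using F(1) by (meson DERIV_continuous_on has_field_derivative_at_within)
  then obtain B where B: "\<And>s. s \<in> {1..2} \<Longrightarrow> \<bar>F s\<bar> \<le> B" using continuous_bounded_Icc by metis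
  have FB: "\<bar>F s\<bar> \<le> max B (F 2)" for s
  proof -
    consider "s \<le> 1" | "s \<in> {1..2}" | "s \<ge> 2" by fastforce
    then show ?thesis using F1[of s] F2[of s] B[of s] m by cases auto
  qed
  define E where "E s = inverse (F 2) * F s" for s
  have dE: "(E has_real_derivative inverse (F 2) * \<theta> s) (at s)" for s
    unfolding E_def by (auto intro!: derivative_eq_intros F)
  have dE': "deriv E s = inverse (F 2) * \<theta> s" for s by (rule DERIV_imp_deriv[OF dE])
  \<comment> \<open>One constant for \<open>E\<close> and \<open>deriv E\<close>:
    \<open>max B (F 2)\<close> bounds \<open>F\<close>, and the summand 1 covers the bump.\<close>
  define C where "C = inverse (F 2) * (max B (F 2) + 1)"
  have mB: "max B (F 2) \<ge> 0" "inverse (F 2) > 0" using m by auto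
  show ?thesis
  proof (rule that[of E C])
    show "smooth1 E" unfolding E_def
      by (intro smooth1_mult smooth1_const smooth1_antideriv[OF \<theta> F(1)])
    show "E s = 0" if "s \<le> 1" for s using F1[OF that] by (simp add: E_def)
    show "E s = 1" if "s \<ge> 2" for s using F2[OF that] m by (simp add: E_def)
    show "\<bar>E s\<bar> \<le> C" for s
      using FB[of s] mB unfolding E_def C_def by (auto simp: abs_mult intro!: mult_left_mono)
    show "\<bar>deriv E s\<bar> \<le> C" for s
      using bump_bounds[of 1 2 0 s] mB unfolding dE' C_def \<theta>_def by (auto simp: abs_mult intro!: mult_left_mono)
    show "deriv E s = 0" if "s \<notin> {1..2}" for s
      using that bump_eq_0[of s 1 2 0] unfolding dE' \<theta>_def by auto
    show "C > 0" using mB by (auto simp: C_def)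
  qed
qed

text \<open>
  A cutoff at scale \<open>1/m\<close> has gradient of size \<open>m\<close> on a ball of measure \<open>m\<^bsup>-n\<^esup>\<close>; for \<open>n \<ge> 2\<close> its
  \<open>L\<^sup>2\<close> norm stays bounded, which suffices since the \<open>L\<^sup>2\<close> norm of \<open>f\<close> on these balls tends to 0.
\<close>

lemma removable_origin:
  fixes f g :: "real ^ 'n::finite \<Rightarrow> real"
  assumes n: "CARD('n) \<ge> 2"
    and f: "locally_integrable (ball 0 R) f" and g: "locally_integrable (ball 0 R) g"
    and f2: "integrable lebesgue (\<lambda>x. indicator (ball 0 R) x * (f x)\<^sup>2)"
    and w: "\<And>\<phi>. \<phi> \<in> test_functions (ball 0 R - {0}) \<Longrightarrow>
      integral\<^sup>L lebesgue (\<lambda>x. f x * partial_deriv i \<phi> x) = - integral\<^sup>L lebesgue (\<lambda>x. g x * \<phi> x)"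
    and \<phi>: "\<phi> \<in> test_functions (ball 0 R)"
  shows "integral\<^sup>L lebesgue (\<lambda>x. f x * partial_deriv i \<phi> x) = - integral\<^sup>L lebesgue (\<lambda>x. g x * \<phi> x)"
proof -
  obtain E C where E: "smooth1 E" "\<And>s. s \<le> 1 \<Longrightarrow> E s = 0" "\<And>s. s \<ge> 2 \<Longrightarrow> E s = 1" "\<And>s. \<bar>E s\<bar> \<le> C"
    "\<And>s. \<bar>deriv E s\<bar> \<le> C" "\<And>s. s \<notin> {1..2} \<Longrightarrow> deriv E s = 0" "C > 0"
    by (rule smooth_step_exists) (rule that)
  define M where "M m = real (Suc m)" for m
  have M: "M m \<ge> 1" "M m > 0" for m by (auto simp: M_def)
  \<comment> \<open>Vanishes for \<open>|x| \<le> 1 / M\<close> and equals 1 for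
    \<open>|x| \<ge> sqrt 2 / M\<close>; \<open>D m\<close> is its partial derivative, supported in
    between.\<close>
  define \<xi> where "\<xi> m x = E ((M m)\<^sup>2 * (x \<bullet> x))" for m and x :: "real ^ 'n"
  define D where "D m x = deriv E ((M m)\<^sup>2 * (x \<bullet> x)) * ((M m)\<^sup>2 * (2 * x $ i))" for m and x :: "real ^ 'n"
  have scal: "smooth1 (\<lambda>s. E ((M m)\<^sup>2 * s))" for m
    using smooth1_compose[OF E(1) smooth1_affine[of "(M m)\<^sup>2" 0]] by simp
  have \<xi>s: "smooth (\<xi> m)" for m
    unfolding \<xi>_def by (rule smooth_compose[OF scal smooth_inner_self])
  have \<xi>d: "partial_deriv i (\<xi> m) = D m" for m
  proof -
    have "((\<lambda>s. E ((M m)\<^sup>2 * s)) has_real_derivative deriv E ((M m)\<^sup>2 * s) * (M m)\<^sup>2) (at s)" for s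
      by (rule DERIV_chain2[OF smooth1_deriv[OF E(1)]]) (auto intro!: derivative_eq_intros)
    from partial_deriv_compose[OF smooth_differentiable[OF smooth_inner_self] this, of i]
    show ?thesis unfolding \<xi>_def D_def by (simp add: partial_deriv_inner_self mult_ac)
  qed
  obtain K where K: "smooth \<phi>" "compact K" "K \<subseteq> ball 0 R" "\<And>x. x \<notin> K \<Longrightarrow> \<phi> x = 0"
    using test_functionsE[OF \<phi>] by metis
  obtain B where B: "\<And>x. \<bar>\<phi> x\<bar> \<le> B" "B \<ge> 0" using test_bounded[OF \<phi>] by metis
  have d\<phi>: "partial_deriv i \<phi> \<in> test_functions (ball 0 R)" by (rule test_partial_deriv[OF \<phi>])
  have Dt: "(\<lambda>x. D m x * \<phi> x) \<in> test_functions (ball 0 R)" for m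
    unfolding \<xi>d[symmetric] by (intro test_mult smooth_partial_deriv \<xi>s \<phi>)
  have \<xi>\<phi>: "(\<lambda>x. \<xi> m x * \<phi> x) \<in> test_functions (ball 0 R - {0})" for m
  proof (rule test_functionsI)
    show "smooth (\<lambda>x. \<xi> m x * \<phi> x)" by (intro smooth_mult \<xi>s K)
    have "closed ((\<lambda>x :: real ^ 'n. (M m)\<^sup>2 * (x \<bullet> x)) -` {1..})"
      by (intro continuous_closed_vimage continuous_intros)
    then show "compact (K \<inter> ((\<lambda>x. (M m)\<^sup>2 * (x \<bullet> x)) -` {1..}))" using K(2) by (rule compact_Int_closed[rotated])
    show "K \<inter> ((\<lambda>x. (M m)\<^sup>2 * (x \<bullet> x)) -` {1..}) \<subseteq> ball 0 R - {0}" using K(3) by auto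
    fix x assume "x \<notin> K \<inter> ((\<lambda>x. (M m)\<^sup>2 * (x \<bullet> x)) -` {1..})"
    then show "\<xi> m x * \<phi> x = 0" using K(4) E(2) by (auto simp: \<xi>_def)
  qed
  have eq: "integral\<^sup>L lebesgue (\<lambda>x. \<xi> m x * (f x * partial_deriv i \<phi> x)) + integral\<^sup>L lebesgue (\<lambda>x. f x * (D m x * \<phi> x))
     = - integral\<^sup>L lebesgue (\<lambda>x. \<xi> m x * (g x * \<phi> x))" for m
  proof -
    have "partial_deriv i (\<lambda>x. \<xi> m x * \<phi> x) = (\<lambda>x. \<xi> m x * partial_deriv i \<phi> x + D m x * \<phi> x)"
      by (subst partial_deriv_mult) (auto intro!: smooth_differentiable \<xi>s K simp: \<xi>d)
    with w[OF \<xi>\<phi>, of m] have "integral\<^sup>L lebesgue (\<lambda>x. f x * (\<xi> m x * partial_deriv i \<phi> x) + f x * (D m x * \<phi> x)) = - integral\<^sup>L lebesgue (\<lambda>x. g x * (\<xi> m x * \<phi> x))"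
      by (simp add: distrib_left)
    moreover have "integrable lebesgue (\<lambda>x. f x * (\<xi> m x * partial_deriv i \<phi> x))" "integrable lebesgue (\<lambda>x. f x * (D m x * \<phi> x))"
      by (intro integrable_test_mult[OF f] test_mult \<xi>s d\<phi> Dt)+
    ultimately show ?thesis by (simp add: mult.left_commute)
  qed
  have lim: "(\<lambda>m. integral\<^sup>L lebesgue (\<lambda>x. \<xi> m x * h x)) \<longlonglongrightarrow> integral\<^sup>L lebesgue h" if h: "integrable lebesgue h" for h
  proof (rule integral_dominated_convergence)
    show "integrable lebesgue (\<lambda>x. C * \<bar>h x\<bar>)" using h by simp
    show "AE x in lebesgue. norm (\<xi> m x * h x) \<le> C * \<bar>h x\<bar>" for m
      using E(4) by (intro AE_I2) (auto simp: \<xi>_def abs_mult intro!: mult_right_mono)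
    have "\<xi> m \<in> borel_measurable lebesgue" for m
      using smooth_borel[OF \<xi>s[of m]] by (simp add: measurable_completion)
    then show "(\<lambda>x. \<xi> m x * h x) \<in> borel_measurable lebesgue" for m using h by simp
    show "AE x in lebesgue. (\<lambda>m. \<xi> m x * h x) \<longlonglongrightarrow> h x"
    proof -
      have "AE x in (lebesgue :: (real ^ 'n) measure). x \<noteq> 0"
        using AE_lborel_singleton[of "0 :: real ^ 'n"] by (simp add: AE_completion_iff)
      then show ?thesis
      proof eventually_elim
        case (elim x)
        have "filterlim (\<lambda>m. (M m)\<^sup>2 * (x \<bullet> x)) at_top sequentially"
          unfolding M_def using elim
          by (intro filterlim_at_top_mult_tendsto_pos[OF tendsto_const] filterlim_pow_at_top
              filterlim_compose[OF filterlim_real_sequentially filterlim_Suc]) auto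
        then have "\<forall>\<^sub>F m in sequentially. (M m)\<^sup>2 * (x \<bullet> x) \<ge> 2" by (simp add: filterlim_at_top)
        then have "\<forall>\<^sub>F m in sequentially. \<xi> m x * h x = h x"
          by eventually_elim (simp add: \<xi>_def E(3))
        then show ?case by (rule tendsto_eventually)
      qed
    qed
  qed (use h in auto)
  \<comment> \<open>A ball outside which the cutoff is constant; \<open>S m\<close> is the mass of
    the square of \<open>f\<close> on it and tends to 0 by dominated convergence.\<close>
  define A where "A m = {x :: real ^ 'n. x \<bullet> x \<le> 2 / (M m)\<^sup>2}" for m
  have Acb: "A m = cball 0 (sqrt 2 / M m)" for m
    using M[of m] by (auto simp: A_def norm_eq_sqrt_inner real_sqrt_divide[symmetric] real_sqrt_le_iff[symmetric, of _ "2 / (M m)\<^sup>2"] simp del: real_sqrt_le_iff)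
      (auto simp: real_sqrt_divide)
  define S where "S m = integral\<^sup>L lebesgue (\<lambda>x. indicator (A m) x * (indicator (ball 0 R) x * (f x)\<^sup>2))" for m
  have Am: "A m \<in> sets lebesgue" for m unfolding Acb by simp
  have S: "S \<longlonglongrightarrow> integral\<^sup>L lebesgue (\<lambda>x :: real ^ 'n. 0 :: real)"
    unfolding S_def
  proof (rule integral_dominated_convergence[OF _ _ f2])
    show "(\<lambda>x. indicator (A m) x * (indicator (ball 0 R) x * (f x)\<^sup>2)) \<in> borel_measurable lebesgue" for m
      using borel_measurable_integrable[OF integrable_mult_indicator[OF Am f2]] by simp
    show "AE x in lebesgue. norm (indicator (A m) x * (indicator (ball 0 R) x * (f x)\<^sup>2)) \<le> indicator (ball 0 R) x * (f x)\<^sup>2" for m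
      by (intro AE_I2) (auto simp: indicator_def)
    have "AE x in (lebesgue :: (real ^ 'n) measure). x \<noteq> 0"
      using AE_lborel_singleton[of "0 :: real ^ 'n"] by (simp add: AE_completion_iff)
    then show "AE x in lebesgue. (\<lambda>m. indicator (A m) x * (indicator (ball 0 R) x * (f x)\<^sup>2)) \<longlonglongrightarrow> 0"
    proof eventually_elim
      case (elim x)
      have "filterlim (\<lambda>m. (M m)\<^sup>2 * (x \<bullet> x)) at_top sequentially"
        unfolding M_def using elim
        by (intro filterlim_at_top_mult_tendsto_pos[OF tendsto_const] filterlim_pow_at_top
            filterlim_compose[OF filterlim_real_sequentially filterlim_Suc]) auto
      then have "\<forall>\<^sub>F m in sequentially. (M m)\<^sup>2 * (x \<bullet> x) > 2" by (simp add: filterlim_at_top_dense)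
      then have "\<forall>\<^sub>F m in sequentially. indicator (A m) x * (indicator (ball 0 R) x * (f x)\<^sup>2) = 0"
      proof eventually_elim
        case (elim m)
        then have "x \<notin> A m" using M[of m] by (simp add: A_def field_simps)
        then show ?case by simp
      qed
      then show ?case by (rule tendsto_eventually)
    qed
  qed auto
  then have S0: "S \<longlonglongrightarrow> 0" by simp
  define v where "v = unit_ball_vol (real CARD('n)) * sqrt 2 ^ CARD('n)"
  have v: "v > 0" by (simp add: v_def)
  have vol: "(M m)\<^sup>2 * measure lebesgue (A m) \<le> v" for m
  proof -
    have "measure lebesgue (A m) = unit_ball_vol (real CARD('n)) * (sqrt 2 / M m) ^ CARD('n)"
      unfolding Acb using M(2)[of m] by (simp add: content_cball)
    also have "\<dots> = v / (M m) ^ CARD('n)" by (simp add: v_def power_divide)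
    finally have "(M m)\<^sup>2 * measure lebesgue (A m) = v * ((M m)\<^sup>2 / (M m) ^ CARD('n))" by simp
    also have "\<dots> \<le> v * 1"
      using M[of m] n v by (intro mult_left_mono) (auto simp: divide_le_eq intro!: power_increasing)
    finally show ?thesis by simp
  qed
  \<comment> \<open>On the support of \<open>D m\<close> one has
    \<open>M m * |x_i| \<le> sqrt 2\<close>, so \<open>|D m x| \<le> 2 * sqrt 2 * C * M m\<close>;
    \<open>B\<close> bounds \<phi>.\<close>
  define P where "P = 2 * sqrt 2 * C * B"
  have P: "P \<ge> 0" using E(7) B by (simp add: P_def)
  \<comment> \<open>Young's inequality with a free parameter \<delta> splits the term into a
    multiple of \<open>S m\<close>, which tends to 0, and \<delta> times a bounded quantity. The
    parameter is fixed only after the desired accuracy.\<close>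
  have rem: "\<bar>integral\<^sup>L lebesgue (\<lambda>x. f x * (D m x * \<phi> x))\<bar> \<le> P * (S m / \<delta> + \<delta> * v)" if \<delta>: "\<delta> > 0" for m \<delta>
  proof -
    have pw: "\<bar>f x * (D m x * \<phi> x)\<bar> \<le> P * (indicator (A m) x * (indicator (ball 0 R) x * (f x)\<^sup>2) / \<delta> + \<delta> * ((M m)\<^sup>2 * indicator (A m) x))" for x
    proof (cases "x \<in> A m \<and> x \<in> ball 0 R \<and> (M m)\<^sup>2 * (x \<bullet> x) \<in> {1..2}")
      case True
      have "norm x \<le> sqrt 2 / M m" using True unfolding Acb by simp
      then have "\<bar>x $ i\<bar> \<le> sqrt 2 / M m" using component_le_norm_cart[of x i] by linarith
      then have "M m * \<bar>x $ i\<bar> \<le> sqrt 2" using M(2)[of m] by (simp add: field_simps)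
      then have "M m * (2 * (M m * \<bar>x $ i\<bar>)) \<le> M m * (2 * sqrt 2)"
        using M(2)[of m] by (intro mult_left_mono) auto
      moreover have "\<bar>(M m)\<^sup>2 * (2 * x $ i)\<bar> = M m * (2 * (M m * \<bar>x $ i\<bar>))"
        using M(2)[of m] by (simp add: abs_mult power2_eq_square)
      ultimately have "\<bar>D m x\<bar> \<le> C * (M m * (2 * sqrt 2))"
        unfolding D_def abs_mult[of "deriv E _"] using E(5) E(7) by (intro mult_mono) auto
      then have "\<bar>D m x * \<phi> x\<bar> \<le> (C * (M m * (2 * sqrt 2))) * B"
        unfolding abs_mult using B(1)[of x] B(2) E(7) M(2)[of m] by (intro mult_mono) auto
      also have "\<dots> = P * M m" by (simp add: P_def)
      finally have "\<bar>f x * (D m x * \<phi> x)\<bar> \<le> \<bar>f x\<bar> * (P * M m)"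
        unfolding abs_mult[of "f x"] by (intro mult_left_mono) auto
      also have "\<dots> = P * (\<bar>f x\<bar> * M m)" by simp
      also have "\<dots> \<le> P * ((f x)\<^sup>2 / \<delta> + \<delta> * (M m)\<^sup>2)"
      proof (rule mult_left_mono[OF _ P])
        have "0 \<le> (\<bar>f x\<bar> - \<delta> * M m)\<^sup>2" by simp
        then have "2 * (\<bar>f x\<bar> * (\<delta> * M m)) \<le> (f x)\<^sup>2 + (\<delta> * M m)\<^sup>2"
          by (simp add: power2_diff)
        moreover have "0 \<le> \<bar>f x\<bar> * (\<delta> * M m)" using \<delta> M(2)[of m] by simp
        ultimately have "\<bar>f x\<bar> * (\<delta> * M m) \<le> (f x)\<^sup>2 + (\<delta> * M m)\<^sup>2" by linarith
        then show "\<bar>f x\<bar> * M m \<le> (f x)\<^sup>2 / \<delta> + \<delta> * (M m)\<^sup>2"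
          using \<delta> by (simp add: field_simps power2_eq_square)
      qed
      finally show ?thesis using True by simp
    next
      case False
      have "D m x * \<phi> x = 0"
      proof (cases "(M m)\<^sup>2 * (x \<bullet> x) \<in> {1..2}")
        case True
        then have "x \<in> A m" using M(2)[of m] by (simp add: A_def field_simps)
        then have "x \<notin> ball 0 R" using False True by blast
        then have "\<phi> x = 0" using K(3,4) by blast
        then show ?thesis by simp
      qed (simp add: D_def E(6))
      then have "\<bar>f x * (D m x * \<phi> x)\<bar> = 0" by simp
      then show ?thesis using P \<delta> by (simp only:) (intro mult_nonneg_nonneg add_nonneg_nonneg divide_nonneg_pos, auto)
    qed
    have iA: "integrable lebesgue (\<lambda>x. indicator (A m) x * (indicator (ball 0 R) x * (f x)\<^sup>2))"
      using integrable_mult_indicator[OF Am f2] by simp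
    have iA1: "integrable lebesgue (indicator (A m) :: _ \<Rightarrow> real)"
      unfolding Acb using M(2)[of m] by (intro integrable_real_indicator) (auto simp: emeasure_cball)
    have "\<bar>integral\<^sup>L lebesgue (\<lambda>x. f x * (D m x * \<phi> x))\<bar> \<le> integral\<^sup>L lebesgue (\<lambda>x. \<bar>f x * (D m x * \<phi> x)\<bar>)"
      by (rule integral_abs_bound)
    also have "\<dots> \<le> integral\<^sup>L lebesgue (\<lambda>x. P * (indicator (A m) x * (indicator (ball 0 R) x * (f x)\<^sup>2) / \<delta> + \<delta> * ((M m)\<^sup>2 * indicator (A m) x)))"
      using iA iA1 pw order_trans[OF abs_ge_zero pw]
      by (intro integral_mono_AE' integrable_mult_right Bochner_Integration.integrable_add integrable_divide AE_I2) auto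
    also have "\<dots> = P * (S m / \<delta> + \<delta> * ((M m)\<^sup>2 * measure lebesgue (A m)))"
      using iA iA1 by (simp add: S_def)
    also have "\<dots> \<le> P * (S m / \<delta> + \<delta> * v)"
      using P vol[of m] \<delta> by (intro mult_left_mono add_left_mono) auto
    finally show ?thesis .
  qed
  have "(\<lambda>m. integral\<^sup>L lebesgue (\<lambda>x. f x * (D m x * \<phi> x))) \<longlonglongrightarrow> 0"
  proof (rule LIMSEQ_I)
    fix r :: real assume r: "r > 0"
    \<comment> \<open>\<open>P + 1\<close> instead of \<open>P\<close>, which may be 0; the second
      summand is then at most half of \<open>r\<close>.\<close>
    define q where "q = (P + 1) * v"
    have q: "q > 0" using P v by (simp add: q_def)
    define \<delta> where "\<delta> = r / (2 * q)"
    have \<delta>: "\<delta> > 0" using r q by (simp add: \<delta>_def)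
    have "P * (\<delta> * v) < r"
    proof -
      have "P * (\<delta> * v) \<le> (P + 1) * (\<delta> * v)" using \<delta> v by (intro mult_right_mono) auto
      also have "\<dots> = \<delta> * q" by (simp add: q_def mult_ac)
      also have "\<dots> = r / 2" using q by (simp add: \<delta>_def)
      finally show ?thesis using r by simp
    qed
    moreover have "(\<lambda>m. P * (S m / \<delta> + \<delta> * v)) \<longlonglongrightarrow> P * (0 / \<delta> + \<delta> * v)"
      using \<delta> by (intro tendsto_intros S0) auto
    ultimately have "\<forall>\<^sub>F m in sequentially. P * (S m / \<delta> + \<delta> * v) < r"
      by (intro order_tendstoD(2)) auto
    then obtain m0 where "\<And>m. m \<ge> m0 \<Longrightarrow> P * (S m / \<delta> + \<delta> * v) < r" by (auto simp: eventually_sequentially)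
    then show "\<exists>no. \<forall>n\<ge>no. norm (integral\<^sup>L lebesgue (\<lambda>x. f x * (D n x * \<phi> x)) - 0) < r"
      using rem[OF \<delta>] by (intro exI[of _ m0]) (auto intro: le_less_trans)
  qed
  then have "(\<lambda>m. integral\<^sup>L lebesgue (\<lambda>x. \<xi> m x * (f x * partial_deriv i \<phi> x)) + integral\<^sup>L lebesgue (\<lambda>x. f x * (D m x * \<phi> x)))
    \<longlonglongrightarrow> integral\<^sup>L lebesgue (\<lambda>x. f x * partial_deriv i \<phi> x) + 0"
    by (intro tendsto_add lim integrable_test_mult[OF f d\<phi>])
  moreover have "(\<lambda>m. - integral\<^sup>L lebesgue (\<lambda>x. \<xi> m x * (g x * \<phi> x))) \<longlonglongrightarrow> - integral\<^sup>L lebesgue (\<lambda>x. g x * \<phi> x)"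
    by (intro tendsto_minus lim integrable_test_mult[OF g \<phi>])
  ultimately show ?thesis unfolding eq using LIMSEQ_unique by fastforce
qed

subsection \<open>Derivatives of radial functions, algebraically\<close>

text \<open>Homogeneous polynomials of degree \<open>m\<close> as functions, the zero function
  belonging to every degree. Generation by multiplication with a coordinate makes smoothness and the
  bound by a multiple of \<open>norm x ^ m\<close> immediate inductions.\<close>

inductive hpoly :: "nat \<Rightarrow> (real ^ 'n::finite \<Rightarrow> real) \<Rightarrow> bool" where
  hpoly_const: "hpoly 0 (\<lambda>x. c)"
| hpoly_mult: "hpoly m f \<Longrightarrow> hpoly (Suc m) (\<lambda>x. x $ i * f x)"
| hpoly_add: "hpoly m f \<Longrightarrow> hpoly m g \<Longrightarrow> hpoly m (\<lambda>x. f x + g x)"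

lemma hpoly_zero: "hpoly m (\<lambda>x :: real ^ 'n::finite. 0)"
proof (induction m)
  case 0 show ?case by (rule hpoly_const)
next
  case (Suc m)
  from hpoly_mult[OF this, of undefined] show ?case by simp
qed

lemma hpoly_cmult: "hpoly m f \<Longrightarrow> hpoly m (\<lambda>x. c * f x)"
proof (induction rule: hpoly.induct)
  case (hpoly_const d) show ?case by (rule hpoly.hpoly_const)
next
  case (hpoly_mult m f i)
  from hpoly.hpoly_mult[OF hpoly_mult.IH, of i] show ?case by (simp add: mult.left_commute)
next
  case (hpoly_add m f g)
  from hpoly.hpoly_add[OF hpoly_add.IH] show ?case by (simp add: distrib_left)
qed

lemma hpoly_smooth: "hpoly m f \<Longrightarrow> smooth f"
  by (induction rule: hpoly.induct) (auto intro: smooth_const smooth_mult smooth_nth smooth_add)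

lemma hpoly_bound: "hpoly m f \<Longrightarrow> \<exists>K\<ge>0. \<forall>x. \<bar>f x\<bar> \<le> K * norm x ^ m"
proof (induction rule: hpoly.induct)
  case (hpoly_const c) show ?case by (intro exI[of _ "\<bar>c\<bar>"]) auto
next
  case (hpoly_mult m f i)
  then obtain K where K: "K \<ge> 0" "\<And>x. \<bar>f x\<bar> \<le> K * norm x ^ m" by blast
  have "\<bar>x $ i * f x\<bar> \<le> K * norm x ^ Suc m" for x
  proof -
    have "\<bar>x $ i * f x\<bar> \<le> norm x * (K * norm x ^ m)"
      unfolding abs_mult using K by (intro mult_mono component_le_norm_cart) auto
    then show ?thesis by (simp add: mult_ac)
  qed
  with K show ?case by blast
next
  case (hpoly_add m f g)
  then obtain K L where "K \<ge> 0" "\<And>x. \<bar>f x\<bar> \<le> K * norm x ^ m" "L \<ge> 0" "\<And>x. \<bar>g x\<bar> \<le> L * norm x ^ m" by blast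
  then show ?case
    by (intro exI[of _ "K + L"]) (auto simp: distrib_right intro!: order_trans[OF abs_triangle_ineq] add_mono)
qed

text \<open>In degree 0 the truncated \<open>m - 1\<close> would not record that the derivative
  vanishes, so this is carried through the induction.\<close>

lemma hpoly_partial_deriv:
  "hpoly m f \<Longrightarrow> (m = 0 \<longrightarrow> partial_deriv i f = (\<lambda>x. 0)) \<and> hpoly (m - 1) (partial_deriv i f)"
proof (induction rule: hpoly.induct)
  case (hpoly_const c) show ?case by (simp add: hpoly_zero)
next
  case (hpoly_mult m f l)
  have "partial_deriv i (\<lambda>x. x $ l * f x) = (\<lambda>x. x $ l * partial_deriv i f x + of_bool (i = l) * f x)"
    using hpoly_smooth[OF hpoly_mult.hyps] by (subst partial_deriv_mult)
      (auto simp: partial_deriv_nth intro!: smooth_differentiable smooth_nth)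
  moreover have "hpoly m (\<lambda>x. x $ l * partial_deriv i f x)"
  proof (cases m)
    case 0 with hpoly_mult.IH show ?thesis by (simp add: hpoly_zero)
  next
    case (Suc m') with hpoly_mult.IH show ?thesis by (auto intro: hpoly.hpoly_mult)
  qed
  ultimately show ?case
    using hpoly.hpoly_add[OF _ hpoly_cmult[OF hpoly_mult.hyps, of "of_bool (i = l)"]] by simp
next
  case (hpoly_add m f g)
  have "partial_deriv i (\<lambda>x. f x + g x) = (\<lambda>x. partial_deriv i f x + partial_deriv i g x)"
    by (intro partial_deriv_add smooth_differentiable hpoly_smooth[OF hpoly_add.hyps(1)] hpoly_smooth[OF hpoly_add.hyps(2)])
  then show ?case using hpoly_add.IH by (auto intro: hpoly.hpoly_add)
qed

text \<open>
  The derivative of \<open>W(|x|\<^sup>2)\<close> along the list of coordinates \<open>\<mu>\<close> is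
  \<open>\<Sum>\<^sub>j coef \<mu> j x W\<^bsup>(j)\<^esup>(|x|\<^sup>2)\<close>.
\<close>

primrec coef :: "'n::finite list \<Rightarrow> nat \<Rightarrow> real ^ 'n \<Rightarrow> real" where
  "coef [] j = (\<lambda>x. of_bool (j = 0))"
| "coef (i # \<mu>) j = (\<lambda>x. partial_deriv i (coef \<mu> j) x + (if j = 0 then 0 else 2 * x $ i * coef \<mu> (j - 1) x))"

text \<open>Each derivative either hits the polynomial and lowers its degree by 1, or hits the
  profile and raises both \<open>j\<close> and the degree by 1; so the degree is
  \<open>2 * j\<close> minus the order. Where this is negative the coefficient is 0, which the
  truncated subtraction alone would not say.\<close>

lemma coef_hpoly: "(2 * j < length \<mu> \<longrightarrow> coef \<mu> j = (\<lambda>x. 0)) \<and> hpoly (2 * j - length \<mu>) (coef \<mu> j)"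
proof (induction \<mu> arbitrary: j)
  case Nil
  show ?case
  proof (cases j)
    case 0 then show ?thesis using hpoly_const[of 1] by simp
  qed (simp add: hpoly_zero)
next
  case (Cons i \<mu>)
  have 1: "hpoly (2 * j - Suc (length \<mu>)) (partial_deriv i (coef \<mu> j))"
    using hpoly_partial_deriv[of "2 * j - length \<mu>" "coef \<mu> j" i] Cons.IH[of j] by simp
  have 2: "hpoly (2 * j - Suc (length \<mu>)) (\<lambda>x. if j = 0 then 0 else 2 * x $ i * coef \<mu> (j - 1) x)"
  proof (cases "j = 0 \<or> 2 * (j - 1) < length \<mu>")
    case True
    then have "(\<lambda>x. if j = 0 then 0 else 2 * x $ i * coef \<mu> (j - 1) x) = (\<lambda>x. 0)" using Cons.IH[of "j - 1"] by auto
    then show ?thesis by (simp only: hpoly_zero)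
  next
    case False
    then have "2 * j - Suc (length \<mu>) = Suc (2 * (j - 1) - length \<mu>)" by auto
    moreover have "hpoly (Suc (2 * (j - 1) - length \<mu>)) (\<lambda>x. 2 * (x $ i * coef \<mu> (j - 1) x))"
      using Cons.IH[of "j - 1"] by (intro hpoly_cmult hpoly_mult) auto
    ultimately show ?thesis using False by (simp add: mult.assoc)
  qed
  have "coef (i # \<mu>) j = (\<lambda>x. 0)" if "2 * j < Suc (length \<mu>)"
  proof -
    have "partial_deriv i (coef \<mu> j) = (\<lambda>x. 0)"
      using hpoly_partial_deriv[of "2 * j - length \<mu>" "coef \<mu> j" i] Cons.IH[of j] that by simp
    moreover have "coef \<mu> (j - 1) = (\<lambda>x. 0)" if "j \<noteq> 0"
      using Cons.IH[of "j - 1"] \<open>2 * j < Suc (length \<mu>)\<close> that by simp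
    ultimately show ?thesis by auto
  qed
  with hpoly_add[OF 1 2] show ?case by simp
qed

lemma coef_smooth: "smooth (coef \<mu> j)"
  using coef_hpoly hpoly_smooth by blast

lemma coef_low: "2 * j < length \<mu> \<Longrightarrow> coef \<mu> j = (\<lambda>x. 0)"
  using coef_hpoly by blast

lemma coef_high: "length \<mu> < j \<Longrightarrow> coef \<mu> j = (\<lambda>x. 0)"
  by (induction \<mu> arbitrary: j) auto

lemma coef_single: "coef [l] (Suc 0) = (\<lambda>x. 2 * x $ l)"
  by simp

lemma coef_bound: "\<exists>K\<ge>0. \<forall>x. \<bar>coef \<mu> j x\<bar> \<le> K * norm x ^ (2 * j - length \<mu>)"
  using coef_hpoly hpoly_bound by blast

lemma finite_lists_length: "finite {\<mu> :: 'n::finite list. length \<mu> = m}"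
  using finite_lists_length_eq[of "UNIV :: 'n set" m] by simp

lemma sum_lists_Suc:
  "(\<Sum>\<mu> | length \<mu> = Suc m. g \<mu>) = (\<Sum>i\<in>UNIV. \<Sum>\<mu> | length \<mu> = m. g (i # \<mu> :: 'n::finite list))"
proof -
  have "{\<mu> :: 'n list. length \<mu> = Suc m} = (\<lambda>(i, \<mu>). i # \<mu>) ` (UNIV \<times> {\<mu>. length \<mu> = m})"
    by (auto simp: length_Suc_conv image_iff)
  then have "(\<Sum>\<mu> | length \<mu> = Suc m. g \<mu>) = (\<Sum>(i, \<mu>)\<in>UNIV \<times> {\<mu>. length \<mu> = m}. g (i # \<mu>))"
    by (simp only:) (subst sum.reindex, auto simp: inj_on_def case_prod_unfold)
  then show ?thesis by (simp add: sum.cartesian_product)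
qed

text \<open>For \<open>m / 2 \<le> j \<le> m\<close> these are the Faa di Bruno numbers
  \<open>m! / ((2j - m)! (m - j)!)\<close>, and 0 otherwise: the coefficients in the
  \<open>m\<close>-th derivative at \<open>t = 0\<close> of a profile composed with
  \<open>|x + t y|^2 = |x|^2 + 2 t (x \<bullet> y) + t^2 |y|^2\<close>.\<close>

primrec contr :: "nat \<Rightarrow> nat \<Rightarrow> real" where
  "contr 0 j = of_bool (j = 0)"
| "contr (Suc m) j = 2 * real (2 * j - m) * contr m j + (if j = 0 then 0 else contr m (j - 1))"

lemma contr_nonneg: "contr m j \<ge> 0"
  by (induction m arbitrary: j) auto

lemma contr_eq_0: "2 * j < m \<or> m < j \<Longrightarrow> contr m j = 0"
proof (induction m arbitrary: j)
  case (Suc m)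
  have "real (2 * j - m) * contr m j = 0" using Suc by (cases "2 * j \<le> m") auto
  moreover have "contr m (j - 1) = 0" if "j \<noteq> 0"
    by (rule Suc.IH) (use Suc.prems that in linarith)
  ultimately show ?case by auto
qed auto

text \<open>Positivity lets the profile derivatives be recovered by division, in
  \<open>coef_lower_bound\<close> for all \<open>j\<close> in the range and in
  \<open>next_profile_derivative\<close> for the top one.\<close>

lemma contr_pos: "m \<le> 2 * j \<Longrightarrow> j \<le> m \<Longrightarrow> contr m j > 0"
proof (induction m arbitrary: j)
  case (Suc m)
  then have j: "j \<noteq> 0" by auto
  show ?case
  proof (cases "j = Suc m")
    case True then show ?thesis using Suc.IH[of m] contr_nonneg[of m j] by (auto intro!: add_nonneg_pos)
  next
    case False
    then have "0 < 2 * real (2 * j - m) * contr m j" using Suc.IH[of j] Suc.prems by (intro mult_pos_pos) auto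
    then show ?thesis unfolding contr.simps using j contr_nonneg[of m "j - 1"]
      by (simp only: if_False add_pos_nonneg)
  qed
qed auto

text \<open>Contracting with a vector \<open>y\<close> amounts to the iterated directional derivative \<open>(y \<cdot> \<nabla>)\<^sup>m\<close>.\<close>

lemma coef_contract:
  fixes x y :: "real ^ 'n::finite"
  shows "(\<Sum>\<mu> | length \<mu> = m. prod_list (map (($) y) \<mu>) * coef \<mu> j x)
    = contr m j * (2 * (x \<bullet> y)) ^ (2 * j - m) * (y \<bullet> y) ^ (m - j)"
proof (induction m arbitrary: j x)
  case 0
  show ?case by (cases j) auto
next
  case (Suc m)
  define S where "S j x = (\<Sum>\<mu> | length \<mu> = m. prod_list (map (($) y) \<mu>) * coef \<mu> j x)" for j and x :: "real ^ 'n"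
  have Seq: "S j = (\<lambda>x. contr m j * (2 * (x \<bullet> y)) ^ (2 * j - m) * (y \<bullet> y) ^ (m - j))" for j
    by (simp add: S_def Suc.IH fun_eq_iff)
  have d1: "partial_deriv i (S j) x = (\<Sum>\<mu> | length \<mu> = m. prod_list (map (($) y) \<mu>) * partial_deriv i (coef \<mu> j) x)" for i j x
  proof -
    have d: "partial_deriv i (\<lambda>x. prod_list (map (($) y) \<mu>) * coef \<mu> j x) x = prod_list (map (($) y) \<mu>) * partial_deriv i (coef \<mu> j) x" for \<mu>
      by (subst partial_deriv_mult) (auto intro!: smooth_differentiable smooth_const coef_smooth)
    show ?thesis
      unfolding S_def[abs_def] by (subst partial_deriv_sum) (auto simp: d intro!: smooth_differentiable smooth_mult smooth_const coef_smooth)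
  qed
  have d2: "partial_deriv i (S j) x = contr m j * (real (2 * j - m) * (2 * (x \<bullet> y)) ^ (2 * j - m - 1) * (2 * y $ i)) * (y \<bullet> y) ^ (m - j)" for i j x
  proof -
    have lin: "((\<lambda>x. 2 * (x \<bullet> y)) has_derivative (\<lambda>h. 2 * (h \<bullet> y))) (at z)" for z
      by (intro derivative_intros)
    then have diff: "(\<lambda>x. 2 * (x \<bullet> y)) differentiable_on UNIV"
      unfolding differentiable_on_def differentiable_def by blast
    have "((\<lambda>s. contr m j * s ^ (2 * j - m) * (y \<bullet> y) ^ (m - j)) has_real_derivative
        contr m j * (real (2 * j - m) * s ^ (2 * j - m - 1)) * (y \<bullet> y) ^ (m - j)) (at s)" for s
      by (auto intro!: derivative_eq_intros)
    from partial_deriv_compose[OF diff this, of i] partial_deriv_eqI[OF lin, of i] show ?thesis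
      unfolding Seq by (simp add: inner_axis' mult_ac)
  qed
  have "(\<Sum>\<mu> | length \<mu> = Suc m. prod_list (map (($) y) \<mu>) * coef \<mu> j x)
    = (\<Sum>i\<in>UNIV. y $ i * partial_deriv i (S j) x + (if j = 0 then 0 else 2 * (x $ i * y $ i) * S (j - 1) x))"
    unfolding sum_lists_Suc d1 S_def
    by (cases "j = 0") (simp_all add: sum_distrib_left distrib_left mult_ac flip: sum.distrib)
  also have "\<dots> = (\<Sum>i\<in>UNIV. y $ i * partial_deriv i (S j) x) + (if j = 0 then 0 else 2 * (x \<bullet> y) * S (j - 1) x)"
    by (simp add: sum.distrib inner_vec_def sum_distrib_left sum_distrib_right)
  also have "(\<Sum>i\<in>UNIV. y $ i * partial_deriv i (S j) x)
      = contr m j * (real (2 * j - m) * (2 * (x \<bullet> y)) ^ (2 * j - m - 1)) * (2 * (y \<bullet> y)) * (y \<bullet> y) ^ (m - j)"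
    unfolding d2 by (simp add: inner_vec_def sum_distrib_left sum_distrib_right mult_ac)
  also have "\<dots> = 2 * real (2 * j - m) * contr m j * (2 * (x \<bullet> y)) ^ (2 * j - Suc m) * (y \<bullet> y) ^ (Suc m - j)"
  proof (cases "j \<le> m")
    case True then show ?thesis by (simp add: Suc_diff_le)
  qed (simp add: contr_eq_0)
  also have "(if j = 0 then 0 else 2 * (x \<bullet> y) * S (j - 1) x)
      = (if j = 0 then 0 else contr m (j - 1)) * (2 * (x \<bullet> y)) ^ (2 * j - Suc m) * (y \<bullet> y) ^ (Suc m - j)"
  proof (cases "j = 0 \<or> 2 * (j - 1) < m")
    case True then show ?thesis by (auto simp: Seq contr_eq_0)
  next
    case False
    then have "2 * j - Suc m = Suc (2 * (j - 1) - m)" "Suc m - j = m - (j - 1)" by auto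
    then show ?thesis using False by (simp add: Seq)
  qed
  finally show ?case by (simp add: distrib_right)
qed

text \<open>Equivalence of norms on polynomials of bounded degree, by induction on the degree:
  \<open>p(t) - 2^(k+1) p(t/2)\<close> has no term of degree \<open>k + 1\<close>, and the other
  coefficients are multiplied by numbers of absolute value at least 1. The leading coefficient is
  then read off at \<open>t = 1\<close>.\<close>

lemma polynomial_coeff_bound:
  "\<exists>K\<ge>0. \<forall>c :: nat \<Rightarrow> real. \<forall>M. (\<forall>t\<in>{0..1}. \<bar>\<Sum>i\<le>k. c i * t ^ i\<bar> \<le> M) \<longrightarrow> (\<forall>i\<le>k. \<bar>c i\<bar> \<le> K * M)"
proof (induction k)
  case 0
  show ?case by (rule exI[of _ 1]) auto
next
  case (Suc k)
  then obtain K where K: "K \<ge> 0"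
    and K2: "\<forall>c :: nat \<Rightarrow> real. \<forall>M. (\<forall>t\<in>{0..1}. \<bar>\<Sum>i\<le>k. c i * t ^ i\<bar> \<le> M) \<longrightarrow> (\<forall>i\<le>k. \<bar>c i\<bar> \<le> K * M)"
    by blast
  have IH: "\<bar>c i\<bar> \<le> K * M" if "\<And>t. t \<in> {0..1} \<Longrightarrow> \<bar>\<Sum>i\<le>k. c i * t ^ i\<bar> \<le> M" "i \<le> k"
    for c :: "nat \<Rightarrow> real" and M i
    using K2[rule_format, of c M i] that by simp
  define L where "L = K * (1 + 2 ^ Suc k)"
  have L: "L \<ge> 0" using K by (simp add: L_def)
  have "\<bar>c i\<bar> \<le> (1 + real (Suc k) * L) * M" if c: "\<And>t. t \<in> {0..1} \<Longrightarrow> \<bar>\<Sum>i\<le>Suc k. c i * t ^ i\<bar> \<le> M" and i: "i \<le> Suc k" for c :: "nat \<Rightarrow> real" and M i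
  proof -
    have M: "M \<ge> 0" using c[of 0] abs_ge_zero order_trans by fastforce
    have low: "\<bar>c i\<bar> \<le> L * M" if "i \<le> k" for i
    proof -
      define b where "b i = c i * (1 - 2 ^ (Suc k - i))" for i
      have "\<bar>\<Sum>i\<le>k. b i * t ^ i\<bar> \<le> (1 + 2 ^ Suc k) * M" if t: "t \<in> {0..1}" for t
      proof -
        have "(\<Sum>i\<le>Suc k. c i * t ^ i) - 2 ^ Suc k * (\<Sum>i\<le>Suc k. c i * (t / 2) ^ i) = (\<Sum>i\<le>Suc k. b i * t ^ i)"
          unfolding sum_distrib_left sum_subtractf[symmetric]
          by (intro sum.cong refl) (auto simp: b_def power_divide algebra_simps power_diff)
        also have "\<dots> = (\<Sum>i\<le>k. b i * t ^ i)" by (simp add: b_def)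
        finally have "(\<Sum>i\<le>k. b i * t ^ i) = (\<Sum>i\<le>Suc k. c i * t ^ i) - 2 ^ Suc k * (\<Sum>i\<le>Suc k. c i * (t / 2) ^ i)" ..
        also have "\<bar>\<dots>\<bar> \<le> M + 2 ^ Suc k * M"
          using c[OF t] c[of "t / 2"] t
          by (intro order_trans[OF abs_triangle_ineq4] add_mono) (auto simp: abs_mult)
        finally show ?thesis by (simp add: algebra_simps)
      qed
      from IH[OF this that] have "\<bar>b i\<bar> \<le> L * M" by (simp add: L_def mult_ac)
      moreover have "\<bar>c i\<bar> * 1 \<le> \<bar>b i\<bar>"
      proof -
        have "(2::real) ^ 1 \<le> 2 ^ (Suc k - i)" using that by (intro power_increasing) auto
        then show ?thesis unfolding b_def abs_mult by (intro mult_left_mono) auto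
      qed
      ultimately show ?thesis by simp
    qed
    show ?thesis
    proof (cases "i = Suc k")
      case False
      then have "\<bar>c i\<bar> \<le> L * M" using i low by simp
      also have "\<dots> \<le> (1 + real (Suc k) * L) * M" using L M by (intro mult_right_mono) (auto simp: algebra_simps)
      finally show ?thesis .
    next
      case True
      have "\<bar>\<Sum>i\<le>Suc k. c i * 1 ^ i\<bar> \<le> M" by (rule c) simp
      moreover have "\<bar>\<Sum>i\<le>k. c i\<bar> \<le> (\<Sum>i\<le>k. L * M)"
        using low by (intro order_trans[OF sum_abs] sum_mono) auto
      ultimately have "\<bar>c (Suc k)\<bar> \<le> M + (\<Sum>i\<le>k. L * M)" by simp
      then show ?thesis using True by (simp add: algebra_simps)
    qed
  qed
  then show ?case using L by (intro exI[of _ "1 + real (Suc k) * L"]) auto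
qed

text \<open>A pointwise statement about arbitrary numbers \<open>W j\<close>. Contraction with a
  unit vector costs nothing, since products of its components are bounded by 1; letting its angle to
  \<open>x\<close> vary gives a polynomial bounded on \<open>[0, 1]\<close>, and
  \<open>polynomial_coeff_bound\<close> bounds each coefficient uniformly in \<open>x\<close> and
  \<open>W\<close>.\<close>

lemma coef_lower_bound:
  assumes n: "CARD('n::finite) \<ge> 2"
  shows "\<exists>K\<ge>0. \<forall>(x :: real ^ 'n) W. \<forall>j. x \<noteq> 0 \<longrightarrow> m \<le> 2 * j \<longrightarrow> j \<le> m \<longrightarrow>
    norm x ^ (2 * j - m) * \<bar>W j\<bar> \<le> K * (\<Sum>\<mu> | length \<mu> = m. \<bar>\<Sum>j\<le>m. coef \<mu> j x * W j\<bar>)"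
proof -
  obtain K where K1: "K \<ge> 0"
    and K2: "\<forall>c :: nat \<Rightarrow> real. \<forall>M. (\<forall>t\<in>{0..1}. \<bar>\<Sum>i\<le>m. c i * t ^ i\<bar> \<le> M) \<longrightarrow> (\<forall>i\<le>m. \<bar>c i\<bar> \<le> K * M)"
    using polynomial_coeff_bound[of m] by blast
  have "\<bar>c i\<bar> \<le> K * M" if "\<And>t. t \<in> {0..1} \<Longrightarrow> \<bar>\<Sum>i\<le>m. c i * t ^ i\<bar> \<le> M" "i \<le> m"
    for c :: "nat \<Rightarrow> real" and M i
    using K2[rule_format, of c M i] that by simp
  note K = K1 this
  define L where "L = (\<Sum>j\<le>m. K / contr m j)"
  have Kc: "K / contr m j \<ge> 0" for j using K contr_nonneg by simp
  have "norm x ^ (2 * j - m) * \<bar>W j\<bar> \<le> L * (\<Sum>\<mu> | length \<mu> = m. \<bar>\<Sum>j\<le>m. coef \<mu> j x * W j\<bar>)"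
    if x: "x \<noteq> 0" and j: "m \<le> 2 * j" "j \<le> m" for x :: "real ^ 'n" and W j
  proof -
    define r where "r = norm x"
    have r: "r > 0" using x by (simp add: r_def)
    define M where "M = (\<Sum>\<mu> | length \<mu> = m. \<bar>\<Sum>j\<le>m. coef \<mu> j x * W j\<bar>)"
    have M: "M \<ge> 0" unfolding M_def by (intro sum_nonneg) auto
    have "2 \<le> DIM(real ^ 'n)" using n by simp
    then obtain z where z: "z \<noteq> 0" "orthogonal x z" by (rule orthogonal_to_vector_exists)
    define e where "e = z /\<^sub>R norm z"
    have e: "e \<bullet> e = 1" "x \<bullet> e = 0" "e \<bullet> x = 0"
      using z by (auto simp: e_def orthogonal_def inner_commute power2_norm_eq_inner[symmetric] power2_eq_square)
    have xx: "x \<bullet> x = r * r" by (simp add: r_def power2_norm_eq_inner[symmetric] power2_eq_square)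
    \<comment> \<open>The exponent \<open>i\<close> of \<open>t\<close> belongs to
      \<open>j = (i + m) div 2\<close>, that is \<open>i = 2 * j - m\<close>; exponents of the other
      parity do not occur.\<close>
    define c where "c i = (if even (i + m) then contr m ((i + m) div 2) * (2 * r) ^ i * W ((i + m) div 2) else 0)" for i
    have "\<bar>\<Sum>i\<le>m. c i * t ^ i\<bar> \<le> M" if t: "t \<in> {0..1}" for t
    proof -
      define y where "y = (t / r) *\<^sub>R x + sqrt (1 - t\<^sup>2) *\<^sub>R e"
      have t2: "t\<^sup>2 \<le> 1" using t by (simp add: power_le_one)
      have xy: "x \<bullet> y = t * r" using r by (simp add: y_def inner_add_right e xx)
      have yy: "y \<bullet> y = 1"
      proof -
        have "y \<bullet> y = (t / r) * (t / r) * (x \<bullet> x) + sqrt (1 - t\<^sup>2) * sqrt (1 - t\<^sup>2) * (e \<bullet> e)"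
          by (simp add: y_def inner_add_left inner_add_right e)
        also have "\<dots> = t\<^sup>2 + (1 - t\<^sup>2)" using r t2 by (simp add: xx e power2_eq_square)
        finally show ?thesis by simp
      qed
      have y1: "\<bar>y $ i\<bar> \<le> 1" for i
        using component_le_norm_cart[of y i] yy by (simp add: norm_eq_sqrt_inner)
      have p1: "\<bar>prod_list (map (($) y) \<mu>)\<bar> \<le> 1" for \<mu>
        by (induction \<mu>) (auto simp: abs_mult intro!: mult_le_one y1)
      have "(\<Sum>i\<le>m. c i * t ^ i) = (\<Sum>i | i \<le> m \<and> even (i + m). c i * t ^ i)"
        by (rule sum.mono_neutral_right) (auto simp: c_def)
      also have "\<dots> = (\<Sum>j | j \<le> m \<and> m \<le> 2 * j. contr m j * (2 * (x \<bullet> y)) ^ (2 * j - m) * W j)"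
        by (rule sum.reindex_bij_witness[of _ "\<lambda>j. 2 * j - m" "\<lambda>i. (i + m) div 2"])
          (auto simp: c_def xy power_mult_distrib mult_ac)
      also have "\<dots> = (\<Sum>j\<le>m. contr m j * (2 * (x \<bullet> y)) ^ (2 * j - m) * W j)"
        by (rule sum.mono_neutral_left) (auto simp: contr_eq_0 not_le)
      also have "\<dots> = (\<Sum>j\<le>m. (\<Sum>\<mu> | length \<mu> = m. prod_list (map (($) y) \<mu>) * coef \<mu> j x) * W j)"
        unfolding coef_contract yy by simp
      also have "\<dots> = (\<Sum>\<mu> | length \<mu> = m. prod_list (map (($) y) \<mu>) * (\<Sum>j\<le>m. coef \<mu> j x * W j))"
        unfolding sum_distrib_left sum_distrib_right by (subst sum.swap) (simp add: mult.assoc)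
      also have "\<bar>\<dots>\<bar> \<le> M"
        unfolding M_def using p1 by (intro order_trans[OF sum_abs] sum_mono) (simp add: abs_mult mult_left_le_one_le)
      finally show ?thesis .
    qed
    from K(2)[OF this, of "2 * j - m"] j have "\<bar>c (2 * j - m)\<bar> \<le> K * M" by simp
    moreover have "c (2 * j - m) = contr m j * (2 * r) ^ (2 * j - m) * W j" using j by (simp add: c_def)
    ultimately have "contr m j * ((2 * r) ^ (2 * j - m) * \<bar>W j\<bar>) \<le> K * M"
      using r contr_nonneg[of m j] by (simp add: abs_mult)
    then have "(2 * r) ^ (2 * j - m) * \<bar>W j\<bar> \<le> K / contr m j * M"
      using contr_pos[OF j] by (simp add: field_simps)
    moreover have "r ^ (2 * j - m) * \<bar>W j\<bar> \<le> (2 * r) ^ (2 * j - m) * \<bar>W j\<bar>"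
      using r by (intro mult_right_mono power_mono) auto
    moreover have "K / contr m j * M \<le> L * M"
      unfolding L_def using j Kc M by (intro mult_right_mono member_le_sum) auto
    ultimately show ?thesis by (simp add: r_def M_def)
  qed
  moreover have "L \<ge> 0" unfolding L_def using Kc by (intro sum_nonneg) auto
  ultimately show ?thesis by blast
qed

subsection \<open>Weak derivatives and Sobolev norms\<close>

text \<open>Valued in \<open>ennreal\<close>, so that estimates can be established before finiteness
  is known; membership in \<open>L2\<close> then follows from them.\<close>

definition sq_int :: "(real ^ 'n::finite) set \<Rightarrow> (real ^ 'n \<Rightarrow> real) \<Rightarrow> ennreal" where
  "sq_int \<Omega> f = (\<integral>\<^sup>+x. ennreal (indicator \<Omega> x * (f x)\<^sup>2) \<partial>lebesgue)"

lemma L2_iff: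
  assumes "\<Omega> \<in> sets lebesgue"
  shows "f \<in> L2 \<Omega> \<longleftrightarrow> (\<lambda>x. indicator \<Omega> x * f x) \<in> borel_measurable lebesgue \<and> sq_int \<Omega> f < \<infinity>"
proof -
  have "f \<in> borel_measurable (lebesgue_on \<Omega>) \<longleftrightarrow> (\<lambda>x. indicator \<Omega> x * f x) \<in> borel_measurable lebesgue"
    using assms by (subst borel_measurable_restrict_space_iff) auto
  moreover have "integrable (lebesgue_on \<Omega>) (\<lambda>x. (f x)\<^sup>2) \<longleftrightarrow> sq_int \<Omega> f < \<infinity>"
    if "(\<lambda>x. indicator \<Omega> x * f x) \<in> borel_measurable lebesgue"
  proof -
    have "(\<lambda>x. (indicator \<Omega> x * f x)\<^sup>2) \<in> borel_measurable lebesgue" using that by measurable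
    moreover have "(indicator \<Omega> x * f x)\<^sup>2 = indicator \<Omega> x * (f x)\<^sup>2" for x by (auto simp: indicator_def)
    ultimately have m: "(\<lambda>x. indicator \<Omega> x * (f x)\<^sup>2) \<in> borel_measurable lebesgue" by simp
    have "integrable (lebesgue_on \<Omega>) (\<lambda>x. (f x)\<^sup>2) \<longleftrightarrow> integrable lebesgue (\<lambda>x. indicator \<Omega> x * (f x)\<^sup>2)"
      using assms by (subst integrable_restrict_space) auto
    also have "\<dots> \<longleftrightarrow> sq_int \<Omega> f < \<infinity>"
      using m by (simp add: integrable_iff_bounded sq_int_def abs_mult)
    finally show ?thesis .
  qed
  ultimately show ?thesis by (auto simp: L2_def)
qed

lemma L2_integrable_sq:
  assumes "\<Omega> \<in> sets lebesgue" "f \<in> L2 \<Omega>"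
  shows "integrable lebesgue (\<lambda>x. indicator \<Omega> x * (f x)\<^sup>2)"
  using assms by (auto simp: L2_def integrable_restrict_space)

lemma L2_norm_eq:
  assumes "\<Omega> \<in> sets lebesgue" "f \<in> L2 \<Omega>"
  shows "ennreal ((L2_norm \<Omega> f)\<^sup>2) = sq_int \<Omega> f"
proof -
  have "(L2_norm \<Omega> f)\<^sup>2 = integral\<^sup>L lebesgue (\<lambda>x. indicator \<Omega> x * (f x)\<^sup>2)"
    using assms(1) unfolding L2_norm_def by (subst integral_restrict_space) auto
  also have "ennreal \<dots> = sq_int \<Omega> f"
    unfolding sq_int_def using L2_integrable_sq[OF assms] by (subst nn_integral_eq_integral) auto
  finally show ?thesis .
qed

lemma sq_int_cong_AE:
  assumes "AE x in lebesgue. x \<in> \<Omega> \<longrightarrow> f x = g x"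
  shows "sq_int \<Omega> f = sq_int \<Omega> g"
  unfolding sq_int_def
  by (rule nn_integral_cong_AE) (use assms in eventually_elim, auto simp: indicator_def)

lemma L2_cong_AE:
  assumes "\<Omega> \<in> sets lebesgue" "AE x in lebesgue. x \<in> \<Omega> \<longrightarrow> f x = g x" "f \<in> L2 \<Omega>"
  shows "g \<in> L2 \<Omega>"
proof -
  have "AE x in lebesgue. indicator \<Omega> x * f x = indicator \<Omega> x * g x"
    using assms(2) by eventually_elim (auto simp: indicator_def)
  then show ?thesis
    using assms borel_measurable_AE[of "\<lambda>x. indicator \<Omega> x * f x" "\<lambda>x. indicator \<Omega> x * g x"] sq_int_cong_AE[OF assms(2)]
    by (simp add: L2_iff)
qed

lemma L2_locally_integrable:
  assumes \<Omega>: "\<Omega> \<in> sets lebesgue" and f: "f \<in> L2 \<Omega>"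
  shows "locally_integrable \<Omega> f"
  unfolding locally_integrable_def
proof (intro allI impI)
  fix K assume K: "compact K \<and> K \<subseteq> \<Omega>"
  have Kl: "K \<in> lmeasurable" using K lmeasurable_compact by blast
  show "f absolutely_integrable_on K"
    unfolding set_integrable_def
  proof (rule Bochner_Integration.integrable_bound)
    have "integrable lebesgue (indicator K :: _ \<Rightarrow> real)"
      using Kl by (intro integrable_real_indicator) (auto simp: fmeasurable_def)
    then show "integrable lebesgue (\<lambda>x. indicator K x + indicator \<Omega> x * (f x)\<^sup>2)"
      using L2_integrable_sq[OF \<Omega> f] by simp
    have "indicat_real K \<in> borel_measurable lebesgue" "(\<lambda>x. indicator \<Omega> x * f x) \<in> borel_measurable lebesgue"
      using f Kl by (auto simp: L2_iff[OF \<Omega>] fmeasurableD)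
    then have "(\<lambda>x. indicator K x * (indicator \<Omega> x * f x)) \<in> borel_measurable lebesgue"
      by (rule borel_measurable_times)
    moreover have "indicator K x * (indicator \<Omega> x * f x) = indicat_real K x *\<^sub>R f x" for x
      using K by (auto simp: indicator_def)
    ultimately show "(\<lambda>x. indicat_real K x *\<^sub>R f x) \<in> borel_measurable lebesgue" by simp
    have "\<bar>f x\<bar> \<le> 1 + (f x)\<^sup>2" for x
    proof -
      have "0 \<le> (\<bar>f x\<bar> - 1)\<^sup>2" by simp
      then have "2 * \<bar>f x\<bar> \<le> 1 + (f x)\<^sup>2" by (simp add: power2_diff)
      then show ?thesis by (smt (verit) abs_ge_zero)
    qed
    then show "AE x in lebesgue. norm (indicat_real K x *\<^sub>R f x) \<le> norm (indicator K x + indicator \<Omega> x * (f x)\<^sup>2)"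
      using K by (intro AE_I2) (auto simp: indicator_def)
  qed
qed

lemma locally_integrable_mono: "locally_integrable \<Omega> f \<Longrightarrow> \<Omega>' \<subseteq> \<Omega> \<Longrightarrow> locally_integrable \<Omega>' f"
  unfolding locally_integrable_def by blast

lemma locally_integrable_add:
  "locally_integrable \<Omega> f \<Longrightarrow> locally_integrable \<Omega> g \<Longrightarrow> locally_integrable \<Omega> (\<lambda>x. f x + g x)"
  unfolding locally_integrable_def by (auto intro: set_integral_add)

lemma locally_integrable_zero: "locally_integrable \<Omega> (\<lambda>x. 0)"
  by (simp add: locally_integrable_def set_integrable_def)

lemma locally_integrable_sum:
  "(\<And>i. i \<in> A \<Longrightarrow> locally_integrable \<Omega> (f i)) \<Longrightarrow> locally_integrable \<Omega> (\<lambda>x. \<Sum>i\<in>A. f i x)"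
  by (induction A rule: infinite_finite_induct) (auto intro: locally_integrable_add locally_integrable_zero)

lemma locally_integrable_mult:
  assumes f: "locally_integrable \<Omega> f" and p: "continuous_on UNIV p"
  shows "locally_integrable \<Omega> (\<lambda>x. p x * f x)"
  unfolding locally_integrable_def
proof (intro allI impI)
  fix K assume K: "compact K \<and> K \<subseteq> \<Omega>"
  have "bounded (p ` K)"
    using K p by (intro compact_imp_bounded compact_continuous_image) (auto intro: continuous_on_subset)
  then obtain C where C: "\<And>x. x \<in> K \<Longrightarrow> \<bar>p x\<bar> \<le> C" by (force simp: bounded_iff)
  have i: "integrable lebesgue (\<lambda>x. indicator K x *\<^sub>R f x)"
    using f K unfolding locally_integrable_def set_integrable_def by blast
  have pm: "p \<in> borel_measurable lebesgue" using p by (simp add: borel_measurable_continuous_onI measurable_completion)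
  show "(\<lambda>x. p x * f x) absolutely_integrable_on K"
    unfolding set_integrable_def
  proof (rule Bochner_Integration.integrable_bound)
    show "integrable lebesgue (\<lambda>x. C * (indicator K x *\<^sub>R f x))" using i by (rule integrable_mult_right)
    have "(\<lambda>x. p x * (indicator K x *\<^sub>R f x)) \<in> borel_measurable lebesgue"
      using pm borel_measurable_integrable[OF i] by (rule borel_measurable_times)
    then show "(\<lambda>x. indicator K x *\<^sub>R (p x * f x)) \<in> borel_measurable lebesgue" by (simp add: mult.left_commute)
    show "AE x in lebesgue. norm (indicator K x *\<^sub>R (p x * f x)) \<le> norm (C * (indicator K x *\<^sub>R f x))"
    proof (rule AE_I2)
      fix x show "norm (indicator K x *\<^sub>R (p x * f x)) \<le> norm (C * (indicator K x *\<^sub>R f x))"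
        using order_trans[OF C[of x] abs_ge_self] by (cases "x \<in> K") (auto simp: abs_mult mult_right_mono)
    qed
  qed
qed

section \<open>Weak derivatives along words of coordinates\<close>

lemma integral_cong_on_test:
  assumes \<Omega>: "open \<Omega>" and f: "locally_integrable \<Omega> f" and g: "locally_integrable \<Omega> g"
    and AE: "AE x in lebesgue. x \<in> \<Omega> \<longrightarrow> f x = g x" and \<phi>: "\<phi> \<in> test_functions \<Omega>"
  shows "integral\<^sup>L lebesgue (\<lambda>x. f x * \<phi> x) = integral\<^sup>L lebesgue (\<lambda>x. g x * \<phi> x)"
proof (rule integral_cong_AE)
  obtain K where K: "K \<subseteq> \<Omega>" "\<And>x. x \<notin> K \<Longrightarrow> \<phi> x = 0"
    using test_functionsE[OF \<phi>] by metis
  show "AE x in lebesgue. f x * \<phi> x = g x * \<phi> x"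
    using AE
  proof eventually_elim
    case (elim x)
    then show ?case using K by (cases "x \<in> \<Omega>") auto
  qed
qed (use integrable_test_mult[OF f \<phi>] integrable_test_mult[OF g \<phi>] in auto)

text \<open>Words replace multi-indices, and local integrability is kept separate, so that
  derivatives can be appended or removed one letter at a time.\<close>

definition weak_list :: "(real ^ 'n::finite) set \<Rightarrow> 'n list \<Rightarrow> (real ^ 'n \<Rightarrow> real) \<Rightarrow> (real ^ 'n \<Rightarrow> real) \<Rightarrow> bool" where
  "weak_list \<Omega> is f g \<longleftrightarrow> (\<forall>\<phi>\<in>test_functions \<Omega>.
     integral\<^sup>L lebesgue (\<lambda>x. f x * foldr partial_deriv is \<phi> x) = (-1) ^ length is * integral\<^sup>L lebesgue (\<lambda>x. g x * \<phi> x))"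

lemma weak_listD:
  "weak_list \<Omega> is f g \<Longrightarrow> \<phi> \<in> test_functions \<Omega> \<Longrightarrow>
    integral\<^sup>L lebesgue (\<lambda>x. f x * foldr partial_deriv is \<phi> x) = (-1) ^ length is * integral\<^sup>L lebesgue (\<lambda>x. g x * \<phi> x)"
  unfolding weak_list_def by blast

lemma has_weak_deriv_iff:
  fixes \<gamma> :: "'n::finite \<Rightarrow> nat"
  assumes "\<Omega> \<in> sets lebesgue" "mset is = mset (multi_list \<gamma>)"
  shows "has_weak_deriv \<Omega> \<gamma> f g \<longleftrightarrow> locally_integrable \<Omega> f \<and> locally_integrable \<Omega> g \<and> weak_list \<Omega> is f g"
proof -
  have len: "sum \<gamma> UNIV = length is" using assms(2) length_multi_list[of \<gamma>] by (metis size_mset)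
  have "multi_deriv \<gamma> \<phi> = foldr partial_deriv is \<phi>" if "\<phi> \<in> test_functions \<Omega>" for \<phi>
    unfolding multi_deriv_list using foldr_partial_deriv_mset[OF test_smooth[OF that] assms(2)] by simp
  then show ?thesis
    unfolding has_weak_deriv_def weak_list_def
    using assms(1) by (simp add: len integral_lebesgue_on_test test_foldr)
qed

lemma weak_list_unique:
  assumes "open \<Omega>" "locally_integrable \<Omega> g" "locally_integrable \<Omega> h"
    and g: "weak_list \<Omega> is f g" and h: "weak_list \<Omega> is f h"
  shows "AE x in lebesgue. x \<in> \<Omega> \<longrightarrow> g x = h x"
proof -
  have "AE x in lebesgue. x \<in> \<Omega> \<longrightarrow> g x + (- 1) * h x = 0"
  proof (rule fundamental_lemma[OF assms(1)])
    show "locally_integrable \<Omega> (\<lambda>x. g x + (- 1) * h x)"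
      by (intro locally_integrable_add locally_integrable_mult assms continuous_intros)
    fix \<phi> assume \<phi>: "\<phi> \<in> test_functions \<Omega>"
    have "(-1) ^ length is * integral\<^sup>L lebesgue (\<lambda>x. g x * \<phi> x) = (-1) ^ length is * integral\<^sup>L lebesgue (\<lambda>x. h x * \<phi> x)"
      using weak_listD[OF g \<phi>] weak_listD[OF h \<phi>] by simp
    then have "integral\<^sup>L lebesgue (\<lambda>x. g x * \<phi> x) = integral\<^sup>L lebesgue (\<lambda>x. h x * \<phi> x)" by simp
    moreover have "integrable lebesgue (\<lambda>x. g x * \<phi> x)" "integrable lebesgue (\<lambda>x. h x * \<phi> x)"
      using integrable_test_mult assms(2,3) \<phi> by blast+
    ultimately show "integral\<^sup>L lebesgue (\<lambda>x. (g x + (- 1) * h x) * \<phi> x) = 0"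
      by (simp add: left_diff_distrib)
  qed
  then show ?thesis by eventually_elim auto
qed

lemma weak_list_Cons:
  assumes f: "weak_list \<Omega> is f g" and g: "weak_list \<Omega> [i] g h"
  shows "weak_list \<Omega> (i # is) f h"
  unfolding weak_list_def
proof
  fix \<phi> assume \<phi>: "\<phi> \<in> test_functions \<Omega>"
  have "foldr partial_deriv (i # is) \<phi> = foldr partial_deriv is (partial_deriv i \<phi>)"
    using foldr_partial_deriv_commute[OF test_smooth[OF \<phi>]] by simp
  then have "integral\<^sup>L lebesgue (\<lambda>x. f x * foldr partial_deriv (i # is) \<phi> x) = (-1) ^ length is * integral\<^sup>L lebesgue (\<lambda>x. g x * partial_deriv i \<phi> x)"
    using weak_listD[OF f test_partial_deriv[OF \<phi>]] by simp
  also have "integral\<^sup>L lebesgue (\<lambda>x. g x * partial_deriv i \<phi> x) = - integral\<^sup>L lebesgue (\<lambda>x. h x * \<phi> x)"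
    using weak_listD[OF g \<phi>] by simp
  finally show "integral\<^sup>L lebesgue (\<lambda>x. f x * foldr partial_deriv (i # is) \<phi> x) = (-1) ^ length (i # is) * integral\<^sup>L lebesgue (\<lambda>x. h x * \<phi> x)"
    by simp
qed

text \<open>Testing with \<open>partial_deriv i \<phi>\<close> turns the family of weak derivatives
  of \<open>f\<close> supplied by a Sobolev space into a chain in which each member is a first weak
  derivative of the preceding one.\<close>

lemma weak_list_split:
  assumes "weak_list \<Omega> is f g" "weak_list \<Omega> (i # is) f h"
  shows "weak_list \<Omega> [i] g h"
  unfolding weak_list_def
proof
  fix \<phi> assume \<phi>: "\<phi> \<in> test_functions \<Omega>"
  have "foldr partial_deriv (i # is) \<phi> = foldr partial_deriv is (partial_deriv i \<phi>)"
    using foldr_partial_deriv_commute[OF test_smooth[OF \<phi>]] by simp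
  then have "(-1) ^ length is * integral\<^sup>L lebesgue (\<lambda>x. g x * partial_deriv i \<phi> x) = (-1) ^ length (i # is) * integral\<^sup>L lebesgue (\<lambda>x. h x * \<phi> x)"
    using weak_listD[OF assms(1) test_partial_deriv[OF \<phi>]] weak_listD[OF assms(2) \<phi>] by simp
  then have "(-1) ^ length is * integral\<^sup>L lebesgue (\<lambda>x. g x * partial_deriv i \<phi> x) = (-1) ^ length is * (- integral\<^sup>L lebesgue (\<lambda>x. h x * \<phi> x))"
    by simp
  then have "integral\<^sup>L lebesgue (\<lambda>x. g x * partial_deriv i \<phi> x) = - integral\<^sup>L lebesgue (\<lambda>x. h x * \<phi> x)"
    by (subst (asm) mult_cancel_left) auto
  then show "integral\<^sup>L lebesgue (\<lambda>x. g x * foldr partial_deriv [i] \<phi> x) = (-1) ^ length [i] * integral\<^sup>L lebesgue (\<lambda>x. h x * \<phi> x)"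
    by simp
qed

lemma weak_list_mono: "weak_list \<Omega> is f g \<Longrightarrow> \<Omega>' \<subseteq> \<Omega> \<Longrightarrow> weak_list \<Omega>' is f g"
  unfolding weak_list_def using test_mono by blast

lemma weak_list_cong:
  assumes "open \<Omega>" "locally_integrable \<Omega> f" "locally_integrable \<Omega> f'" "locally_integrable \<Omega> g" "locally_integrable \<Omega> g'"
    and "AE x in lebesgue. x \<in> \<Omega> \<longrightarrow> f x = f' x" "AE x in lebesgue. x \<in> \<Omega> \<longrightarrow> g x = g' x" "weak_list \<Omega> is f g"
  shows "weak_list \<Omega> is f' g'"
  unfolding weak_list_def
proof
  fix \<phi> assume \<phi>: "\<phi> \<in> test_functions \<Omega>"
  show "integral\<^sup>L lebesgue (\<lambda>x. f' x * foldr partial_deriv is \<phi> x) = (-1) ^ length is * integral\<^sup>L lebesgue (\<lambda>x. g' x * \<phi> x)"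
    using weak_listD[OF assms(8) \<phi>] integral_cong_on_test[OF assms(1-3,6) test_foldr[OF \<phi>, of "is"]]
      integral_cong_on_test[OF assms(1,4,5,7) \<phi>] by simp
qed

lemma weak_list_mult:
  assumes f: "locally_integrable \<Omega> f" and g: "locally_integrable \<Omega> g" and p: "smooth p" and w: "weak_list \<Omega> [i] f g"
  shows "weak_list \<Omega> [i] (\<lambda>x. p x * f x) (\<lambda>x. partial_deriv i p x * f x + p x * g x)"
  unfolding weak_list_def
proof
  fix \<phi> assume \<phi>: "\<phi> \<in> test_functions \<Omega>"
  have p\<phi>: "(\<lambda>x. p x * \<phi> x) \<in> test_functions \<Omega>" by (rule test_mult[OF p \<phi>])
  have dp\<phi>: "(\<lambda>x. partial_deriv i p x * \<phi> x) \<in> test_functions \<Omega>" by (rule test_mult[OF smooth_partial_deriv[OF p] \<phi>])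
  have pd\<phi>: "(\<lambda>x. p x * partial_deriv i \<phi> x) \<in> test_functions \<Omega>" by (rule test_mult[OF p test_partial_deriv[OF \<phi>]])
  have "partial_deriv i (\<lambda>x. p x * \<phi> x) = (\<lambda>x. p x * partial_deriv i \<phi> x + partial_deriv i p x * \<phi> x)"
    by (intro partial_deriv_mult smooth_differentiable p test_smooth[OF \<phi>])
  then have "integral\<^sup>L lebesgue (\<lambda>x. f x * (p x * partial_deriv i \<phi> x) + f x * (partial_deriv i p x * \<phi> x)) = - integral\<^sup>L lebesgue (\<lambda>x. g x * (p x * \<phi> x))"
    using weak_listD[OF w p\<phi>] by (simp add: distrib_left)
  then have "integral\<^sup>L lebesgue (\<lambda>x. f x * (p x * partial_deriv i \<phi> x)) + integral\<^sup>L lebesgue (\<lambda>x. f x * (partial_deriv i p x * \<phi> x)) = - integral\<^sup>L lebesgue (\<lambda>x. g x * (p x * \<phi> x))"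
    using integrable_test_mult[OF f pd\<phi>] integrable_test_mult[OF f dp\<phi>] by simp
  moreover have "integral\<^sup>L lebesgue (\<lambda>x. (partial_deriv i p x * f x + p x * g x) * \<phi> x)
     = integral\<^sup>L lebesgue (\<lambda>x. f x * (partial_deriv i p x * \<phi> x)) + integral\<^sup>L lebesgue (\<lambda>x. g x * (p x * \<phi> x))"
    using integrable_test_mult[OF f dp\<phi>] integrable_test_mult[OF g p\<phi>]
    by (subst Bochner_Integration.integral_add[symmetric]) (auto simp: algebra_simps)
  moreover have "integral\<^sup>L lebesgue (\<lambda>x. p x * f x * partial_deriv i \<phi> x) = integral\<^sup>L lebesgue (\<lambda>x. f x * (p x * partial_deriv i \<phi> x))"
    by (simp add: mult_ac)
  ultimately show "integral\<^sup>L lebesgue (\<lambda>x. p x * f x * foldr partial_deriv [i] \<phi> x) = (-1) ^ length [i] * integral\<^sup>L lebesgue (\<lambda>x. (partial_deriv i p x * f x + p x * g x) * \<phi> x)"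
    by simp
qed

lemma weak_list_zero: "weak_list \<Omega> is (\<lambda>x. 0) (\<lambda>x. 0)"
  by (simp add: weak_list_def)

lemma weak_list_add:
  assumes "locally_integrable \<Omega> f" "locally_integrable \<Omega> g" "locally_integrable \<Omega> f'" "locally_integrable \<Omega> g'"
    and "weak_list \<Omega> is f g" "weak_list \<Omega> is f' g'"
  shows "weak_list \<Omega> is (\<lambda>x. f x + f' x) (\<lambda>x. g x + g' x)"
  unfolding weak_list_def
proof
  fix \<phi> assume \<phi>: "\<phi> \<in> test_functions \<Omega>"
  note d = test_foldr[OF \<phi>, of "is"]
  show "integral\<^sup>L lebesgue (\<lambda>x. (f x + f' x) * foldr partial_deriv is \<phi> x) = (-1) ^ length is * integral\<^sup>L lebesgue (\<lambda>x. (g x + g' x) * \<phi> x)"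
    using weak_listD[OF assms(5) \<phi>] weak_listD[OF assms(6) \<phi>]
      integrable_test_mult[OF assms(1) d] integrable_test_mult[OF assms(3) d]
      integrable_test_mult[OF assms(2) \<phi>] integrable_test_mult[OF assms(4) \<phi>]
    by (simp add: distrib_left distrib_right)
qed

lemma weak_list_sum:
  assumes "\<And>a. a \<in> A \<Longrightarrow> locally_integrable \<Omega> (f a)" "\<And>a. a \<in> A \<Longrightarrow> locally_integrable \<Omega> (g a)"
    and "\<And>a. a \<in> A \<Longrightarrow> weak_list \<Omega> is (f a) (g a)"
  shows "weak_list \<Omega> is (\<lambda>x. \<Sum>a\<in>A. f a x) (\<lambda>x. \<Sum>a\<in>A. g a x)"
  using assms
proof (induction A rule: infinite_finite_induct)
  case (insert a A)
  then have "weak_list \<Omega> is (\<lambda>x. f a x + (\<Sum>a\<in>A. f a x)) (\<lambda>x. g a x + (\<Sum>a\<in>A. g a x))"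
    by (intro weak_list_add locally_integrable_sum) auto
  then show ?case using insert by simp
qed (auto simp: weak_list_zero)

text \<open>\<open>weak_deriv\<close> is a choice; by uniqueness almost everywhere it may be
  replaced in the norm by any derivatives that can be exhibited.\<close>

lemma sobolev_characterization:
  assumes \<Omega>: "open \<Omega>" and f: "f \<in> L2 \<Omega>"
    and g: "\<And>\<gamma>. sum \<gamma> UNIV \<le> k \<Longrightarrow> g \<gamma> \<in> L2 \<Omega> \<and> has_weak_deriv \<Omega> \<gamma> f (g \<gamma>)"
  shows "f \<in> sobolev k \<Omega>"
    and "ennreal ((sobolev_norm k \<Omega> f)\<^sup>2) = (\<Sum>\<gamma> | sum \<gamma> UNIV \<le> k. sq_int \<Omega> (g \<gamma>))"
proof -
  have \<Omega>s: "\<Omega> \<in> sets lebesgue" using \<Omega> by (metis borel_open sets_completionI_sets sets_lborel)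
  show "f \<in> sobolev k \<Omega>" using f g unfolding sobolev_def by blast
  have wd: "ennreal ((L2_norm \<Omega> (weak_deriv \<Omega> \<gamma> f))\<^sup>2) = sq_int \<Omega> (g \<gamma>)" if "sum \<gamma> UNIV \<le> k" for \<gamma>
  proof -
    have w: "has_weak_deriv \<Omega> \<gamma> f (weak_deriv \<Omega> \<gamma> f)"
      unfolding weak_deriv_def using g[OF that] by (metis someI)
    have AE: "AE x in lebesgue. x \<in> \<Omega> \<longrightarrow> g \<gamma> x = weak_deriv \<Omega> \<gamma> f x"
      using w g[OF that] has_weak_deriv_iff[OF \<Omega>s refl, of \<gamma>] by (intro weak_list_unique[OF \<Omega>, of _ _ "multi_list \<gamma>" f]) auto
    show ?thesis
      using L2_norm_eq[OF \<Omega>s L2_cong_AE[OF \<Omega>s AE conjunct1[OF g[OF that]]]] sq_int_cong_AE[OF AE] by simp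
  qed
  have "ennreal ((sobolev_norm k \<Omega> f)\<^sup>2) = ennreal (\<Sum>\<gamma> | sum \<gamma> UNIV \<le> k. (L2_norm \<Omega> (weak_deriv \<Omega> \<gamma> f))\<^sup>2)"
    unfolding sobolev_norm_def by (simp add: sum_nonneg)
  also have "\<dots> = (\<Sum>\<gamma> | sum \<gamma> UNIV \<le> k. ennreal ((L2_norm \<Omega> (weak_deriv \<Omega> \<gamma> f))\<^sup>2))"
    by (rule sum_ennreal[symmetric]) auto
  also have "\<dots> = (\<Sum>\<gamma> | sum \<gamma> UNIV \<le> k. sq_int \<Omega> (g \<gamma>))"
    using wd by (intro sum.cong) auto
  finally show "ennreal ((sobolev_norm k \<Omega> f)\<^sup>2) = (\<Sum>\<gamma> | sum \<gamma> UNIV \<le> k. sq_int \<Omega> (g \<gamma>))" .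
qed

lemma sobolev_norm_ge:
  assumes "open \<Omega>" "f \<in> sobolev k \<Omega>" "sum \<gamma> UNIV \<le> k" "g \<in> L2 \<Omega>" "has_weak_deriv \<Omega> \<gamma> f g"
  shows "sq_int \<Omega> g \<le> ennreal ((sobolev_norm k \<Omega> f)\<^sup>2)"
proof -
  have "\<forall>\<gamma>. \<exists>h. sum \<gamma> UNIV \<le> k \<longrightarrow> h \<in> L2 \<Omega> \<and> has_weak_deriv \<Omega> \<gamma> f h"
    using assms(2) unfolding sobolev_def by blast
  then obtain h where h: "\<And>\<gamma>. sum \<gamma> UNIV \<le> k \<Longrightarrow> h \<gamma> \<in> L2 \<Omega> \<and> has_weak_deriv \<Omega> \<gamma> f (h \<gamma>)" by metis
  \<comment> \<open>The norm may be computed with any family of derivatives, so the given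
    \<open>g\<close> is put into the family at its index.\<close>
  define h' where "h' = h(\<gamma> := g)"
  have h': "h' \<gamma> \<in> L2 \<Omega> \<and> has_weak_deriv \<Omega> \<gamma> f (h' \<gamma>)" if "sum \<gamma> UNIV \<le> k" for \<gamma>
    using h[OF that] assms(4,5) by (auto simp: h'_def)
  have "sq_int \<Omega> g \<le> (\<Sum>\<gamma> | sum \<gamma> UNIV \<le> k. sq_int \<Omega> (h' \<gamma>))"
    using assms(3) finite_multi_indices[of k] member_le_sum[of \<gamma> "{\<gamma>. sum \<gamma> UNIV \<le> k}" "\<lambda>\<gamma>. sq_int \<Omega> (h' \<gamma>)"]
    by (simp add: h'_def)
  then show ?thesis
    using sobolev_characterization(2)[OF assms(1) _ h'] assms(2) unfolding sobolev_def by simp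
qed

lemma sobolev_scale:
  assumes \<Omega>: "open \<Omega>" and f: "f \<in> sobolev k \<Omega>" and f': "\<And>x. x \<in> \<Omega> \<Longrightarrow> f' x = c * f x"
  shows "f' \<in> sobolev k \<Omega>" "sobolev_norm k \<Omega> f' = \<bar>c\<bar> * sobolev_norm k \<Omega> f"
proof -
  have \<Omega>s: "\<Omega> \<in> sets lebesgue" using \<Omega> by (metis borel_open sets_completionI_sets sets_lborel)
  have cL: "h \<in> L2 \<Omega> \<Longrightarrow> (\<lambda>x. c * h x) \<in> L2 \<Omega>" for h
    by (auto simp: L2_def power_mult_distrib)
  have sq: "sq_int \<Omega> (\<lambda>x. c * h x) = ennreal (c\<^sup>2) * sq_int \<Omega> h" if "h \<in> L2 \<Omega>" for h
    unfolding sq_int_def using borel_measurable_integrable[OF L2_integrable_sq[OF \<Omega>s that]]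
    by (subst nn_integral_cmult[symmetric]) (auto simp: power_mult_distrib ennreal_mult'[symmetric] mult_ac)
  have "\<forall>\<gamma>. \<exists>h. sum \<gamma> UNIV \<le> k \<longrightarrow> h \<in> L2 \<Omega> \<and> has_weak_deriv \<Omega> \<gamma> f h"
    using f unfolding sobolev_def by blast
  then obtain h where h: "\<And>\<gamma>. sum \<gamma> UNIV \<le> k \<Longrightarrow> h \<gamma> \<in> L2 \<Omega> \<and> has_weak_deriv \<Omega> \<gamma> f (h \<gamma>)" by metis
  have fL: "f \<in> L2 \<Omega>" using f by (simp add: sobolev_def)
  have AE: "AE x in lebesgue. x \<in> \<Omega> \<longrightarrow> c * f x = f' x" using f' by auto
  have f'L: "f' \<in> L2 \<Omega>" by (rule L2_cong_AE[OF \<Omega>s AE cL[OF fL]])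
  have h': "(\<lambda>x. c * h \<gamma> x) \<in> L2 \<Omega> \<and> has_weak_deriv \<Omega> \<gamma> f' (\<lambda>x. c * h \<gamma> x)" if "sum \<gamma> UNIV \<le> k" for \<gamma>
  proof
    show 1: "(\<lambda>x. c * h \<gamma> x) \<in> L2 \<Omega>" using cL h[OF that] by blast
    have "weak_list \<Omega> (multi_list \<gamma>) f (h \<gamma>)"
      using h[OF that] has_weak_deriv_iff[OF \<Omega>s refl, of \<gamma>] by blast
    then have "weak_list \<Omega> (multi_list \<gamma>) (\<lambda>x. c * f x) (\<lambda>x. c * h \<gamma> x)"
      unfolding weak_list_def by (simp add: mult.assoc)
    then have "weak_list \<Omega> (multi_list \<gamma>) f' (\<lambda>x. c * h \<gamma> x)"
      by (rule weak_list_cong[OF \<Omega> _ _ _ _ AE, rotated 5]) (auto intro!: L2_locally_integrable[OF \<Omega>s] 1 f'L cL[OF fL])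
    then show "has_weak_deriv \<Omega> \<gamma> f' (\<lambda>x. c * h \<gamma> x)"
      using has_weak_deriv_iff[OF \<Omega>s refl, of \<gamma>] L2_locally_integrable[OF \<Omega>s] 1 f'L by blast
  qed
  show "f' \<in> sobolev k \<Omega>" by (rule sobolev_characterization(1)[OF \<Omega> f'L h'])
  have A: "ennreal ((sobolev_norm k \<Omega> f')\<^sup>2) = (\<Sum>\<gamma> | sum \<gamma> UNIV \<le> k. sq_int \<Omega> (\<lambda>x. c * h \<gamma> x))"
    by (rule sobolev_characterization(2)[OF \<Omega> f'L h'])
  have B: "ennreal ((sobolev_norm k \<Omega> f)\<^sup>2) = (\<Sum>\<gamma> | sum \<gamma> UNIV \<le> k. sq_int \<Omega> (h \<gamma>))"
    by (rule sobolev_characterization(2)[OF \<Omega> fL h])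
  have "ennreal ((sobolev_norm k \<Omega> f')\<^sup>2) = ennreal (c\<^sup>2) * ennreal ((sobolev_norm k \<Omega> f)\<^sup>2)"
    unfolding A B sum_distrib_left using sq h by (intro sum.cong) auto
  also have "\<dots> = ennreal ((\<bar>c\<bar> * sobolev_norm k \<Omega> f)\<^sup>2)"
    by (simp add: ennreal_mult'[symmetric] power_mult_distrib)
  finally have "(sobolev_norm k \<Omega> f')\<^sup>2 = (\<bar>c\<bar> * sobolev_norm k \<Omega> f)\<^sup>2" by simp
  moreover have "sobolev_norm k \<Omega> h \<ge> 0" for h by (simp add: sobolev_norm_def sum_nonneg)
  ultimately show "sobolev_norm k \<Omega> f' = \<bar>c\<bar> * sobolev_norm k \<Omega> f"
    by (simp add: power2_eq_iff_nonneg)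
qed

subsection \<open>Jets of radial functions\<close>

text \<open>The formal derivative along \<open>\<mu>\<close>, with \<open>W j\<close> in place of
  the \<open>j\<close>-th profile derivative. For a nonempty word the coefficient of
  \<open>W 0\<close> is 0, so words ending in \<open>l\<close> describe derivatives of
  \<open>2 x_l W 1 (|x|^2)\<close> whether or not \<open>W 0\<close> is a primitive of
  \<open>W 1\<close>.\<close>

definition radial_jet :: "(nat \<Rightarrow> real \<Rightarrow> real) \<Rightarrow> 'n::finite list \<Rightarrow> real ^ 'n \<Rightarrow> real" where
  "radial_jet W \<mu> x = (\<Sum>j\<le>length \<mu>. coef \<mu> j x * W j (x \<bullet> x))"

lemma radial_jet_borel:
  assumes "\<And>j. W j \<in> borel_measurable borel"
  shows "radial_jet W \<mu> \<in> borel_measurable borel"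
proof -
  have [measurable]: "W j \<in> borel_measurable borel" "coef \<mu> j \<in> borel_measurable borel" for j
    using assms smooth_borel[OF coef_smooth] by auto
  show ?thesis unfolding radial_jet_def[abs_def] by measurable
qed

lemma radial_jet_locally_integrable:
  assumes R: "R > 0" and W: "\<And>j. loc1 (R\<^sup>2) (W j)"
  shows "locally_integrable (ball 0 R - {0}) (radial_jet W \<mu>)"
  unfolding radial_jet_def[abs_def]
  by (intro locally_integrable_sum locally_integrable_radial[OF W R] smooth_continuous coef_smooth)

lemma weak_list_radial:
  assumes "ac_deriv (R\<^sup>2) U V" "R > 0"
  shows "weak_list (ball 0 R - {0}) [i] (\<lambda>x. U (x \<bullet> x)) (\<lambda>x. 2 * x $ i * V (x \<bullet> x))"
  unfolding weak_list_def by (auto simp: weak_deriv_radial[OF assms])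

text \<open>Product rule for each summand, followed by the recursion of \<open>coef\<close>.
  Summands with \<open>j < q\<close> have coefficient 0, so the \<open>W j\<close> have to be linked
  by \<open>ac_deriv\<close> only from \<open>q\<close> on.\<close>

lemma radial_jet_weak_deriv:
  fixes \<mu> :: "'n::finite list"
  assumes R: "R > 0" and W: "\<And>j. loc1 (R\<^sup>2) (W j)" and q: "q \<le> 1" "q \<le> length \<mu>"
    and ac: "\<And>j. q \<le> j \<Longrightarrow> j \<le> length \<mu> \<Longrightarrow> ac_deriv (R\<^sup>2) (W j) (W (Suc j))"
  shows "weak_list (ball 0 R - {0}) [i] (radial_jet W \<mu>) (radial_jet W (i # \<mu>))"
proof -
  let ?P = "ball 0 R - {0} :: (real ^ 'n) set"
  have loc: "locally_integrable ?P (\<lambda>x. p x * W j (x \<bullet> x))" if "smooth p" for p j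
    by (intro locally_integrable_radial[OF W R] smooth_continuous that)
  have loc1: "locally_integrable ?P (\<lambda>x. W j (x \<bullet> x))" for j
    using loc[OF smooth_const[of 1], of j] by simp
  have "weak_list ?P [i] (\<lambda>x. coef \<mu> j x * W j (x \<bullet> x))
      (\<lambda>x. partial_deriv i (coef \<mu> j) x * W j (x \<bullet> x) + coef \<mu> j x * (2 * x $ i * W (Suc j) (x \<bullet> x)))"
    if j: "j \<le> length \<mu>" for j
  proof (cases "q \<le> j")
    case True
    show ?thesis
      by (rule weak_list_mult[OF loc1 loc coef_smooth weak_list_radial[OF ac[OF True j] R]])
        (intro smooth_mult smooth_const smooth_nth)
  next
    case False
    then have "coef \<mu> j = (\<lambda>x. 0)" using q by (intro coef_low) auto
    then show ?thesis by (simp add: weak_list_zero)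
  qed
  then have "weak_list ?P [i] (\<lambda>x. \<Sum>j\<le>length \<mu>. coef \<mu> j x * W j (x \<bullet> x))
      (\<lambda>x. \<Sum>j\<le>length \<mu>. partial_deriv i (coef \<mu> j) x * W j (x \<bullet> x) + coef \<mu> j x * (2 * x $ i * W (Suc j) (x \<bullet> x)))"
  proof (intro weak_list_sum)
    fix j
    have "locally_integrable ?P (\<lambda>x. partial_deriv i (coef \<mu> j) x * W j (x \<bullet> x) + coef \<mu> j x * (2 * x $ i) * W (Suc j) (x \<bullet> x))"
      by (intro locally_integrable_add loc smooth_partial_deriv smooth_mult coef_smooth smooth_const smooth_nth)
    then show "locally_integrable ?P (\<lambda>x. partial_deriv i (coef \<mu> j) x * W j (x \<bullet> x) + coef \<mu> j x * (2 * x $ i * W (Suc j) (x \<bullet> x)))"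
      by (simp add: mult.assoc)
  qed (auto intro: loc coef_smooth)
  moreover have "(\<Sum>j\<le>length \<mu>. partial_deriv i (coef \<mu> j) x * W j (x \<bullet> x) + coef \<mu> j x * (2 * x $ i * W (Suc j) (x \<bullet> x))) = radial_jet W (i # \<mu>) x" for x
  proof -
    have "radial_jet W (i # \<mu>) x = (\<Sum>j\<le>Suc (length \<mu>). partial_deriv i (coef \<mu> j) x * W j (x \<bullet> x))
      + (\<Sum>j\<le>Suc (length \<mu>). (if j = 0 then 0 else 2 * x $ i * coef \<mu> (j - 1) x) * W j (x \<bullet> x))"
      by (simp add: radial_jet_def distrib_right sum.distrib)
    also have "(\<Sum>j\<le>Suc (length \<mu>). partial_deriv i (coef \<mu> j) x * W j (x \<bullet> x)) = (\<Sum>j\<le>length \<mu>. partial_deriv i (coef \<mu> j) x * W j (x \<bullet> x))"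
      by (simp add: coef_high)
    also have "(\<Sum>j\<le>Suc (length \<mu>). (if j = 0 then 0 else 2 * x $ i * coef \<mu> (j - 1) x) * W j (x \<bullet> x))
      = (\<Sum>j\<le>length \<mu>. coef \<mu> j x * (2 * x $ i * W (Suc j) (x \<bullet> x)))"
      by (subst sum.atMost_Suc_shift) (simp add: mult_ac)
    finally show ?thesis by (simp add: sum.distrib)
  qed
  ultimately show ?thesis unfolding radial_jet_def[of W \<mu>, abs_def] by simp
qed

lemma AE_nonzero: "AE x in (lebesgue :: (real ^ 'n::finite) measure). x \<noteq> 0"
  using AE_lborel_singleton[of "0 :: real ^ 'n"] by (simp add: AE_completion_iff)

text \<open>On the punctured ball the jets are weak derivatives of each other; their square
  integrability carries this across the origin, one order at a time. \<open>q = 0\<close> is the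
  radial function itself, \<open>q = 1\<close> with \<open>lam = [l]\<close> a component of the
  form.\<close>

lemma radial_jet_sobolev:
  fixes lam :: "'n::finite list"
  assumes n: "CARD('n) \<ge> 2" and R: "R > 0" and W: "\<And>j. loc1 (R\<^sup>2) (W j)" and q: "q \<le> 1" "length lam = q"
    and ac: "\<And>j. q \<le> j \<Longrightarrow> j < q + k \<Longrightarrow> ac_deriv (R\<^sup>2) (W j) (W (Suc j))"
    and L2: "\<And>is. length is \<le> k \<Longrightarrow> radial_jet W (is @ lam) \<in> L2 (ball 0 R)"
    and f: "AE x in lebesgue. x \<in> ball 0 R \<longrightarrow> radial_jet W lam x = f x"
  shows "f \<in> sobolev k (ball 0 R)"
    and "ennreal ((sobolev_norm k (ball 0 R) f)\<^sup>2) = (\<Sum>\<gamma> | sum \<gamma> UNIV \<le> k. sq_int (ball 0 R) (radial_jet W (multi_list \<gamma> @ lam)))"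
proof -
  let ?B = "ball 0 R :: (real ^ 'n) set"
  have B: "?B \<in> sets lebesgue" by simp
  have w: "weak_list ?B is (radial_jet W lam) (radial_jet W (is @ lam))" if "length is \<le> k" for "is"
    using that
  proof (induction "is")
    case Nil show ?case by (simp add: weak_list_def)
  next
    case (Cons i "is")
    have "weak_list (?B - {0}) [i] (radial_jet W (is @ lam)) (radial_jet W (i # is @ lam))"
      using Cons.prems q by (intro radial_jet_weak_deriv[OF R W] ac) auto
    then have wP: "integral\<^sup>L lebesgue (\<lambda>x. radial_jet W (is @ lam) x * partial_deriv i \<phi> x) = - integral\<^sup>L lebesgue (\<lambda>x. radial_jet W (i # is @ lam) x * \<phi> x)"
      if "\<phi> \<in> test_functions (?B - {0})" for \<phi>
      using weak_listD[OF _ that, of "[i]"] by simp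
    have l1: "radial_jet W (is @ lam) \<in> L2 ?B" using Cons.prems by (intro L2) auto
    have l2: "radial_jet W (i # is @ lam) \<in> L2 ?B" using L2[of "i # is"] Cons.prems by simp
    have "weak_list ?B [i] (radial_jet W (is @ lam)) (radial_jet W (i # is @ lam))"
      unfolding weak_list_def
      using removable_origin[OF n L2_locally_integrable[OF B l1] L2_locally_integrable[OF B l2] L2_integrable_sq[OF B l1] wP]
      by simp
    from weak_list_Cons[OF Cons.IH this] Cons.prems show ?case by simp
  qed
  have L0: "radial_jet W lam \<in> L2 ?B" using L2[of "[]"] by simp
  have fL: "f \<in> L2 ?B" by (rule L2_cong_AE[OF B f L0])
  have "radial_jet W (multi_list \<gamma> @ lam) \<in> L2 ?B \<and> has_weak_deriv ?B \<gamma> f (radial_jet W (multi_list \<gamma> @ lam))"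
    if "sum \<gamma> UNIV \<le> k" for \<gamma>
  proof -
    have len: "length (multi_list \<gamma>) \<le> k" using that by (simp add: length_multi_list)
    have "weak_list ?B (multi_list \<gamma>) f (radial_jet W (multi_list \<gamma> @ lam))"
      by (rule weak_list_cong[OF _ _ _ _ _ f _ w[OF len]]) (auto intro!: L2_locally_integrable[OF B] L0 fL L2[OF len])
    then show ?thesis
      using has_weak_deriv_iff[OF B refl] L2[OF len] L2_locally_integrable[OF B] fL by blast
  qed
  from sobolev_characterization[OF open_ball fL this]
  show "f \<in> sobolev k (ball 0 R)"
    and "ennreal ((sobolev_norm k (ball 0 R) f)\<^sup>2) = (\<Sum>\<gamma> | sum \<gamma> UNIV \<le> k. sq_int (ball 0 R) (radial_jet W (multi_list \<gamma> @ lam)))"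
    by blast+
qed

subsection \<open>Recovering the derivatives of the profile\<close>

lemma weak1_add: "weak1 T U V \<Longrightarrow> weak1 T U' V' \<Longrightarrow> weak1 T (\<lambda>s. U s + U' s) (\<lambda>s. V s + V' s)"
  unfolding weak1_def
  by (auto simp: loc1_add distrib_right loc1_test1_integrable test1_deriv)

lemma weak1_cmult: "weak1 T U V \<Longrightarrow> weak1 T (\<lambda>s. c * U s) (\<lambda>s. c * V s)"
  unfolding weak1_def by (auto simp: loc1_cmult mult.assoc)

lemma weak1_zero: "weak1 T (\<lambda>s. 0) (\<lambda>s. 0)"
  by (simp add: weak1_def loc1_const)

lemma weak1_sum_ex:
  "(\<And>j. j \<in> A \<Longrightarrow> \<exists>V. weak1 T (U j) V) \<Longrightarrow> \<exists>V. weak1 T (\<lambda>s. \<Sum>j\<in>A. U j s) V"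
proof (induction A rule: infinite_finite_induct)
  case (insert a A)
  then obtain V V' where "weak1 T (U a) V" "weak1 T (\<lambda>s. \<Sum>j\<in>A. U j s) V'" by blast
  from weak1_add[OF this] show ?case using insert by auto
qed (auto intro: weak1_zero)

lemma loc1_cong:
  assumes U: "loc1 T U" and U': "U' \<in> borel_measurable borel" and eq: "\<And>s. 0 < s \<Longrightarrow> s < T \<Longrightarrow> U s = U' s"
  shows "loc1 T U'"
proof -
  have "set_integrable lborel {a..b} U'" if "0 < a" "b < T" for a b
  proof -
    have "(\<lambda>s. indicat_real {a..b} s *\<^sub>R U s) = (\<lambda>s. indicat_real {a..b} s *\<^sub>R U' s)"
      using eq that by (auto simp: indicator_def fun_eq_iff)
    then show ?thesis using loc1D[OF U that] by (simp add: set_integrable_def)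
  qed
  then show ?thesis using U' by (simp add: loc1_def)
qed

lemma weak1_cong:
  assumes w: "weak1 T U V" and U': "U' \<in> borel_measurable borel" and eq: "\<And>s. 0 < s \<Longrightarrow> s < T \<Longrightarrow> U s = U' s"
  shows "weak1 T U' V"
proof -
  have "U' s * deriv \<eta> s = U s * deriv \<eta> s" if \<eta>: "test1 T \<eta>" for \<eta> s
  proof -
    obtain a b where ab: "0 < a" "b < T" "\<And>s. s \<notin> {a..b} \<Longrightarrow> deriv \<eta> s = 0"
      by (rule test1E[OF test1_deriv[OF \<eta>]]) (rule that)
    show ?thesis using ab eq[of s] by (cases "s \<in> {a..b}") auto
  qed
  then have "(\<lambda>s. U' s * deriv \<eta> s) = (\<lambda>s. U s * deriv \<eta> s)" if "test1 T \<eta>" for \<eta>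
    using that by blast
  moreover have "loc1 T U'" using w by (intro loc1_cong[OF _ U' eq]) (auto simp: weak1_def)
  ultimately show ?thesis using w unfolding weak1_def by presburger
qed

text \<open>On a compact subinterval of the positive axis the density is bounded away from 0, so it
  can be divided out.\<close>

lemma loc1_of_radial:
  assumes R: "R > 0" and [measurable]: "g \<in> borel_measurable borel"
    and loc: "locally_integrable (ball 0 R - {0}) (\<lambda>x :: real ^ 'n::finite. g (x \<bullet> x))"
  shows "loc1 (R\<^sup>2) g"
  unfolding loc1_def
proof (intro conjI allI impI)
  fix a b :: real assume ab: "0 < a" "b < R\<^sup>2"
  let ?A = "{x :: real ^ 'n. x \<bullet> x \<in> {a..b}}"
  have sub: "?A \<subseteq> ball 0 R - {0}"
  proof
    fix x assume "x \<in> ?A"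
    then have "0 < x \<bullet> x \<and> x \<bullet> x < R\<^sup>2" using ab unfolding mem_Collect_eq atLeastAtMost_iff by linarith
    then show "x \<in> ball 0 R - {0}" using punctured_ball_iff[OF R] by blast
  qed
  have "set_integrable lebesgue ?A (\<lambda>x. g (x \<bullet> x))"
    using loc sub annulus_compact unfolding locally_integrable_def by blast
  moreover have "(\<lambda>x. indicator ?A x *\<^sub>R g (x \<bullet> x)) = (\<lambda>x. indicator {a..b} (x \<bullet> x) * g (x \<bullet> x))"
    by (auto simp: indicator_def)
  ultimately have "integrable lebesgue (\<lambda>x :: real ^ 'n. indicator {a..b} (x \<bullet> x) * g (x \<bullet> x))"
    by (simp add: set_integrable_def)
  then have "integrable (lborel :: (real ^ 'n) measure) (\<lambda>x. indicator {a..b} (x \<bullet> x) * g (x \<bullet> x))"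
    by (subst (asm) integrable_completion) auto
  then have i: "integrable lborel (\<lambda>s. radial_density TYPE('n) s * (indicator {a..b} s * g s))"
    by (subst (asm) integrable_radial[of "\<lambda>s. indicator {a..b} s * g s"]) auto
  have "continuous_on {a..b} (\<lambda>s. inverse (radial_const TYPE('n) * s powr (real CARD('n) / 2 - 1)))"
    using ab radial_const_pos[of "TYPE('n)"] by (intro continuous_intros) auto
  then obtain B where B: "\<And>s. s \<in> {a..b} \<Longrightarrow> \<bar>inverse (radial_const TYPE('n) * s powr (real CARD('n) / 2 - 1))\<bar> \<le> B"
    using continuous_bounded_Icc by metis
  have "integrable lborel (\<lambda>s. (radial_density TYPE('n) s * (indicator {a..b} s * g s)) * (indicator {a..b} s * inverse (radial_density TYPE('n) s)))"
  proof (rule integrable_mult_bounded1[of "{a..b}" _ _ B])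
    show "set_integrable lborel {a..b} (\<lambda>s. radial_density TYPE('n) s * (indicator {a..b} s * g s))"
      unfolding set_integrable_def by (rule integrable_mult_indicator[OF _ i]) simp
    show "\<bar>indicator {a..b} s * inverse (radial_density TYPE('n) s)\<bar> \<le> B" if "s \<in> {a..b}" for s
      using B[OF that] that ab by (simp add: radial_density_def)
  qed auto
  moreover have "(radial_density TYPE('n) s * (indicator {a..b} s * g s)) * (indicator {a..b} s * inverse (radial_density TYPE('n) s)) = indicator {a..b} s *\<^sub>R g s" for s
    using radial_density_pos[of s "TYPE('n)"] ab by (cases "s \<in> {a..b}") auto
  ultimately show "set_integrable lborel {a..b} g" by (simp add: set_integrable_def)
qed auto

abbreviation monom_list :: "'n::finite list \<Rightarrow> real ^ 'n \<Rightarrow> real" where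
  "monom_list \<mu> x \<equiv> prod_list (map (($) x) \<mu>)"

lemma smooth_monom_list: "smooth (monom_list \<mu>)"
  by (induction \<mu>) (auto intro: smooth_const smooth_mult smooth_nth)

text \<open>The choice \<open>y = x\<close> in \<open>coef_contract\<close> makes the contraction
  radial.\<close>

lemma contract_radial_jet:
  "(\<Sum>\<mu> | length \<mu> = M. monom_list \<mu> x * radial_jet W \<mu> x)
    = (\<Sum>j\<le>M. contr M j * 2 ^ (2 * j - M) * (x \<bullet> x) ^ j * W j (x \<bullet> x))"
proof -
  have "(\<Sum>\<mu> | length \<mu> = M. monom_list \<mu> x * radial_jet W \<mu> x)
    = (\<Sum>\<mu> | length \<mu> = M. \<Sum>j\<le>M. monom_list \<mu> x * coef \<mu> j x * W j (x \<bullet> x))"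
    by (intro sum.cong refl) (simp add: radial_jet_def sum_distrib_left mult.assoc)
  also have "\<dots> = (\<Sum>j\<le>M. (\<Sum>\<mu> | length \<mu> = M. monom_list \<mu> x * coef \<mu> j x) * W j (x \<bullet> x))"
    by (subst sum.swap) (simp add: sum_distrib_right)
  also have "\<dots> = (\<Sum>j\<le>M. contr M j * 2 ^ (2 * j - M) * (x \<bullet> x) ^ j * W j (x \<bullet> x))"
  proof (rule sum.cong[OF refl])
    fix j assume "j \<in> {..M}"
    show "(\<Sum>\<mu> | length \<mu> = M. monom_list \<mu> x * coef \<mu> j x) * W j (x \<bullet> x) = contr M j * 2 ^ (2 * j - M) * (x \<bullet> x) ^ j * W j (x \<bullet> x)"
    proof (cases "M \<le> 2 * j")
      case True
      then have "(x \<bullet> x) ^ j = (x \<bullet> x) ^ (2 * j - M) * (x \<bullet> x) ^ (M - j)"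
        using \<open>j \<in> {..M}\<close> by (simp flip: power_add)
      then show ?thesis by (simp add: coef_contract power_mult_distrib)
    qed (simp add: coef_contract contr_eq_0)
  qed
  finally show ?thesis .
qed

text \<open>
  If all jets of order \<open>M\<close> have weak gradients, then so does their contraction with \<open>x\<close>, which is
  radial; this determines \<open>(W\<^sub>M)'\<close> from the derivatives already known.
\<close>

lemma next_profile_derivative:
  fixes g :: "'n::finite \<Rightarrow> 'n list \<Rightarrow> real ^ 'n \<Rightarrow> real"
  assumes R: "R > 0" and W: "\<And>j. loc1 (R\<^sup>2) (W j)" and q: "q \<le> 1" "q \<le> M" "\<And>j. j < q \<Longrightarrow> W j = (\<lambda>_. 0)"
    and w: "\<And>j. q \<le> j \<Longrightarrow> j < M \<Longrightarrow> weak1 (R\<^sup>2) (W j) (W (Suc j))"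
    and g: "\<And>i \<mu>. length \<mu> = M \<Longrightarrow> locally_integrable (ball 0 R - {0}) (g i \<mu>)"
      "\<And>i \<mu>. length \<mu> = M \<Longrightarrow> weak_list (ball 0 R - {0}) [i] (radial_jet W \<mu>) (g i \<mu>)"
  obtains V where "weak1 (R\<^sup>2) (W M) V"
proof -
  let ?P = "ball 0 R - {0} :: (real ^ 'n) set"
  define c where "c j = contr M j * 2 ^ (2 * j - M)" for j
  define H where "H s = (\<Sum>j\<le>M. c j * (s powr real j * W j s))" for s
  have cM: "c M > 0" by (simp add: c_def contr_pos)
  have Wb: "W j \<in> borel_measurable borel" for j using W loc1_borel by blast
  have Hx: "(\<Sum>\<mu> | length \<mu> = M. monom_list \<mu> x * radial_jet W \<mu> x) = H (x \<bullet> x)" if "x \<noteq> 0" for x :: "real ^ 'n"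
    unfolding contract_radial_jet using that by (simp add: H_def c_def powr_realpow mult_ac)
  have Hloc: "loc1 (R\<^sup>2) H"
  proof -
    have "loc1 (R\<^sup>2) (\<lambda>s. \<Sum>j\<in>A. c j * (s powr real j * W j s))" for A
      by (induction A rule: infinite_finite_induct) (auto intro!: loc1_const loc1_add loc1_cmult loc1_powr W)
    then show ?thesis by (simp add: H_def[abs_def])
  qed
  define G where "G i x = (\<Sum>\<mu> | length \<mu> = M. partial_deriv i (monom_list \<mu>) x * radial_jet W \<mu> x + monom_list \<mu> x * g i \<mu> x)" for i x
  note jl = radial_jet_locally_integrable[OF R W]
  have Gt: "locally_integrable ?P (\<lambda>x. partial_deriv i (monom_list \<mu>) x * radial_jet W \<mu> x + monom_list \<mu> x * g i \<mu> x)"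
    if "length \<mu> = M" for i \<mu>
    by (intro locally_integrable_add locally_integrable_mult jl g that smooth_continuous smooth_partial_deriv smooth_monom_list)
  have Gl: "locally_integrable ?P (G i)" for i
    unfolding G_def[abs_def] by (intro locally_integrable_sum Gt) auto
  have Sl: "locally_integrable ?P (\<lambda>x. \<Sum>\<mu> | length \<mu> = M. monom_list \<mu> x * radial_jet W \<mu> x)"
    by (intro locally_integrable_sum locally_integrable_mult jl smooth_continuous smooth_monom_list)
  have HPl: "locally_integrable ?P (\<lambda>x. H (x \<bullet> x))"
    using locally_integrable_radial[OF Hloc R, of "\<lambda>_ :: real ^ 'n. 1"] by simp
  have "weak_list ?P [i] (\<lambda>x. \<Sum>\<mu> | length \<mu> = M. monom_list \<mu> x * radial_jet W \<mu> x) (G i)" for i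
    unfolding G_def[abs_def]
    by (intro weak_list_sum weak_list_mult Gt locally_integrable_mult jl g smooth_continuous smooth_monom_list) auto
  then have "weak_list ?P [i] (\<lambda>x. H (x \<bullet> x)) (G i)" for i
    by (rule weak_list_cong[rotated -1, OF _ _ Sl HPl Gl Gl]) (use Hx in auto)
  then have wH: "integral\<^sup>L lebesgue (\<lambda>x. H (x \<bullet> x) * partial_deriv i \<phi> x) = - integral\<^sup>L lebesgue (\<lambda>x. G i x * \<phi> x)"
    if "\<phi> \<in> test_functions ?P" for i \<phi>
    using weak_listD[OF _ that, of "[i]"] by simp
  obtain \<kappa> where \<kappa>: "weak1 (R\<^sup>2) H \<kappa>"
    by (rule weak_gradient_radial[OF R Hloc Gl wH]) auto
  have "\<exists>V. weak1 (R\<^sup>2) (\<lambda>s. - c j * (s powr real j * W j s)) V" if "j \<in> {..<M}" for j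
  proof (cases "q \<le> j")
    case True
    then show ?thesis using weak1_cmult[OF weak1_powr_mult[OF w[OF True]]] that by blast
  next
    case False
    then show ?thesis using q(3)[of j] weak1_zero by auto
  qed
  then have "\<exists>V. weak1 (R\<^sup>2) (\<lambda>s. \<Sum>j<M. - c j * (s powr real j * W j s)) V"
    by (rule weak1_sum_ex)
  then obtain V where V: "weak1 (R\<^sup>2) (\<lambda>s. \<Sum>j<M. - c j * (s powr real j * W j s)) V" ..
  \<comment> \<open>Removing the lower terms, whose weak derivatives are known, leaves
    \<open>c M * s^M * W M\<close>; multiplication by \<open>s^(-M) / c M\<close> isolates
    \<open>W M\<close>, with weak derivatives carried along by the product rule.\<close>
  have "weak1 (R\<^sup>2) (\<lambda>s. H s + (\<Sum>j<M. - c j * (s powr real j * W j s))) (\<lambda>s. \<kappa> s + V s)"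
    by (rule weak1_add[OF \<kappa> V])
  from weak1_cmult[OF weak1_powr_mult[OF this, of "- real M"], of "1 / c M"]
  obtain V' where V': "weak1 (R\<^sup>2) (\<lambda>s. 1 / c M * (s powr (- real M) * (H s + (\<Sum>j<M. - c j * (s powr real j * W j s))))) V'"
    by (rule that)
  have "weak1 (R\<^sup>2) (W M) V'"
  proof (rule weak1_cong[OF V' Wb])
    fix s :: real assume s: "0 < s"
    have "H s + (\<Sum>j<M. - c j * (s powr real j * W j s)) = c M * (s powr real M * W M s)"
      by (simp add: H_def lessThan_Suc_atMost[symmetric] sum_negf)
    then show "1 / c M * (s powr (- real M) * (H s + (\<Sum>j<M. - c j * (s powr real j * W j s)))) = W M s"
      using s cM by (simp add: powr_minus)
  qed
  then show ?thesis by (rule that)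
qed

lemma locally_integrable_cong_AE:
  assumes f: "locally_integrable \<Omega> f" and AE: "AE x in lebesgue. x \<in> \<Omega> \<longrightarrow> f x = g x"
  shows "locally_integrable \<Omega> g"
  unfolding locally_integrable_def
proof (intro allI impI)
  fix K assume K: "compact K \<and> K \<subseteq> \<Omega>"
  then have i: "integrable lebesgue (\<lambda>x. indicator K x *\<^sub>R f x)"
    using f unfolding locally_integrable_def set_integrable_def by blast
  have AE': "AE x in lebesgue. indicator K x *\<^sub>R f x = indicator K x *\<^sub>R g x"
    using AE by eventually_elim (use K in \<open>auto simp: indicator_def\<close>)
  then show "g absolutely_integrable_on K"
    unfolding set_integrable_def
    by (rule integrable_cong_AE_imp[OF i borel_measurable_AE[OF borel_measurable_integrable[OF i] AE'], rotated])
qed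

text \<open>Contracting the given components with \<open>x\<close> turns them into
  \<open>s^q U(s)\<close> times a positive constant, and the factor can be divided out away from the
  origin.\<close>

lemma loc1_profile:
  fixes f :: "'n::finite list \<Rightarrow> real ^ 'n \<Rightarrow> real"
  assumes R: "R > 0" and U: "U \<in> borel_measurable borel"
    and f: "\<And>\<mu>. length \<mu> = q \<Longrightarrow> locally_integrable (ball 0 R) (f \<mu>)"
      "\<And>\<mu>. length \<mu> = q \<Longrightarrow> AE x in lebesgue. x \<in> ball 0 R \<longrightarrow> f \<mu> x = coef \<mu> q x * U (x \<bullet> x)"
  shows "loc1 (R\<^sup>2) U"
proof -
  let ?P = "ball 0 R - {0} :: (real ^ 'n) set"
  define c where "c = contr q q * 2 ^ q"
  have c: "c > 0" by (simp add: c_def contr_pos)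
  define h where "h s = c * (s powr real q * U s)" for s
  have hb: "h \<in> borel_measurable borel" unfolding h_def using U by measurable
  have "locally_integrable ?P (\<lambda>x. \<Sum>\<mu> | length \<mu> = q. monom_list \<mu> x * f \<mu> x)"
    by (intro locally_integrable_sum locally_integrable_mult locally_integrable_mono[OF f(1)] smooth_continuous smooth_monom_list) auto
  moreover have "AE x in lebesgue. x \<in> ?P \<longrightarrow> (\<Sum>\<mu> | length \<mu> = q. monom_list \<mu> x * f \<mu> x) = h (x \<bullet> x)"
  proof -
    have "AE x in lebesgue. \<forall>\<mu>\<in>{\<mu>. length \<mu> = q}. x \<in> ball 0 R \<longrightarrow> f \<mu> x = coef \<mu> q x * U (x \<bullet> x)"
      using f(2) finite_lists_length[of q] by (subst AE_finite_all) auto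
    then show ?thesis
    proof eventually_elim
      case (elim x)
      show ?case
      proof
        assume x: "x \<in> ?P"
        then have "(\<Sum>\<mu> | length \<mu> = q. monom_list \<mu> x * f \<mu> x) = (\<Sum>\<mu> | length \<mu> = q. monom_list \<mu> x * coef \<mu> q x) * U (x \<bullet> x)"
          unfolding sum_distrib_right using elim by (intro sum.cong) auto
        also have "\<dots> = c * ((x \<bullet> x) ^ q * U (x \<bullet> x))"
          by (simp add: coef_contract c_def power_mult_distrib)
        finally show "(\<Sum>\<mu> | length \<mu> = q. monom_list \<mu> x * f \<mu> x) = h (x \<bullet> x)"
          using x by (simp add: h_def powr_realpow)
      qed
    qed
  qed
  ultimately have "locally_integrable ?P (\<lambda>x. h (x \<bullet> x))" by (rule locally_integrable_cong_AE)
  then have "loc1 (R\<^sup>2) h" by (rule loc1_of_radial[OF R hb])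
  then have "loc1 (R\<^sup>2) (\<lambda>s. 1 / c * (s powr (- real q) * h s))" by (intro loc1_cmult loc1_powr)
  then show ?thesis
    by (rule loc1_cong[OF _ U]) (use c in \<open>simp add: h_def powr_minus\<close>)
qed

text \<open>Induction on the order. The jets of length \<open>q + m\<close> agree with given weak
  derivatives, which for \<open>m < k\<close> have weak gradients themselves;
  \<open>next_profile_derivative\<close> then produces the next \<open>W\<close>, and uniqueness of
  weak derivatives identifies the jets of length \<open>q + m + 1\<close> with the given
  ones.\<close>

lemma sobolev_profile:
  fixes f :: "'n::finite list \<Rightarrow> real ^ 'n \<Rightarrow> real"
  assumes R: "R > 0" and q: "q \<le> 1" and U: "U \<in> borel_measurable borel"
    and f: "\<And>\<mu>. length \<mu> = q \<Longrightarrow> f \<mu> \<in> sobolev k (ball 0 R)"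
      "\<And>\<mu>. length \<mu> = q \<Longrightarrow> AE x in lebesgue. x \<in> ball 0 R \<longrightarrow> f \<mu> x = coef \<mu> q x * U (x \<bullet> x)"
  shows "\<exists>W. W q = U \<and> (\<forall>j. loc1 (R\<^sup>2) (W j)) \<and> (\<forall>j. q \<le> j \<longrightarrow> j < q + k \<longrightarrow> ac_deriv (R\<^sup>2) (W j) (W (Suc j))) \<and>
    (\<forall>is \<mu>. length is \<le> k \<longrightarrow> length \<mu> = q \<longrightarrow>
      sq_int (ball 0 R) (radial_jet W (is @ \<mu>)) \<le> ennreal ((sobolev_norm k (ball 0 R) (f \<mu>))\<^sup>2))"
proof -
  let ?B = "ball 0 R :: (real ^ 'n) set" and ?P = "ball 0 R - {0} :: (real ^ 'n) set"
  have B: "?B \<in> sets lebesgue" by simp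
  have oP: "open ?P" by auto
  \<comment> \<open>Weak derivatives are indexed by words through the multiset of letters; this
    makes consecutive ones available for \<open>weak_list_split\<close>.\<close>
  have "\<exists>g. length \<mu> = q \<longrightarrow> length is \<le> k \<longrightarrow> g \<in> L2 ?B \<and> has_weak_deriv ?B (count (mset is)) (f \<mu>) g" for \<mu> "is"
  proof (cases "length \<mu> = q \<and> length is \<le> k")
    case True
    then have "sum (count (mset is)) UNIV \<le> k" by (simp add: sum_count_mset)
    then have "\<exists>g\<in>L2 ?B. has_weak_deriv ?B (count (mset is)) (f \<mu>) g"
      using f(1)[of \<mu>] True unfolding sobolev_def by blast
    then show ?thesis by blast
  qed auto
  then obtain g where g: "\<And>\<mu> is. length \<mu> = q \<Longrightarrow> length is \<le> k \<Longrightarrow> g \<mu> is \<in> L2 ?B"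
    "\<And>\<mu> is. length \<mu> = q \<Longrightarrow> length is \<le> k \<Longrightarrow> has_weak_deriv ?B (count (mset is)) (f \<mu>) (g \<mu> is)" by metis
  have gl: "locally_integrable ?B (g \<mu> is)" and gw: "weak_list ?B is (f \<mu>) (g \<mu> is)"
    if "length \<mu> = q" "length is \<le> k" for \<mu> "is"
    using g(2)[OF that] has_weak_deriv_iff[OF B multi_list_count[symmetric], of "is"] by auto
  have fl: "locally_integrable ?B (f \<mu>)" if "length \<mu> = q" for \<mu>
    using f(1)[OF that] by (intro L2_locally_integrable[OF B]) (simp add: sobolev_def)
  have Uloc: "loc1 (R\<^sup>2) U" by (rule loc1_profile[OF R U fl f(2)])
  have "\<exists>W. W q = U \<and> (\<forall>j. loc1 (R\<^sup>2) (W j)) \<and> (\<forall>j<q. W j = (\<lambda>_. 0)) \<and>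
    (\<forall>j. q \<le> j \<longrightarrow> j < q + m \<longrightarrow> weak1 (R\<^sup>2) (W j) (W (Suc j))) \<and>
    (\<forall>is \<mu>. length is \<le> m \<longrightarrow> length \<mu> = q \<longrightarrow> (AE x in lebesgue. x \<in> ?B \<longrightarrow> radial_jet W (is @ \<mu>) x = g \<mu> is x))"
    if "m \<le> k" for m
    using that
  proof (induction m)
    case 0
    \<comment> \<open>Entries other than \<open>q\<close> are placeholders: those above
      \<open>q\<close> are overwritten one by one, those below stay 0.\<close>
    define W where "W j = (if j = q then U else (\<lambda>_. 0))" for j
    have "AE x in lebesgue. x \<in> ?B \<longrightarrow> radial_jet W \<mu> x = g \<mu> [] x" if \<mu>: "length \<mu> = q" for \<mu>
    proof -
      have "radial_jet W \<mu> x = coef \<mu> q x * U (x \<bullet> x)" for x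
        unfolding radial_jet_def \<mu> W_def by (simp add: if_distrib if_distribR cong: if_cong)
      moreover have "AE x in lebesgue. x \<in> ?B \<longrightarrow> f \<mu> x = g \<mu> [] x"
        by (rule weak_list_unique[OF open_ball fl[OF \<mu>] gl[OF \<mu>] _ gw[OF \<mu>]]) (auto simp: weak_list_def)
      ultimately show ?thesis using f(2)[OF \<mu>] by (auto elim: AE_mp)
    qed
    moreover have "W q = U" "loc1 (R\<^sup>2) (W j)" "j < q \<Longrightarrow> W j = (\<lambda>_. 0)" for j
      by (auto simp: W_def Uloc loc1_const)
    ultimately show ?case by (intro exI[of _ W]) auto
  next
    case (Suc m)
    then obtain W where W: "W q = U" "\<And>j. loc1 (R\<^sup>2) (W j)" "\<And>j. j < q \<Longrightarrow> W j = (\<lambda>_. 0)"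
      "\<And>j. q \<le> j \<Longrightarrow> j < q + m \<Longrightarrow> weak1 (R\<^sup>2) (W j) (W (Suc j))"
      "\<And>is \<mu>. length is \<le> m \<Longrightarrow> length \<mu> = q \<Longrightarrow> AE x in lebesgue. x \<in> ?B \<longrightarrow> radial_jet W (is @ \<mu>) x = g \<mu> is x"
      by (auto dest!: Suc_leD)
    have wd: "weak_list ?P [i] (radial_jet W (is @ \<mu>)) (g \<mu> (i # is))" if "length is = m" "length \<mu> = q" for i "is" \<mu>
    proof -
      have "weak_list ?B [i] (g \<mu> is) (g \<mu> (i # is))"
        using that Suc.prems by (intro weak_list_split[OF gw gw]) auto
      then have w: "weak_list ?P [i] (g \<mu> is) (g \<mu> (i # is))" by (rule weak_list_mono) auto
      have l: "locally_integrable ?P (g \<mu> is)" "locally_integrable ?P (g \<mu> (i # is))"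
        using that Suc.prems by (auto intro!: locally_integrable_mono[OF gl])
      have "AE x in lebesgue. x \<in> ?P \<longrightarrow> g \<mu> is x = radial_jet W (is @ \<mu>) x"
        using W(5)[of "is" \<mu>] that by (auto elim: AE_mp)
      from weak_list_cong[OF oP l(1) radial_jet_locally_integrable[OF R W(2)] l(2,2) this _ w]
      show ?thesis by simp
    qed
    \<comment> \<open>A word of length \<open>q + m\<close> is cut into its first \<open>m\<close>
      letters, the derivatives, and its last \<open>q\<close> letters, which name the
      component.\<close>
    obtain V where V: "weak1 (R\<^sup>2) (W (q + m)) V"
    proof (rule next_profile_derivative[where R = R and W = W and q = q and M = "q + m" and g = "\<lambda>i \<mu>. g (drop m \<mu>) (i # take m \<mu>)"])
      fix i and \<mu> :: "'n list" assume "length \<mu> = q + m"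
      then show "locally_integrable ?P (g (drop m \<mu>) (i # take m \<mu>))"
        using Suc.prems by (intro locally_integrable_mono[OF gl]) auto
      show "weak_list ?P [i] (radial_jet W \<mu>) (g (drop m \<mu>) (i # take m \<mu>))"
        using wd[of "take m \<mu>" "drop m \<mu>" i] \<open>length \<mu> = q + m\<close> by simp
    qed (use R q W(2-4) in auto)
    define W' where "W' = W(Suc (q + m) := V)"
    have W'loc: "loc1 (R\<^sup>2) (W' j)" for j using W(2) V by (auto simp: W'_def weak1_def)
    have W'w: "weak1 (R\<^sup>2) (W' j) (W' (Suc j))" if "q \<le> j" "j < q + Suc m" for j
      using W(4)[of j] V that by (auto simp: W'_def less_Suc_eq)
    \<comment> \<open>Jets of length at most \<open>q + m\<close> contain only \<open>W j\<close>
      with \<open>j \<le> q + m\<close> and do not see the new entry.\<close>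
    have jet: "radial_jet W' \<mu> = radial_jet W \<mu>" if "length \<mu> \<le> q + m" for \<mu> :: "'n list"
      using that by (auto simp: radial_jet_def W'_def fun_eq_iff intro!: sum.cong)
    have "AE x in lebesgue. x \<in> ?B \<longrightarrow> radial_jet W' (is @ \<mu>) x = g \<mu> is x" if len: "length is \<le> Suc m" "length \<mu> = q" for "is" \<mu>
    proof (cases "length is \<le> m")
      case True
      then show ?thesis using W(5)[OF True len(2)] jet[of "is @ \<mu>"] len by simp
    next
      case False
      then obtain i js where split: "is = i # js" "length js = m" using len(1) by (cases "is") auto
      have j1: "weak_list ?P [i] (radial_jet W (js @ \<mu>)) (radial_jet W' (i # js @ \<mu>))"
        using radial_jet_weak_deriv[where W = W' and \<mu> = "js @ \<mu>" and i = i, OF R W'loc q] split len jet[of "js @ \<mu>"] weak1_imp_ac_deriv[OF W'w] R by simp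
      have "AE x in lebesgue. x \<in> ?P \<longrightarrow> radial_jet W' (i # js @ \<mu>) x = g \<mu> (i # js) x"
        by (rule weak_list_unique[OF oP radial_jet_locally_integrable[OF R W'loc] _ j1 wd[OF split(2) len(2)]])
          (use split len Suc.prems in \<open>auto intro!: locally_integrable_mono[OF gl]\<close>)
      with AE_nonzero show ?thesis unfolding split by eventually_elim auto
    qed
    moreover have "W' q = U" "j < q \<Longrightarrow> W' j = (\<lambda>_. 0)" for j
      using W(1,3) by (auto simp: W'_def)
    ultimately show ?case
      using W'loc W'w by (intro exI[of _ W'] conjI allI impI)
  qed
  from this[OF order_refl] obtain W where W: "W q = U" "\<And>j. loc1 (R\<^sup>2) (W j)" "\<And>j. j < q \<Longrightarrow> W j = (\<lambda>_. 0)"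
    "\<And>j. q \<le> j \<Longrightarrow> j < q + k \<Longrightarrow> weak1 (R\<^sup>2) (W j) (W (Suc j))"
    "\<And>is \<mu>. length is \<le> k \<Longrightarrow> length \<mu> = q \<Longrightarrow> AE x in lebesgue. x \<in> ?B \<longrightarrow> radial_jet W (is @ \<mu>) x = g \<mu> is x"
    by auto
  show ?thesis
  proof (intro exI[of _ W] conjI allI impI)
    show "ac_deriv (R\<^sup>2) (W j) (W (Suc j))" if "q \<le> j" "j < q + k" for j
      using weak1_imp_ac_deriv[OF W(4)[OF that]] R by simp
    fix "is" \<mu> :: "'n list" assume len: "length is \<le> k" "length \<mu> = q"
    have "sq_int ?B (g \<mu> is) \<le> ennreal ((sobolev_norm k ?B (f \<mu>))\<^sup>2)"
      using len by (intro sobolev_norm_ge[OF open_ball f(1) _ g]) (auto simp: sum_count_mset)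
    then show "sq_int ?B (radial_jet W (is @ \<mu>)) \<le> ennreal ((sobolev_norm k ?B (f \<mu>))\<^sup>2)"
      using sq_int_cong_AE[OF W(5)[OF len]] by simp
  qed (rule W)+
qed

subsection \<open>Weighted estimates for the profile\<close>

definition weighted :: "real \<Rightarrow> real \<Rightarrow> (real \<Rightarrow> real) \<Rightarrow> ennreal" where
  "weighted T e V = (\<integral>\<^sup>+s. ennreal (indicator {0<..<T} s * (s powr e * (V s)\<^sup>2)) \<partial>lborel)"

lemma weighted_radial:
  assumes R: "R > 0" and [measurable]: "V \<in> borel_measurable borel"
  shows "(\<integral>\<^sup>+x. ennreal (indicator (ball 0 R) x * ((x \<bullet> x) ^ p * (V (x \<bullet> x))\<^sup>2)) \<partial>(lebesgue :: (real ^ 'n::finite) measure))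
    = ennreal (radial_const TYPE('n)) * weighted (R\<^sup>2) (real p + real CARD('n) / 2 - 1) V"
proof -
  define g where "g s = ennreal (indicator {0<..<R\<^sup>2} s * (s ^ p * (V s)\<^sup>2))" for s
  have [measurable]: "g \<in> borel_measurable borel" unfolding g_def by measurable
  have "(\<integral>\<^sup>+x. ennreal (indicator (ball 0 R) x * ((x \<bullet> x) ^ p * (V (x \<bullet> x))\<^sup>2)) \<partial>(lebesgue :: (real ^ 'n) measure))
    = (\<integral>\<^sup>+x. g (x \<bullet> x) \<partial>(lebesgue :: (real ^ 'n) measure))"
  proof (rule nn_integral_cong_AE)
    show "AE x in (lebesgue :: (real ^ 'n) measure). ennreal (indicator (ball 0 R) x * ((x \<bullet> x) ^ p * (V (x \<bullet> x))\<^sup>2)) = g (x \<bullet> x)"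
      using AE_nonzero
    proof eventually_elim
      case (elim x)
      then have "indicat_real (ball 0 R) x = indicator {0<..<R\<^sup>2} (x \<bullet> x)"
        using punctured_ball_iff[OF R, of x] by (auto simp: indicator_def)
      then show ?case by (simp only: g_def)
    qed
  qed
  also have "\<dots> = (\<integral>\<^sup>+s. ennreal (radial_density TYPE('n) s) * g s \<partial>lborel)"
    by (subst nn_integral_completion, subst nn_integral_radial) auto
  also have "\<dots> = (\<integral>\<^sup>+s. ennreal (radial_const TYPE('n)) * ennreal (indicator {0<..<R\<^sup>2} s * (s powr (real p + real CARD('n) / 2 - 1) * (V s)\<^sup>2)) \<partial>lborel)"
  proof (rule nn_integral_cong)
    fix s :: real
    show "ennreal (radial_density TYPE('n) s) * g s = ennreal (radial_const TYPE('n)) * ennreal (indicator {0<..<R\<^sup>2} s * (s powr (real p + real CARD('n) / 2 - 1) * (V s)\<^sup>2))"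
    proof (cases "s \<in> {0<..<R\<^sup>2}")
      case True
      then have "s powr (real p + real CARD('n) / 2 - 1) = s powr (real CARD('n) / 2 - 1) * s ^ p"
        by (simp add: powr_realpow[symmetric] flip: powr_add) (simp add: algebra_simps)
      then show ?thesis using True radial_const_pos[of "TYPE('n)"]
        by (simp add: g_def radial_density_def ennreal_mult'[symmetric] mult_ac)
    qed (simp add: g_def)
  qed
  also have "\<dots> = ennreal (radial_const TYPE('n)) * weighted (R\<^sup>2) (real p + real CARD('n) / 2 - 1) V"
    unfolding weighted_def by (rule nn_integral_cmult) measurable
  finally show ?thesis .
qed

text \<open>Each coefficient is bounded through its homogeneity, and Cauchy-Schwarz is applied to
  the sum over \<open>j\<close>; indices with \<open>2 * j < length \<mu>\<close> drop out. The
  constant depends on the word alone and is uniform in \<open>R\<close> and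
  \<open>W\<close>.\<close>

lemma jet_upper_bound:
  fixes \<mu> :: "'n::finite list"
  shows "\<exists>K\<ge>0. \<forall>R>0. \<forall>W. (\<forall>j. W j \<in> borel_measurable borel) \<longrightarrow>
    sq_int (ball 0 R) (radial_jet W \<mu>) \<le> ennreal K *
      (\<Sum>j | j \<le> length \<mu> \<and> length \<mu> \<le> 2 * j. weighted (R\<^sup>2) (real (2 * j - length \<mu>) + real CARD('n) / 2 - 1) (W j))"
proof -
  define m where "m = length \<mu>"
  define J where "J = {j. j \<le> m \<and> m \<le> 2 * j}"
  have J: "finite J" by (simp add: J_def)
  obtain L where L: "\<And>j. L j \<ge> 0" "\<And>j x. \<bar>coef \<mu> j x\<bar> \<le> L j * norm x ^ (2 * j - m)"
    using coef_bound[of \<mu>] unfolding m_def by metis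
  define c where "c = radial_const TYPE('n)"
  have c: "c > 0" by (simp add: c_def radial_const_pos)
  define K where "K = real (card J) * (\<Sum>j\<in>J. (L j)\<^sup>2) * c"
  have "sq_int (ball 0 R) (radial_jet W \<mu>) \<le> ennreal K * (\<Sum>j\<in>J. weighted (R\<^sup>2) (real (2 * j - m) + real CARD('n) / 2 - 1) (W j))"
    if R: "R > 0" and W: "\<And>j. W j \<in> borel_measurable borel" for R W
  proof -
    have [measurable]: "W j \<in> borel_measurable borel" for j by (rule W)
    have pt: "(radial_jet W \<mu> x)\<^sup>2 \<le> (\<Sum>j\<in>J. real (card J) * (\<Sum>j\<in>J. (L j)\<^sup>2) * ((x \<bullet> x) ^ (2 * j - m) * (W j (x \<bullet> x))\<^sup>2))" for x
    proof -
      have "radial_jet W \<mu> x = (\<Sum>j\<in>J. coef \<mu> j x * W j (x \<bullet> x))"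
        unfolding radial_jet_def
      proof (rule sum.mono_neutral_right)
        show "\<forall>j\<in>{..length \<mu>} - J. coef \<mu> j x * W j (x \<bullet> x) = 0"
        proof
          fix j assume "j \<in> {..length \<mu>} - J"
          then have "2 * j < length \<mu>" by (auto simp: J_def m_def)
          then show "coef \<mu> j x * W j (x \<bullet> x) = 0" by (simp add: coef_low)
        qed
      qed (auto simp: J_def m_def)
      then have "(radial_jet W \<mu> x)\<^sup>2 \<le> (\<Sum>j\<in>J. (coef \<mu> j x * W j (x \<bullet> x))\<^sup>2) * real (card J)"
        using sum_squared_le_sum_of_squares[of "\<lambda>j. coef \<mu> j x * W j (x \<bullet> x)" J] by simp
      also have "\<dots> \<le> (\<Sum>j\<in>J. (\<Sum>j\<in>J. (L j)\<^sup>2) * ((x \<bullet> x) ^ (2 * j - m) * (W j (x \<bullet> x))\<^sup>2)) * real (card J)"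
      proof (intro mult_right_mono sum_mono)
        fix j assume j: "j \<in> J"
        have "(coef \<mu> j x)\<^sup>2 \<le> (L j * norm x ^ (2 * j - m))\<^sup>2"
          using L(2)[of j x] L(1)[of j] by (intro abs_le_square_iff[THEN iffD1]) (simp add: abs_mult)
        also have "\<dots> = (L j)\<^sup>2 * (x \<bullet> x) ^ (2 * j - m)"
          by (simp add: power_mult_distrib power2_norm_eq_inner[symmetric] power_mult[symmetric] mult.commute)
        also have "\<dots> \<le> (\<Sum>j\<in>J. (L j)\<^sup>2) * (x \<bullet> x) ^ (2 * j - m)"
          using j J by (intro mult_right_mono member_le_sum) auto
        finally show "(coef \<mu> j x * W j (x \<bullet> x))\<^sup>2 \<le> (\<Sum>j\<in>J. (L j)\<^sup>2) * ((x \<bullet> x) ^ (2 * j - m) * (W j (x \<bullet> x))\<^sup>2)"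
          unfolding power_mult_distrib mult.assoc[symmetric] by (rule mult_right_mono) simp
      qed simp
      finally show ?thesis by (simp add: sum_distrib_right sum_distrib_left mult_ac)
    qed
    define b where "b = real (card J) * (\<Sum>j\<in>J. (L j)\<^sup>2)"
    have b: "b \<ge> 0" by (simp add: b_def sum_nonneg)
    have "sq_int (ball 0 R) (radial_jet W \<mu>) \<le> (\<integral>\<^sup>+x. (\<Sum>j\<in>J. ennreal b * ennreal (indicator (ball 0 R) x * ((x \<bullet> x) ^ (2 * j - m) * (W j (x \<bullet> x))\<^sup>2))) \<partial>(lebesgue :: (real ^ 'n) measure))"
      unfolding sq_int_def
    proof (rule nn_integral_mono)
      fix x :: "real ^ 'n"
      have "indicator (ball 0 R) x * (radial_jet W \<mu> x)\<^sup>2 \<le> (\<Sum>j\<in>J. b * (indicator (ball 0 R) x * ((x \<bullet> x) ^ (2 * j - m) * (W j (x \<bullet> x))\<^sup>2)))"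
        using pt[of x] by (auto simp: indicator_def b_def)
      then have "ennreal (indicator (ball 0 R) x * (radial_jet W \<mu> x)\<^sup>2) \<le> ennreal (\<Sum>j\<in>J. b * (indicator (ball 0 R) x * ((x \<bullet> x) ^ (2 * j - m) * (W j (x \<bullet> x))\<^sup>2)))"
        by (rule ennreal_leI)
      also have "\<dots> = (\<Sum>j\<in>J. ennreal b * ennreal (indicator (ball 0 R) x * ((x \<bullet> x) ^ (2 * j - m) * (W j (x \<bullet> x))\<^sup>2)))"
        using b by (subst sum_ennreal[symmetric]) (auto simp: ennreal_mult')
      finally show "ennreal (indicator (ball 0 R) x * (radial_jet W \<mu> x)\<^sup>2) \<le> (\<Sum>j\<in>J. ennreal b * ennreal (indicator (ball 0 R) x * ((x \<bullet> x) ^ (2 * j - m) * (W j (x \<bullet> x))\<^sup>2)))" .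
    qed
    also have "\<dots> = (\<Sum>j\<in>J. ennreal b * (ennreal c * weighted (R\<^sup>2) (real (2 * j - m) + real CARD('n) / 2 - 1) (W j)))"
    proof -
      have m: "(\<lambda>x :: real ^ 'n. ennreal (indicator (ball 0 R) x * ((x \<bullet> x) ^ (2 * j - m) * (W j (x \<bullet> x))\<^sup>2))) \<in> borel_measurable lebesgue" for j
      proof (rule measurable_completion)
        have "(\<lambda>x :: real ^ 'n. indicator (ball 0 R) x * ((x \<bullet> x) ^ (2 * j - m) * (W j (x \<bullet> x))\<^sup>2)) \<in> borel_measurable lborel"
          using measurable_compose[OF inner_self_borel W[of j]]
          by (intro borel_measurable_times borel_measurable_indicator borel_measurable_power) auto
        then show "(\<lambda>x :: real ^ 'n. ennreal (indicator (ball 0 R) x * ((x \<bullet> x) ^ (2 * j - m) * (W j (x \<bullet> x))\<^sup>2))) \<in> borel_measurable lborel"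
          by (rule measurable_compose[OF _ measurable_ennreal])
      qed
      show ?thesis
        using m by (subst nn_integral_sum) (auto simp: nn_integral_cmult[OF m] weighted_radial[OF R] c_def)
    qed
    also have "\<dots> = ennreal K * (\<Sum>j\<in>J. weighted (R\<^sup>2) (real (2 * j - m) + real CARD('n) / 2 - 1) (W j))"
    proof -
      have "ennreal K = ennreal b * ennreal c"
        using b c by (simp add: K_def b_def ennreal_mult[symmetric] sum_nonneg)
      then show ?thesis by (simp only: sum_distrib_left mult.assoc)
    qed
    finally show ?thesis .
  qed
  moreover have "K \<ge> 0" using c by (auto simp: K_def intro!: mult_nonneg_nonneg sum_nonneg)
  ultimately show ?thesis unfolding J_def m_def by blast
qed

text \<open>The square of \<open>coef_lower_bound\<close>, integrated over the ball; the constant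
  collects Cauchy-Schwarz over all words of length \<open>m\<close> and the factor from the change
  to the variable \<open>s\<close>.\<close>

lemma jet_lower_bound:
  assumes n: "CARD('n::finite) \<ge> 2"
  shows "\<exists>K\<ge>0. \<forall>R>0. \<forall>W j. (\<forall>j. W j \<in> borel_measurable borel) \<longrightarrow> m \<le> 2 * j \<longrightarrow> j \<le> m \<longrightarrow>
    weighted (R\<^sup>2) (real (2 * j - m) + real CARD('n) / 2 - 1) (W j) \<le> ennreal K *
      (\<Sum>\<mu> | length (\<mu> :: 'n list) = m. sq_int (ball 0 R) (radial_jet W \<mu>))"
proof -
  obtain L where L: "L \<ge> 0" and L2: "\<And>(x :: real ^ 'n) W j. x \<noteq> 0 \<Longrightarrow> m \<le> 2 * j \<Longrightarrow> j \<le> m \<Longrightarrow>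
    norm x ^ (2 * j - m) * \<bar>W j\<bar> \<le> L * (\<Sum>\<mu> | length \<mu> = m. \<bar>\<Sum>j\<le>m. coef \<mu> j x * W j\<bar>)"
    using coef_lower_bound[OF n, of m] by blast
  define A where "A = {\<mu> :: 'n list. length \<mu> = m}"
  have A: "finite A" unfolding A_def by (rule finite_lists_length)
  define c where "c = radial_const TYPE('n)"
  have c: "c > 0" by (simp add: c_def radial_const_pos)
  define b where "b = L\<^sup>2 * real (card A)"
  have b: "b \<ge> 0" by (simp add: b_def)
  have "weighted (R\<^sup>2) (real (2 * j - m) + real CARD('n) / 2 - 1) (W j) \<le> ennreal (b / c) * (\<Sum>\<mu>\<in>A. sq_int (ball 0 R) (radial_jet W \<mu>))"
    if R: "R > 0" and W: "\<And>j. W j \<in> borel_measurable borel" and j: "m \<le> 2 * j" "j \<le> m" for R W j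
  proof -
    have [measurable]: "radial_jet W \<mu> \<in> borel_measurable borel" for \<mu> :: "'n list" by (rule radial_jet_borel[OF W])
    have m [measurable]: "(\<lambda>x. ennreal (indicator (ball 0 R) x * (radial_jet W \<mu> x)\<^sup>2)) \<in> borel_measurable lebesgue" for \<mu> :: "'n list"
    proof (rule measurable_completion)
      have "(\<lambda>x. indicator (ball 0 R) x * (radial_jet W \<mu> x)\<^sup>2) \<in> borel_measurable lborel"
        using radial_jet_borel[OF W] by (intro borel_measurable_times borel_measurable_indicator borel_measurable_power) auto
      then show "(\<lambda>x. ennreal (indicator (ball 0 R) x * (radial_jet W \<mu> x)\<^sup>2)) \<in> borel_measurable lborel"
        by (rule measurable_compose[OF _ measurable_ennreal])
    qed
    have "ennreal c * weighted (R\<^sup>2) (real (2 * j - m) + real CARD('n) / 2 - 1) (W j)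
      = (\<integral>\<^sup>+x. ennreal (indicator (ball 0 R) x * ((x \<bullet> x) ^ (2 * j - m) * (W j (x \<bullet> x))\<^sup>2)) \<partial>(lebesgue :: (real ^ 'n) measure))"
      unfolding c_def by (rule weighted_radial[OF R W, symmetric])
    also have "\<dots> \<le> (\<integral>\<^sup>+x. (\<Sum>\<mu>\<in>A. ennreal b * ennreal (indicator (ball 0 R) x * (radial_jet W \<mu> x)\<^sup>2)) \<partial>lebesgue)"
    proof (rule nn_integral_mono_AE, use AE_nonzero in eventually_elim)
      case (elim x)
      have "(x \<bullet> x) ^ (2 * j - m) * (W j (x \<bullet> x))\<^sup>2 = (norm x ^ (2 * j - m) * \<bar>W j (x \<bullet> x)\<bar>)\<^sup>2"
        by (simp add: power_mult_distrib power2_norm_eq_inner[symmetric] power_mult[symmetric] mult.commute)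
      also have "\<dots> \<le> (L * (\<Sum>\<mu>\<in>A. \<bar>radial_jet W \<mu> x\<bar>))\<^sup>2"
      proof (rule power_mono)
        have "(\<Sum>\<mu>\<in>A. \<bar>radial_jet W \<mu> x\<bar>) = (\<Sum>\<mu> | length \<mu> = m. \<bar>\<Sum>j\<le>m. coef \<mu> j x * W j (x \<bullet> x)\<bar>)"
          by (auto simp: A_def radial_jet_def intro!: sum.cong)
        then show "norm x ^ (2 * j - m) * \<bar>W j (x \<bullet> x)\<bar> \<le> L * (\<Sum>\<mu>\<in>A. \<bar>radial_jet W \<mu> x\<bar>)"
          using L2[OF elim j, of "\<lambda>j. W j (x \<bullet> x)"] by simp
      qed simp
      also have "\<dots> = L\<^sup>2 * (\<Sum>\<mu>\<in>A. \<bar>radial_jet W \<mu> x\<bar>)\<^sup>2" by (rule power_mult_distrib)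
      also have "\<dots> \<le> L\<^sup>2 * ((\<Sum>\<mu>\<in>A. (radial_jet W \<mu> x)\<^sup>2) * real (card A))"
        using mult_left_mono[OF sum_squared_le_sum_of_squares[of "\<lambda>\<mu>. \<bar>radial_jet W \<mu> x\<bar>" A], of "L\<^sup>2"] by simp
      also have "\<dots> = (\<Sum>\<mu>\<in>A. b * (radial_jet W \<mu> x)\<^sup>2)"
        by (simp add: b_def sum_distrib_left sum_distrib_right mult_ac)
      finally have "indicator (ball 0 R) x * ((x \<bullet> x) ^ (2 * j - m) * (W j (x \<bullet> x))\<^sup>2) \<le> (\<Sum>\<mu>\<in>A. b * (indicator (ball 0 R) x * (radial_jet W \<mu> x)\<^sup>2))"
        by (auto simp: indicator_def)
      then have "ennreal (indicator (ball 0 R) x * ((x \<bullet> x) ^ (2 * j - m) * (W j (x \<bullet> x))\<^sup>2)) \<le> ennreal (\<Sum>\<mu>\<in>A. b * (indicator (ball 0 R) x * (radial_jet W \<mu> x)\<^sup>2))"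
        by (rule ennreal_leI)
      also have "\<dots> = (\<Sum>\<mu>\<in>A. ennreal b * ennreal (indicator (ball 0 R) x * (radial_jet W \<mu> x)\<^sup>2))"
        using b by (subst sum_ennreal[symmetric]) (auto simp: ennreal_mult')
      finally show ?case .
    qed
    also have "\<dots> = ennreal b * (\<Sum>\<mu>\<in>A. sq_int (ball 0 R) (radial_jet W \<mu>))"
      using m by (subst nn_integral_sum) (auto simp: nn_integral_cmult[OF m] sq_int_def sum_distrib_left)
    finally have "ennreal (1 / c) * (ennreal c * weighted (R\<^sup>2) (real (2 * j - m) + real CARD('n) / 2 - 1) (W j))
      \<le> ennreal (1 / c) * (ennreal b * (\<Sum>\<mu>\<in>A. sq_int (ball 0 R) (radial_jet W \<mu>)))"
      by (rule mult_left_mono) simp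
    then show ?thesis
      using c b by (simp add: mult.assoc[symmetric] ennreal_mult'[symmetric])
  qed
  then show ?thesis using b c unfolding A_def by (intro exI[of _ "b / c"]) auto
qed

text \<open>
  Hardy's inequality: \<open>U\<close> near 0 is compared with its values on \<open>(T/2, T)\<close>, the difference being
  estimated by the Cauchy-Schwarz inequality with the weight \<open>\<sigma>\<^bsup>1 + \<alpha>/2\<^esup>\<close>.
\<close>

lemma hardy_inequality:
  assumes ac: "ac_deriv T U V" and T: "T > 0" and \<alpha>: "\<alpha> > 0"
  shows "weighted T (\<alpha> - 1) U \<le> ennreal (8 / \<alpha>\<^sup>2) * weighted T (\<alpha> + 1) V + ennreal ((4 / \<alpha> + 2) / T) * weighted T \<alpha> U"
proof -
  obtain U' where U': "AE s in lborel. 0 < s \<and> s < T \<longrightarrow> U s = U' s"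
    "\<And>a b. 0 < a \<Longrightarrow> a \<le> b \<Longrightarrow> b < T \<Longrightarrow> U' b - U' a = (LINT s:{a..b}|lborel. V s)"
    and loc: "loc1 T U" "loc1 T V"
    using ac unfolding ac_deriv_def by metis
  have [measurable]: "U \<in> borel_measurable borel" "V \<in> borel_measurable borel"
    using loc loc1_borel by auto
  \<comment> \<open>Any \<open>b\<close> strictly between 0 and \<alpha> would make both integrals
    below converge; the resulting constant \<open>1 / (b (\<alpha> - b))\<close> is smallest at the
    midpoint.\<close>
  define b where "b = \<alpha> / 2"
  have b: "b > 0" using \<alpha> by (simp add: b_def)
  define H where "H s = (\<integral>\<^sup>+\<sigma>. ennreal (indicator {s..<T} \<sigma> * ((V \<sigma>)\<^sup>2 * \<sigma> powr (1 + b))) \<partial>lborel)" for s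
  define G where "G s = ennreal (s powr (- b) / b) * H s" for s
  have Hm [measurable]: "H \<in> borel_measurable borel"
  proof -
    have "(\<lambda>(s, \<sigma>). ennreal ((if s \<le> \<sigma> \<and> \<sigma> < T then 1 else 0) * ((V \<sigma>)\<^sup>2 * \<sigma> powr (1 + b)))) \<in> borel_measurable (borel \<Otimes>\<^sub>M lborel)"
      by measurable
    from lborel.borel_measurable_nn_integral[OF this] show ?thesis
      unfolding H_def[abs_def] by (simp add: indicator_def of_bool_def)
  qed
  have cs: "ennreal ((U' t - U' s)\<^sup>2) \<le> G s" if st: "0 < s" "s \<le> t" "t < T" for s t
  proof -
    have iV: "integrable lborel (\<lambda>\<sigma>. indicator {s..t} \<sigma> * \<bar>V \<sigma>\<bar>)"
      using set_integrable_abs[OF loc1D[OF loc(2) st(1,3)]] by (simp add: set_integrable_def)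
    have "\<bar>U' t - U' s\<bar> \<le> integral\<^sup>L lborel (\<lambda>\<sigma>. \<bar>indicator {s..t} \<sigma> *\<^sub>R V \<sigma>\<bar>)"
      unfolding U'(2)[OF st] set_lebesgue_integral_def by (rule integral_abs_bound)
    also have "\<dots> = integral\<^sup>L lborel (\<lambda>\<sigma>. indicator {s..t} \<sigma> * \<bar>V \<sigma>\<bar>)"
      by (simp add: abs_mult)
    finally have "ennreal \<bar>U' t - U' s\<bar> \<le> ennreal (integral\<^sup>L lborel (\<lambda>\<sigma>. indicator {s..t} \<sigma> * \<bar>V \<sigma>\<bar>))"
      by (rule ennreal_leI)
    also have "\<dots> = (\<integral>\<^sup>+\<sigma>. ennreal (indicator {s..t} \<sigma> * \<bar>V \<sigma>\<bar>) \<partial>lborel)"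
      using iV by (intro nn_integral_eq_integral[symmetric]) auto
    \<comment> \<open>Cauchy-Schwarz needs the integrand as a product: the weight
      \<open>\<sigma> powr ((1 + b) / 2)\<close> is inserted and compensated. The square of the
      compensating factor integrates to at most \<open>s powr (- b) / b\<close>.\<close>
    also have "\<dots> = (\<integral>\<^sup>+\<sigma>. ennreal (indicator {s..t} \<sigma> * (\<bar>V \<sigma>\<bar> * \<sigma> powr ((1 + b) / 2))) * ennreal (indicator {s..t} \<sigma> * \<sigma> powr (- (1 + b) / 2)) \<partial>lborel)"
    proof (rule nn_integral_cong)
      fix \<sigma> :: real
      show "ennreal (indicator {s..t} \<sigma> * \<bar>V \<sigma>\<bar>) = ennreal (indicator {s..t} \<sigma> * (\<bar>V \<sigma>\<bar> * \<sigma> powr ((1 + b) / 2))) * ennreal (indicator {s..t} \<sigma> * \<sigma> powr (- (1 + b) / 2))"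
      proof (cases "\<sigma> \<in> {s..t}")
        case True
        then have "\<sigma> powr ((1 + b) / 2) * \<sigma> powr (- (1 + b) / 2) = 1" 
        proof -
          have "(1 + b) / 2 + - (1 + b) / 2 = 0" by (simp add: field_simps)
          then have "\<sigma> powr ((1 + b) / 2 + - (1 + b) / 2) = 1" using True st by (simp only: powr_zero_eq_one) auto
          then show ?thesis by (simp only: powr_add)
        qed
        then show ?thesis using True by (simp add: ennreal_mult'[symmetric] mult.assoc)
      qed simp
    qed
    finally have "(ennreal \<bar>U' t - U' s\<bar>)\<^sup>2 \<le> (\<integral>\<^sup>+\<sigma>. ennreal (indicator {s..t} \<sigma> * (\<bar>V \<sigma>\<bar> * \<sigma> powr ((1 + b) / 2))) * ennreal (indicator {s..t} \<sigma> * \<sigma> powr (- (1 + b) / 2)) \<partial>lborel)\<^sup>2"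
      by (rule power_mono) simp
    also have "\<dots> \<le> (\<integral>\<^sup>+\<sigma>. (ennreal (indicator {s..t} \<sigma> * (\<bar>V \<sigma>\<bar> * \<sigma> powr ((1 + b) / 2))))\<^sup>2 \<partial>lborel) * (\<integral>\<^sup>+\<sigma>. (ennreal (indicator {s..t} \<sigma> * \<sigma> powr (- (1 + b) / 2)))\<^sup>2 \<partial>lborel)"
      by (rule Cauchy_Schwarz_nn_integral) measurable
    also have "\<dots> \<le> H s * ennreal (s powr (- b) / b)"
    proof (rule mult_mono)
      show "(\<integral>\<^sup>+\<sigma>. (ennreal (indicator {s..t} \<sigma> * (\<bar>V \<sigma>\<bar> * \<sigma> powr ((1 + b) / 2))))\<^sup>2 \<partial>lborel) \<le> H s"
        unfolding H_def
      proof (rule nn_integral_mono)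
        fix \<sigma> :: real
        show "(ennreal (indicator {s..t} \<sigma> * (\<bar>V \<sigma>\<bar> * \<sigma> powr ((1 + b) / 2))))\<^sup>2 \<le> ennreal (indicator {s..<T} \<sigma> * ((V \<sigma>)\<^sup>2 * \<sigma> powr (1 + b)))"
          using st by (cases "\<sigma> \<in> {s..t}") (auto simp: ennreal_power power_mult_distrib power2_eq_square[of "\<sigma> powr _"] simp flip: powr_add)
      qed
      have "(\<integral>\<^sup>+\<sigma>. (ennreal (indicator {s..t} \<sigma> * \<sigma> powr (- (1 + b) / 2)))\<^sup>2 \<partial>lborel) = (\<integral>\<^sup>+\<sigma>. ennreal (\<sigma> powr (- 1 - b)) * indicator {s..t} \<sigma> \<partial>lborel)"
      proof (rule nn_integral_cong)
        fix \<sigma> :: real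
        have "\<sigma> powr (- (1 + b) / 2) * \<sigma> powr (- (1 + b) / 2) = \<sigma> powr (- 1 - b)" if "\<sigma> > 0"
          using that by (simp flip: powr_add)
        then show "(ennreal (indicator {s..t} \<sigma> * \<sigma> powr (- (1 + b) / 2)))\<^sup>2 = ennreal (\<sigma> powr (- 1 - b)) * indicator {s..t} \<sigma>"
          using st by (cases "\<sigma> \<in> {s..t}") (auto simp: ennreal_power power2_eq_square[of "\<sigma> powr _"])
      qed
      also have "\<dots> = ennreal (- (t powr (- b)) / b - (- (s powr (- b)) / b))"
      proof (rule nn_integral_FTC_Icc[where F = "\<lambda>\<sigma>. - (\<sigma> powr (- b)) / b"])
        fix \<sigma> assume "\<sigma> \<in> {s..t}"
        then have "((\<lambda>\<sigma>. - (\<sigma> powr (- b)) / b) has_real_derivative \<sigma> powr (- b - 1)) (at \<sigma>)"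
          using st b by (auto intro!: derivative_eq_intros)
        moreover have e: "- b - 1 = - 1 - b" by simp
        ultimately show "((\<lambda>\<sigma>. - (\<sigma> powr (- b)) / b) has_real_derivative \<sigma> powr (- 1 - b)) (at \<sigma>)"
          by (simp only: e)
      qed (use st in auto)
      also have "\<dots> \<le> ennreal (s powr (- b) / b)"
        using b by (intro ennreal_leI) simp
      finally show "(\<integral>\<^sup>+\<sigma>. (ennreal (indicator {s..t} \<sigma> * \<sigma> powr (- (1 + b) / 2)))\<^sup>2 \<partial>lborel) \<le> ennreal (s powr (- b) / b)" .
    qed auto
    finally show ?thesis by (simp add: G_def ennreal_power mult.commute)
  qed
  define A where "A = (\<integral>\<^sup>+t. ennreal (indicator {T / 2<..<T} t * (U t)\<^sup>2) \<partial>lborel)"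
  have A: "ennreal ((T / 2) powr \<alpha>) * A \<le> weighted T \<alpha> U"
  proof -
    have "ennreal ((T / 2) powr \<alpha>) * A = (\<integral>\<^sup>+t. ennreal ((T / 2) powr \<alpha>) * ennreal (indicator {T / 2<..<T} t * (U t)\<^sup>2) \<partial>lborel)"
      unfolding A_def by (rule nn_integral_cmult[symmetric]) measurable
    also have "\<dots> \<le> weighted T \<alpha> U"
      unfolding weighted_def
    proof (rule nn_integral_mono)
      fix t :: real
      show "ennreal ((T / 2) powr \<alpha>) * ennreal (indicator {T / 2<..<T} t * (U t)\<^sup>2) \<le> ennreal (indicator {0<..<T} t * (t powr \<alpha> * (U t)\<^sup>2))"
        using T \<alpha> by (cases "t \<in> {T / 2<..<T}") (auto simp: ennreal_mult'[symmetric] intro!: ennreal_leI mult_right_mono powr_mono2)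
    qed
    finally show ?thesis .
  qed
  \<comment> \<open>The inequality \<open>U(s)^2 \<le> 2 U(t)^2 + 2 (U(t) - U(s))^2\<close> is
    integrated over \<open>t\<close> in \<open>(T/2, T)\<close>, the increment being bounded by
    \<open>G s\<close> uniformly in \<open>t\<close>; division by the length \<open>T / 2\<close>
    gives \<open>4 / T\<close>.\<close>
  have near: "ennreal ((U s)\<^sup>2) \<le> ennreal (4 / T) * A + 2 * G s" if s: "0 < s" "s \<le> T / 2" "U s = U' s" for s
  proof -
    have "ennreal (T / 2) * ennreal ((U s)\<^sup>2) = (\<integral>\<^sup>+t. ennreal ((U s)\<^sup>2) * indicator {T / 2<..<T} t \<partial>lborel)"
      using T by (subst nn_integral_cmult_indicator) (auto simp: mult.commute)
    also have "\<dots> \<le> (\<integral>\<^sup>+t. 2 * ennreal (indicator {T / 2<..<T} t * (U t)\<^sup>2) + 2 * G s * indicator {T / 2<..<T} t \<partial>lborel)"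
    proof (rule nn_integral_mono_AE, use U'(1) in eventually_elim)
      case (elim t)
      show ?case
      proof (cases "t \<in> {T / 2<..<T}")
        case True
        then have t: "U t = U' t" "s \<le> t" "t < T" using elim s T by auto
        have "(U s)\<^sup>2 \<le> 2 * (U t)\<^sup>2 + 2 * (U' t - U' s)\<^sup>2"
        proof -
          have "0 \<le> (2 * U t - U s)\<^sup>2" by simp
          then show ?thesis using t(1) s(3) by (simp add: power2_eq_square algebra_simps)
        qed
        then have "ennreal ((U s)\<^sup>2) \<le> ennreal (2 * (U t)\<^sup>2 + 2 * (U' t - U' s)\<^sup>2)" by (rule ennreal_leI)
        also have "\<dots> = 2 * ennreal ((U t)\<^sup>2) + 2 * ennreal ((U' t - U' s)\<^sup>2)"
          by (simp add: ennreal_mult')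
        also have "\<dots> \<le> 2 * ennreal ((U t)\<^sup>2) + 2 * G s"
          using cs[OF s(1) t(2,3)] by (intro add_left_mono mult_left_mono) auto
        finally show ?thesis using True by simp
      qed simp
    qed
    also have "\<dots> = 2 * A + 2 * G s * ennreal (T / 2)"
      unfolding A_def using T by (subst nn_integral_add) (auto simp: nn_integral_cmult nn_integral_cmult_indicator)
    finally have "ennreal (2 / T) * (ennreal (T / 2) * ennreal ((U s)\<^sup>2)) \<le> ennreal (2 / T) * (2 * A + 2 * G s * ennreal (T / 2))"
      by (rule mult_left_mono) simp
    moreover have "ennreal (2 / T) * (ennreal (T / 2) * ennreal ((U s)\<^sup>2)) = ennreal ((U s)\<^sup>2)"
      using T by (simp add: mult.assoc[symmetric] ennreal_mult'[symmetric])
    moreover have "ennreal (2 / T) * (2 * A + 2 * G s * ennreal (T / 2)) = ennreal (4 / T) * A + 2 * G s"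
    proof -
      have "ennreal (2 / T) * 2 = ennreal (4 / T)"
        using T by (metis ennreal_mult' ennreal_numeral mult.commute numeral_Bit0 times_divide_eq_right mult_2 zero_le_numeral)
      moreover have "ennreal (2 / T) * ennreal (T / 2) = 1"
        using T by (simp add: ennreal_mult'[symmetric])
      ultimately show ?thesis by (simp add: distrib_left mult.assoc[symmetric] mult.commute[of _ "ennreal (T / 2)"])
    qed
    ultimately show ?thesis by simp
  qed
  \<comment> \<open>By Tonelli the order of \<open>s\<close> and \<sigma> is exchanged, and the
    inner integral of \<open>s powr (b - 1)\<close> up to \<sigma> is explicit; this gives
    \<open>1 / b^2 = 4 / \<alpha>\<^sup>2\<close>.\<close>
  have GI: "(\<integral>\<^sup>+s. ennreal (indicator {0<..<T} s * s powr (\<alpha> - 1)) * G s \<partial>lborel) \<le> ennreal (4 / \<alpha>\<^sup>2) * weighted T (\<alpha> + 1) V"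
  proof -
    define h where "h s \<sigma> = ennreal ((if 0 < s \<and> s \<le> \<sigma> \<and> \<sigma> < T then 1 else 0) * (s powr (b - 1) / b * ((V \<sigma>)\<^sup>2 * \<sigma> powr (1 + b))))" for s \<sigma>
    have hm: "case_prod h \<in> borel_measurable (lborel \<Otimes>\<^sub>M lborel)" unfolding h_def by measurable
    have "(\<integral>\<^sup>+s. ennreal (indicator {0<..<T} s * s powr (\<alpha> - 1)) * G s \<partial>lborel) \<le> (\<integral>\<^sup>+s. (\<integral>\<^sup>+\<sigma>. h s \<sigma> \<partial>lborel) \<partial>lborel)"
    proof (rule nn_integral_mono)
      fix s :: real
      have "ennreal (indicator {0<..<T} s * s powr (\<alpha> - 1)) * G s
        = (\<integral>\<^sup>+\<sigma>. ennreal (indicator {0<..<T} s * (s powr (b - 1) / b)) * ennreal (indicator {s..<T} \<sigma> * ((V \<sigma>)\<^sup>2 * \<sigma> powr (1 + b))) \<partial>lborel)"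
      proof -
        have "indicator {0<..<T} s * s powr (\<alpha> - 1) * (s powr (- b) / b) = indicator {0<..<T} s * (s powr (b - 1) / b)"
          by (cases "s > 0") (auto simp: b_def simp flip: powr_add)
        then have "ennreal (indicator {0<..<T} s * s powr (\<alpha> - 1)) * ennreal (s powr (- b) / b) = ennreal (indicator {0<..<T} s * (s powr (b - 1) / b))"
          using b by (subst ennreal_mult'[symmetric]) auto
        then have "ennreal (indicator {0<..<T} s * s powr (\<alpha> - 1)) * G s = ennreal (indicator {0<..<T} s * (s powr (b - 1) / b)) * H s"
          unfolding G_def by (metis mult.assoc)
        also have "\<dots> = (\<integral>\<^sup>+\<sigma>. ennreal (indicator {0<..<T} s * (s powr (b - 1) / b)) * ennreal (indicator {s..<T} \<sigma> * ((V \<sigma>)\<^sup>2 * \<sigma> powr (1 + b))) \<partial>lborel)"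
          unfolding H_def by (rule nn_integral_cmult[symmetric]) measurable
        finally show ?thesis .
      qed
      also have "\<dots> \<le> (\<integral>\<^sup>+\<sigma>. h s \<sigma> \<partial>lborel)"
        by (rule nn_integral_mono) (use b in \<open>auto simp: h_def indicator_def ennreal_mult'[symmetric]\<close>)
      finally show "ennreal (indicator {0<..<T} s * s powr (\<alpha> - 1)) * G s \<le> (\<integral>\<^sup>+\<sigma>. h s \<sigma> \<partial>lborel)" .
    qed
    also have "\<dots> = (\<integral>\<^sup>+\<sigma>. (\<integral>\<^sup>+s. h s \<sigma> \<partial>lborel) \<partial>lborel)"
      by (rule lborel_pair.Fubini'[OF hm, symmetric])
    also have "\<dots> \<le> (\<integral>\<^sup>+\<sigma>. ennreal (4 / \<alpha>\<^sup>2) * ennreal (indicator {0<..<T} \<sigma> * (\<sigma> powr (\<alpha> + 1) * (V \<sigma>)\<^sup>2)) \<partial>lborel)"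
    proof (rule nn_integral_mono)
      fix \<sigma> :: real
      show "(\<integral>\<^sup>+s. h s \<sigma> \<partial>lborel) \<le> ennreal (4 / \<alpha>\<^sup>2) * ennreal (indicator {0<..<T} \<sigma> * (\<sigma> powr (\<alpha> + 1) * (V \<sigma>)\<^sup>2))"
      proof (cases "\<sigma> \<in> {0<..<T}")
        case False
        then have "h s \<sigma> = 0" for s by (auto simp: h_def)
        then show ?thesis by simp
      next
        case True
        have "(\<integral>\<^sup>+s. h s \<sigma> \<partial>lborel) \<le> (\<integral>\<^sup>+s. ennreal ((V \<sigma>)\<^sup>2 * \<sigma> powr (1 + b) / b) * (ennreal (s powr (b - 1)) * indicator {0..\<sigma>} s) \<partial>lborel)"
          by (rule nn_integral_mono) (use b in \<open>auto simp: h_def indicator_def ennreal_mult'[symmetric] mult_ac intro!: ennreal_leI\<close>)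
        also have "\<dots> = ennreal ((V \<sigma>)\<^sup>2 * \<sigma> powr (1 + b) / b) * (\<integral>\<^sup>+s. ennreal (s powr (b - 1)) * indicator {0..\<sigma>} s \<partial>lborel)"
          by (rule nn_integral_cmult) measurable
        also have "(\<integral>\<^sup>+s. ennreal (s powr (b - 1)) * indicator {0..\<sigma>} s \<partial>lborel) = ennreal (\<sigma> powr (b - 1 + 1) / (b - 1 + 1))"
          using b True by (intro nn_integral_has_integral_lebesgue' has_integral_powr_from_0) auto
        also have "ennreal ((V \<sigma>)\<^sup>2 * \<sigma> powr (1 + b) / b) * ennreal (\<sigma> powr (b - 1 + 1) / (b - 1 + 1)) = ennreal ((V \<sigma>)\<^sup>2 * (\<sigma> powr (1 + b) * \<sigma> powr b) / (b * b))"
          using b by (simp add: ennreal_mult'[symmetric])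
        also have "\<sigma> powr (1 + b) * \<sigma> powr b = \<sigma> powr (\<alpha> + 1)"
          using True by (simp add: b_def flip: powr_add)
        also have "(V \<sigma>)\<^sup>2 * \<sigma> powr (\<alpha> + 1) / (b * b) = 4 / \<alpha>\<^sup>2 * (\<sigma> powr (\<alpha> + 1) * (V \<sigma>)\<^sup>2)"
          by (simp add: b_def power2_eq_square)
        finally show ?thesis using True by (simp add: ennreal_mult'[symmetric])
      qed
    qed
    also have "\<dots> = ennreal (4 / \<alpha>\<^sup>2) * weighted T (\<alpha> + 1) V"
      unfolding weighted_def by (rule nn_integral_cmult) measurable
    finally show ?thesis .
  qed
  \<comment> \<open>On \<open>(0, T/2]\<close> the estimate \<open>near\<close> gives the first two
    summands. On \<open>(T/2, T)\<close> the weight \<open>s powr (\<alpha> - 1)\<close> is at most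
    \<open>2 / T\<close> times \<open>s powr \<alpha>\<close>, which gives the third. The first and
    third add up to the factor \<open>(4 / \<alpha> + 2) / T\<close>.\<close>
  have "weighted T (\<alpha> - 1) U \<le> (\<integral>\<^sup>+s. (ennreal (4 / T) * A) * (ennreal (s powr (\<alpha> - 1)) * indicator {0..T / 2} s)
      + (2 * (ennreal (indicator {0<..<T} s * s powr (\<alpha> - 1)) * G s)
      + ennreal (2 / T) * ennreal (indicator {0<..<T} s * (s powr \<alpha> * (U s)\<^sup>2))) \<partial>lborel)"
    unfolding weighted_def
  proof (rule nn_integral_mono_AE, use U'(1) in eventually_elim)
    case (elim s)
    consider "s \<notin> {0<..<T}" | "0 < s" "s \<le> T / 2" "s < T" | "T / 2 < s" "s < T" "0 < s" using T by fastforce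
    then show ?case
    proof cases
      case 2
      have "ennreal (s powr (\<alpha> - 1) * (U s)\<^sup>2) = ennreal (s powr (\<alpha> - 1)) * ennreal ((U s)\<^sup>2)"
        by (rule ennreal_mult') simp
      also have "\<dots> \<le> ennreal (s powr (\<alpha> - 1)) * (ennreal (4 / T) * A + 2 * G s)"
        using near[of s] 2 elim by (intro mult_left_mono) auto
      also have "\<dots> = (ennreal (4 / T) * A) * ennreal (s powr (\<alpha> - 1)) + 2 * (ennreal (s powr (\<alpha> - 1)) * G s)"
        by (simp add: distrib_left mult_ac)
      also have "\<dots> \<le> (ennreal (4 / T) * A) * ennreal (s powr (\<alpha> - 1)) + (2 * (ennreal (s powr (\<alpha> - 1)) * G s) + ennreal (2 / T) * ennreal (s powr \<alpha> * (U s)\<^sup>2))"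
        by (intro add_left_mono) simp
      finally show ?thesis using 2 by simp
    next
      case 3
      have "s powr (\<alpha> - 1) \<le> 2 / T * s powr \<alpha>"
      proof -
        have "1 * s powr (\<alpha> - 1) \<le> (2 / T * s) * s powr (\<alpha> - 1)"
          using 3 T by (intro mult_right_mono) (auto simp: field_simps)
        also have "\<dots> = 2 / T * s powr \<alpha>" using 3 by (simp add: powr_mult_base)
        finally show ?thesis by simp
      qed
      then have "ennreal (s powr (\<alpha> - 1) * (U s)\<^sup>2) \<le> ennreal (2 / T * (s powr \<alpha> * (U s)\<^sup>2))"
        by (intro ennreal_leI) (metis mult.assoc mult_right_mono zero_le_power2)
      also have "\<dots> = ennreal (2 / T) * ennreal (s powr \<alpha> * (U s)\<^sup>2)" using T by (intro ennreal_mult') simp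
      finally show ?thesis using 3 by (simp add: add_increasing)
    qed simp
  qed
  also have "\<dots> = (ennreal (4 / T) * A) * (\<integral>\<^sup>+s. ennreal (s powr (\<alpha> - 1)) * indicator {0..T / 2} s \<partial>lborel)
      + (2 * (\<integral>\<^sup>+s. ennreal (indicator {0<..<T} s * s powr (\<alpha> - 1)) * G s \<partial>lborel) + ennreal (2 / T) * weighted T \<alpha> U)"
  proof -
    have [measurable]: "G \<in> borel_measurable borel" unfolding G_def by measurable
    show ?thesis unfolding weighted_def
      by (subst nn_integral_add, measurable, subst nn_integral_add, measurable) (simp add: nn_integral_cmult)
  qed
  also have "(\<integral>\<^sup>+s. ennreal (s powr (\<alpha> - 1)) * indicator {0..T / 2} s \<partial>lborel) = ennreal ((T / 2) powr (\<alpha> - 1 + 1) / (\<alpha> - 1 + 1))"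
    using \<alpha> T by (intro nn_integral_has_integral_lebesgue' has_integral_powr_from_0) auto
  also have "(ennreal (4 / T) * A) * ennreal ((T / 2) powr (\<alpha> - 1 + 1) / (\<alpha> - 1 + 1)) = ennreal (4 / \<alpha> / T) * (ennreal ((T / 2) powr \<alpha>) * A)"
  proof -
    have "ennreal (4 / T) * ennreal ((T / 2) powr \<alpha> / \<alpha>) = ennreal (4 / \<alpha> / T) * ennreal ((T / 2) powr \<alpha>)"
      using T \<alpha> by (simp add: ennreal_mult'[symmetric] mult_ac)
    then show ?thesis by (simp add: mult_ac)
  qed
  also have "\<dots> + (2 * (\<integral>\<^sup>+s. ennreal (indicator {0<..<T} s * s powr (\<alpha> - 1)) * G s \<partial>lborel) + ennreal (2 / T) * weighted T \<alpha> U)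
    \<le> ennreal (4 / \<alpha> / T) * weighted T \<alpha> U + (2 * (ennreal (4 / \<alpha>\<^sup>2) * weighted T (\<alpha> + 1) V) + ennreal (2 / T) * weighted T \<alpha> U)"
    by (intro add_mono mult_left_mono A GI order_refl) auto
  also have "\<dots> = ennreal (8 / \<alpha>\<^sup>2) * weighted T (\<alpha> + 1) V + ennreal ((4 / \<alpha> + 2) / T) * weighted T \<alpha> U"
  proof -
    have "ennreal ((4 / \<alpha> + 2) / T) = ennreal (4 / \<alpha> / T) + ennreal (2 / T)"
      using T \<alpha> by (simp add: ennreal_plus[symmetric] add_divide_distrib del: ennreal_plus)
    moreover have "2 * ennreal (4 / \<alpha>\<^sup>2) = ennreal (8 / \<alpha>\<^sup>2)"
      using ennreal_mult'[of 2 "4 / \<alpha>\<^sup>2"] by simp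
    ultimately show ?thesis by (simp add: distrib_right mult.assoc[symmetric] add_ac)
  qed
  finally show ?thesis .
qed

section \<open>Comparison of Sobolev norms in dimensions \<open>d\<close> and
  \<open>d + 2\<close>\<close>

lemma weighted_le_sobolev:
  assumes "CARD('n::finite) \<ge> 2"
  shows "\<exists>K\<ge>0. \<forall>R>0. \<forall>W N. (\<forall>j. W j \<in> borel_measurable borel) \<longrightarrow>
    (\<forall>is (\<mu> :: 'n list). length is \<le> k \<longrightarrow> length \<mu> = q \<longrightarrow> sq_int (ball 0 R) (radial_jet W (is @ \<mu>)) \<le> N) \<longrightarrow>
    (\<forall>m\<le>k. \<forall>j. j \<le> m + q \<longrightarrow> m + q \<le> 2 * j \<longrightarrow>
      weighted (R\<^sup>2) (real (2 * j - (m + q)) + real CARD('n) / 2 - 1) (W j) \<le> ennreal K * N)"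
proof -
  obtain K where K: "\<And>m. K m \<ge> 0" "\<And>m R W j. R > 0 \<Longrightarrow> \<forall>j. W j \<in> borel_measurable borel \<Longrightarrow> m \<le> 2 * j \<Longrightarrow> j \<le> m \<Longrightarrow>
      weighted (R\<^sup>2) (real (2 * j - m) + real CARD('n) / 2 - 1) (W j) \<le> ennreal (K m) *
        (\<Sum>\<mu> | length (\<mu> :: 'n list) = m. sq_int (ball 0 R) (radial_jet W \<mu>))"
    using jet_lower_bound[OF assms] by metis
  define c where "c m = real (card {\<mu> :: 'n list. length \<mu> = m})" for m
  define L where "L = (\<Sum>m\<le>k. K (m + q) * c (m + q))"
  have L: "L \<ge> 0" unfolding L_def c_def using K(1) by (intro sum_nonneg) auto
  have "weighted (R\<^sup>2) (real (2 * j - (m + q)) + real CARD('n) / 2 - 1) (W j) \<le> ennreal L * N"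
    if R: "R > 0" and W: "\<forall>j. W j \<in> borel_measurable borel"
      and N: "\<forall>is (\<mu> :: 'n list). length is \<le> k \<longrightarrow> length \<mu> = q \<longrightarrow> sq_int (ball 0 R) (radial_jet W (is @ \<mu>)) \<le> N"
      and mj: "m \<le> k" "j \<le> m + q" "m + q \<le> 2 * j" for R W N m j
  proof -
    \<comment> \<open>Every word of length \<open>m + q\<close> consists of \<open>m\<close>
      derivatives followed by the \<open>q\<close> letters naming the component, so \<open>N\<close>
      bounds its jet.\<close>
    have "sq_int (ball 0 R) (radial_jet W \<mu>) \<le> N" if "length \<mu> = m + q" for \<mu> :: "'n list"
      using N[rule_format, of "take m \<mu>" "drop m \<mu>"] that mj by simp
    then have "(\<Sum>\<mu> | length (\<mu> :: 'n list) = m + q. sq_int (ball 0 R) (radial_jet W \<mu>)) \<le> (\<Sum>\<mu> | length (\<mu> :: 'n list) = m + q. N)"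
      by (intro sum_mono) simp
    also have "\<dots> = ennreal (c (m + q)) * N"
      by (simp add: c_def ennreal_of_nat_eq_real_of_nat)
    finally have "weighted (R\<^sup>2) (real (2 * j - (m + q)) + real CARD('n) / 2 - 1) (W j) \<le> ennreal (K (m + q)) * (ennreal (c (m + q)) * N)"
      by (rule order_trans[OF K(2)[OF R W mj(3,2)] mult_left_mono]) simp
    also have "\<dots> = ennreal (K (m + q) * c (m + q)) * N"
      using K(1) by (simp add: ennreal_mult' mult.assoc)
    also have "\<dots> \<le> ennreal L * N"
      unfolding L_def using K(1) mj by (intro mult_right_mono ennreal_leI member_le_sum) (auto simp: c_def)
    finally show ?thesis .
  qed
  then show ?thesis using L by blast
qed

text \<open>Finite weighted norms make all jets square integrable, which is what
  \<open>radial_jet_sobolev\<close> needs in order to give membership and not only an estimate. The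
  constant is again uniform in \<open>R\<close>.\<close>

lemma sobolev_le_weighted:
  fixes \<nu> :: "'n::finite list"
  assumes n: "CARD('n) \<ge> 2" and q: "q \<le> 1" "length \<nu> = q"
  shows "\<exists>K\<ge>0. \<forall>R>0. \<forall>W f N. (\<forall>j. loc1 (R\<^sup>2) (W j)) \<longrightarrow>
    (\<forall>j. q \<le> j \<longrightarrow> j < q + k \<longrightarrow> ac_deriv (R\<^sup>2) (W j) (W (Suc j))) \<longrightarrow>
    (AE x in lebesgue. x \<in> ball 0 R \<longrightarrow> radial_jet W \<nu> x = f x) \<longrightarrow> N < \<infinity> \<longrightarrow>
    (\<forall>m\<le>k. \<forall>j. j \<le> m + q \<longrightarrow> m + q \<le> 2 * j \<longrightarrow>
      weighted (R\<^sup>2) (real (2 * j - (m + q)) + real CARD('n) / 2 - 1) (W j) \<le> N) \<longrightarrow>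
    f \<in> sobolev k (ball 0 R) \<and> ennreal ((sobolev_norm k (ball 0 R) f)\<^sup>2) \<le> ennreal K * N"
proof -
  define Q where "Q \<mu> K \<longleftrightarrow> K \<ge> 0 \<and> (\<forall>R>0. \<forall>W. (\<forall>j. W j \<in> borel_measurable borel) \<longrightarrow>
    sq_int (ball 0 R) (radial_jet W \<mu>) \<le> ennreal K *
    (\<Sum>j | j \<le> length \<mu> \<and> length \<mu> \<le> 2 * j. weighted (R\<^sup>2) (real (2 * j - length \<mu>) + real CARD('n) / 2 - 1) (W j)))"
    for \<mu> :: "'n list" and K
  have "\<forall>\<mu>. \<exists>K. Q \<mu> K" unfolding Q_def using jet_upper_bound by blast
  from choice[OF this] obtain K where Q: "\<And>\<mu>. Q \<mu> (K \<mu>)" by blast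
  note K = Q[unfolded Q_def, THEN conjunct1] Q[unfolded Q_def, THEN conjunct2, rule_format]
  define c where "c \<mu> = K \<mu> * real (card {j. j \<le> length \<mu> \<and> length \<mu> \<le> 2 * j})" for \<mu>
  have c: "c \<mu> \<ge> 0" for \<mu> unfolding c_def using K(1) by simp
  define L where "L = (\<Sum>\<gamma> | sum \<gamma> UNIV \<le> k. c (multi_list \<gamma> @ \<nu>))"
  have L: "L \<ge> 0" unfolding L_def using c by (intro sum_nonneg) auto
  have "f \<in> sobolev k (ball 0 R) \<and> ennreal ((sobolev_norm k (ball 0 R) f)\<^sup>2) \<le> ennreal L * N"
    if R: "R > 0" and W: "\<forall>j. loc1 (R\<^sup>2) (W j)" and ac: "\<forall>j. q \<le> j \<longrightarrow> j < q + k \<longrightarrow> ac_deriv (R\<^sup>2) (W j) (W (Suc j))"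
      and f: "AE x in lebesgue. x \<in> ball 0 R \<longrightarrow> radial_jet W \<nu> x = f x" and N: "N < \<infinity>"
      and bd: "\<forall>m\<le>k. \<forall>j. j \<le> m + q \<longrightarrow> m + q \<le> 2 * j \<longrightarrow>
        weighted (R\<^sup>2) (real (2 * j - (m + q)) + real CARD('n) / 2 - 1) (W j) \<le> N" for R W f N
  proof -
    have Wb: "\<forall>j. W j \<in> borel_measurable borel" using W loc1_borel by blast
    have le: "sq_int (ball 0 R) (radial_jet W (is @ \<nu>)) \<le> ennreal (c (is @ \<nu>)) * N" if "length is \<le> k" for "is"
    proof -
      let ?\<mu> = "is @ \<nu>"
      have "(\<Sum>j | j \<le> length ?\<mu> \<and> length ?\<mu> \<le> 2 * j. weighted (R\<^sup>2) (real (2 * j - length ?\<mu>) + real CARD('n) / 2 - 1) (W j))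
        \<le> (\<Sum>j | j \<le> length ?\<mu> \<and> length ?\<mu> \<le> 2 * j. N)"
        using bd that q by (intro sum_mono) auto
      also have "\<dots> = ennreal (real (card {j. j \<le> length ?\<mu> \<and> length ?\<mu> \<le> 2 * j})) * N"
        by (simp add: ennreal_of_nat_eq_real_of_nat)
      finally have "sq_int (ball 0 R) (radial_jet W ?\<mu>) \<le> ennreal (K ?\<mu>) * (ennreal (real (card {j. j \<le> length ?\<mu> \<and> length ?\<mu> \<le> 2 * j})) * N)"
        by (rule order_trans[OF K(2)[OF R Wb[rule_format]] mult_left_mono]) simp
      then show ?thesis using K(1) by (simp add: c_def ennreal_mult' mult.assoc)
    qed
    have L2: "radial_jet W (is @ \<nu>) \<in> L2 (ball 0 R)" if "length is \<le> k" for "is"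
    proof -
      have "radial_jet W (is @ \<nu>) \<in> borel_measurable borel" using Wb by (intro radial_jet_borel) blast
      moreover have "sq_int (ball 0 R) (radial_jet W (is @ \<nu>)) < \<infinity>"
        using le[OF that] N by (metis ennreal_less_top ennreal_mult_less_top infinity_ennreal_def le_less_trans)
      ultimately show ?thesis
        by (subst L2_iff) (auto intro!: measurable_completion borel_measurable_times borel_measurable_indicator)
    qed
    note S = radial_jet_sobolev[where W = W and k = k and f = f, OF n R W[rule_format] q ac[rule_format] L2 f]
    have "ennreal ((sobolev_norm k (ball 0 R) f)\<^sup>2) \<le> (\<Sum>\<gamma> | sum \<gamma> UNIV \<le> k. ennreal (c (multi_list \<gamma> @ \<nu>)) * N)"
      by (subst S(2)) (auto intro!: sum_mono le simp: length_multi_list)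
    also have "\<dots> = ennreal L * N"
      unfolding L_def using c by (simp add: sum_distrib_right[symmetric] sum_ennreal)
    finally show ?thesis using S(1) by blast
  qed
  then show ?thesis using L by blast
qed

lemma AE_ball_radial:
  assumes "R > 0" "AE s in lborel. 0 < s \<and> s < R\<^sup>2 \<longrightarrow> P s"
  shows "AE x in (lebesgue :: (real ^ 'n::finite) measure). x \<in> ball 0 R \<longrightarrow> P (x \<bullet> x)"
  using AE_radial_open[OF assms(2)] AE_nonzero
proof eventually_elim
  case (elim x)
  then show ?case using punctured_ball_iff[OF assms(1), of x] by blast
qed

text \<open>The profile is \<open>W 1\<close> in dimension \<open>d\<close> and becomes the zeroth
  derivative in dimension \<open>d + 2\<close>. All weighted norms required there already occur in
  dimension \<open>d\<close>, so a shift of indices suffices.\<close>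

lemma sobolev_dimension_shift_up:
  assumes d: "CARD('d::finite) \<ge> 2" and e: "CARD('e::finite) = CARD('d) + 2"
  shows "\<exists>K\<ge>0. \<forall>R>0. \<forall>v. (\<forall>l. (\<lambda>x :: real ^ 'd. 2 * x $ l * v (x \<bullet> x)) \<in> sobolev k (ball 0 R)) \<longrightarrow>
    (\<lambda>x :: real ^ 'e. v (x \<bullet> x)) \<in> sobolev k (ball 0 R) \<and>
    ennreal ((sobolev_norm k (ball 0 R) (\<lambda>x :: real ^ 'e. v (x \<bullet> x)))\<^sup>2)
      \<le> ennreal K * (\<Sum>l\<in>UNIV. ennreal ((sobolev_norm k (ball 0 R) (\<lambda>x :: real ^ 'd. 2 * x $ l * v (x \<bullet> x)))\<^sup>2))"
proof -
  have e2: "CARD('e) \<ge> 2" using e by simp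
  obtain K1 where K1: "K1 \<ge> 0" "\<And>R W N m j. R > 0 \<Longrightarrow> \<forall>j. W j \<in> borel_measurable borel \<Longrightarrow>
    \<forall>is (\<mu> :: 'd list). length is \<le> k \<longrightarrow> length \<mu> = 1 \<longrightarrow> sq_int (ball 0 R) (radial_jet W (is @ \<mu>)) \<le> N \<Longrightarrow>
    m \<le> k \<Longrightarrow> j \<le> m + 1 \<Longrightarrow> m + 1 \<le> 2 * j \<Longrightarrow>
      weighted (R\<^sup>2) (real (2 * j - (m + 1)) + real CARD('d) / 2 - 1) (W j) \<le> ennreal K1 * N"
    using weighted_le_sobolev[OF d, of k 1] by metis
  define P where "P K R W f N \<longleftrightarrow> ((\<forall>j. loc1 (R\<^sup>2) (W j)) \<longrightarrow>
    (\<forall>j. 0 \<le> j \<longrightarrow> j < 0 + k \<longrightarrow> ac_deriv (R\<^sup>2) (W j) (W (Suc j))) \<longrightarrow>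
    (AE x in lebesgue. x \<in> ball 0 R \<longrightarrow> radial_jet W ([] :: 'e list) x = f x) \<longrightarrow> N < \<infinity> \<longrightarrow>
    (\<forall>m\<le>k. \<forall>j. j \<le> m + 0 \<longrightarrow> m + 0 \<le> 2 * j \<longrightarrow>
      weighted (R\<^sup>2) (real (2 * j - (m + 0)) + real CARD('e) / 2 - 1) (W j) \<le> N) \<longrightarrow>
    f \<in> sobolev k (ball 0 R) \<and> ennreal ((sobolev_norm k (ball 0 R) f)\<^sup>2) \<le> ennreal K * N)" for K R W f N
  have "\<exists>K\<ge>0. \<forall>R>0. \<forall>W f N. P K R W f N"
    unfolding P_def by (rule sobolev_le_weighted[OF e2]) auto
  then obtain K2 where K2: "K2 \<ge> 0" "\<And>R W f N. R > 0 \<Longrightarrow> P K2 R W f N" by blast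
  have "(\<lambda>x :: real ^ 'e. v (x \<bullet> x)) \<in> sobolev k (ball 0 R) \<and>
    ennreal ((sobolev_norm k (ball 0 R) (\<lambda>x :: real ^ 'e. v (x \<bullet> x)))\<^sup>2)
      \<le> ennreal (K2 * K1) * (\<Sum>l\<in>UNIV. ennreal ((sobolev_norm k (ball 0 R) (\<lambda>x :: real ^ 'd. 2 * x $ l * v (x \<bullet> x)))\<^sup>2))"
    if R: "R > 0" and v: "\<forall>l. (\<lambda>x :: real ^ 'd. 2 * x $ l * v (x \<bullet> x)) \<in> sobolev k (ball 0 R)" for R v
  proof -
    let ?f = "\<lambda>l (x :: real ^ 'd). 2 * x $ l * v (x \<bullet> x)"
    define N where "N = (\<Sum>l\<in>UNIV. ennreal ((sobolev_norm k (ball 0 R) (?f l))\<^sup>2))"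
    have fm [measurable]: "?f l \<in> borel_measurable (lebesgue_on (ball 0 R))" for l
      using v by (auto simp: sobolev_def L2_def)
    have xm [measurable]: "(\<lambda>x :: real ^ 'd. x $ l) \<in> borel_measurable (lebesgue_on (ball 0 R))" for l
      by (intro measurable_restrict_space1 measurable_completion) simp
    \<comment> \<open>Measurability of the profile is recovered by dividing
      \<open>\<Sum>\<^sub>l x_l f_l = 2 |x|^2 v(|x|^2)\<close> by \<open>2 |x|^2\<close>; the
      convention that division by 0 is 0 matches the \<open>if\<close>.\<close>
    have "(\<lambda>x :: real ^ 'd. if x \<bullet> x = 0 then 0 else v (x \<bullet> x)) = (\<lambda>x. (\<Sum>l\<in>UNIV. x $ l * ?f l x) / (2 * (\<Sum>l\<in>UNIV. x $ l * x $ l)))"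
    proof
      fix x :: "real ^ 'd"
      have "(\<Sum>l\<in>UNIV. x $ l * ?f l x) = 2 * (x \<bullet> x) * v (x \<bullet> x)"
        by (simp add: inner_vec_def sum_distrib_left sum_distrib_right mult_ac)
      moreover have "(\<Sum>l\<in>UNIV. x $ l * x $ l) = x \<bullet> x"
        by (simp add: inner_vec_def)
      ultimately show "(if x \<bullet> x = 0 then 0 else v (x \<bullet> x)) = (\<Sum>l\<in>UNIV. x $ l * ?f l x) / (2 * (\<Sum>l\<in>UNIV. x $ l * x $ l))"
        by (cases "x = 0") simp_all
    qed
    then have "(\<lambda>x :: real ^ 'd. (\<lambda>s. if s = 0 then 0 else v s) (x \<bullet> x)) \<in> borel_measurable (lebesgue_on (ball 0 R))"
      by simp
    then obtain U where U: "U \<in> borel_measurable borel"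
      and "AE s in lborel. 0 < s \<and> s < R\<^sup>2 \<longrightarrow> (if s = 0 then 0 else v s) = U s"
      using R by (rule radial_borel_version)
    then have vU: "AE s in lborel. 0 < s \<and> s < R\<^sup>2 \<longrightarrow> v s = U s" by (auto elim: eventually_mono)
    have feq: "AE x in lebesgue. x \<in> ball 0 R \<longrightarrow> ?f (hd \<mu>) x = coef \<mu> 1 x * U (x \<bullet> x)" if \<mu>: "length \<mu> = 1" for \<mu>
    proof -
      obtain l where l: "\<mu> = [l]" using \<mu> by (auto simp: length_Suc_conv)
      show ?thesis using AE_ball_radial[OF R vU] by eventually_elim (auto simp: l coef_single simp del: coef.simps)
    qed
    have "\<exists>W. W 1 = U \<and> (\<forall>j. loc1 (R\<^sup>2) (W j)) \<and> (\<forall>j. 1 \<le> j \<longrightarrow> j < 1 + k \<longrightarrow> ac_deriv (R\<^sup>2) (W j) (W (Suc j))) \<and>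
      (\<forall>is (\<mu> :: 'd list). length is \<le> k \<longrightarrow> length \<mu> = 1 \<longrightarrow>
        sq_int (ball 0 R) (radial_jet W (is @ \<mu>)) \<le> ennreal ((sobolev_norm k (ball 0 R) (?f (hd \<mu>)))\<^sup>2))"
      by (rule sobolev_profile[OF R order_refl U, of "\<lambda>\<mu>. ?f (hd \<mu>)" k, OF v[rule_format] feq])
    then obtain W where W: "W 1 = U" "\<forall>j. loc1 (R\<^sup>2) (W j)" "\<forall>j. 1 \<le> j \<longrightarrow> j < 1 + k \<longrightarrow> ac_deriv (R\<^sup>2) (W j) (W (Suc j))"
      "\<forall>is (\<mu> :: 'd list). length is \<le> k \<longrightarrow> length \<mu> = 1 \<longrightarrow>
        sq_int (ball 0 R) (radial_jet W (is @ \<mu>)) \<le> ennreal ((sobolev_norm k (ball 0 R) (?f (hd \<mu>)))\<^sup>2)"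
      by blast
    have N: "\<forall>is (\<mu> :: 'd list). length is \<le> k \<longrightarrow> length \<mu> = 1 \<longrightarrow> sq_int (ball 0 R) (radial_jet W (is @ \<mu>)) \<le> N"
    proof (intro allI impI)
      fix "is" \<mu> :: "'d list" assume *: "length is \<le> k" "length \<mu> = 1"
      have "ennreal ((sobolev_norm k (ball 0 R) (?f (hd \<mu>)))\<^sup>2) \<le> N"
        unfolding N_def by (rule member_le_sum) auto
      then show "sq_int (ball 0 R) (radial_jet W (is @ \<mu>)) \<le> N" using W(4) * by (blast intro: order_trans)
    qed
    have Wb: "\<forall>j. W j \<in> borel_measurable borel" using W(2) loc1_borel by blast
    have "(\<lambda>x :: real ^ 'e. v (x \<bullet> x)) \<in> sobolev k (ball 0 R) \<and>
      ennreal ((sobolev_norm k (ball 0 R) (\<lambda>x :: real ^ 'e. v (x \<bullet> x)))\<^sup>2) \<le> ennreal K2 * (ennreal K1 * N)"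
    proof (rule K2(2)[OF R, of "\<lambda>j. W (Suc j)", unfolded P_def, rule_format (no_asm)])
      show "AE x in lebesgue. x \<in> ball 0 R \<longrightarrow> radial_jet (\<lambda>j. W (Suc j)) ([] :: 'e list) x = v (x \<bullet> x)"
        using AE_ball_radial[OF R vU] by eventually_elim (use W(1) in \<open>auto simp: radial_jet_def\<close>)
      show "ennreal K1 * N < \<infinity>" by (simp add: N_def ennreal_mult_less_top)
      show "\<forall>m\<le>k. \<forall>j. j \<le> m + 0 \<longrightarrow> m + 0 \<le> 2 * j \<longrightarrow>
        weighted (R\<^sup>2) (real (2 * j - (m + 0)) + real CARD('e) / 2 - 1) (W (Suc j)) \<le> ennreal K1 * N"
      proof (intro allI impI)
        fix m j assume mj: "m \<le> k" "j \<le> m + 0" "m + 0 \<le> 2 * j"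
        \<comment> \<open>Raising \<open>j\<close> and the order by 1 adds 1 to
          \<open>2 * j - m\<close>, just as two extra dimensions add 1 to half the
          dimension.\<close>
        have E: "real (2 * Suc j - (m + 1)) + real CARD('d) / 2 - 1 = real (2 * j - (m + 0)) + real CARD('e) / 2 - 1"
          using mj e by (simp add: of_nat_diff add_divide_distrib)
        show "weighted (R\<^sup>2) (real (2 * j - (m + 0)) + real CARD('e) / 2 - 1) (W (Suc j)) \<le> ennreal K1 * N"
          using K1(2)[OF R Wb N mj(1), of "Suc j"] mj unfolding E by simp
      qed
    qed (use W in auto)
    then show ?thesis using K1(1) K2(1) by (simp add: N_def ennreal_mult' mult.assoc)
  qed
  then show ?thesis using K1(1) K2(1) by (intro exI[of _ "K2 * K1"]) auto
qed

text \<open>The reverse shift leaves one weighted norm uncovered: for odd \<open>m\<close>, the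
  index with \<open>2 * J = m + 1\<close> corresponds to \<open>2 * j < m\<close>, out of range in
  dimension \<open>d + 2\<close>. Hardy's inequality bounds it by two norms in range, with a
  constant depending on the lower bound \<delta> of the radius.\<close>

lemma sobolev_dimension_shift_down:
  assumes d: "CARD('d::finite) \<ge> 2" and e: "CARD('e::finite) = CARD('d) + 2" and \<delta>: "\<delta> > 0"
  shows "\<exists>K\<ge>0. \<forall>R\<ge>\<delta>. \<forall>v l. (\<lambda>x :: real ^ 'e. v (x \<bullet> x)) \<in> sobolev k (ball 0 R) \<longrightarrow>
    (\<lambda>x :: real ^ 'd. 2 * x $ l * v (x \<bullet> x)) \<in> sobolev k (ball 0 R) \<and>
    ennreal ((sobolev_norm k (ball 0 R) (\<lambda>x :: real ^ 'd. 2 * x $ l * v (x \<bullet> x)))\<^sup>2)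
      \<le> ennreal K * ennreal ((sobolev_norm k (ball 0 R) (\<lambda>x :: real ^ 'e. v (x \<bullet> x)))\<^sup>2)"
proof -
  have e2: "CARD('e) \<ge> 2" using e by simp
  obtain K1 where K1: "K1 \<ge> 0" "\<And>R W N m j. R > 0 \<Longrightarrow> \<forall>j. W j \<in> borel_measurable borel \<Longrightarrow>
    \<forall>is (\<mu> :: 'e list). length is \<le> k \<longrightarrow> length \<mu> = 0 \<longrightarrow> sq_int (ball 0 R) (radial_jet W (is @ \<mu>)) \<le> N \<Longrightarrow>
    m \<le> k \<Longrightarrow> j \<le> m + 0 \<Longrightarrow> m + 0 \<le> 2 * j \<Longrightarrow>
      weighted (R\<^sup>2) (real (2 * j - (m + 0)) + real CARD('e) / 2 - 1) (W j) \<le> ennreal K1 * N"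
    using weighted_le_sobolev[OF e2, of k 0] by metis
  define P where "P K l R W f N \<longleftrightarrow> ((\<forall>j. loc1 (R\<^sup>2) (W j)) \<longrightarrow>
    (\<forall>j. 1 \<le> j \<longrightarrow> j < 1 + k \<longrightarrow> ac_deriv (R\<^sup>2) (W j) (W (Suc j))) \<longrightarrow>
    (AE x in lebesgue. x \<in> ball 0 R \<longrightarrow> radial_jet W [l] x = f x) \<longrightarrow> N < \<infinity> \<longrightarrow>
    (\<forall>m\<le>k. \<forall>j. j \<le> m + 1 \<longrightarrow> m + 1 \<le> 2 * j \<longrightarrow>
      weighted (R\<^sup>2) (real (2 * j - (m + 1)) + real CARD('d) / 2 - 1) (W j) \<le> N) \<longrightarrow>
    f \<in> sobolev k (ball 0 R) \<and> ennreal ((sobolev_norm k (ball 0 R) f)\<^sup>2) \<le> ennreal K * N)" for K and l :: 'd and R W f N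
  have "\<exists>K\<ge>0. \<forall>R>0. \<forall>W f N. P K l R W f N" for l
    unfolding P_def by (rule sobolev_le_weighted[OF d]) auto
  then have "\<forall>l. \<exists>K. K \<ge> 0 \<and> (\<forall>R>0. \<forall>W f N. P K l R W f N)" by blast
  from choice[OF this] obtain K2 where K2: "\<And>l. K2 l \<ge> 0" "\<And>l R W f N. R > 0 \<Longrightarrow> P (K2 l) l R W f N" by blast
  define \<alpha> where "\<alpha> = real CARD('d) / 2"
  have \<alpha>: "\<alpha> > 0" by (simp add: \<alpha>_def)
  \<comment> \<open>The summand 1 serves the indices where the weights match; the others are the
    constants of \<open>hardy_inequality\<close> for \<open>T = R\<^sup>2\<close>, with
    \<open>R\<^sup>2\<close> bounded below by \<open>\<delta>\<^sup>2\<close>.\<close>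
  define c where "c = 1 + 8 / \<alpha>\<^sup>2 + (4 / \<alpha> + 2) / \<delta>\<^sup>2"
  have c: "c \<ge> 1" using \<alpha> by (simp add: c_def)
  define L where "L = (\<Sum>l\<in>UNIV. K2 l * (c * K1))"
  have L: "L \<ge> 0" unfolding L_def using c K1(1) K2(1) by (intro sum_nonneg) auto
  have "(\<lambda>x :: real ^ 'd. 2 * x $ l * v (x \<bullet> x)) \<in> sobolev k (ball 0 R) \<and>
    ennreal ((sobolev_norm k (ball 0 R) (\<lambda>x :: real ^ 'd. 2 * x $ l * v (x \<bullet> x)))\<^sup>2)
      \<le> ennreal L * ennreal ((sobolev_norm k (ball 0 R) (\<lambda>x :: real ^ 'e. v (x \<bullet> x)))\<^sup>2)"
    if R\<delta>: "R \<ge> \<delta>" and v: "(\<lambda>x :: real ^ 'e. v (x \<bullet> x)) \<in> sobolev k (ball 0 R)" for R v l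
  proof -
    let ?f = "\<lambda>x :: real ^ 'e. v (x \<bullet> x)"
    have R: "R > 0" using R\<delta> \<delta> by simp
    define N where "N = ennreal ((sobolev_norm k (ball 0 R) ?f)\<^sup>2)"
    have "?f \<in> borel_measurable (lebesgue_on (ball 0 R))" using v by (auto simp: sobolev_def L2_def)
    then obtain U where U: "U \<in> borel_measurable borel"
      and vU: "AE s in lborel. 0 < s \<and> s < R\<^sup>2 \<longrightarrow> v s = U s"
      using R by (rule radial_borel_version)
    have feq: "AE x in lebesgue. x \<in> ball 0 R \<longrightarrow> ?f x = coef \<mu> 0 x * U (x \<bullet> x)" if \<mu>: "length \<mu> = 0" for \<mu>
      using AE_ball_radial[OF R vU] by eventually_elim (use \<mu> in auto)
    have "\<exists>W. W 0 = U \<and> (\<forall>j. loc1 (R\<^sup>2) (W j)) \<and> (\<forall>j. 0 \<le> j \<longrightarrow> j < 0 + k \<longrightarrow> ac_deriv (R\<^sup>2) (W j) (W (Suc j))) \<and>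
      (\<forall>is (\<mu> :: 'e list). length is \<le> k \<longrightarrow> length \<mu> = 0 \<longrightarrow>
        sq_int (ball 0 R) (radial_jet W (is @ \<mu>)) \<le> ennreal ((sobolev_norm k (ball 0 R) ?f)\<^sup>2))"
      by (rule sobolev_profile[OF R le0 U, of "\<lambda>\<mu>. ?f" k, OF v feq])
    then obtain W where W: "W 0 = U" "\<forall>j. loc1 (R\<^sup>2) (W j)" "\<forall>j. 0 \<le> j \<longrightarrow> j < 0 + k \<longrightarrow> ac_deriv (R\<^sup>2) (W j) (W (Suc j))"
      "\<forall>is (\<mu> :: 'e list). length is \<le> k \<longrightarrow> length \<mu> = 0 \<longrightarrow>
        sq_int (ball 0 R) (radial_jet W (is @ \<mu>)) \<le> ennreal ((sobolev_norm k (ball 0 R) ?f)\<^sup>2)"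
      by blast
    have Wb: "\<forall>j. W j \<in> borel_measurable borel" using W(2) loc1_borel by blast
    have N: "\<forall>is (\<mu> :: 'e list). length is \<le> k \<longrightarrow> length \<mu> = 0 \<longrightarrow> sq_int (ball 0 R) (radial_jet W (is @ \<mu>)) \<le> N"
      using W(4) unfolding N_def by blast
    \<comment> \<open>Slot 0 would hold a primitive of the profile; 0 is an admissible filler, since
      the coefficient of this slot vanishes in the jets of all nonempty words.\<close>
    define W1 where "W1 j = (case j of 0 \<Rightarrow> (\<lambda>_. 0) | Suc i \<Rightarrow> W i)" for j
    have W1: "W1 0 = (\<lambda>_. 0)" "\<And>j. W1 (Suc j) = W j" by (simp_all add: W1_def)
    have "(\<lambda>x :: real ^ 'd. 2 * x $ l * v (x \<bullet> x)) \<in> sobolev k (ball 0 R) \<and>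
      ennreal ((sobolev_norm k (ball 0 R) (\<lambda>x :: real ^ 'd. 2 * x $ l * v (x \<bullet> x)))\<^sup>2) \<le> ennreal (K2 l) * (ennreal (c * K1) * N)"
    proof (rule K2(2)[OF R, of l W1, unfolded P_def, rule_format (no_asm)])
      show "\<forall>j. loc1 (R\<^sup>2) (W1 j)" using W(2) loc1_const by (auto simp: W1_def split: nat.split)
      show "\<forall>j. 1 \<le> j \<longrightarrow> j < 1 + k \<longrightarrow> ac_deriv (R\<^sup>2) (W1 j) (W1 (Suc j))"
        using W(3) by (auto simp: W1_def split: nat.split)
      show "AE x in lebesgue. x \<in> ball 0 R \<longrightarrow> radial_jet W1 [l] x = 2 * x $ l * v (x \<bullet> x)"
        using AE_ball_radial[OF R vU]
        by eventually_elim (use W(1) W1 in \<open>auto simp: radial_jet_def\<close>)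
      show "ennreal (c * K1) * N < \<infinity>" by (simp add: N_def ennreal_mult_less_top)
      show "\<forall>m\<le>k. \<forall>j. j \<le> m + 1 \<longrightarrow> m + 1 \<le> 2 * j \<longrightarrow>
        weighted (R\<^sup>2) (real (2 * j - (m + 1)) + real CARD('d) / 2 - 1) (W1 j) \<le> ennreal (c * K1) * N"
      proof (intro allI impI)
        fix m J assume mJ: "m \<le> k" "J \<le> m + 1" "m + 1 \<le> 2 * J"
        then obtain j where J: "J = Suc j" by (cases J) auto
        show "weighted (R\<^sup>2) (real (2 * J - (m + 1)) + real CARD('d) / 2 - 1) (W1 J) \<le> ennreal (c * K1) * N"
        proof (cases "m \<le> 2 * j")
          case True
          have E: "real (2 * J - (m + 1)) + real CARD('d) / 2 - 1 = real (2 * j - (m + 0)) + real CARD('e) / 2 - 1"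
            using True e by (simp add: J of_nat_diff add_divide_distrib)
          have "weighted (R\<^sup>2) (real (2 * J - (m + 1)) + real CARD('d) / 2 - 1) (W1 J) \<le> ennreal K1 * N"
            using K1(2)[OF R Wb N mJ(1), of j] mJ True unfolding E by (simp add: J W1)
          also have "\<dots> \<le> ennreal (c * K1) * N"
            using c K1(1) mult_right_mono[of 1 c K1] by (intro mult_right_mono ennreal_leI) auto
          finally show ?thesis .
        next
          case False
          \<comment> \<open>\<open>W (Suc j)\<close> is then estimated at order \<open>m\<close> and
            \<open>W j\<close> at order \<open>m - 1 = 2 * j\<close>, with weights \<alpha> + 1 and
            \<alpha>, while the weight sought is \<alpha> - 1.\<close>
          then have m: "m = 2 * j + 1" using mJ by (simp add: J)
          have e': "real CARD('e) / 2 - 1 = \<alpha>" using e by (simp add: \<alpha>_def add_divide_distrib)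
          have V: "weighted (R\<^sup>2) (\<alpha> + 1) (W (Suc j)) \<le> ennreal K1 * N"
          proof -
            have E: "real (2 * Suc j - (m + 0)) + real CARD('e) / 2 - 1 = \<alpha> + 1" using e' by (simp add: m)
            show ?thesis using K1(2)[OF R Wb N mJ(1), of "Suc j"] unfolding E by (simp add: m)
          qed
          have U: "weighted (R\<^sup>2) \<alpha> (W j) \<le> ennreal K1 * N"
            using K1(2)[OF R Wb N, of "2 * j" j] e' mJ(1) by (simp add: m)
          have "weighted (R\<^sup>2) (\<alpha> - 1) (W j) \<le> ennreal (8 / \<alpha>\<^sup>2) * weighted (R\<^sup>2) (\<alpha> + 1) (W (Suc j))
              + ennreal ((4 / \<alpha> + 2) / R\<^sup>2) * weighted (R\<^sup>2) \<alpha> (W j)"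
            using W(3)[rule_format, of j] R \<alpha> mJ(1) by (intro hardy_inequality) (auto simp: m)
          also have "\<dots> \<le> ennreal (8 / \<alpha>\<^sup>2) * (ennreal K1 * N) + ennreal ((4 / \<alpha> + 2) / \<delta>\<^sup>2) * (ennreal K1 * N)"
            using R\<delta> \<delta> \<alpha> by (intro add_mono mult_mono U V ennreal_leI divide_left_mono power_mono) auto
          also have "\<dots> = ennreal (8 / \<alpha>\<^sup>2 + (4 / \<alpha> + 2) / \<delta>\<^sup>2) * (ennreal K1 * N)"
            using \<alpha> by (subst ennreal_plus) (auto simp: distrib_right)
          also have "\<dots> \<le> ennreal c * (ennreal K1 * N)"
            by (intro mult_right_mono ennreal_leI) (auto simp: c_def)
          also have "\<dots> = ennreal (c * K1) * N"
            using c K1(1) by (simp add: ennreal_mult' mult.assoc)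
          finally show ?thesis by (simp add: J W1 m \<alpha>_def)
        qed
      qed
    qed
    moreover have "ennreal (K2 l) * (ennreal (c * K1) * N) \<le> ennreal L * N"
    proof -
      have "ennreal (K2 l) * (ennreal (c * K1) * N) = ennreal (K2 l * (c * K1)) * N"
        using K2(1) by (simp add: ennreal_mult' mult.assoc)
      also have "\<dots> \<le> ennreal L * N"
        unfolding L_def using c K1(1) K2(1) by (intro mult_right_mono ennreal_leI member_le_sum) auto
      finally show ?thesis .
    qed
    ultimately show ?thesis unfolding N_def by (blast intro: order_trans)
  qed
  then show ?thesis using L by blast
qed

text \<open>Every entry of the form is 0, 1 or -1 times one of the functions \<open>f p\<close>.
  Conversely \<open>f l\<close> is the entry \<open>A m x $ l $ m\<close> for any \<open>m\<close>
  different from \<open>l\<close>, which exists because the dimension is at least 2. The factor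
  \<open>CARD('d) ^ 3\<close> counts entries.\<close>

lemma equivariant_form_sobolev:
  fixes A :: "'d::finite one_form" and f :: "'d \<Rightarrow> real ^ 'd \<Rightarrow> real"
  assumes d: "CARD('d) \<ge> 2" and A: "equivariant_form R u A"
    and f: "\<And>l x. x \<in> ball 0 R \<Longrightarrow> f l x = x $ l * u (norm x)"
  shows "A \<in> sobolev_form k (ball 0 R) \<longleftrightarrow> (\<forall>l. f l \<in> sobolev k (ball 0 R))" (is ?mem)
    and "A \<in> sobolev_form k (ball 0 R) \<Longrightarrow>
      (sobolev_form_norm k (ball 0 R) A)\<^sup>2 \<le> real CARD('d) ^ 3 * (\<Sum>l\<in>UNIV. (sobolev_norm k (ball 0 R) (f l))\<^sup>2)" (is "_ \<Longrightarrow> ?upper")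
    and "A \<in> sobolev_form k (ball 0 R) \<Longrightarrow>
      (\<Sum>l\<in>UNIV. (sobolev_norm k (ball 0 R) (f l))\<^sup>2) \<le> real CARD('d) * (sobolev_form_norm k (ball 0 R) A)\<^sup>2" (is "_ \<Longrightarrow> ?lower")
proof -
  let ?B = "ball 0 R :: (real ^ 'd) set"
  let ?N = "sobolev_norm k ?B"
  \<comment> \<open>\<open>p\<close> selects the coordinate and \<open>a\<close> the sign; for
    \<open>i = j = l\<close> the two terms of the defining formula cancel, and \<open>a\<close> is
    0.\<close>
  define p where "p i j l = (if j = l then i else j)" for i j l :: 'd
  define a :: "'d \<Rightarrow> 'd \<Rightarrow> 'd \<Rightarrow> real" where "a i j l = of_bool (j = l \<and> i \<noteq> l) - of_bool (i = l \<and> j \<noteq> l)" for i j l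
  have comp: "A l x $ i $ j = a i j l * f (p i j l) x" if "x \<in> ?B" for i j l x
    using A that unfolding equivariant_form_def by (auto simp: a_def p_def f)
  have a1: "(a i j l)\<^sup>2 \<le> 1" for i j l by (simp add: a_def of_bool_def)
  have up: "(\<lambda>x. A l x $ i $ j) \<in> sobolev k ?B" "(?N (\<lambda>x. A l x $ i $ j))\<^sup>2 \<le> (\<Sum>p\<in>UNIV. (?N (f p))\<^sup>2)"
    if "\<forall>l. f l \<in> sobolev k ?B" for i j l
  proof -
    have S: "(\<lambda>x. A l x $ i $ j) \<in> sobolev k ?B" "?N (\<lambda>x. A l x $ i $ j) = \<bar>a i j l\<bar> * ?N (f (p i j l))"
      using sobolev_scale[where f' = "\<lambda>x. A l x $ i $ j", OF open_ball that[THEN spec, of "p i j l"] comp] by auto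
    show "(\<lambda>x. A l x $ i $ j) \<in> sobolev k ?B" by (rule S(1))
    have "(?N (\<lambda>x. A l x $ i $ j))\<^sup>2 \<le> 1 * (?N (f (p i j l)))\<^sup>2"
      unfolding S(2) power_mult_distrib power2_abs using a1 by (rule mult_right_mono) simp
    also have "\<dots> \<le> (\<Sum>p\<in>UNIV. (?N (f p))\<^sup>2)"
      using member_le_sum[of "p i j l" UNIV "\<lambda>p. (?N (f p))\<^sup>2"] by simp
    finally show "(?N (\<lambda>x. A l x $ i $ j))\<^sup>2 \<le> (\<Sum>p\<in>UNIV. (?N (f p))\<^sup>2)" .
  qed
  have N2: "(sobolev_form_norm k ?B A)\<^sup>2 = (\<Sum>i\<in>UNIV. \<Sum>j\<in>UNIV. \<Sum>l\<in>UNIV. (?N (\<lambda>x. A l x $ i $ j))\<^sup>2)"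
    unfolding sobolev_form_norm_def by (intro real_sqrt_pow2 sum_nonneg) simp
  have low: "f l \<in> sobolev k ?B" "(?N (f l))\<^sup>2 \<le> (sobolev_form_norm k ?B A)\<^sup>2" if Ak: "A \<in> sobolev_form k ?B" for l
  proof -
    have "(UNIV :: 'd set) \<noteq> {l}"
    proof
      assume "(UNIV :: 'd set) = {l}"
      then have "CARD('d) = card {l}" by (rule arg_cong)
      then show False using d by simp
    qed
    then obtain m where m: "m \<noteq> l" by blast
    have mem: "(\<lambda>x. A m x $ l $ m) \<in> sobolev k ?B" using Ak by (auto simp: sobolev_form_def)
    have "f l x = 1 * A m x $ l $ m" if "x \<in> ?B" for x
      using comp[OF that, of m l m] m by (simp add: a_def p_def)
    note S = sobolev_scale[where f' = "f l" and c = 1, OF open_ball mem this]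
    show "f l \<in> sobolev k ?B" by (rule S(1))
    have "(?N (f l))\<^sup>2 = (?N (\<lambda>x. A m x $ l $ m))\<^sup>2" using S(2) by simp
    also have "\<dots> \<le> (\<Sum>n\<in>UNIV. (?N (\<lambda>x. A n x $ l $ m))\<^sup>2)"
      by (rule member_le_sum) auto
    also have "\<dots> \<le> (\<Sum>j\<in>UNIV. \<Sum>n\<in>UNIV. (?N (\<lambda>x. A n x $ l $ j))\<^sup>2)"
      by (rule member_le_sum[where f = "\<lambda>j. \<Sum>n\<in>UNIV. (?N (\<lambda>x. A n x $ l $ j))\<^sup>2"]) (auto intro: sum_nonneg)
    also have "\<dots> \<le> (\<Sum>i\<in>UNIV. \<Sum>j\<in>UNIV. \<Sum>n\<in>UNIV. (?N (\<lambda>x. A n x $ i $ j))\<^sup>2)"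
      by (rule member_le_sum[where f = "\<lambda>i. \<Sum>j\<in>UNIV. \<Sum>n\<in>UNIV. (?N (\<lambda>x. A n x $ i $ j))\<^sup>2"]) (auto intro!: sum_nonneg)
    finally show "(?N (f l))\<^sup>2 \<le> (sobolev_form_norm k ?B A)\<^sup>2" unfolding N2 .
  qed
  show mem: ?mem using up(1) low(1) unfolding sobolev_form_def by blast
  show ?upper if "A \<in> sobolev_form k ?B"
  proof -
    have "(sobolev_form_norm k ?B A)\<^sup>2 \<le> (\<Sum>i\<in>(UNIV :: 'd set). \<Sum>j\<in>(UNIV :: 'd set). \<Sum>l\<in>(UNIV :: 'd set). \<Sum>p\<in>UNIV. (?N (f p))\<^sup>2)"
      unfolding N2 using that mem by (intro sum_mono up(2)) simp
    then show ?thesis by (simp add: power3_eq_cube)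
  qed
  show ?lower if "A \<in> sobolev_form k ?B"
    using sum_mono[of UNIV "\<lambda>l. (?N (f l))\<^sup>2", OF low(2)[OF that]] by simp
qed

theorem proposition1p5:
  fixes k :: nat
  assumes "CARD('d::finite) \<ge> 2"
    and "CARD('e::finite) = CARD('d) + 2"
    and "real k < real CARD('d) / 2 + 2"
  shows "(\<forall>R>0. \<forall>u. \<forall>A :: 'd one_form. equivariant_form R u A \<longrightarrow>
            (A \<in> sobolev_form k (ball 0 R) \<longleftrightarrow>
             (\<lambda>x :: real ^ 'e. u (norm x)) \<in> sobolev k (ball 0 R)))
       \<and> (\<forall>S. bounded S \<and> (\<exists>\<delta>>0. \<forall>R\<in>S. \<delta> \<le> R) \<longrightarrow>
            (\<exists>C>0. \<forall>R\<in>S. \<forall>u. \<forall>A :: 'd one_form.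
               equivariant_form R u A \<and> A \<in> sobolev_form k (ball 0 R) \<longrightarrow>
                 sobolev_form_norm k (ball 0 R) A
                   \<le> C * sobolev_norm k (ball 0 R) (\<lambda>x :: real ^ 'e. u (norm x)) \<and>
                 sobolev_norm k (ball 0 R) (\<lambda>x :: real ^ 'e. u (norm x))
                   \<le> C * sobolev_form_norm k (ball 0 R) A))"
proof -
  let ?d = "real CARD('d)"
  define v :: "(real \<Rightarrow> real) \<Rightarrow> real \<Rightarrow> real" where "v u s = u (sqrt s) / 2" for u s
  define f where "f u l x = 2 * x $ l * v u (x \<bullet> x)" for u and l :: 'd and x
  define g where "g u x = v u (x \<bullet> x)" for u and x :: "real ^ 'e"
  have f_eq: "f u l x = x $ l * u (norm x)" for u l x
    by (simp add: f_def v_def norm_eq_sqrt_inner)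
  have g_eq: "u (norm x) = 2 * g u x" "g u x = 1 / 2 * u (norm x)" for u x
    by (simp_all add: g_def v_def norm_eq_sqrt_inner)
  have g: "(\<lambda>x :: real ^ 'e. u (norm x)) \<in> sobolev k (ball 0 R) \<longleftrightarrow> g u \<in> sobolev k (ball 0 R)" for u R
    using sobolev_scale(1)[where f = "g u", OF open_ball _ g_eq(1)] sobolev_scale(1)[where f' = "g u", OF open_ball _ g_eq(2)] by blast
  have g_norm: "sobolev_norm k (ball 0 R) (\<lambda>x :: real ^ 'e. u (norm x)) = 2 * sobolev_norm k (ball 0 R) (g u)"
    if "g u \<in> sobolev k (ball 0 R)" for u R
    using sobolev_scale(2)[where f' = "\<lambda>x. u (norm x)", OF open_ball that g_eq(1)] by simp
  note form = equivariant_form_sobolev[where f = "f _", OF assms(1) _ f_eq]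
  obtain K where K: "K \<ge> 0" "\<And>R u. R > 0 \<Longrightarrow> \<forall>l. f u l \<in> sobolev k (ball 0 R) \<Longrightarrow> g u \<in> sobolev k (ball 0 R) \<and>
      (sobolev_norm k (ball 0 R) (g u))\<^sup>2 \<le> K * (\<Sum>l\<in>UNIV. (sobolev_norm k (ball 0 R) (f u l))\<^sup>2)"
  proof -
    obtain K where K: "K \<ge> 0" "\<forall>R>0. \<forall>v. (\<forall>l. (\<lambda>x :: real ^ 'd. 2 * x $ l * v (x \<bullet> x)) \<in> sobolev k (ball 0 R)) \<longrightarrow>
      (\<lambda>x :: real ^ 'e. v (x \<bullet> x)) \<in> sobolev k (ball 0 R) \<and>
      ennreal ((sobolev_norm k (ball 0 R) (\<lambda>x :: real ^ 'e. v (x \<bullet> x)))\<^sup>2)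
      \<le> ennreal K * (\<Sum>l\<in>UNIV. ennreal ((sobolev_norm k (ball 0 R) (\<lambda>x :: real ^ 'd. 2 * x $ l * v (x \<bullet> x)))\<^sup>2))"
      using sobolev_dimension_shift_up[OF assms(1,2), of k] by blast
    show ?thesis
    proof (rule that[OF K(1)])
      fix R :: real and u assume R: "R > 0" and "\<forall>l. f u l \<in> sobolev k (ball 0 R)"
      then have "g u \<in> sobolev k (ball 0 R) \<and> ennreal ((sobolev_norm k (ball 0 R) (g u))\<^sup>2)
        \<le> ennreal K * (\<Sum>l\<in>UNIV. ennreal ((sobolev_norm k (ball 0 R) (f u l))\<^sup>2))"
        using K(2) unfolding f_def g_def by blast
      then show "g u \<in> sobolev k (ball 0 R) \<and>
        (sobolev_norm k (ball 0 R) (g u))\<^sup>2 \<le> K * (\<Sum>l\<in>UNIV. (sobolev_norm k (ball 0 R) (f u l))\<^sup>2)"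
        using K(1) by (simp add: sum_ennreal ennreal_mult'[symmetric] sum_nonneg)
    qed
  qed
  have down: "\<exists>K\<ge>0. \<forall>R\<ge>\<delta>. \<forall>u l. g u \<in> sobolev k (ball 0 R) \<longrightarrow> f u l \<in> sobolev k (ball 0 R) \<and>
      (sobolev_norm k (ball 0 R) (f u l))\<^sup>2 \<le> K * (sobolev_norm k (ball 0 R) (g u))\<^sup>2" if \<delta>: "\<delta> > 0" for \<delta>
  proof -
    obtain K where K: "K \<ge> 0" "\<forall>R\<ge>\<delta>. \<forall>v l. (\<lambda>x :: real ^ 'e. v (x \<bullet> x)) \<in> sobolev k (ball 0 R) \<longrightarrow>
      (\<lambda>x :: real ^ 'd. 2 * x $ l * v (x \<bullet> x)) \<in> sobolev k (ball 0 R) \<and>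
      ennreal ((sobolev_norm k (ball 0 R) (\<lambda>x :: real ^ 'd. 2 * x $ l * v (x \<bullet> x)))\<^sup>2)
      \<le> ennreal K * ennreal ((sobolev_norm k (ball 0 R) (\<lambda>x :: real ^ 'e. v (x \<bullet> x)))\<^sup>2)"
      using sobolev_dimension_shift_down[OF assms(1,2) \<delta>, of k] by blast
    have "f u l \<in> sobolev k (ball 0 R) \<and> (sobolev_norm k (ball 0 R) (f u l))\<^sup>2 \<le> K * (sobolev_norm k (ball 0 R) (g u))\<^sup>2"
      if "R \<ge> \<delta>" "g u \<in> sobolev k (ball 0 R)" for R u l
    proof -
      have "f u l \<in> sobolev k (ball 0 R) \<and> ennreal ((sobolev_norm k (ball 0 R) (f u l))\<^sup>2)
        \<le> ennreal K * ennreal ((sobolev_norm k (ball 0 R) (g u))\<^sup>2)"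
        using K(2) that unfolding f_def g_def by blast
      then show ?thesis using K(1) by (simp add: ennreal_mult'[symmetric])
    qed
    then show ?thesis using K(1) by blast
  qed
  \<comment> \<open>For membership at a single radius, \<open>R\<close> itself serves as the lower
    bound in \<open>down\<close>.\<close>
  have mem: "A \<in> sobolev_form k (ball 0 R) \<longleftrightarrow> g u \<in> sobolev k (ball 0 R)"
    if R: "R > 0" and A: "equivariant_form R u A" for R u and A :: "'d one_form"
    using form(1)[OF A] K(2)[OF R] down[OF R] by blast
  have bound: "\<exists>C>0. \<forall>R\<in>S. \<forall>u. \<forall>A :: 'd one_form. equivariant_form R u A \<and> A \<in> sobolev_form k (ball 0 R) \<longrightarrow>
      sobolev_form_norm k (ball 0 R) A \<le> C * sobolev_norm k (ball 0 R) (\<lambda>x :: real ^ 'e. u (norm x)) \<and>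
      sobolev_norm k (ball 0 R) (\<lambda>x :: real ^ 'e. u (norm x)) \<le> C * sobolev_form_norm k (ball 0 R) A"
    if \<delta>: "\<delta> > 0" "\<forall>R\<in>S. \<delta> \<le> R" for S and \<delta> :: real
  proof -
    obtain L where L: "L \<ge> 0" "\<And>R u l. R \<ge> \<delta> \<Longrightarrow> g u \<in> sobolev k (ball 0 R) \<Longrightarrow>
        (sobolev_norm k (ball 0 R) (f u l))\<^sup>2 \<le> L * (sobolev_norm k (ball 0 R) (g u))\<^sup>2"
      using down[OF \<delta>(1)] by blast
    \<comment> \<open>\<open>?d ^ 4\<close> combines the \<open>?d ^ 3\<close> entries of the form
      with the \<open>?d\<close> functions \<open>f u l\<close>; the 4 comes from
      \<open>u = 2 v\<close>, and the summand 1 makes \<open>C\<close> positive.\<close>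
    define C where "C = sqrt (1 + ?d ^ 4 * L + 4 * K * ?d)"
    have C0: "?d ^ 4 * L \<ge> 0" "4 * K * ?d \<ge> 0" using L(1) K(1) by simp_all
    then have C: "C > 0" "C\<^sup>2 = 1 + ?d ^ 4 * L + 4 * K * ?d" unfolding C_def by (simp_all add: add_nonneg_nonneg add_pos_nonneg)
    have "sobolev_form_norm k (ball 0 R) A \<le> C * sobolev_norm k (ball 0 R) (\<lambda>x :: real ^ 'e. u (norm x)) \<and>
      sobolev_norm k (ball 0 R) (\<lambda>x :: real ^ 'e. u (norm x)) \<le> C * sobolev_form_norm k (ball 0 R) A"
      if RS: "R \<in> S" and A: "equivariant_form R u A" and Ak: "A \<in> sobolev_form k (ball 0 R)" for R u and A :: "'d one_form"
    proof -
      have R: "R \<ge> \<delta>" "R > 0" using RS \<delta> by force+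
      let ?a = "sobolev_form_norm k (ball 0 R) A" and ?g = "sobolev_norm k (ball 0 R) (g u)"
      let ?F = "\<Sum>l\<in>UNIV. (sobolev_norm k (ball 0 R) (f u l))\<^sup>2"
      have gk: "g u \<in> sobolev k (ball 0 R)" using mem[OF R(2) A] Ak by blast
      have a0: "?a \<ge> 0" and g0: "?g \<ge> 0" by (auto simp: sobolev_form_norm_def sobolev_norm_def intro!: sum_nonneg)
      have "?F \<le> ?d * (L * ?g\<^sup>2)" using sum_mono[of UNIV, OF L(2)[OF R(1) gk]] by simp
      then have "?d ^ 3 * ?F \<le> ?d ^ 3 * (?d * (L * ?g\<^sup>2))" by (rule mult_left_mono) simp
      also have "\<dots> = ?d ^ 4 * L * ?g\<^sup>2" by (simp add: eval_nat_numeral mult_ac)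
      finally have "?a\<^sup>2 \<le> ?d ^ 4 * L * ?g\<^sup>2" by (rule order_trans[OF form(2)[OF A Ak]])
      also have "\<dots> \<le> C\<^sup>2 * (4 * ?g\<^sup>2)"
        using C0 unfolding C(2) by (intro mult_mono) auto
      finally have "?a\<^sup>2 \<le> (C * (2 * ?g))\<^sup>2" by (simp add: power_mult_distrib)
      then have 1: "?a \<le> C * (2 * ?g)" by (rule power2_le_imp_le) (use C g0 in simp)
      have "?g\<^sup>2 \<le> K * ?F" using K(2)[OF R(2)] form(1)[OF A] Ak by blast
      also have "\<dots> \<le> K * (?d * ?a\<^sup>2)" using form(3)[OF A Ak] K(1) by (rule mult_left_mono)
      finally have "4 * ?g\<^sup>2 \<le> (4 * K * ?d) * ?a\<^sup>2" by simp
      also have "\<dots> \<le> C\<^sup>2 * ?a\<^sup>2"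
        using C0 unfolding C(2) by (intro mult_right_mono) auto
      finally have "(2 * ?g)\<^sup>2 \<le> (C * ?a)\<^sup>2" by (simp add: power_mult_distrib)
      then have "2 * ?g \<le> C * ?a" by (rule power2_le_imp_le) (use C a0 in simp)
      with 1 show ?thesis unfolding g_norm[OF gk] by simp
    qed
    then show ?thesis using C(1) by blast
  qed
  show ?thesis using mem g bound by blast
qed

end
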